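(* Let $K$ be a field, let $\mathcal{C}$ be a small $K$-category which is abelian, complete and cocomplete, and let $\mathcal{F}$ be a torsion free class in $\mathcal{C}$. Then the canonical projection $\pi:\mathcal{C}\to\mathcal{C}/\mathcal{I}_{\mathcal{F}}$ is a homological epimorphism.
   Context: A $K$-category is a category whose Hom-sets are $K$-vector spaces with $K$-bilinear composition; it is small if its objects form a set. $\mathrm{Mod}(\mathcal{C})$ is the abelian category of covariant $K$-linear functors $\mathcal{C}\to\mathrm{Mod}(K)$, where $\mathrm{Mod}(K)$ is the category of $K$-vector spaces. A torsion pair in $\mathcal{C}$ is a pair $(\mathcal{T},\mathcal{F})$ of full subcategories such that $\mathrm{Hom}_{\mathcal{C}}(M,N)=0$ for all $M\in\mathcal{T}$, $N\in\mathcal{F}$, and every $C\in\mathcal{C}$ fits in an exact sequence $0\to Y_C\to C\to Z^C\to0$ with $Y_C\in\mathcal{T}$, $Z^C\in\mathcal{F}$. Then $\mathcal{F}$ is called a torsion free class. $\mathcal{I}_{\mathcal{F}}$ is the two-sided ideal of $\mathcal{C}$ for which $\mathcal{I}_{\mathcal{F}}(C,C')$ consists of the morphisms $C\to C'$ that factor through some object of $\mathcal{F}$. For a two-sided ideal $\mathcal{I}$ of $\mathcal{C}$, the quotient $\mathcal{C}/\mathcal{I}$ has the same objects as $\mathcal{C}$ and morphism spaces $\mathcal{C}(X,Y)/\mathcal{I}(X,Y)$, with canonical projection $\pi:\mathcal{C}\to\mathcal{C}/\mathcal{I}$. The ideal $\mathcal{I}$ is strongly idempotent if the canonical maps $\mathrm{Ext}^{i}_{\mathrm{Mod}(\mathcal{C}/\mathcal{I})}(F,F')\to\mathrm{Ext}^{i}_{\mathrm{Mod}(\mathcal{C})}(F\circ\pi,F'\circ\pi)$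 induced by the exact functor $F\mapsto F\circ\pi$ are isomorphisms for all $F,F'\in\mathrm{Mod}(\mathcal{C}/\mathcal{I})$ and all $0\le i<\infty$; $\pi$ is a homological epimorphism if $\mathcal{I}$ is strongly idempotent. *)

theory Defs
  imports "HOL-Algebra.Module" "HOL-Algebra.AbelCoset" "HOL-Library.FuncSet" "HOL-Library.Equipollence"
begin

section \<open>Categories, functors, limits\<close>

text \<open>
  Hom-sets are indexed by source and target and need not be disjoint, so composition takes the
  three objects as arguments: \<open>Cmp C a b c g f\<close> is the composite of \<open>f : a \<rightarrow> b\<close> followed by
  \<open>g : b \<rightarrow> c\<close>.  Only values at objects in \<open>Obj C\<close> and arrows in the corresponding Hom-sets matter.
\<close>

record ('o, 'm) cat =
  Obj :: "'o set"
  Hom :: "'o \<Rightarrow> 'o \<Rightarrow> 'm set"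
  Cmp :: "'o \<Rightarrow> 'o \<Rightarrow> 'o \<Rightarrow> 'm \<Rightarrow> 'm \<Rightarrow> 'm"
  Idn :: "'o \<Rightarrow> 'm"

definition category :: "('o, 'm, 'z) cat_scheme \<Rightarrow> bool" where
  "category C \<longleftrightarrow>
     (\<forall>a\<in>Obj C. Idn C a \<in> Hom C a a) \<and>
     (\<forall>a\<in>Obj C. \<forall>b\<in>Obj C. \<forall>c\<in>Obj C. \<forall>f\<in>Hom C a b. \<forall>g\<in>Hom C b c. Cmp C a b c g f \<in> Hom C a c) \<and>
     (\<forall>a\<in>Obj C. \<forall>b\<in>Obj C. \<forall>f\<in>Hom C a b.
        Cmp C a b b (Idn C b) f = f \<and> Cmp C a a b f (Idn C a) = f) \<and>
     (\<forall>a\<in>Obj C. \<forall>b\<in>Obj C. \<forall>c\<in>Obj C. \<forall>d\<in>Obj C. \<forall>f\<in>Hom C a b. \<forall>g\<in>Hom C b c. \<forall>h\<in>Hom C c d.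
        Cmp C a b d (Cmp C b c d h g) f = Cmp C a c d h (Cmp C a b c g f))"

definition op_cat :: "('o, 'm, 'z) cat_scheme \<Rightarrow> ('o, 'm) cat" where
  "op_cat C = \<lparr>Obj = Obj C, Hom = (\<lambda>a b. Hom C b a),
     Cmp = (\<lambda>a b c g f. Cmp C c b a f g), Idn = Idn C\<rparr>"

record ('o, 'm, 'p, 'n) fnctr =
  fobj :: "'o \<Rightarrow> 'p"
  farr :: "'o \<Rightarrow> 'o \<Rightarrow> 'm \<Rightarrow> 'n"

definition is_functor ::
  "('o, 'm, 'y) cat_scheme \<Rightarrow> ('p, 'n, 'z) cat_scheme \<Rightarrow> ('o, 'm, 'p, 'n) fnctr \<Rightarrow> bool" where
  "is_functor A B G \<longleftrightarrow>
     (\<forall>a\<in>Obj A. fobj G a \<in> Obj B) \<and>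
     (\<forall>a\<in>Obj A. \<forall>b\<in>Obj A. \<forall>f\<in>Hom A a b. farr G a b f \<in> Hom B (fobj G a) (fobj G b)) \<and>
     (\<forall>a\<in>Obj A. farr G a a (Idn A a) = Idn B (fobj G a)) \<and>
     (\<forall>a\<in>Obj A. \<forall>b\<in>Obj A. \<forall>c\<in>Obj A. \<forall>f\<in>Hom A a b. \<forall>g\<in>Hom A b c.
        farr G a c (Cmp A a b c g f) =
        Cmp B (fobj G a) (fobj G b) (fobj G c) (farr G b c g) (farr G a b f))"

definition fcomp ::
  "('p, 'n, 'q, 'l) fnctr \<Rightarrow> ('o, 'm, 'p, 'n) fnctr \<Rightarrow> ('o, 'm, 'q, 'l) fnctr" where
  "fcomp H G = \<lparr>fobj = (\<lambda>a. fobj H (fobj G a)),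
     farr = (\<lambda>a b f. farr H (fobj G a) (fobj G b) (farr G a b f))\<rparr>"

definition is_cone ::
  "('i, 'j) cat \<Rightarrow> ('o, 'm, 'z) cat_scheme \<Rightarrow> ('i, 'j, 'o, 'm) fnctr \<Rightarrow> 'o \<Rightarrow> ('i \<Rightarrow> 'm) \<Rightarrow> bool" where
  "is_cone J C D x p \<longleftrightarrow> x \<in> Obj C \<and> (\<forall>i\<in>Obj J. p i \<in> Hom C x (fobj D i)) \<and>
     (\<forall>i\<in>Obj J. \<forall>j\<in>Obj J. \<forall>u\<in>Hom J i j. Cmp C x (fobj D i) (fobj D j) (farr D i j u) (p i) = p j)"

definition is_limit ::
  "('i, 'j) cat \<Rightarrow> ('o, 'm, 'z) cat_scheme \<Rightarrow> ('i, 'j, 'o, 'm) fnctr \<Rightarrow> 'o \<Rightarrow> ('i \<Rightarrow> 'm) \<Rightarrow> bool" where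
  "is_limit J C D x p \<longleftrightarrow> is_cone J C D x p \<and>
     (\<forall>y q. is_cone J C D y q \<longrightarrow>
        (\<exists>!h. h \<in> Hom C y x \<and> (\<forall>i\<in>Obj J. Cmp C y x (fobj D i) (p i) h = q i)))"

text \<open>
  HOL cannot quantify over types inside a formula, so the universe of small index categories is
  given by two types: one for their objects and one for their arrows.  A theorem in which these types
  are variables is asserted for every such universe.
\<close>

definition complete ::
  "'i itself \<Rightarrow> 'j itself \<Rightarrow> ('o, 'm, 'z) cat_scheme \<Rightarrow> bool" where
  "complete TI TJ C \<longleftrightarrow>
     (\<forall>(J :: ('i, 'j) cat) D. category J \<and> is_functor J C D \<longrightarrow> (\<exists>x p. is_limit J C D x p))"

definition cocomplete ::
  "'i itself \<Rightarrow> 'j itself \<Rightarrow> ('o, 'm, 'z) cat_scheme \<Rightarrow> bool" where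
  "cocomplete TI TJ C \<longleftrightarrow> complete TI TJ (op_cat C)"


section \<open>Vector spaces\<close>

text \<open>
  A vector space over a field \<open>K\<close> is a \<^locale>\<open>module\<close> over \<open>K\<close>.  The record type of modules also has
  the ring fields \<open>mult\<close> and \<open>one\<close>, which are irrelevant here.
\<close>

definition mk_module ::
  "'v set \<Rightarrow> 'v \<Rightarrow> ('v \<Rightarrow> 'v \<Rightarrow> 'v) \<Rightarrow> ('k \<Rightarrow> 'v \<Rightarrow> 'v) \<Rightarrow> ('k, 'v) module" where
  "mk_module V z pl sm =
     \<lparr>carrier = V, monoid.mult = (\<lambda>_ _. z), one = z, zero = z, add = pl, smult = sm\<rparr>"

definition linear_map :: "'k ring \<Rightarrow> ('k, 'v) module \<Rightarrow> ('k, 'w) module \<Rightarrow> ('v \<Rightarrow> 'w) \<Rightarrow> bool" where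
  "linear_map K V W f \<longleftrightarrow> f \<in> carrier V \<rightarrow> carrier W \<and>
     (\<forall>x\<in>carrier V. \<forall>y\<in>carrier V. f (x \<oplus>\<^bsub>V\<^esub> y) = f x \<oplus>\<^bsub>W\<^esub> f y) \<and>
     (\<forall>r\<in>carrier K. \<forall>x\<in>carrier V. f (r \<odot>\<^bsub>V\<^esub> x) = r \<odot>\<^bsub>W\<^esub> f x)"

definition linear_iso :: "'k ring \<Rightarrow> ('k, 'v) module \<Rightarrow> ('k, 'w) module \<Rightarrow> ('v \<Rightarrow> 'w) \<Rightarrow> bool" where
  "linear_iso K V W f \<longleftrightarrow> linear_map K V W f \<and> bij_betw f (carrier V) (carrier W)"

definition quot_module :: "('k, 'v) module \<Rightarrow> 'v set \<Rightarrow> ('k, 'v set) module" where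
  "quot_module V W = mk_module (A_RCOSETS V W) W (set_add V)
     (\<lambda>r X. \<Union>x\<in>X. W +>\<^bsub>V\<^esub> (r \<odot>\<^bsub>V\<^esub> x))"


section \<open>\<open>K\<close>-categories\<close>

text \<open>\<open>HomK C a b\<close> is the Hom-set \<open>Hom C a b\<close> together with its vector space structure.\<close>

record ('o, 'm, 'k) kcat = "('o, 'm) cat" +
  HomK :: "'o \<Rightarrow> 'o \<Rightarrow> ('k, 'm) module"

definition kcategory :: "'k ring \<Rightarrow> ('o, 'm, 'k) kcat \<Rightarrow> bool" where
  "kcategory K C \<longleftrightarrow> category C \<and>
     (\<forall>a\<in>Obj C. \<forall>b\<in>Obj C. module K (HomK C a b) \<and> carrier (HomK C a b) = Hom C a b) \<and>
     (\<forall>a\<in>Obj C. \<forall>b\<in>Obj C. \<forall>c\<in>Obj C.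
        (\<forall>g\<in>Hom C b c. linear_map K (HomK C a b) (HomK C a c) (\<lambda>f. Cmp C a b c g f)) \<and>
        (\<forall>f\<in>Hom C a b. linear_map K (HomK C b c) (HomK C a c) (\<lambda>g. Cmp C a b c g f)))"

text \<open>
  The objects and arrows of a category always form sets here.  The following says that these sets
  belong to the universe given by the infinite type \<open>'v\<close>, whose subsets will serve as carriers of
  the vector spaces in \<open>Mod(K)\<close>.
\<close>

definition small_in :: "'v itself \<Rightarrow> ('o, 'm, 'z) cat_scheme \<Rightarrow> bool" where
  "small_in TV C \<longleftrightarrow> infinite (UNIV :: 'v set) \<and> Obj C \<lesssim> (UNIV :: 'v set) \<and>
     (\<forall>a\<in>Obj C. \<forall>b\<in>Obj C. Hom C a b \<lesssim> (UNIV :: 'v set))"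

definition linear_functor ::
  "'k ring \<Rightarrow> ('o, 'm, 'k) kcat \<Rightarrow> ('p, 'n, 'k) kcat \<Rightarrow> ('o, 'm, 'p, 'n) fnctr \<Rightarrow> bool" where
  "linear_functor K A B G \<longleftrightarrow> is_functor A B G \<and>
     (\<forall>a\<in>Obj A. \<forall>b\<in>Obj A.
        linear_map K (HomK A a b) (HomK B (fobj G a) (fobj G b)) (farr G a b))"

definition VectCat :: "'k ring \<Rightarrow> (('k, 'v) module, 'v \<Rightarrow> 'v, 'k) kcat" where
  "VectCat K = (let
       hom = (\<lambda>V W. {f \<in> extensional (carrier V). linear_map K V W f})
     in \<lparr>Obj = {V. module K V}, Hom = hom,
         Cmp = (\<lambda>U V W g f. compose (carrier U) g f), Idn = (\<lambda>V. \<lambda>x\<in>carrier V. x),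
         HomK = (\<lambda>V W. mk_module (hom V W) (\<lambda>x\<in>carrier V. \<zero>\<^bsub>W\<^esub>)
            (\<lambda>f g. \<lambda>x\<in>carrier V. f x \<oplus>\<^bsub>W\<^esub> g x) (\<lambda>r f. \<lambda>x\<in>carrier V. r \<odot>\<^bsub>W\<^esub> f x))\<rparr>)"

definition nat_trans ::
  "('o, 'm, 'y) cat_scheme \<Rightarrow> ('p, 'n, 'z) cat_scheme \<Rightarrow>
   ('o, 'm, 'p, 'n) fnctr \<Rightarrow> ('o, 'm, 'p, 'n) fnctr \<Rightarrow> ('o \<Rightarrow> 'n) set" where
  "nat_trans A B M N = {t \<in> (\<Pi>\<^sub>E a\<in>Obj A. Hom B (fobj M a) (fobj N a)).
     \<forall>a\<in>Obj A. \<forall>b\<in>Obj A. \<forall>f\<in>Hom A a b.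
       Cmp B (fobj M a) (fobj M b) (fobj N b) (t b) (farr M a b f) =
       Cmp B (fobj M a) (fobj N a) (fobj N b) (farr N a b f) (t a)}"

text \<open>The category of \<open>K\<close>-linear functors and natural transformations.\<close>

definition FunCat ::
  "'k ring \<Rightarrow> ('o, 'm, 'k) kcat \<Rightarrow> ('p, 'n, 'k) kcat \<Rightarrow> (('o, 'm, 'p, 'n) fnctr, 'o \<Rightarrow> 'n, 'k) kcat" where
  "FunCat K A B =
     \<lparr>Obj = {M. linear_functor K A B M}, Hom = nat_trans A B,
      Cmp = (\<lambda>L M N s t. \<lambda>a\<in>Obj A. Cmp B (fobj L a) (fobj M a) (fobj N a) (s a) (t a)),
      Idn = (\<lambda>M. \<lambda>a\<in>Obj A. Idn B (fobj M a)),
      HomK = (\<lambda>M N. mk_module (nat_trans A B M N)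
         (\<lambda>a\<in>Obj A. \<zero>\<^bsub>HomK B (fobj M a) (fobj N a)\<^esub>)
         (\<lambda>s t. \<lambda>a\<in>Obj A. s a \<oplus>\<^bsub>HomK B (fobj M a) (fobj N a)\<^esub> t a)
         (\<lambda>r t. \<lambda>a\<in>Obj A. r \<odot>\<^bsub>HomK B (fobj M a) (fobj N a)\<^esub> t a))\<rparr>"

text \<open>\<open>Mod(C)\<close>, with vector spaces carried by subsets of \<open>'v\<close>.\<close>

type_synonym ('o, 'm, 'k, 'v) rep = "('o, 'm, ('k, 'v) module, 'v \<Rightarrow> 'v) fnctr"

definition ModCat ::
  "'k ring \<Rightarrow> ('o, 'm, 'k) kcat \<Rightarrow> (('o, 'm, 'k, 'v) rep, 'o \<Rightarrow> 'v \<Rightarrow> 'v, 'k) kcat" where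
  "ModCat K C = FunCat K C (VectCat K)"

text \<open>The functor \<open>M \<mapsto> M \<circ> G\<close> on functor categories, for \<open>G\<close> with source \<open>A\<close>.\<close>

definition precomp ::
  "('o, 'm, 'z) cat_scheme \<Rightarrow> ('o, 'm, 'p, 'n) fnctr \<Rightarrow>
   (('p, 'n, 'q, 'l) fnctr, 'p \<Rightarrow> 'l, ('o, 'm, 'q, 'l) fnctr, 'o \<Rightarrow> 'l) fnctr" where
  "precomp A G = \<lparr>fobj = (\<lambda>M. fcomp M G), farr = (\<lambda>M N t. \<lambda>a\<in>Obj A. t (fobj G a))\<rparr>"


section \<open>Abelian categories\<close>

definition is_mono :: "('o, 'm, 'z) cat_scheme \<Rightarrow> 'o \<Rightarrow> 'o \<Rightarrow> 'm \<Rightarrow> bool" where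
  "is_mono C a b f \<longleftrightarrow> a \<in> Obj C \<and> b \<in> Obj C \<and> f \<in> Hom C a b \<and>
     (\<forall>x\<in>Obj C. \<forall>u\<in>Hom C x a. \<forall>v\<in>Hom C x a. Cmp C x a b f u = Cmp C x a b f v \<longrightarrow> u = v)"

definition is_epi :: "('o, 'm, 'z) cat_scheme \<Rightarrow> 'o \<Rightarrow> 'o \<Rightarrow> 'm \<Rightarrow> bool" where
  "is_epi C a b f \<longleftrightarrow> a \<in> Obj C \<and> b \<in> Obj C \<and> f \<in> Hom C a b \<and>
     (\<forall>x\<in>Obj C. \<forall>u\<in>Hom C b x. \<forall>v\<in>Hom C b x. Cmp C a b x u f = Cmp C a b x v f \<longrightarrow> u = v)"

text \<open>\<open>is_kernel C k a b m f\<close>: the arrow \<open>m : k \<rightarrow> a\<close> is a kernel of \<open>f : a \<rightarrow> b\<close>.\<close>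

definition is_kernel :: "('o, 'm, 'k) kcat \<Rightarrow> 'o \<Rightarrow> 'o \<Rightarrow> 'o \<Rightarrow> 'm \<Rightarrow> 'm \<Rightarrow> bool" where
  "is_kernel C k a b m f \<longleftrightarrow> k \<in> Obj C \<and> a \<in> Obj C \<and> b \<in> Obj C \<and>
     m \<in> Hom C k a \<and> f \<in> Hom C a b \<and> Cmp C k a b f m = \<zero>\<^bsub>HomK C k b\<^esub> \<and>
     (\<forall>x\<in>Obj C. \<forall>u\<in>Hom C x a. Cmp C x a b f u = \<zero>\<^bsub>HomK C x b\<^esub> \<longrightarrow>
        (\<exists>!v. v \<in> Hom C x k \<and> Cmp C x k a m v = u))"

text \<open>\<open>is_cokernel C a b q f e\<close>: the arrow \<open>e : b \<rightarrow> q\<close> is a cokernel of \<open>f : a \<rightarrow> b\<close>.\<close>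

definition is_cokernel :: "('o, 'm, 'k) kcat \<Rightarrow> 'o \<Rightarrow> 'o \<Rightarrow> 'o \<Rightarrow> 'm \<Rightarrow> 'm \<Rightarrow> bool" where
  "is_cokernel C a b q f e \<longleftrightarrow> a \<in> Obj C \<and> b \<in> Obj C \<and> q \<in> Obj C \<and>
     f \<in> Hom C a b \<and> e \<in> Hom C b q \<and> Cmp C a b q e f = \<zero>\<^bsub>HomK C a q\<^esub> \<and>
     (\<forall>x\<in>Obj C. \<forall>u\<in>Hom C b x. Cmp C a b x u f = \<zero>\<^bsub>HomK C a x\<^esub> \<longrightarrow>
        (\<exists>!v. v \<in> Hom C q x \<and> Cmp C b q x v e = u))"

definition is_zero_object :: "('o, 'm, 'z) cat_scheme \<Rightarrow> 'o \<Rightarrow> bool" where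
  "is_zero_object C z \<longleftrightarrow> z \<in> Obj C \<and>
     (\<forall>a\<in>Obj C. (\<exists>!f. f \<in> Hom C a z) \<and> (\<exists>!f. f \<in> Hom C z a))"

definition is_biproduct ::
  "('o, 'm, 'k) kcat \<Rightarrow> 'o \<Rightarrow> 'o \<Rightarrow> 'o \<Rightarrow> 'm \<Rightarrow> 'm \<Rightarrow> 'm \<Rightarrow> 'm \<Rightarrow> bool" where
  "is_biproduct C a b s i j p q \<longleftrightarrow> s \<in> Obj C \<and>
     i \<in> Hom C a s \<and> j \<in> Hom C b s \<and> p \<in> Hom C s a \<and> q \<in> Hom C s b \<and>
     Cmp C a s a p i = Idn C a \<and> Cmp C b s b q j = Idn C b \<and>
     Cmp C b s a p j = \<zero>\<^bsub>HomK C b a\<^esub> \<and> Cmp C a s b q i = \<zero>\<^bsub>HomK C a b\<^esub> \<and>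
     Cmp C s a s i p \<oplus>\<^bsub>HomK C s s\<^esub> Cmp C s b s j q = Idn C s"

definition abelian :: "('o, 'm, 'k) kcat \<Rightarrow> bool" where
  "abelian C \<longleftrightarrow>
     (\<exists>z. is_zero_object C z) \<and>
     (\<forall>a\<in>Obj C. \<forall>b\<in>Obj C. \<exists>s i j p q. is_biproduct C a b s i j p q) \<and>
     (\<forall>a\<in>Obj C. \<forall>b\<in>Obj C. \<forall>f\<in>Hom C a b.
        (\<exists>k m. is_kernel C k a b m f) \<and> (\<exists>q e. is_cokernel C a b q f e)) \<and>
     (\<forall>a b f. is_mono C a b f \<longrightarrow> (\<exists>c g. is_kernel C a b c f g)) \<and>
     (\<forall>a b f. is_epi C a b f \<longrightarrow> (\<exists>c g. is_cokernel C c a b g f))"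

definition short_exact :: "('o, 'm, 'k) kcat \<Rightarrow> 'o \<Rightarrow> 'o \<Rightarrow> 'o \<Rightarrow> 'm \<Rightarrow> 'm \<Rightarrow> bool" where
  "short_exact C a b c f g \<longleftrightarrow> is_kernel C a b c f g \<and> is_cokernel C a b c f g"

text \<open>
  Exactness at \<open>b\<close> of \<open>f : a \<rightarrow> b\<close>, \<open>g : b \<rightarrow> c\<close>: the composite vanishes and the induced arrow
  from \<open>a\<close> to the kernel of \<open>g\<close> is an epimorphism.
\<close>

definition exact_at :: "('o, 'm, 'k) kcat \<Rightarrow> 'o \<Rightarrow> 'o \<Rightarrow> 'o \<Rightarrow> 'm \<Rightarrow> 'm \<Rightarrow> bool" where
  "exact_at C a b c f g \<longleftrightarrow> f \<in> Hom C a b \<and> g \<in> Hom C b c \<and>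
     Cmp C a b c g f = \<zero>\<^bsub>HomK C a c\<^esub> \<and>
     (\<exists>k m f'. is_kernel C k b c m g \<and> is_epi C a k f' \<and> Cmp C a k b m f' = f)"


section \<open>Ext\<close>

definition projective :: "('o, 'm, 'z) cat_scheme \<Rightarrow> 'o \<Rightarrow> bool" where
  "projective C p \<longleftrightarrow> p \<in> Obj C \<and>
     (\<forall>b c g. is_epi C b c g \<longrightarrow> (\<forall>f\<in>Hom C p c. \<exists>h\<in>Hom C p b. Cmp C p b c g h = f))"

record ('o, 'm) resolution =
  rterm :: "nat \<Rightarrow> 'o"
  rdiff :: "nat \<Rightarrow> 'm"
  raug :: "'m"

text \<open>\<open>\<dots> \<rightarrow> rterm R 1 \<rightarrow> rterm R 0 \<rightarrow> x \<rightarrow> 0\<close>, where \<open>rdiff R n : rterm R (n + 1) \<rightarrow> rterm R n\<close>.\<close>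

definition projective_resolution ::
  "('o, 'm, 'k) kcat \<Rightarrow> 'o \<Rightarrow> ('o, 'm) resolution \<Rightarrow> bool" where
  "projective_resolution A x R \<longleftrightarrow>
     (\<forall>n. projective A (rterm R n)) \<and>
     is_epi A (rterm R 0) x (raug R) \<and>
     exact_at A (rterm R 1) (rterm R 0) x (rdiff R 0) (raug R) \<and>
     (\<forall>n. exact_at A (rterm R (n + 2)) (rterm R (n + 1)) (rterm R n) (rdiff R (n + 1)) (rdiff R n))"

definition the_resolution :: "('o, 'm, 'k) kcat \<Rightarrow> 'o \<Rightarrow> ('o, 'm) resolution" where
  "the_resolution A x = (SOME R. projective_resolution A x R)"

definition cocycles :: "('o, 'm, 'k) kcat \<Rightarrow> ('o, 'm) resolution \<Rightarrow> 'o \<Rightarrow> nat \<Rightarrow> 'm set" where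
  "cocycles A R y i = {f \<in> Hom A (rterm R i) y.
     Cmp A (rterm R (Suc i)) (rterm R i) y f (rdiff R i) = \<zero>\<^bsub>HomK A (rterm R (Suc i)) y\<^esub>}"

fun coboundaries :: "('o, 'm, 'k) kcat \<Rightarrow> ('o, 'm) resolution \<Rightarrow> 'o \<Rightarrow> nat \<Rightarrow> 'm set" where
  "coboundaries A R y 0 = {\<zero>\<^bsub>HomK A (rterm R 0) y\<^esub>}"
| "coboundaries A R y (Suc i) =
     (\<lambda>g. Cmp A (rterm R (Suc i)) (rterm R i) y g (rdiff R i)) ` Hom A (rterm R i) y"

text \<open>The \<open>i\<close>-th cohomology space of the complex of all \<open>Hom A (rterm R n) y\<close>.\<close>

definition cohomology ::
  "('o, 'm, 'k) kcat \<Rightarrow> ('o, 'm) resolution \<Rightarrow> 'o \<Rightarrow> nat \<Rightarrow> ('k, 'm set) module" where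
  "cohomology A R y i =
     quot_module ((HomK A (rterm R i) y)\<lparr>carrier := cocycles A R y i\<rparr>) (coboundaries A R y i)"

definition Ext :: "('o, 'm, 'k) kcat \<Rightarrow> 'o \<Rightarrow> 'o \<Rightarrow> nat \<Rightarrow> ('k, 'm set) module" where
  "Ext A x y i = cohomology A (the_resolution A x) y i"

text \<open>
  For an exact functor \<open>G : A \<rightarrow> B\<close> and resolutions \<open>R\<close> of \<open>x\<close> and \<open>S\<close> of \<open>G x\<close>, a chain map from
  \<open>S\<close> to the exact complex \<open>G R\<close> lifting the identity of \<open>G x\<close>.
\<close>

definition comparison ::
  "('o, 'm, 'k) kcat \<Rightarrow> ('p, 'n, 'k) kcat \<Rightarrow> ('o, 'm, 'p, 'n) fnctr \<Rightarrow> 'o \<Rightarrow>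
   ('o, 'm) resolution \<Rightarrow> ('p, 'n) resolution \<Rightarrow> (nat \<Rightarrow> 'n) \<Rightarrow> bool" where
  "comparison A B G x R S h \<longleftrightarrow>
     (\<forall>n. h n \<in> Hom B (rterm S n) (fobj G (rterm R n))) \<and>
     Cmp B (rterm S 0) (fobj G (rterm R 0)) (fobj G x) (farr G (rterm R 0) x (raug R)) (h 0) = raug S \<and>
     (\<forall>n. Cmp B (rterm S (Suc n)) (fobj G (rterm R (Suc n))) (fobj G (rterm R n))
             (farr G (rterm R (Suc n)) (rterm R n) (rdiff R n)) (h (Suc n)) =
          Cmp B (rterm S (Suc n)) (rterm S n) (fobj G (rterm R n)) (h n) (rdiff S n))"

text \<open>
  The canonical map from \<open>Ext A x y i\<close> to \<open>Ext B (G x) (G y) i\<close>: the class of a cocycle \<open>f\<close> is sent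
  to the class of \<open>G f \<circ> h i\<close>.  The choice of \<open>h\<close> only matters up to homotopy.
\<close>

definition Ext_map ::
  "('o, 'm, 'k) kcat \<Rightarrow> ('p, 'n, 'k) kcat \<Rightarrow> ('o, 'm, 'p, 'n) fnctr \<Rightarrow> 'o \<Rightarrow> 'o \<Rightarrow> nat \<Rightarrow>
   'm set \<Rightarrow> 'n set" where
  "Ext_map A B G x y i X = (let
       R = the_resolution A x;
       S = the_resolution B (fobj G x);
       h = (SOME h. comparison A B G x R S h)
     in \<Union>f\<in>X. coboundaries B S (fobj G y) i +>\<^bsub>HomK B (rterm S i) (fobj G y)\<^esub>
          Cmp B (rterm S i) (fobj G (rterm R i)) (fobj G y) (farr G (rterm R i) y f) (h i))"


section \<open>Ideals, quotients and homological epimorphisms\<close>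

definition two_sided_ideal :: "'k ring \<Rightarrow> ('o, 'm, 'k) kcat \<Rightarrow> ('o \<Rightarrow> 'o \<Rightarrow> 'm set) \<Rightarrow> bool" where
  "two_sided_ideal K C I \<longleftrightarrow>
     (\<forall>a\<in>Obj C. \<forall>b\<in>Obj C. submodule (I a b) K (HomK C a b)) \<and>
     (\<forall>a\<in>Obj C. \<forall>b\<in>Obj C. \<forall>c\<in>Obj C. \<forall>f\<in>Hom C a b. \<forall>g\<in>Hom C b c.
        f \<in> I a b \<or> g \<in> I b c \<longrightarrow> Cmp C a b c g f \<in> I a c)"

definition quot_cat :: "('o, 'm, 'k) kcat \<Rightarrow> ('o \<Rightarrow> 'o \<Rightarrow> 'm set) \<Rightarrow> ('o, 'm set, 'k) kcat" where
  "quot_cat C I = \<lparr>Obj = Obj C,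
     Hom = (\<lambda>a b. carrier (quot_module (HomK C a b) (I a b))),
     Cmp = (\<lambda>a b c Y X. \<Union>g\<in>Y. \<Union>f\<in>X. I a c +>\<^bsub>HomK C a c\<^esub> Cmp C a b c g f),
     Idn = (\<lambda>a. I a a +>\<^bsub>HomK C a a\<^esub> Idn C a),
     HomK = (\<lambda>a b. quot_module (HomK C a b) (I a b))\<rparr>"

definition quot_proj :: "('o, 'm, 'k) kcat \<Rightarrow> ('o \<Rightarrow> 'o \<Rightarrow> 'm set) \<Rightarrow> ('o, 'm, 'o, 'm set) fnctr" where
  "quot_proj C I = \<lparr>fobj = (\<lambda>a. a), farr = (\<lambda>a b f. I a b +>\<^bsub>HomK C a b\<^esub> f)\<rparr>"

definition strongly_idempotent ::
  "'v itself \<Rightarrow> 'k ring \<Rightarrow> ('o, 'm, 'k) kcat \<Rightarrow> ('o \<Rightarrow> 'o \<Rightarrow> 'm set) \<Rightarrow> bool" where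
  "strongly_idempotent TV K C I \<longleftrightarrow> two_sided_ideal K C I \<and>
     (let A = (ModCat K (quot_cat C I) :: (('o, 'm set, 'k, 'v) rep, 'o \<Rightarrow> 'v \<Rightarrow> 'v, 'k) kcat);
          B = (ModCat K C :: (('o, 'm, 'k, 'v) rep, 'o \<Rightarrow> 'v \<Rightarrow> 'v, 'k) kcat);
          P = precomp C (quot_proj C I)
      in \<forall>M\<in>Obj A. \<forall>N\<in>Obj A. \<forall>i.
           linear_iso K (Ext A M N i) (Ext B (fobj P M) (fobj P N) i) (Ext_map A B P M N i))"

text \<open>
  Being a homological epimorphism is only defined for canonical projections \<open>p : C \<rightarrow> D\<close> onto a
  quotient \<open>D\<close> of \<open>C\<close> by an ideal.
\<close>

definition homological_epimorphism ::
  "'v itself \<Rightarrow> 'k ring \<Rightarrow> ('o, 'm, 'k) kcat \<Rightarrow> ('o, 'm set, 'k) kcat \<Rightarrow>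
   ('o, 'm, 'o, 'm set) fnctr \<Rightarrow> bool" where
  "homological_epimorphism TV K C D p \<longleftrightarrow>
     (\<exists>I. D = quot_cat C I \<and> p = quot_proj C I \<and> strongly_idempotent TV K C I)"


section \<open>Torsion pairs\<close>

text \<open>Full subcategories are given by their sets of objects.\<close>

definition torsion_pair :: "('o, 'm, 'k) kcat \<Rightarrow> 'o set \<Rightarrow> 'o set \<Rightarrow> bool" where
  "torsion_pair C T F \<longleftrightarrow> T \<subseteq> Obj C \<and> F \<subseteq> Obj C \<and>
     (\<forall>a\<in>T. \<forall>b\<in>F. Hom C a b = {\<zero>\<^bsub>HomK C a b\<^esub>}) \<and>
     (\<forall>c\<in>Obj C. \<exists>y\<in>T. \<exists>z\<in>F. \<exists>f g. short_exact C y c z f g)"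

definition torsion_free_class :: "('o, 'm, 'k) kcat \<Rightarrow> 'o set \<Rightarrow> bool" where
  "torsion_free_class C F \<longleftrightarrow> (\<exists>T. torsion_pair C T F)"

definition factor_ideal :: "('o, 'm, 'k) kcat \<Rightarrow> 'o set \<Rightarrow> 'o \<Rightarrow> 'o \<Rightarrow> 'm set" where
  "factor_ideal C F a b = {h. \<exists>z\<in>F. \<exists>f\<in>Hom C a z. \<exists>g\<in>Hom C z b. h = Cmp C a z b g f}"

end

theory Submission
  imports Defs
begin

text \<open>
  Let \<open>\<epsilon>\<^sub>c : c \<rightarrow> Z\<^sub>c\<close> be the torsion free quotient of \<open>c\<close>.  A morphism from \<open>c\<close> to an object of
  \<open>F\<close> factors uniquely through \<open>\<epsilon>\<^sub>c\<close>, so the ideal \<open>I\<close> of morphisms factoring through \<open>F\<close> satisfies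
  \<open>I(c, -) \<cong> C(Z\<^sub>c, -)\<close>: it is projective as a left module, and it contains the identities of the
  \<open>Z\<^sub>c\<close>.  If \<open>U\<close> is a sum of representable functors then \<open>I U\<close> is a sum of functors
  \<open>C(Z\<^sub>c, -)\<close>; it is therefore projective and has no nonzero map to a \<open>C/I\<close>-module \<open>N\<close>, since
  \<open>N(Z\<^sub>c) = 0\<close>.  Hence \<open>0 \<rightarrow> I U \<rightarrow> U \<rightarrow> U / I U \<rightarrow> 0\<close> shows that projective \<open>C/I\<close>-modules
  have no higher extensions by \<open>N\<close> over \<open>C\<close>, so a projective resolution over \<open>C/I\<close> computes the
  extensions over \<open>C\<close>: the mapping cone of the comparison from a projective resolution over \<open>C\<close>
  stays exact under \<open>Hom(-, N)\<close>.
\<close>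

section \<open>Linear functors and natural transformations, elementwise\<close>

text \<open>Ext is computed from resolutions picked by \<open>SOME\<close>, and the comparison
  \<open>h\<close> is picked in the same way, so the argument has to work for all resolutions and
  every chain map; it proceeds on cochains and not through long exact sequences. What keeps the cone
  exact under \<open>Hom(-, N)\<close> is a class of modules, called \<open>good\<close>: it
  contains the projective C-modules and the restrictions of projective C/I-modules, it allows direct
  sums and kernels of epimorphisms between its members, and maps to \<open>N\<close> extend from
  such kernels. A projective C/I-module is in general only a direct summand of some
  \<open>U / I U\<close>, which is why the class is defined with an endomorphism of \<open>U\<close>
  and not by a short exact sequence alone. The other constraint is one of universes: all modules of
  \<open>ModCat\<close> are carried by subsets of the type \<open>'v\<close>, whereas free modules,
  pairs and cosets naturally live in other types. Smallness of C and infinity of \<open>'v\<close>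
  provide copies of the first two in \<open>'v\<close>; quotients are carried by
  representatives.\<close>

lemma (in abelian_group) minus_zeroD:
  assumes "x \<in> carrier G" "y \<in> carrier G" "x \<ominus> y = \<zero>"
  shows "x = y"
  using assms minus_equality[of x "\<ominus> y"] by (simp add: a_minus_def)

lemma (in abelian_group) minus_zero_right:
  assumes "x \<in> carrier G"
  shows "x \<ominus> \<zero> = x"
  using assms minus_equality[of \<zero> \<zero>] by (simp add: a_minus_def)

lemma (in abelian_group) add_minus_add:
  assumes "x \<in> carrier G" "y \<in> carrier G" "z \<in> carrier G" "w \<in> carrier G"
  shows "(x \<oplus> y) \<ominus> (z \<oplus> w) = (x \<ominus> z) \<oplus> (y \<ominus> w)"
  using assms by (simp add: a_minus_def minus_add a_ac)

lemma (in module) smult_minus: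
  assumes "r \<in> carrier R" "x \<in> carrier M" "y \<in> carrier M"
  shows "r \<odot>\<^bsub>M\<^esub> (x \<ominus>\<^bsub>M\<^esub> y) = r \<odot>\<^bsub>M\<^esub> x \<ominus>\<^bsub>M\<^esub> r \<odot>\<^bsub>M\<^esub> y"
  using assms by (simp add: M.minus_eq smult_r_distr smult_r_minus)

lemma linear_map_closed: "linear_map K V W f \<Longrightarrow> x \<in> carrier V \<Longrightarrow> f x \<in> carrier W"
  by (auto simp: linear_map_def)

lemma linear_map_add:
  "linear_map K V W f \<Longrightarrow> x \<in> carrier V \<Longrightarrow> y \<in> carrier V \<Longrightarrow> f (x \<oplus>\<^bsub>V\<^esub> y) = f x \<oplus>\<^bsub>W\<^esub> f y"
  by (auto simp: linear_map_def)

lemma linear_map_smult: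
  "linear_map K V W f \<Longrightarrow> r \<in> carrier K \<Longrightarrow> x \<in> carrier V \<Longrightarrow> f (r \<odot>\<^bsub>V\<^esub> x) = r \<odot>\<^bsub>W\<^esub> f x"
  by (auto simp: linear_map_def)

lemma linear_map_zero:
  assumes "module K V" "module K W" "linear_map K V W f"
  shows "f \<zero>\<^bsub>V\<^esub> = \<zero>\<^bsub>W\<^esub>"
proof -
  interpret V: module K V by fact
  interpret W: module K W by fact
  have "f \<zero>\<^bsub>V\<^esub> = f (\<zero>\<^bsub>K\<^esub> \<odot>\<^bsub>V\<^esub> \<zero>\<^bsub>V\<^esub>)" by simp
  also have "\<dots> = \<zero>\<^bsub>W\<^esub>"
    using assms(3) by (subst linear_map_smult[OF assms(3)]) (auto simp: linear_map_closed)
  finally show ?thesis .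
qed

lemma linear_map_inv:
  assumes "module K V" "module K W" "linear_map K V W f" "x \<in> carrier V"
  shows "f (\<ominus>\<^bsub>V\<^esub> x) = \<ominus>\<^bsub>W\<^esub> f x"
proof -
  interpret V: module K V by fact
  interpret W: module K W by fact
  have "f (\<ominus>\<^bsub>V\<^esub> x) \<oplus>\<^bsub>W\<^esub> f x = f (\<ominus>\<^bsub>V\<^esub> x \<oplus>\<^bsub>V\<^esub> x)"
    using assms by (simp add: linear_map_add)
  also have "\<dots> = \<zero>\<^bsub>W\<^esub>"
    using assms by (simp add: V.l_neg linear_map_zero)
  finally show ?thesis
    using W.minus_equality[of "f (\<ominus>\<^bsub>V\<^esub> x)" "f x"] assms(3,4) by (simp add: linear_map_closed)
qed

lemma linear_map_minus:
  assumes "module K V" "module K W" "linear_map K V W f" "x \<in> carrier V" "y \<in> carrier V"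
  shows "f (x \<ominus>\<^bsub>V\<^esub> y) = f x \<ominus>\<^bsub>W\<^esub> f y"
proof -
  interpret V: module K V by fact
  interpret W: module K W by fact
  show ?thesis
    using assms by (simp add: a_minus_def linear_map_add linear_map_inv)
qed

lemma linear_map_comp:
  "linear_map K U V f \<Longrightarrow> linear_map K V W g \<Longrightarrow> linear_map K U W (\<lambda>x. g (f x))"
  by (auto simp: linear_map_def Pi_def)

lemma linear_map_plus:
  assumes "module K V" "module K W" "linear_map K V W f" "linear_map K V W g"
  shows "linear_map K V W (\<lambda>x. f x \<oplus>\<^bsub>W\<^esub> g x)"
proof -
  interpret V: module K V by fact
  interpret W: module K W by fact
  show ?thesis
    using assms(3,4) by (auto simp: linear_map_def Pi_def W.a_ac W.smult_r_distr)
qed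

lemma linear_map_uminus:
  assumes "module K V" "module K W" "linear_map K V W f"
  shows "linear_map K V W (\<lambda>x. \<ominus>\<^bsub>W\<^esub> f x)"
proof -
  interpret V: module K V by fact
  interpret W: module K W by fact
  show ?thesis
    using assms(3) by (auto simp: linear_map_def Pi_def W.minus_add W.smult_r_minus)
qed

lemma submodule_subset: "submodule S K V \<Longrightarrow> x \<in> S \<Longrightarrow> x \<in> carrier V"
  using subgroup.mem_carrier[OF submodule.axioms(1)] by fastforce

lemma submodule_zero: "submodule S K V \<Longrightarrow> \<zero>\<^bsub>V\<^esub> \<in> S"
  using subgroup.one_closed[OF submodule.axioms(1)] by fastforce

lemma submodule_add: "submodule S K V \<Longrightarrow> x \<in> S \<Longrightarrow> y \<in> S \<Longrightarrow> x \<oplus>\<^bsub>V\<^esub> y \<in> S"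
  using subgroup.m_closed[OF submodule.axioms(1)] by fastforce

lemma submodule_inv:
  "module K V \<Longrightarrow> submodule S K V \<Longrightarrow> x \<in> S \<Longrightarrow> \<ominus>\<^bsub>V\<^esub> x \<in> S"
  by (rule module.submoduleE(3))

lemma submodule_smult: "submodule S K V \<Longrightarrow> r \<in> carrier K \<Longrightarrow> x \<in> S \<Longrightarrow> r \<odot>\<^bsub>V\<^esub> x \<in> S"
  by (rule submodule.smult_closed)

text \<open>Negation is multiplication by -1, so closure under scalars already gives closure under
  inverses. The later submodules are verified through this criterion.\<close>

lemma submodule_smultI:
  assumes "module K V" "S \<subseteq> carrier V" "\<zero>\<^bsub>V\<^esub> \<in> S"
    and "\<And>x y. x \<in> S \<Longrightarrow> y \<in> S \<Longrightarrow> x \<oplus>\<^bsub>V\<^esub> y \<in> S"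
    and "\<And>r x. r \<in> carrier K \<Longrightarrow> x \<in> S \<Longrightarrow> r \<odot>\<^bsub>V\<^esub> x \<in> S"
  shows "submodule S K V"
proof -
  interpret V: module K V by fact
  show ?thesis
  proof (rule V.submoduleI)
    fix x assume x: "x \<in> S"
    have "\<ominus>\<^bsub>V\<^esub> x = (\<ominus>\<^bsub>K\<^esub> \<one>\<^bsub>K\<^esub>) \<odot>\<^bsub>V\<^esub> x"
      using x assms(2) by (subst V.smult_l_minus) auto
    then show "\<ominus>\<^bsub>V\<^esub> x \<in> S"
      using assms(5)[OF _ x] by auto
  qed (use assms in auto)
qed

text \<open>The inverse in a record is defined by a search within its carrier, so shrinking the
  carrier might change it; uniqueness of inverses in the smaller module shows that it does not. This
  is needed for differences of cocycles.\<close>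

lemma submodule_inv_eq:
  assumes "module K V" "submodule S K V" "x \<in> S"
  shows "\<ominus>\<^bsub>V\<lparr>carrier := S\<rparr>\<^esub> x = \<ominus>\<^bsub>V\<^esub> x"
proof -
  interpret V: module K V by fact
  interpret S: module K "V\<lparr>carrier := S\<rparr>"
    by (rule submodule.submodule_is_module) fact+
  show ?thesis
    using S.minus_equality[of "\<ominus>\<^bsub>V\<^esub> x" x] assms submodule_inv[OF assms]
        submodule_subset[OF assms(2)]
    by (simp add: V.l_neg)
qed

text \<open>
  Equality of arrows in the functor category requires extensional functions.  Until the functor
  category itself is needed, \<open>rep_hom\<close> and \<open>is_rep\<close> ignore values outside the carriers, so that
  composites, sums and restrictions need no normalisation; they also relate functors whose values
  are carried by different types.
\<close>

locale linear_cat =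
  fixes K :: "'k ring" and D :: "('o, 'm, 'k) kcat"
  assumes carrier_HomK: "\<And>a b. a \<in> Obj D \<Longrightarrow> b \<in> Obj D \<Longrightarrow> carrier (HomK D a b) = Hom D a b"
    and Idn_closed: "\<And>a. a \<in> Obj D \<Longrightarrow> Idn D a \<in> Hom D a a"
    and Cmp_closed: "\<And>a b c f g. a \<in> Obj D \<Longrightarrow> b \<in> Obj D \<Longrightarrow> c \<in> Obj D \<Longrightarrow>
      f \<in> Hom D a b \<Longrightarrow> g \<in> Hom D b c \<Longrightarrow> Cmp D a b c g f \<in> Hom D a c"
    and Hom_add_closed: "\<And>a b f g. a \<in> Obj D \<Longrightarrow> b \<in> Obj D \<Longrightarrow> f \<in> Hom D a b \<Longrightarrow> g \<in> Hom D a b \<Longrightarrow>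
      f \<oplus>\<^bsub>HomK D a b\<^esub> g \<in> Hom D a b"
    and Hom_smult_closed: "\<And>a b r f. a \<in> Obj D \<Longrightarrow> b \<in> Obj D \<Longrightarrow> r \<in> carrier K \<Longrightarrow> f \<in> Hom D a b \<Longrightarrow>
      r \<odot>\<^bsub>HomK D a b\<^esub> f \<in> Hom D a b"
begin

definition is_rep :: "('o, 'm, 'k, 'v) rep \<Rightarrow> bool" where
  "is_rep M \<longleftrightarrow>
     (\<forall>a\<in>Obj D. module K (fobj M a)) \<and>
     (\<forall>a\<in>Obj D. \<forall>b\<in>Obj D. \<forall>f\<in>Hom D a b. linear_map K (fobj M a) (fobj M b) (farr M a b f)) \<and>
     (\<forall>a\<in>Obj D. \<forall>x\<in>carrier (fobj M a). farr M a a (Idn D a) x = x) \<and>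
     (\<forall>a\<in>Obj D. \<forall>b\<in>Obj D. \<forall>c\<in>Obj D. \<forall>f\<in>Hom D a b. \<forall>g\<in>Hom D b c. \<forall>x\<in>carrier (fobj M a).
        farr M a c (Cmp D a b c g f) x = farr M b c g (farr M a b f x)) \<and>
     (\<forall>a\<in>Obj D. \<forall>b\<in>Obj D. \<forall>f\<in>Hom D a b. \<forall>g\<in>Hom D a b. \<forall>x\<in>carrier (fobj M a).
        farr M a b (f \<oplus>\<^bsub>HomK D a b\<^esub> g) x = farr M a b f x \<oplus>\<^bsub>fobj M b\<^esub> farr M a b g x) \<and>
     (\<forall>a\<in>Obj D. \<forall>b\<in>Obj D. \<forall>r\<in>carrier K. \<forall>f\<in>Hom D a b. \<forall>x\<in>carrier (fobj M a).
        farr M a b (r \<odot>\<^bsub>HomK D a b\<^esub> f) x = r \<odot>\<^bsub>fobj M b\<^esub> farr M a b f x)"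

definition rep_hom :: "('o, 'm, 'k, 'v) rep \<Rightarrow> ('o, 'm, 'k, 'w) rep \<Rightarrow> ('o \<Rightarrow> 'v \<Rightarrow> 'w) \<Rightarrow> bool" where
  "rep_hom M N t \<longleftrightarrow>
     (\<forall>a\<in>Obj D. linear_map K (fobj M a) (fobj N a) (t a)) \<and>
     (\<forall>a\<in>Obj D. \<forall>b\<in>Obj D. \<forall>f\<in>Hom D a b. \<forall>x\<in>carrier (fobj M a).
        t b (farr M a b f x) = farr N a b f (t a x))"

definition rep_surj :: "('o, 'm, 'k, 'v) rep \<Rightarrow> ('o, 'm, 'k, 'w) rep \<Rightarrow> ('o \<Rightarrow> 'v \<Rightarrow> 'w) \<Rightarrow> bool" where
  "rep_surj M N t \<longleftrightarrow> (\<forall>a\<in>Obj D. \<forall>y\<in>carrier (fobj N a). \<exists>x\<in>carrier (fobj M a). t a x = y)"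

definition rep_ker :: "('o, 'm, 'k, 'v) rep \<Rightarrow> ('o, 'm, 'k, 'w) rep \<Rightarrow> ('o \<Rightarrow> 'v \<Rightarrow> 'w) \<Rightarrow> 'o \<Rightarrow> 'v set"
    where
  "rep_ker M N t a = {x \<in> carrier (fobj M a). t a x = \<zero>\<^bsub>fobj N a\<^esub>}"

definition rep_im :: "('o, 'm, 'k, 'v) rep \<Rightarrow> ('o \<Rightarrow> 'v \<Rightarrow> 'w) \<Rightarrow> 'o \<Rightarrow> 'w set" where
  "rep_im M t a = t a ` carrier (fobj M a)"

text \<open>Only the carriers shrink; the operations and \<open>farr\<close> are kept. A map into or
  out of the submodule is thus the same function as for the ambient module, and inclusions are
  \<open>\<lambda>a x. x\<close>.\<close>

definition subrep :: "('o, 'm, 'k, 'v) rep \<Rightarrow> ('o \<Rightarrow> 'v set) \<Rightarrow> ('o, 'm, 'k, 'v) rep" where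
  "subrep M S = M\<lparr>fobj := \<lambda>a. (fobj M a)\<lparr>carrier := S a\<rparr>\<rparr>"

definition is_subrep :: "('o, 'm, 'k, 'v) rep \<Rightarrow> ('o \<Rightarrow> 'v set) \<Rightarrow> bool" where
  "is_subrep M S \<longleftrightarrow> (\<forall>a\<in>Obj D. submodule (S a) K (fobj M a)) \<and>
     (\<forall>a\<in>Obj D. \<forall>b\<in>Obj D. \<forall>f\<in>Hom D a b. \<forall>x\<in>S a. farr M a b f x \<in> S b)"

text \<open>The test modules \<open>M\<close> and \<open>N\<close> are carried by the same type as
  \<open>Q\<close>, since a definition cannot quantify over types. Free modules therefore have to be
  copied to \<open>'v\<close> before they count as projective among the modules over
  \<open>'v\<close>.\<close>

definition rep_proj :: "('o, 'm, 'k, 'v) rep \<Rightarrow> bool" where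
  "rep_proj Q \<longleftrightarrow> is_rep Q \<and>
     (\<forall>(M :: ('o, 'm, 'k, 'v) rep) (N :: ('o, 'm, 'k, 'v) rep) g f.
        is_rep M \<and> is_rep N \<and> rep_hom M N g \<and> rep_surj M N g \<and> rep_hom Q N f \<longrightarrow>
        (\<exists>h. rep_hom Q M h \<and> (\<forall>a\<in>Obj D. \<forall>x\<in>carrier (fobj Q a). g a (h a x) = f a x)))"

lemma rep_module: "is_rep M \<Longrightarrow> a \<in> Obj D \<Longrightarrow> module K (fobj M a)"
  by (simp add: is_rep_def)

lemma rep_group: "is_rep M \<Longrightarrow> a \<in> Obj D \<Longrightarrow> abelian_group (fobj M a)"
  by (metis rep_module module.axioms(2))

lemma rep_arr_linear:
  "is_rep M \<Longrightarrow> a \<in> Obj D \<Longrightarrow> b \<in> Obj D \<Longrightarrow> f \<in> Hom D a b \<Longrightarrow>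
   linear_map K (fobj M a) (fobj M b) (farr M a b f)"
  by (simp add: is_rep_def)

lemma rep_arr_closed:
  "is_rep M \<Longrightarrow> a \<in> Obj D \<Longrightarrow> b \<in> Obj D \<Longrightarrow> f \<in> Hom D a b \<Longrightarrow> x \<in> carrier (fobj M a) \<Longrightarrow>
   farr M a b f x \<in> carrier (fobj M b)"
  by (meson rep_arr_linear linear_map_closed)

lemma rep_arr_add:
  "is_rep M \<Longrightarrow> a \<in> Obj D \<Longrightarrow> b \<in> Obj D \<Longrightarrow> f \<in> Hom D a b \<Longrightarrow> x \<in> carrier (fobj M a) \<Longrightarrow>
   y \<in> carrier (fobj M a) \<Longrightarrow>
   farr M a b f (x \<oplus>\<^bsub>fobj M a\<^esub> y) = farr M a b f x \<oplus>\<^bsub>fobj M b\<^esub> farr M a b f y"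
  by (meson rep_arr_linear linear_map_add)

lemma rep_arr_smult:
  "is_rep M \<Longrightarrow> a \<in> Obj D \<Longrightarrow> b \<in> Obj D \<Longrightarrow> f \<in> Hom D a b \<Longrightarrow> x \<in> carrier (fobj M a) \<Longrightarrow>
   r \<in> carrier K \<Longrightarrow> farr M a b f (r \<odot>\<^bsub>fobj M a\<^esub> x) = r \<odot>\<^bsub>fobj M b\<^esub> farr M a b f x"
  by (meson rep_arr_linear linear_map_smult)

lemma rep_arr_zero:
  "is_rep M \<Longrightarrow> a \<in> Obj D \<Longrightarrow> b \<in> Obj D \<Longrightarrow> f \<in> Hom D a b \<Longrightarrow>
   farr M a b f \<zero>\<^bsub>fobj M a\<^esub> = \<zero>\<^bsub>fobj M b\<^esub>"
  by (meson rep_arr_linear linear_map_zero rep_module)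

lemma rep_arr_minus:
  "is_rep M \<Longrightarrow> a \<in> Obj D \<Longrightarrow> b \<in> Obj D \<Longrightarrow> f \<in> Hom D a b \<Longrightarrow> x \<in> carrier (fobj M a) \<Longrightarrow>
   y \<in> carrier (fobj M a) \<Longrightarrow>
   farr M a b f (x \<ominus>\<^bsub>fobj M a\<^esub> y) = farr M a b f x \<ominus>\<^bsub>fobj M b\<^esub> farr M a b f y"
  by (meson rep_arr_linear linear_map_minus rep_module)

lemma rep_arr_inv:
  "is_rep M \<Longrightarrow> a \<in> Obj D \<Longrightarrow> b \<in> Obj D \<Longrightarrow> f \<in> Hom D a b \<Longrightarrow> x \<in> carrier (fobj M a) \<Longrightarrow>
   farr M a b f (\<ominus>\<^bsub>fobj M a\<^esub> x) = \<ominus>\<^bsub>fobj M b\<^esub> farr M a b f x"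
  by (meson rep_arr_linear linear_map_inv rep_module)

lemma rep_arr_id: "is_rep M \<Longrightarrow> a \<in> Obj D \<Longrightarrow> x \<in> carrier (fobj M a) \<Longrightarrow> farr M a a (Idn D a) x = x"
  by (simp add: is_rep_def)

lemma rep_arr_comp:
  "is_rep M \<Longrightarrow> a \<in> Obj D \<Longrightarrow> b \<in> Obj D \<Longrightarrow> c \<in> Obj D \<Longrightarrow> f \<in> Hom D a b \<Longrightarrow> g \<in> Hom D b c \<Longrightarrow>
   x \<in> carrier (fobj M a) \<Longrightarrow> farr M a c (Cmp D a b c g f) x = farr M b c g (farr M a b f x)"
  by (simp add: is_rep_def)

lemma rep_arr_plus:
  "is_rep M \<Longrightarrow> a \<in> Obj D \<Longrightarrow> b \<in> Obj D \<Longrightarrow> f \<in> Hom D a b \<Longrightarrow> g \<in> Hom D a b \<Longrightarrow>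
   x \<in> carrier (fobj M a) \<Longrightarrow>
   farr M a b (f \<oplus>\<^bsub>HomK D a b\<^esub> g) x = farr M a b f x \<oplus>\<^bsub>fobj M b\<^esub> farr M a b g x"
  by (simp add: is_rep_def)

lemma rep_arr_scale:
  "is_rep M \<Longrightarrow> a \<in> Obj D \<Longrightarrow> b \<in> Obj D \<Longrightarrow> r \<in> carrier K \<Longrightarrow> f \<in> Hom D a b \<Longrightarrow>
   x \<in> carrier (fobj M a) \<Longrightarrow>
   farr M a b (r \<odot>\<^bsub>HomK D a b\<^esub> f) x = r \<odot>\<^bsub>fobj M b\<^esub> farr M a b f x"
  by (simp add: is_rep_def)

lemma hom_linear: "rep_hom M N t \<Longrightarrow> a \<in> Obj D \<Longrightarrow> linear_map K (fobj M a) (fobj N a) (t a)"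
  by (simp add: rep_hom_def)

lemma hom_closed: "rep_hom M N t \<Longrightarrow> a \<in> Obj D \<Longrightarrow> x \<in> carrier (fobj M a) \<Longrightarrow> t a x \<in> carrier (fobj N a)"
  by (meson hom_linear linear_map_closed)

lemma hom_add:
  "rep_hom M N t \<Longrightarrow> a \<in> Obj D \<Longrightarrow> x \<in> carrier (fobj M a) \<Longrightarrow> y \<in> carrier (fobj M a) \<Longrightarrow>
   t a (x \<oplus>\<^bsub>fobj M a\<^esub> y) = t a x \<oplus>\<^bsub>fobj N a\<^esub> t a y"
  by (meson hom_linear linear_map_add)

lemma hom_smult:
  "rep_hom M N t \<Longrightarrow> a \<in> Obj D \<Longrightarrow> r \<in> carrier K \<Longrightarrow> x \<in> carrier (fobj M a) \<Longrightarrow>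
   t a (r \<odot>\<^bsub>fobj M a\<^esub> x) = r \<odot>\<^bsub>fobj N a\<^esub> t a x"
  by (meson hom_linear linear_map_smult)

lemma hom_nat:
  "rep_hom M N t \<Longrightarrow> a \<in> Obj D \<Longrightarrow> b \<in> Obj D \<Longrightarrow> f \<in> Hom D a b \<Longrightarrow> x \<in> carrier (fobj M a) \<Longrightarrow>
   t b (farr M a b f x) = farr N a b f (t a x)"
  by (simp add: rep_hom_def)

lemma hom_zero:
  "rep_hom M N t \<Longrightarrow> is_rep M \<Longrightarrow> is_rep N \<Longrightarrow> a \<in> Obj D \<Longrightarrow> t a \<zero>\<^bsub>fobj M a\<^esub> = \<zero>\<^bsub>fobj N a\<^esub>"
  by (meson hom_linear linear_map_zero rep_module)

lemma hom_inv:
  "rep_hom M N t \<Longrightarrow> is_rep M \<Longrightarrow> is_rep N \<Longrightarrow> a \<in> Obj D \<Longrightarrow> x \<in> carrier (fobj M a) \<Longrightarrow>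
   t a (\<ominus>\<^bsub>fobj M a\<^esub> x) = \<ominus>\<^bsub>fobj N a\<^esub> t a x"
  by (meson hom_linear linear_map_inv rep_module)

lemma hom_minus:
  "rep_hom M N t \<Longrightarrow> is_rep M \<Longrightarrow> is_rep N \<Longrightarrow> a \<in> Obj D \<Longrightarrow> x \<in> carrier (fobj M a) \<Longrightarrow>
   y \<in> carrier (fobj M a) \<Longrightarrow> t a (x \<ominus>\<^bsub>fobj M a\<^esub> y) = t a x \<ominus>\<^bsub>fobj N a\<^esub> t a y"
  by (meson hom_linear linear_map_minus rep_module)

lemma hom_comp: "rep_hom L M s \<Longrightarrow> rep_hom M N t \<Longrightarrow> rep_hom L N (\<lambda>a x. t a (s a x))"
  unfolding rep_hom_def by (auto intro: linear_map_comp simp: linear_map_closed)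

lemma hom_id: "rep_hom M M (\<lambda>a x. x)"
  by (auto simp: rep_hom_def linear_map_def)

lemma hom_plus:
  assumes "is_rep M" "is_rep N" "rep_hom M N s" "rep_hom M N t"
  shows "rep_hom M N (\<lambda>a x. s a x \<oplus>\<^bsub>fobj N a\<^esub> t a x)"
  using assms hom_closed[OF assms(3)] hom_closed[OF assms(4)] hom_nat[OF assms(3)]
      hom_nat[OF assms(4)]
  by (subst rep_hom_def) (auto intro!: linear_map_plus rep_module simp: hom_linear rep_arr_add)

lemma hom_uminus:
  assumes "is_rep M" "is_rep N" "rep_hom M N t"
  shows "rep_hom M N (\<lambda>a x. \<ominus>\<^bsub>fobj N a\<^esub> t a x)"
  using assms hom_closed[OF assms(3)] hom_nat[OF assms(3)]
  by (subst rep_hom_def) (auto intro!: linear_map_uminus rep_module simp: hom_linear rep_arr_inv)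

lemma hom_diff:
  assumes "is_rep M" "is_rep N" "rep_hom M N s" "rep_hom M N t"
  shows "rep_hom M N (\<lambda>a x. s a x \<ominus>\<^bsub>fobj N a\<^esub> t a x)"
  unfolding a_minus_def by (intro hom_plus hom_uminus assms)

lemma hom_zero_map:
  assumes "is_rep M" "is_rep N"
  shows "rep_hom M N (\<lambda>a x. \<zero>\<^bsub>fobj N a\<^esub>)"
proof -
  have "linear_map K (fobj M a) (fobj N a) (\<lambda>x. \<zero>\<^bsub>fobj N a\<^esub>)" if "a \<in> Obj D" for a
  proof -
    interpret N: module K "fobj N a" using assms that by (simp add: rep_module)
    show ?thesis by (auto simp: linear_map_def)
  qed
  then show ?thesis
    using assms by (auto simp: rep_hom_def rep_arr_zero)
qed

lemma hom_cong:
  assumes "rep_hom M N s" "is_rep M" "\<And>a x. a \<in> Obj D \<Longrightarrow> x \<in> carrier (fobj M a) \<Longrightarrow> s a x = t a x"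
  shows "rep_hom M N t"
proof -
  have "linear_map K (fobj M a) (fobj N a) (t a)" if a: "a \<in> Obj D" for a
  proof -
    interpret M: module K "fobj M a" using assms a by (simp add: rep_module)
    show ?thesis
      using hom_linear[OF assms(1) a] assms(3)[OF a] by (auto simp: linear_map_def Pi_def)
  qed
  then show ?thesis
    using assms(1) assms(3)[symmetric] rep_arr_closed[OF assms(2)] by (auto simp: rep_hom_def)
qed

lemma subrep_simps [simp]:
  "carrier (fobj (subrep M S) a) = S a"
  "\<zero>\<^bsub>fobj (subrep M S) a\<^esub> = \<zero>\<^bsub>fobj M a\<^esub>"
  "x \<oplus>\<^bsub>fobj (subrep M S) a\<^esub> y = x \<oplus>\<^bsub>fobj M a\<^esub> y"
  "r \<odot>\<^bsub>fobj (subrep M S) a\<^esub> x = r \<odot>\<^bsub>fobj M a\<^esub> x"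
  "farr (subrep M S) = farr M"
  by (simp_all add: subrep_def)

lemma is_subrepD:
  assumes "is_subrep M S" "a \<in> Obj D"
  shows "submodule (S a) K (fobj M a)"
  using assms by (simp add: is_subrep_def)

lemma is_subrep_mem: "is_subrep M S \<Longrightarrow> a \<in> Obj D \<Longrightarrow> x \<in> S a \<Longrightarrow> x \<in> carrier (fobj M a)"
  by (meson is_subrepD submodule_subset)

lemma is_rep_subrep:
  assumes "is_rep M" "is_subrep M S"
  shows "is_rep (subrep M S)"
proof -
  have "module K (fobj (subrep M S) a)" if "a \<in> Obj D" for a
    using submodule.submodule_is_module[OF is_subrepD[OF assms(2) that] rep_module[OF assms(1)
        that]]
    by (simp add: subrep_def)
  moreover have "linear_map K (fobj (subrep M S) a) (fobj (subrep M S) b) (farr M a b f)"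
    if "a \<in> Obj D" "b \<in> Obj D" "f \<in> Hom D a b" for a b f
    using assms that is_subrep_mem[OF assms(2)]
    by (auto simp: linear_map_def is_subrep_def rep_arr_add rep_arr_smult)
  ultimately show ?thesis
    using assms(1) is_subrep_mem[OF assms(2)]
    unfolding is_rep_def by simp
qed

lemma hom_to_subrep:
  assumes "rep_hom M N t" "\<And>a x. a \<in> Obj D \<Longrightarrow> x \<in> carrier (fobj M a) \<Longrightarrow> t a x \<in> S a"
  shows "rep_hom M (subrep N S) t"
  using assms by (auto simp: rep_hom_def linear_map_def)

lemma hom_from_subrep_to:
  assumes "rep_hom M (subrep N S) t" "is_subrep N S"
  shows "rep_hom M N t"
  using assms(1) is_subrep_mem[OF assms(2)] by (auto simp: rep_hom_def linear_map_def Pi_def)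

lemma hom_restrict:
  assumes "rep_hom M N t" "is_subrep M S"
  shows "rep_hom (subrep M S) N t"
  using assms(1) is_subrep_mem[OF assms(2)] by (auto simp: rep_hom_def linear_map_def Pi_def)

lemma hom_restrict_to:
  assumes "rep_hom M N t" "is_subrep M S" "\<And>a x. a \<in> Obj D \<Longrightarrow> x \<in> S a \<Longrightarrow> t a x \<in> T a"
  shows "rep_hom (subrep M S) (subrep N T) t"
  using assms by (intro hom_to_subrep hom_restrict) auto

lemma is_subrep_ker:
  assumes "is_rep M" "is_rep N" "rep_hom M N t"
  shows "is_subrep M (rep_ker M N t)"
  unfolding is_subrep_def
proof (intro conjI ballI)
  fix a assume a: "a \<in> Obj D"
  interpret M: module K "fobj M a" using assms a by (simp add: rep_module)
  interpret N: module K "fobj N a" using assms a by (simp add: rep_module)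
  show "submodule (rep_ker M N t a) K (fobj M a)"
    using assms a
    by (intro submodule_smultI M.module_axioms)
      (auto simp: rep_ker_def hom_add hom_smult hom_zero)
next
  fix a b f x assume "a \<in> Obj D" "b \<in> Obj D" "f \<in> Hom D a b" "x \<in> rep_ker M N t a"
  then show "farr M a b f x \<in> rep_ker M N t b"
    using assms by (auto simp: rep_ker_def rep_arr_closed hom_nat rep_arr_zero)
qed

lemma is_subrep_im:
  assumes "is_rep M" "is_rep N" "rep_hom M N t"
  shows "is_subrep N (rep_im M t)"
  unfolding is_subrep_def
proof (intro conjI ballI)
  fix a assume a: "a \<in> Obj D"
  interpret M: module K "fobj M a" using assms a by (simp add: rep_module)
  interpret N: module K "fobj N a" using assms a by (simp add: rep_module)
  show "submodule (rep_im M t a) K (fobj N a)"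
  proof (rule submodule_smultI[OF N.module_axioms])
    show "rep_im M t a \<subseteq> carrier (fobj N a)"
      using assms a by (auto simp: rep_im_def hom_closed)
    show "\<zero>\<^bsub>fobj N a\<^esub> \<in> rep_im M t a"
      using assms a unfolding rep_im_def by (metis M.zero_closed hom_zero image_eqI)
    show "x \<oplus>\<^bsub>fobj N a\<^esub> y \<in> rep_im M t a" if "x \<in> rep_im M t a" "y \<in> rep_im M t a" for x y
      using that hom_add[OF assms(3) a, symmetric] by (auto simp: rep_im_def)
    show "r \<odot>\<^bsub>fobj N a\<^esub> x \<in> rep_im M t a" if "r \<in> carrier K" "x \<in> rep_im M t a" for r x
      using that hom_smult[OF assms(3) a, symmetric] by (auto simp: rep_im_def)
  qed
next
  fix a b f x assume "a \<in> Obj D" "b \<in> Obj D" "f \<in> Hom D a b" "x \<in> rep_im M t a"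
  then show "farr N a b f x \<in> rep_im M t b"
    using assms hom_nat[OF assms(3), symmetric] by (auto simp: rep_im_def rep_arr_closed)
qed

section \<open>Maps given by choices of preimages\<close>

text \<open>A total relation that is closed under sums, scalars and arrows, and relates zero only to
  zero, is single-valued: two pairs over one element differ by a pair over zero. This yields maps
  whose values depend on a choice of preimage, with no coherence demanded of the choice.\<close>

lemma rep_hom_of_relation:
  assumes M: "is_rep M" and N: "is_rep N"
    and total: "\<And>a x. a \<in> Obj D \<Longrightarrow> x \<in> carrier (fobj M a) \<Longrightarrow> \<exists>y. R a x y"
    and dom: "\<And>a x y. a \<in> Obj D \<Longrightarrow> R a x y \<Longrightarrow> x \<in> carrier (fobj M a) \<and> y \<in> carrier (fobj N a)"
    and add: "\<And>a x y x' y'. a \<in> Obj D \<Longrightarrow> R a x y \<Longrightarrow> R a x' y' \<Longrightarrow>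
      R a (x \<oplus>\<^bsub>fobj M a\<^esub> x') (y \<oplus>\<^bsub>fobj N a\<^esub> y')"
    and smult: "\<And>a r x y. a \<in> Obj D \<Longrightarrow> r \<in> carrier K \<Longrightarrow> R a x y \<Longrightarrow>
      R a (r \<odot>\<^bsub>fobj M a\<^esub> x) (r \<odot>\<^bsub>fobj N a\<^esub> y)"
    and arr: "\<And>a b f x y. a \<in> Obj D \<Longrightarrow> b \<in> Obj D \<Longrightarrow> f \<in> Hom D a b \<Longrightarrow> R a x y \<Longrightarrow>
      R b (farr M a b f x) (farr N a b f y)"
    and zero: "\<And>a y. a \<in> Obj D \<Longrightarrow> R a \<zero>\<^bsub>fobj M a\<^esub> y \<Longrightarrow> y = \<zero>\<^bsub>fobj N a\<^esub>"
  obtains t where "rep_hom M N t" "\<And>a x y. a \<in> Obj D \<Longrightarrow> R a x y \<Longrightarrow> t a x = y"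
proof -
  define t where "t = (\<lambda>a x. SOME y. R a x y)"
  have uniq: "y = z" if a: "a \<in> Obj D" and y: "R a x y" and z: "R a x z" for a x y z
  proof -
    interpret M: module K "fobj M a" using M a by (simp add: rep_module)
    interpret N: module K "fobj N a" using N a by (simp add: rep_module)
    note d = dom[OF a y] dom[OF a z]
    have neg: "(\<ominus>\<^bsub>K\<^esub> \<one>\<^bsub>K\<^esub>) \<in> carrier K" by simp
    have "R a (x \<oplus>\<^bsub>fobj M a\<^esub> (\<ominus>\<^bsub>K\<^esub> \<one>\<^bsub>K\<^esub>) \<odot>\<^bsub>fobj M a\<^esub> x) (y \<oplus>\<^bsub>fobj N a\<^esub> (\<ominus>\<^bsub>K\<^esub> \<one>\<^bsub>K\<^esub>) \<odot>\<^bsub>fobj N a\<^esub> z)"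
      by (intro add smult a y z neg)
    then have "R a \<zero>\<^bsub>fobj M a\<^esub> (y \<ominus>\<^bsub>fobj N a\<^esub> z)"
      using d by (simp add: M.smult_l_minus N.smult_l_minus M.r_neg a_minus_def)
    then have "y \<ominus>\<^bsub>fobj N a\<^esub> z = \<zero>\<^bsub>fobj N a\<^esub>" by (rule zero[OF a])
    then show ?thesis using d N.minus_zeroD by auto
  qed
  have eq: "t a x = y" if "a \<in> Obj D" "R a x y" for a x y
    unfolding t_def by (rule uniq[OF that(1) someI[of "R a x", OF that(2)] that(2)])
  have sat: "R a x (t a x)" if "a \<in> Obj D" "x \<in> carrier (fobj M a)" for a x
    unfolding t_def using total[OF that] by (rule someI_ex)
  have "rep_hom M N t"
    unfolding rep_hom_def linear_map_def
  proof (intro conjI ballI)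
    show "t a \<in> carrier (fobj M a) \<rightarrow> carrier (fobj N a)" if "a \<in> Obj D" for a
      using sat[OF that] dom[OF that] by blast
    show "t a (x \<oplus>\<^bsub>fobj M a\<^esub> y) = t a x \<oplus>\<^bsub>fobj N a\<^esub> t a y"
      if "a \<in> Obj D" "x \<in> carrier (fobj M a)" "y \<in> carrier (fobj M a)" for a x y
      by (intro eq add sat that)
    show "t a (r \<odot>\<^bsub>fobj M a\<^esub> x) = r \<odot>\<^bsub>fobj N a\<^esub> t a x"
      if "a \<in> Obj D" "r \<in> carrier K" "x \<in> carrier (fobj M a)" for a r x
      by (intro eq smult sat that)
    show "t b (farr M a b f x) = farr N a b f (t a x)"
      if "a \<in> Obj D" "b \<in> Obj D" "f \<in> Hom D a b" "x \<in> carrier (fobj M a)" for a b f x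
      by (intro eq arr sat that)
  qed
  then show ?thesis using eq that by blast
qed

text \<open>The relation consists of the pairs \<open>(q a x, t a x)\<close>: it is total because
  \<open>q\<close> is onto, and only zero lies over zero because the kernel of \<open>q\<close> lies
  in that of \<open>t\<close>.\<close>

lemma hom_factor_surj:
  assumes "is_rep M" "is_rep N" "is_rep L" "rep_hom M N q" "rep_surj M N q" "rep_hom M L t"
    and ker: "\<And>a x. a \<in> Obj D \<Longrightarrow> x \<in> carrier (fobj M a) \<Longrightarrow> q a x = \<zero>\<^bsub>fobj N a\<^esub> \<Longrightarrow> t a x = \<zero>\<^bsub>fobj L a\<^esub>"
  obtains s where "rep_hom N L s" "\<And>a x. a \<in> Obj D \<Longrightarrow> x \<in> carrier (fobj M a) \<Longrightarrow> s a (q a x) = t a x"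
proof -
  define R where "R = (\<lambda>a y z. \<exists>x\<in>carrier (fobj M a). y = q a x \<and> z = t a x)"
  obtain s where s: "rep_hom N L s" "\<And>a x y. a \<in> Obj D \<Longrightarrow> R a x y \<Longrightarrow> s a x = y"
  proof (rule rep_hom_of_relation[OF assms(2,3), of R])
    show "\<exists>y. R a x y" if "a \<in> Obj D" "x \<in> carrier (fobj N a)" for a x
      using assms(5) that unfolding R_def rep_surj_def by metis
    show "x \<in> carrier (fobj N a) \<and> y \<in> carrier (fobj L a)" if "a \<in> Obj D" "R a x y" for a x y
      using that hom_closed[OF assms(4)] hom_closed[OF assms(6)] unfolding R_def by auto
    show "R a (x \<oplus>\<^bsub>fobj N a\<^esub> x') (y \<oplus>\<^bsub>fobj L a\<^esub> y')" if a: "a \<in> Obj D" "R a x y" "R a x' y'"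
        for a x y x' y'
    proof -
      interpret M: module K "fobj M a" using assms a by (simp add: rep_module)
      obtain u v where "u \<in> carrier (fobj M a)" "v \<in> carrier (fobj M a)" "x = q a u" "y = t a u"
        "x' = q a v" "y' = t a v"
        using a(2,3) unfolding R_def by auto
      then show ?thesis
        using hom_add[OF assms(4) a(1)] hom_add[OF assms(6) a(1)]
        unfolding R_def by (intro bexI[of _ "u \<oplus>\<^bsub>fobj M a\<^esub> v"]) auto
    qed
    show "R a (r \<odot>\<^bsub>fobj N a\<^esub> x) (r \<odot>\<^bsub>fobj L a\<^esub> y)" if a: "a \<in> Obj D" "r \<in> carrier K" "R a x y"
        for a r x y
    proof -
      interpret M: module K "fobj M a" using assms a by (simp add: rep_module)
      obtain u where "u \<in> carrier (fobj M a)" "x = q a u" "y = t a u"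
        using a(3) unfolding R_def by auto
      then show ?thesis
        using a(2) hom_smult[OF assms(4) a(1)] hom_smult[OF assms(6) a(1)]
        unfolding R_def by (intro bexI[of _ "r \<odot>\<^bsub>fobj M a\<^esub> u"]) auto
    qed
    show "R b (farr N a b f x) (farr L a b f y)"
      if a: "a \<in> Obj D" "b \<in> Obj D" "f \<in> Hom D a b" "R a x y" for a b f x y
    proof -
      obtain u where "u \<in> carrier (fobj M a)" "x = q a u" "y = t a u"
        using a(4) unfolding R_def by auto
      then show ?thesis
        using hom_nat[OF assms(4) a(1-3)] hom_nat[OF assms(6) a(1-3)]
          rep_arr_closed[OF assms(1) a(1-3)]
        unfolding R_def by (intro bexI[of _ "farr M a b f u"]) auto
    qed
    show "y = \<zero>\<^bsub>fobj L a\<^esub>" if "a \<in> Obj D" "R a \<zero>\<^bsub>fobj N a\<^esub> y" for a y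
      using that ker unfolding R_def by metis
  qed blast
  show ?thesis
    by (rule that[OF s(1)]) (auto simp: R_def intro!: s(2))
qed

section \<open>Projective modules\<close>

lemma proj_rep: "rep_proj Q \<Longrightarrow> is_rep Q"
  by (simp add: rep_proj_def)

lemma proj_lift:
  fixes M N Q :: "('o, 'm, 'k, 'v) rep"
  assumes "rep_proj Q" "is_rep M" "is_rep N" "rep_hom M N g" "rep_surj M N g" "rep_hom Q N f"
  obtains h where "rep_hom Q M h"
    "\<And>a x. a \<in> Obj D \<Longrightarrow> x \<in> carrier (fobj Q a) \<Longrightarrow> g a (h a x) = f a x"
proof -
  have "\<exists>h. rep_hom Q M h \<and> (\<forall>a\<in>Obj D. \<forall>x\<in>carrier (fobj Q a). g a (h a x) = f a x)"
    using assms(1)[unfolded rep_proj_def, THEN conjunct2, rule_format, of M N g f] assms(2-) by simp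
  then show ?thesis using that by auto
qed

text \<open>The image of \<open>g\<close> is a submodule of \<open>N\<close> onto which
  \<open>g\<close> is surjective, so the lifting property applies to maps that land in it.\<close>

lemma proj_lift_im:
  fixes M N Q :: "('o, 'm, 'k, 'v) rep"
  assumes "rep_proj Q" "is_rep M" "is_rep N" "rep_hom M N g" "rep_hom Q N f"
    and "\<And>a x. a \<in> Obj D \<Longrightarrow> x \<in> carrier (fobj Q a) \<Longrightarrow> f a x \<in> rep_im M g a"
  obtains h where "rep_hom Q M h"
    "\<And>a x. a \<in> Obj D \<Longrightarrow> x \<in> carrier (fobj Q a) \<Longrightarrow> g a (h a x) = f a x"
proof -
  let ?N = "subrep N (rep_im M g)"
  have "is_rep ?N"
    by (intro is_rep_subrep is_subrep_im assms)
  moreover have "rep_hom M ?N g" "rep_surj M ?N g" "rep_hom Q ?N f"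
    using assms(4-) by (auto intro: hom_to_subrep simp: rep_im_def rep_surj_def)
  ultimately show ?thesis
    using proj_lift[OF assms(1,2), of ?N g f] that by blast
qed

text \<open>The hypotheses say that the identity of \<open>V\<close> factors through the sum of
  \<open>U\<close> and \<open>U'\<close>. The sum itself is not formed: the lifts of
  \<open>f\<close> after \<open>r\<close> and after \<open>r'\<close> are pulled back by
  \<open>k\<close> and \<open>k'\<close> and added.\<close>

lemma proj_of_sum:
  fixes V U U' :: "('o, 'm, 'k, 'v) rep"
  assumes V: "is_rep V" and U: "rep_proj U" "rep_proj U'"
    and k: "rep_hom V U k" "rep_hom V U' k'" and r: "rep_hom U V r" "rep_hom U' V r'"
    and eq: "\<And>a x. a \<in> Obj D \<Longrightarrow> x \<in> carrier (fobj V a) \<Longrightarrow> x = r a (k a x) \<oplus>\<^bsub>fobj V a\<^esub> r' a (k' a x)"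
  shows "rep_proj V"
  unfolding rep_proj_def
proof (intro conjI V allI impI; elim conjE)
  fix M N :: "('o, 'm, 'k, 'v) rep" and g f
  assume M: "is_rep M" and N: "is_rep N" and g: "rep_hom M N g" "rep_surj M N g"
      and f: "rep_hom V N f"
  obtain h where h: "rep_hom U M h" "\<And>a x. a \<in> Obj D \<Longrightarrow> x \<in> carrier (fobj U a) \<Longrightarrow>
      g a (h a x) = f a (r a x)"
    by (rule proj_lift[OF U(1) M N g hom_comp[OF r(1) f]]) blast
  obtain h' where h': "rep_hom U' M h'" "\<And>a x. a \<in> Obj D \<Longrightarrow> x \<in> carrier (fobj U' a) \<Longrightarrow>
      g a (h' a x) = f a (r' a x)"
    by (rule proj_lift[OF U(2) M N g hom_comp[OF r(2) f]]) blast
  let ?h = "\<lambda>a x. h a (k a x) \<oplus>\<^bsub>fobj M a\<^esub> h' a (k' a x)"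
  have "rep_hom V M ?h"
    by (intro hom_plus V M hom_comp[OF k(1) h(1)] hom_comp[OF k(2) h'(1)])
  moreover have "g a (?h a x) = f a x" if "a \<in> Obj D" "x \<in> carrier (fobj V a)" for a x
  proof -
    have "g a (?h a x) = f a (r a (k a x)) \<oplus>\<^bsub>fobj N a\<^esub> f a (r' a (k' a x))"
      using that by (simp add: hom_add[OF g(1)] h h' hom_closed[OF h(1)] hom_closed[OF h'(1)]
          hom_closed[OF k(1)] hom_closed[OF k(2)])
    also have "\<dots> = f a (r a (k a x) \<oplus>\<^bsub>fobj V a\<^esub> r' a (k' a x))"
      using that by (simp add: hom_add[OF f] hom_closed[OF k(1)] hom_closed[OF k(2)]
          hom_closed[OF r(1)] hom_closed[OF r(2)])
    finally show ?thesis using eq[OF that] by simp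
  qed
  ultimately show "\<exists>h. rep_hom V M h \<and> (\<forall>a\<in>Obj D. \<forall>x\<in>carrier (fobj V a). g a (h a x) = f a x)"
    by blast
qed

text \<open>The case of \<open>proj_of_sum\<close> in which both summands are \<open>U\<close> and
  the second one is sent to \<open>V\<close> by zero.\<close>

lemma proj_retract:
  fixes V U :: "('o, 'm, 'k, 'v) rep"
  assumes V: "is_rep V" and U: "rep_proj U" and k: "rep_hom V U k" and r: "rep_hom U V r"
    and eq: "\<And>a x. a \<in> Obj D \<Longrightarrow> x \<in> carrier (fobj V a) \<Longrightarrow> r a (k a x) = x"
  shows "rep_proj V"
proof (rule proj_of_sum[OF V U U k k r hom_zero_map[OF proj_rep[OF U] V]])
  fix a x assume a: "a \<in> Obj D" "x \<in> carrier (fobj V a)"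
  interpret V: module K "fobj V a" using V a by (simp add: rep_module)
  show "x = r a (k a x) \<oplus>\<^bsub>fobj V a\<^esub> \<zero>\<^bsub>fobj V a\<^esub>"
    using a eq by simp
qed

end

section \<open>Modules with a two-term projective presentation\<close>

context linear_cat
begin

text \<open>
  The identity of \<open>X\<close> factors through \<open>U / J\<close>: the map \<open>X \<rightarrow> U / J\<close> is induced by \<open>\<theta>\<close>, which avoids
  forming the quotient.  As \<open>U\<close> and \<open>J\<close> are projective and \<open>Hom(J, Y) = 0\<close>, all higher extensions of
  \<open>X\<close> by \<open>Y\<close> vanish.
\<close>

definition good_pres ::
  "('o, 'm, 'k, 'v) rep \<Rightarrow> ('o, 'm, 'k, 'v) rep \<Rightarrow> ('o, 'm, 'k, 'v) rep \<Rightarrow>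
   ('o \<Rightarrow> 'v set) \<Rightarrow> ('o \<Rightarrow> 'v \<Rightarrow> 'v) \<Rightarrow> ('o \<Rightarrow> 'v \<Rightarrow> 'v) \<Rightarrow> bool" where
  "good_pres Y X U J p \<theta> \<longleftrightarrow> is_rep X \<and>
     rep_proj U \<and> is_subrep U J \<and> rep_proj (subrep U J) \<and>
     (\<forall>t. rep_hom (subrep U J) Y t \<longrightarrow> (\<forall>a\<in>Obj D. \<forall>x\<in>J a. t a x = \<zero>\<^bsub>fobj Y a\<^esub>)) \<and>
     rep_hom U X p \<and> rep_surj U X p \<and> (\<forall>a\<in>Obj D. \<forall>x\<in>J a. p a x = \<zero>\<^bsub>fobj X a\<^esub>) \<and>
     rep_hom U U \<theta> \<and> (\<forall>a\<in>Obj D. \<forall>x\<in>carrier (fobj U a). p a (\<theta> a x) = p a x) \<and>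
     (\<forall>a\<in>Obj D. \<forall>x\<in>carrier (fobj U a). p a x = \<zero>\<^bsub>fobj X a\<^esub> \<longrightarrow> \<theta> a x \<in> J a)"

definition good :: "('o, 'm, 'k, 'v) rep \<Rightarrow> ('o, 'm, 'k, 'v) rep \<Rightarrow> bool" where
  "good Y X \<longleftrightarrow> (\<exists>U J p \<theta>. good_pres Y X U J p \<theta>)"

lemma good_presI:
  assumes "is_rep X" "rep_proj U" "is_subrep U J" "rep_proj (subrep U J)"
    and "\<And>t a x. rep_hom (subrep U J) Y t \<Longrightarrow> a \<in> Obj D \<Longrightarrow> x \<in> J a \<Longrightarrow> t a x = \<zero>\<^bsub>fobj Y a\<^esub>"
    and "rep_hom U X p" "rep_surj U X p" "\<And>a x. a \<in> Obj D \<Longrightarrow> x \<in> J a \<Longrightarrow> p a x = \<zero>\<^bsub>fobj X a\<^esub>"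
    and "rep_hom U U \<theta>" "\<And>a x. a \<in> Obj D \<Longrightarrow> x \<in> carrier (fobj U a) \<Longrightarrow> p a (\<theta> a x) = p a x"
    and "\<And>a x. a \<in> Obj D \<Longrightarrow> x \<in> carrier (fobj U a) \<Longrightarrow> p a x = \<zero>\<^bsub>fobj X a\<^esub> \<Longrightarrow> \<theta> a x \<in> J a"
  shows "good_pres Y X U J p \<theta>"
  unfolding good_pres_def using assms by blast

lemma good_presD:
  assumes "good_pres Y X U J p \<theta>"
  shows "is_rep X" "rep_proj U" "is_subrep U J" "rep_proj (subrep U J)"
    "\<And>t a x. rep_hom (subrep U J) Y t \<Longrightarrow> a \<in> Obj D \<Longrightarrow> x \<in> J a \<Longrightarrow> t a x = \<zero>\<^bsub>fobj Y a\<^esub>"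
    "rep_hom U X p" "rep_surj U X p" "\<And>a x. a \<in> Obj D \<Longrightarrow> x \<in> J a \<Longrightarrow> p a x = \<zero>\<^bsub>fobj X a\<^esub>"
    "rep_hom U U \<theta>" "\<And>a x. a \<in> Obj D \<Longrightarrow> x \<in> carrier (fobj U a) \<Longrightarrow> p a (\<theta> a x) = p a x"
    "\<And>a x. a \<in> Obj D \<Longrightarrow> x \<in> carrier (fobj U a) \<Longrightarrow> p a x = \<zero>\<^bsub>fobj X a\<^esub> \<Longrightarrow> \<theta> a x \<in> J a"
  using assms unfolding good_pres_def by blast+

lemma good_rep: "good Y X \<Longrightarrow> is_rep X"
  by (auto simp: good_def good_pres_def)

text \<open>
  The kernel \<open>V\<close> of \<open>U1 \<rightarrow> X0\<close> covers the kernel of \<open>q\<close>.  It is projective because its identity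
  \<open>v \<mapsto> \<rho> v + \<sigma> (\<kappa> v)\<close> factors through \<open>U1 \<oplus> J0\<close>.
\<close>

lemma good_ker:
  fixes X1 X0 Y :: "('o, 'm, 'k, 'v) rep"
  assumes X0: "good Y X0" and X1: "good Y X1" and q: "rep_hom X1 X0 q" "rep_surj X1 X0 q"
  shows "good Y (subrep X1 (rep_ker X1 X0 q))"
proof -
  obtain U0 J0 p0 \<theta>0 where "good_pres Y X0 U0 J0 p0 \<theta>0"
    using X0 unfolding good_def by blast
  note x0 = good_presD[OF this]
  obtain U1 J1 p1 \<theta>1 where "good_pres Y X1 U1 J1 p1 \<theta>1"
    using X1 unfolding good_def by blast
  note x1 = good_presD[OF this]
  note U0 = proj_rep[OF x0(2)] and U1 = proj_rep[OF x1(2)]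
  define \<pi> where "\<pi> = (\<lambda>a x. q a (p1 a x))"
  have \<pi>: "rep_hom U1 X0 \<pi>"
    unfolding \<pi>_def by (rule hom_comp[OF x1(6) q(1)])
  have \<pi>_surj: "rep_surj U1 X0 \<pi>"
    using q(2) x1(7) unfolding rep_surj_def \<pi>_def by metis
  define V where "V = rep_ker U1 X0 \<pi>"
  have V: "is_subrep U1 V"
    unfolding V_def by (rule is_subrep_ker[OF U1 x0(1) \<pi>])
  have V_mem: "x \<in> V a \<longleftrightarrow> x \<in> carrier (fobj U1 a) \<and> q a (p1 a x) = \<zero>\<^bsub>fobj X0 a\<^esub>" for a x
    by (simp add: V_def rep_ker_def \<pi>_def)
  have rV: "is_rep (subrep U1 V)" by (rule is_rep_subrep[OF U1 V])
  \<comment> \<open>\<open>U1\<close> and \<open>U0\<close> are projective and map onto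
    \<open>X0\<close> by \<pi> and \<open>p0\<close>. As in Schanuel's lemma, \<delta> and \<sigma>
    lift each of these two maps along the other.\<close>
  obtain \<delta> where \<delta>: "rep_hom U1 U0 \<delta>" "\<And>a x. a \<in> Obj D \<Longrightarrow> x \<in> carrier (fobj U1 a) \<Longrightarrow>
      p0 a (\<delta> a x) = \<pi> a x"
    by (rule proj_lift[OF x1(2) U0 x0(1,6,7) \<pi>]) blast
  obtain \<sigma> where \<sigma>: "rep_hom U0 U1 \<sigma>" "\<And>a x. a \<in> Obj D \<Longrightarrow> x \<in> carrier (fobj U0 a) \<Longrightarrow>
      \<pi> a (\<sigma> a x) = p0 a x"
    by (rule proj_lift[OF x0(2) U1 x0(1) \<pi> \<pi>_surj x0(6)]) blast
  have rJ0: "is_rep (subrep U0 J0)" by (rule proj_rep[OF x0(4)])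
  define \<kappa> where "\<kappa> = (\<lambda>a x. \<theta>0 a (\<delta> a x))"
  have \<kappa>: "rep_hom U1 U0 \<kappa>"
    unfolding \<kappa>_def by (rule hom_comp[OF \<delta>(1) x0(9)])
  \<comment> \<open>\<rho> removes from \<open>x\<close> the part that \<open>X0\<close> sees:
    \<theta>0 does not change images under \<open>p0\<close>, so \<pi> \<sigma> \<kappa> = p0
    \<theta>0 \<delta> = p0 \<delta> = \<pi>, and \<rho> lands in \<open>V\<close>.\<close>
  define \<rho> where "\<rho> = (\<lambda>a x. x \<ominus>\<^bsub>fobj U1 a\<^esub> \<sigma> a (\<kappa> a x))"
  have \<rho>: "rep_hom U1 U1 \<rho>"
    unfolding \<rho>_def by (intro hom_diff U1 hom_id hom_comp[OF \<kappa> \<sigma>(1)])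
  have \<rho>_V: "\<rho> a x \<in> V a" if "a \<in> Obj D" "x \<in> carrier (fobj U1 a)" for a x
  proof -
    interpret U: module K "fobj U1 a" by (rule rep_module[OF U1 that(1)])
    interpret X: module K "fobj X0 a" by (rule rep_module[OF x0(1) that(1)])
    have c: "\<sigma> a (\<kappa> a x) \<in> carrier (fobj U1 a)"
      using that by (simp add: hom_closed[OF \<sigma>(1)] hom_closed[OF \<kappa>])
    have "\<pi> a (\<rho> a x) = \<pi> a x \<ominus>\<^bsub>fobj X0 a\<^esub> \<pi> a (\<sigma> a (\<kappa> a x))"
      unfolding \<rho>_def using that c by (simp add: hom_minus[OF \<pi> U1 x0(1)])
    also have "\<pi> a (\<sigma> a (\<kappa> a x)) = \<pi> a x"
      using that by (simp add: \<sigma>(2) hom_closed[OF \<kappa>]) (simp add: \<kappa>_def x0(10) hom_closed[OF \<delta>(1)]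
          \<delta>(2))
    finally have "\<pi> a (\<rho> a x) = \<zero>\<^bsub>fobj X0 a\<^esub>"
      using hom_closed[OF \<pi> that] by (simp add: X.minus_eq X.r_neg)
    then show ?thesis
      using that by (simp add: V_def rep_ker_def hom_closed[OF \<rho>])
  qed
  have pV: "rep_proj (subrep U1 V)"
  proof (rule proj_of_sum[OF rV x1(2) x0(4)])
    show "rep_hom (subrep U1 V) U1 (\<lambda>a x. x)"
      by (rule hom_restrict[OF hom_id V])
    \<comment> \<open>On \<open>V\<close> the composite of \<delta> with \<open>p0\<close> is \<pi>
      and hence zero, and \<theta>0 moves the kernel of \<open>p0\<close> into
      \<open>J0\<close>.\<close>
    have "\<kappa> a x \<in> J0 a" if "a \<in> Obj D" "x \<in> V a" for a x
      using that unfolding \<kappa>_def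
      by (intro x0(11)) (auto simp: V_mem hom_closed[OF \<delta>(1)] \<delta>(2) \<pi>_def)
    then show "rep_hom (subrep U1 V) (subrep U0 J0) \<kappa>"
      by (rule hom_restrict_to[OF \<kappa> V])
    show "rep_hom U1 (subrep U1 V) \<rho>"
      by (rule hom_to_subrep[OF \<rho> \<rho>_V])
    have "\<sigma> a x \<in> V a" if "a \<in> Obj D" "x \<in> J0 a" for a x
      using that \<sigma>(2)[of a x] is_subrep_mem[OF x0(3) that]
      by (auto simp: V_mem hom_closed[OF \<sigma>(1)] x0(8) \<pi>_def)
    then show "rep_hom (subrep U0 J0) (subrep U1 V) \<sigma>"
      by (rule hom_restrict_to[OF \<sigma>(1) x0(3)])
    fix a x assume a: "a \<in> Obj D" and "x \<in> carrier (fobj (subrep U1 V) a)"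
    then have x: "x \<in> carrier (fobj U1 a)" by (simp add: V_mem)
    interpret U: module K "fobj U1 a" by (rule rep_module[OF U1 a])
    show "x = \<rho> a x \<oplus>\<^bsub>fobj (subrep U1 V) a\<^esub> \<sigma> a (\<kappa> a x)"
      using a x hom_closed[OF \<sigma>(1) a hom_closed[OF \<kappa> a x]]
      by (simp add: \<rho>_def U.minus_eq U.a_assoc U.l_neg)
  qed
  let ?Z = "subrep X1 (rep_ker X1 X0 q)"
  have Zs: "is_subrep X1 (rep_ker X1 X0 q)" by (rule is_subrep_ker[OF x1(1) x0(1) q(1)])
  have J1V: "J1 a \<subseteq> V a" if "a \<in> Obj D" for a
    using that is_subrep_mem[OF x1(3)] x1(8) hom_zero[OF q(1) x1(1) x0(1)] by (auto simp: V_mem)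
  have sub_sub: "subrep (subrep U1 V) J1 = subrep U1 J1"
    by (simp add: subrep_def)
  \<comment> \<open>The presentation of \<open>X1\<close> is restricted to \<open>V\<close>, with
    the same \<open>J1\<close>, which lies in \<open>V\<close> because \<open>p1\<close> kills it.
    Nested submodules are equal as records, so projectivity of \<open>J1\<close> and the vanishing
    of its maps to \<open>Y\<close> carry over unchanged.\<close>
  have "good_pres Y ?Z (subrep U1 V) J1 p1 \<theta>1"
  proof (rule good_presI)
    show "is_rep ?Z" by (rule is_rep_subrep[OF x1(1) Zs])
    show "rep_proj (subrep U1 V)" by fact
    have "submodule (J1 a) K (fobj (subrep U1 V) a)" if a: "a \<in> Obj D" for a
    proof -
      note sm = is_subrepD[OF x1(3) a]
      show ?thesis
        by (intro submodule_smultI rep_module[OF rV a])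
          (use J1V[OF a] submodule_zero[OF sm] submodule_add[OF sm] submodule_smult[OF sm] in auto)
    qed
    then show "is_subrep (subrep U1 V) J1"
      using x1(3) by (simp add: is_subrep_def)
    show "rep_proj (subrep (subrep U1 V) J1)" unfolding sub_sub by fact
    show "t a x = \<zero>\<^bsub>fobj Y a\<^esub>" if "rep_hom (subrep (subrep U1 V) J1) Y t" "a \<in> Obj D" "x \<in> J1 a"
        for t a x
      using that unfolding sub_sub by (rule x1(5))
    show "rep_hom (subrep U1 V) ?Z p1"
      by (rule hom_restrict_to[OF x1(6) V]) (auto simp: V_mem rep_ker_def hom_closed[OF x1(6)])
    show "rep_surj (subrep U1 V) ?Z p1"
      unfolding rep_surj_def
    proof (intro ballI)
      fix a y assume a: "a \<in> Obj D" and y: "y \<in> carrier (fobj ?Z a)"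
      then obtain x where "x \<in> carrier (fobj U1 a)" "p1 a x = y"
        using x1(7) unfolding rep_surj_def by (force simp: rep_ker_def)
      then show "\<exists>x\<in>carrier (fobj (subrep U1 V) a). p1 a x = y"
        using y by (intro bexI[of _ x]) (auto simp: rep_ker_def V_mem)
    qed
    show "p1 a x = \<zero>\<^bsub>fobj ?Z a\<^esub>" if "a \<in> Obj D" "x \<in> J1 a" for a x
      using x1(8)[OF that] by simp
    show "rep_hom (subrep U1 V) (subrep U1 V) \<theta>1"
      by (rule hom_restrict_to[OF x1(9) V]) (auto simp: V_mem hom_closed[OF x1(9)] x1(10))
    show "p1 a (\<theta>1 a x) = p1 a x" if "a \<in> Obj D" "x \<in> carrier (fobj (subrep U1 V) a)" for a x
      using that by (simp add: V_mem x1(10))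
    show "\<theta>1 a x \<in> J1 a" if "a \<in> Obj D" "x \<in> carrier (fobj (subrep U1 V) a)"
        "p1 a x = \<zero>\<^bsub>fobj ?Z a\<^esub>" for a x
      using that by (simp add: V_mem x1(11))
  qed
  then show ?thesis unfolding good_def by blast
qed

text \<open>This is the vanishing of the first extension group of \<open>X0\<close> by
  \<open>Y\<close>, expressed for the kernel of a surjection onto \<open>X0\<close>. A lift
  \<open>l\<close> of \<open>p\<close> to \<open>X1\<close> allows one to subtract from
  \<open>y\<close> an element with the same image in \<open>X0\<close>; the value of
  \<open>g\<close> is \<open>f\<close> of the difference, which lies in the kernel.\<close>

lemma good_extend:
  fixes X1 X0 Y :: "('o, 'm, 'k, 'v) rep"
  assumes X0: "good Y X0" and X1: "is_rep X1" and Y: "is_rep Y"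
      and q: "rep_hom X1 X0 q" "rep_surj X1 X0 q"
    and f: "rep_hom (subrep X1 (rep_ker X1 X0 q)) Y f"
  obtains g where "rep_hom X1 Y g"
    "\<And>a x. a \<in> Obj D \<Longrightarrow> x \<in> carrier (fobj X1 a) \<Longrightarrow> q a x = \<zero>\<^bsub>fobj X0 a\<^esub> \<Longrightarrow> g a x = f a x"
proof -
  obtain U J p \<theta> where "good_pres Y X0 U J p \<theta>"
    using X0 unfolding good_def by blast
  note x = good_presD[OF this]
  note U = proj_rep[OF x(2)]
  obtain l0 where l0: "rep_hom U X1 l0" "\<And>a x. a \<in> Obj D \<Longrightarrow> x \<in> carrier (fobj U a) \<Longrightarrow>
      q a (l0 a x) = p a x"
    by (rule proj_lift[OF x(2) X1 x(1) q x(6)]) blast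
  \<comment> \<open>Composing the lift with \<theta> makes the later value independent of
    \<open>u\<close>: two choices differ by an element of the kernel of \<open>p\<close>, which
    \<theta> moves into \<open>J\<close>, and \<open>f\<close> after \<open>l0\<close> is zero on
    \<open>J\<close> because it is a map from \<open>J\<close> to \<open>Y\<close>.\<close>
  define l where "l = (\<lambda>a u. l0 a (\<theta> a u))"
  have l: "rep_hom U X1 l" unfolding l_def by (rule hom_comp[OF x(9) l0(1)])
  have ql: "q a (l a u) = p a u" if "a \<in> Obj D" "u \<in> carrier (fobj U a)" for a u
    using that by (simp add: l_def l0(2) hom_closed[OF x(9)] x(10))
  let ?k = "rep_ker X1 X0 q"
  have k: "is_subrep X1 ?k" by (rule is_subrep_ker[OF X1 x(1) q(1)])
  note rk = is_rep_subrep[OF X1 k]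
  have km: "y \<ominus>\<^bsub>fobj X1 a\<^esub> l a u \<in> ?k a"
    if a: "a \<in> Obj D" and "u \<in> carrier (fobj U a)" "y \<in> carrier (fobj X1 a)" "p a u = q a y"
        for a u y
  proof -
    interpret X1: module K "fobj X1 a" by (rule rep_module[OF X1 a])
    interpret X0: module K "fobj X0 a" by (rule rep_module[OF x(1) a])
    show ?thesis
      using that by (simp add: rep_ker_def hom_closed[OF l] hom_minus[OF q(1) X1 x(1)] ql
          hom_closed[OF q(1)]
          X0.minus_eq X0.r_neg)
  qed
  have fl: "f a (l a u) = \<zero>\<^bsub>fobj Y a\<^esub>" if a: "a \<in> Obj D" "u \<in> carrier (fobj U a)"
      "p a u = \<zero>\<^bsub>fobj X0 a\<^esub>" for a u
  proof -
    have "l0 a v \<in> ?k a" if "a \<in> Obj D" "v \<in> J a" for a v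
      using that is_subrep_mem[OF x(3)] by (auto simp: rep_ker_def hom_closed[OF l0(1)] l0(2) x(8))
    then have "rep_hom (subrep U J) (subrep X1 ?k) l0"
      by (rule hom_restrict_to[OF l0(1) x(3)])
    from hom_comp[OF this f] have "rep_hom (subrep U J) Y (\<lambda>a x. f a (l0 a x))" .
    from x(5)[OF this a(1) x(11)[OF a]] show ?thesis by (simp add: l_def)
  qed
  define R where "R = (\<lambda>a y z. y \<in> carrier (fobj X1 a) \<and>
    (\<exists>u\<in>carrier (fobj U a). p a u = q a y \<and> z = f a (y \<ominus>\<^bsub>fobj X1 a\<^esub> l a u)))"
  obtain g where g: "rep_hom X1 Y g" "\<And>a y z. a \<in> Obj D \<Longrightarrow> R a y z \<Longrightarrow> g a y = z"
  proof (rule rep_hom_of_relation[OF X1 Y, of R])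
    show "\<exists>y. R a x y" if "a \<in> Obj D" "x \<in> carrier (fobj X1 a)" for a x
      using x(7) that hom_closed[OF q(1) that] unfolding R_def rep_surj_def by blast
    show "y \<in> carrier (fobj X1 a) \<and> z \<in> carrier (fobj Y a)" if "a \<in> Obj D" "R a y z" for a y z
      using that hom_closed[OF f] km by (auto simp: R_def)
    fix a assume a: "a \<in> Obj D"
    interpret X1: module K "fobj X1 a" by (rule rep_module[OF X1 a])
    interpret X0: module K "fobj X0 a" by (rule rep_module[OF x(1) a])
    interpret U: module K "fobj U a" by (rule rep_module[OF U a])
    interpret Y: module K "fobj Y a" by (rule rep_module[OF Y a])
    show "R a (y \<oplus>\<^bsub>fobj X1 a\<^esub> y') (z \<oplus>\<^bsub>fobj Y a\<^esub> z')" if R: "R a y z" "R a y' z'" for y z y' z'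
    proof -
      obtain u u' where u: "u \<in> carrier (fobj U a)" "p a u = q a y" "z = f a (y \<ominus>\<^bsub>fobj X1 a\<^esub> l a u)"
        "u' \<in> carrier (fobj U a)" "p a u' = q a y'" "z' = f a (y' \<ominus>\<^bsub>fobj X1 a\<^esub> l a u')"
        and y: "y \<in> carrier (fobj X1 a)" "y' \<in> carrier (fobj X1 a)"
        using R by (auto simp: R_def)
      have "z \<oplus>\<^bsub>fobj Y a\<^esub> z' = f a ((y \<ominus>\<^bsub>fobj X1 a\<^esub> l a u) \<oplus>\<^bsub>fobj X1 a\<^esub> (y' \<ominus>\<^bsub>fobj X1 a\<^esub> l a u'))"
        using hom_add[OF f a] u y km[OF a] by simp
      also have "\<dots> = f a ((y \<oplus>\<^bsub>fobj X1 a\<^esub> y') \<ominus>\<^bsub>fobj X1 a\<^esub> l a (u \<oplus>\<^bsub>fobj U a\<^esub> u'))"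
        using u y a by (simp add: hom_add[OF l] X1.add_minus_add hom_closed[OF l])
      finally show ?thesis
        using u y a unfolding R_def
        by (auto intro!: bexI[of _ "u \<oplus>\<^bsub>fobj U a\<^esub> u'"] simp: hom_add[OF x(6)] hom_add[OF q(1)])
    qed
    show "R a (r \<odot>\<^bsub>fobj X1 a\<^esub> y) (r \<odot>\<^bsub>fobj Y a\<^esub> z)" if r: "r \<in> carrier K" and R: "R a y z" for r y z
    proof -
      obtain u where u: "u \<in> carrier (fobj U a)" "p a u = q a y" "z = f a (y \<ominus>\<^bsub>fobj X1 a\<^esub> l a u)"
        and y: "y \<in> carrier (fobj X1 a)"
        using R by (auto simp: R_def)
      have "r \<odot>\<^bsub>fobj Y a\<^esub> z = f a (r \<odot>\<^bsub>fobj X1 a\<^esub> (y \<ominus>\<^bsub>fobj X1 a\<^esub> l a u))"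
        using hom_smult[OF f a r] u y km[OF a] by simp
      also have "\<dots> = f a ((r \<odot>\<^bsub>fobj X1 a\<^esub> y) \<ominus>\<^bsub>fobj X1 a\<^esub> l a (r \<odot>\<^bsub>fobj U a\<^esub> u))"
        using u y a r by (simp add: hom_smult[OF l] X1.smult_minus hom_closed[OF l])
      finally show ?thesis
        using u y a r unfolding R_def
        by (auto intro!: bexI[of _ "r \<odot>\<^bsub>fobj U a\<^esub> u"] simp: hom_smult[OF x(6)] hom_smult[OF q(1)])
    qed
    show "R b (farr X1 a b h y) (farr Y a b h z)"
      if b: "b \<in> Obj D" and h: "h \<in> Hom D a b" and R: "R a y z" for b h y z
    proof -
      obtain u where u: "u \<in> carrier (fobj U a)" "p a u = q a y" "z = f a (y \<ominus>\<^bsub>fobj X1 a\<^esub> l a u)"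
        and y: "y \<in> carrier (fobj X1 a)"
        using R by (auto simp: R_def)
      have "farr Y a b h z = f b (farr X1 a b h (y \<ominus>\<^bsub>fobj X1 a\<^esub> l a u))"
        using hom_nat[OF f a b h] u y km[OF a] by simp
      also have "\<dots> = f b (farr X1 a b h y \<ominus>\<^bsub>fobj X1 b\<^esub> l b (farr U a b h u))"
        using u y a b h by (simp add: hom_nat[OF l] rep_arr_minus[OF X1] hom_closed[OF l])
      finally show ?thesis
        using u y a b h unfolding R_def
        by (auto intro!: bexI[of _ "farr U a b h u"]
            simp: hom_nat[OF x(6)] hom_nat[OF q(1)] rep_arr_closed[OF X1] rep_arr_closed[OF U])
    qed
    show "z = \<zero>\<^bsub>fobj Y a\<^esub>" if R: "R a \<zero>\<^bsub>fobj X1 a\<^esub> z" for z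
    proof -
      obtain u where u: "u \<in> carrier (fobj U a)" "p a u = q a \<zero>\<^bsub>fobj X1 a\<^esub>"
          "z = f a (\<zero>\<^bsub>fobj X1 a\<^esub> \<ominus>\<^bsub>fobj X1 a\<^esub> l a u)"
        using R by (auto simp: R_def)
      have "\<zero>\<^bsub>fobj X1 a\<^esub> \<ominus>\<^bsub>fobj X1 a\<^esub> l a u = l a (\<ominus>\<^bsub>fobj U a\<^esub> u)"
        using u a by (simp add: hom_inv[OF l U X1] hom_closed[OF l] X1.minus_eq)
      moreover have "p a (\<ominus>\<^bsub>fobj U a\<^esub> u) = \<zero>\<^bsub>fobj X0 a\<^esub>"
        using u a by (simp add: hom_inv[OF x(6) U x(1)] hom_zero[OF q(1) X1 x(1)])
      ultimately show ?thesis using fl[OF a] u by simp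
    qed
  qed blast
  show ?thesis
  proof (rule that[OF g(1)])
    fix a y assume a: "a \<in> Obj D" and y: "y \<in> carrier (fobj X1 a)" "q a y = \<zero>\<^bsub>fobj X0 a\<^esub>"
    interpret X1: module K "fobj X1 a" by (rule rep_module[OF X1 a])
    interpret U: module K "fobj U a" by (rule rep_module[OF U a])
    have "R a y (f a y)"
      unfolding R_def
      using a y
      by (auto intro!: bexI[of _ "\<zero>\<^bsub>fobj U a\<^esub>"]
          simp: hom_zero[OF x(6) U x(1)] hom_zero[OF l U X1] X1.minus_zero_right)
    then show "g a y = f a y" by (rule g(2)[OF a])
  qed
qed

text \<open>Dimension shifting without Ext: the modules of cycles are good by induction through
  \<open>good_ker\<close>; a map that vanishes on boundaries factors through the cycles one degree
  lower, and \<open>good_extend\<close> continues it to the whole term. Thus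
  \<open>Hom(-, Y)\<close> keeps the complex exact.\<close>

lemma good_exact_complex:
  fixes X :: "nat \<Rightarrow> ('o, 'm, 'k, 'v) rep" and Y :: "('o, 'm, 'k, 'v) rep"
  assumes X: "\<And>n. good Y (X n)" and Y: "is_rep Y" and d: "\<And>n. rep_hom (X (Suc n)) (X n) (d n)"
    and surj: "rep_surj (X 1) (X 0) (d 0)"
    and exact: "\<And>n a x. a \<in> Obj D \<Longrightarrow> x \<in> carrier (fobj (X (Suc n)) a) \<Longrightarrow>
      d n a x = \<zero>\<^bsub>fobj (X n) a\<^esub> \<longleftrightarrow> x \<in> rep_im (X (Suc (Suc n))) (d (Suc n)) a"
    and f: "rep_hom (X n) Y f"
    and fd: "\<And>a x. a \<in> Obj D \<Longrightarrow> x \<in> carrier (fobj (X (Suc n)) a) \<Longrightarrow> f a (d n a x) = \<zero>\<^bsub>fobj Y a\<^esub>"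
  shows "case n of
      0 \<Rightarrow> \<forall>a\<in>Obj D. \<forall>x\<in>carrier (fobj (X 0) a). f a x = \<zero>\<^bsub>fobj Y a\<^esub>
    | Suc m \<Rightarrow> \<exists>g. rep_hom (X m) Y g \<and> (\<forall>a\<in>Obj D. \<forall>x\<in>carrier (fobj (X n) a). f a x = g a (d m a x))"
proof (cases n)
  case 0
  then show ?thesis
    using surj fd unfolding rep_surj_def by (auto, metis)
next
  case (Suc m)
  \<comment> \<open>\<open>Z n\<close> is the image of \<open>d n\<close>. In degree 0 this is all
    of \<open>X 0\<close>, where the complex ends with a surjection; in higher degrees it is the
    kernel of the differential that leaves \<open>X n\<close>.\<close>
  define Z where "Z = (\<lambda>n. case n of 0 \<Rightarrow> X 0 | Suc m \<Rightarrow> subrep (X n) (rep_ker (X n) (X m) (d m)))"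
  have rX: "is_rep (X n)" for n by (rule good_rep[OF X])
  have car: "x \<in> carrier (fobj (Z n) a) \<Longrightarrow> x \<in> carrier (fobj (X n) a)" for n a x
    by (cases n) (auto simp: Z_def rep_ker_def)
  have zero: "\<zero>\<^bsub>fobj (Z n) a\<^esub> = \<zero>\<^bsub>fobj (X n) a\<^esub>" for n a
    by (cases n) (auto simp: Z_def)
  have dZ: "rep_hom (X (Suc n)) (Z n) (d n)" for n
  proof (cases n)
    case (Suc m)
    show ?thesis unfolding Z_def Suc nat.case
      by (intro hom_to_subrep d)
        (auto simp: rep_ker_def hom_closed[OF d] exact rep_im_def)
  qed (use d[of 0] in \<open>simp add: Z_def\<close>)
  have dZs: "rep_surj (X (Suc n)) (Z n) (d n)" for n
  proof (cases n)
    case (Suc m)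
    show ?thesis unfolding Z_def Suc nat.case rep_surj_def
      using exact[of _ _ m] by (auto simp: rep_ker_def rep_im_def)
  qed (use surj in \<open>simp add: Z_def\<close>)
  have ker: "rep_ker (X (Suc n)) (Z n) (d n) = rep_ker (X (Suc n)) (X n) (d n)" for n
    by (simp add: rep_ker_def fun_eq_iff zero)
  have goodZ: "good Y (Z n)" for n
  proof (induction n)
    case (Suc n)
    show ?case
      using good_ker[OF Suc X dZ dZs] unfolding ker by (simp add: Z_def)
  qed (simp add: Z_def X)
  have kerf: "f a x = \<zero>\<^bsub>fobj Y a\<^esub>"
    if "a \<in> Obj D" "x \<in> carrier (fobj (X n) a)" "d m a x = \<zero>\<^bsub>fobj (Z m) a\<^esub>" for a x
    using that exact[of a x m] fd Suc by (auto simp: zero rep_im_def)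
  obtain g0 where g0: "rep_hom (Z m) Y g0"
    "\<And>a x. a \<in> Obj D \<Longrightarrow> x \<in> carrier (fobj (X n) a) \<Longrightarrow> g0 a (d m a x) = f a x"
    using hom_factor_surj[OF rX good_rep[OF goodZ] Y _ _ f, of m "d m"] dZ dZs kerf Suc by metis
  have "\<exists>g. rep_hom (X m) Y g \<and> (\<forall>a\<in>Obj D. \<forall>x\<in>carrier (fobj (Z m) a). g a x = g0 a x)"
  proof (cases m)
    case 0
    then show ?thesis using g0 by (auto simp: Z_def)
  next
    case (Suc k)
    have "rep_hom (subrep (X m) (rep_ker (X m) (Z k) (d k))) Y g0"
      using g0(1) unfolding Suc ker by (simp add: Z_def)
    from good_extend[OF goodZ rX Y _ _ this] obtain g where
      "rep_hom (X m) Y g" "\<And>a x. a \<in> Obj D \<Longrightarrow> x \<in> carrier (fobj (X m) a) \<Longrightarrow>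
         d k a x = \<zero>\<^bsub>fobj (Z k) a\<^esub> \<Longrightarrow> g a x = g0 a x"
      using dZ[of k] dZs[of k] unfolding Suc by metis
    note this[unfolded zero]
    then show ?thesis
      by (intro exI[of _ g]) (auto simp: Z_def Suc rep_ker_def)
  qed
  then obtain g where g: "rep_hom (X m) Y g" "\<And>a x. a \<in> Obj D \<Longrightarrow> x \<in> carrier (fobj (Z m) a) \<Longrightarrow>
      g a x = g0 a x"
    by blast
  have "f a x = g a (d m a x)" if "a \<in> Obj D" "x \<in> carrier (fobj (X n) a)" for a x
    using that g0(2)[OF that] g(2)[OF that(1) hom_closed[OF dZ[of m] that(1)]] Suc by simp
  then show ?thesis using g(1) Suc by auto
qed

end

section \<open>Quotients, transport and biproducts\<close>

text \<open>Structure transported along \<open>e\<close>, with \<open>inv_into\<close> as a choice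
  of preimages. The map \<open>e\<close> may fail to be injective: if its fibres are the cosets of a
  submodule, the result is the quotient. Quotients and copies in another type are thus one
  construction.\<close>

definition push_module :: "('k, 'w) module \<Rightarrow> ('w \<Rightarrow> 'v) \<Rightarrow> ('k, 'v) module" where
  "push_module V e = mk_module (e ` carrier V) (e \<zero>\<^bsub>V\<^esub>)
     (\<lambda>x y. e (inv_into (carrier V) e x \<oplus>\<^bsub>V\<^esub> inv_into (carrier V) e y))
     (\<lambda>r x. e (r \<odot>\<^bsub>V\<^esub> inv_into (carrier V) e x))"

text \<open>Preimages of the same element differ by a member of \<open>S\<close>, so the operations
  computed from chosen preimages agree, after \<open>e\<close>, with those computed from any
  others.\<close>

lemma push_module:
  assumes "module K V" "submodule S K V"
    and e: "\<And>x y. x \<in> carrier V \<Longrightarrow> y \<in> carrier V \<Longrightarrow> e x = e y \<longleftrightarrow> x \<ominus>\<^bsub>V\<^esub> y \<in> S"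
  shows "module K (push_module V e)" "linear_map K V (push_module V e) e"
proof -
  interpret V: module K V by fact
  let ?s = "inv_into (carrier V) e"
  have s: "?s (e x) \<in> carrier V" "e (?s (e x)) = e x" if "x \<in> carrier V" for x
    using that by (auto intro: inv_into_into f_inv_into_f)
  have zero: "\<zero>\<^bsub>push_module V e\<^esub> = e \<zero>\<^bsub>V\<^esub>"
    and car: "carrier (push_module V e) = e ` carrier V"
    by (auto simp: push_module_def mk_module_def)
  have add: "e x \<oplus>\<^bsub>push_module V e\<^esub> e y = e (x \<oplus>\<^bsub>V\<^esub> y)" if x: "x \<in> carrier V"
      and y: "y \<in> carrier V" for x y
  proof -
    have "?s (e x) \<ominus>\<^bsub>V\<^esub> x \<in> S" "?s (e y) \<ominus>\<^bsub>V\<^esub> y \<in> S"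
      using e s[OF x] s[OF y] x y by blast+
    then have "(?s (e x) \<oplus>\<^bsub>V\<^esub> ?s (e y)) \<ominus>\<^bsub>V\<^esub> (x \<oplus>\<^bsub>V\<^esub> y) \<in> S"
      using submodule_add[OF assms(2)] s x y by (simp add: V.add_minus_add)
    then show ?thesis
      using e s x y by (simp add: push_module_def mk_module_def)
  qed
  have smult: "r \<odot>\<^bsub>push_module V e\<^esub> e x = e (r \<odot>\<^bsub>V\<^esub> x)" if x: "x \<in> carrier V"
      and r: "r \<in> carrier K" for r x
  proof -
    have "?s (e x) \<ominus>\<^bsub>V\<^esub> x \<in> S"
      using e s[OF x] x by blast
    then have "r \<odot>\<^bsub>V\<^esub> ?s (e x) \<ominus>\<^bsub>V\<^esub> r \<odot>\<^bsub>V\<^esub> x \<in> S"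
      using submodule_smult[OF assms(2) r, of "?s (e x) \<ominus>\<^bsub>V\<^esub> x"] s x r by (simp add: V.smult_minus)
    then show ?thesis
      using e s x r by (simp add: push_module_def mk_module_def)
  qed
  show "module K (push_module V e)"
  proof (rule moduleI)
    show "cring K" by (rule V.R.is_cring)
    show "abelian_group (push_module V e)"
    proof (rule abelian_groupI)
      fix x assume "x \<in> carrier (push_module V e)"
      then obtain x' where x': "x' \<in> carrier V" "x = e x'" by (auto simp: car)
      then have "e (\<ominus>\<^bsub>V\<^esub> x') \<oplus>\<^bsub>push_module V e\<^esub> x = \<zero>\<^bsub>push_module V e\<^esub>"
        by (simp add: add zero V.l_neg)
      then show "\<exists>y\<in>carrier (push_module V e). y \<oplus>\<^bsub>push_module V e\<^esub> x = \<zero>\<^bsub>push_module V e\<^esub>"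
        using x' car by blast
    qed (auto simp: car zero add V.a_ac)
  qed (auto simp: car add smult V.smult_l_distr V.smult_r_distr V.smult_assoc1)
  show "linear_map K V (push_module V e) e"
    by (auto simp: linear_map_def car add smult)
qed

lemma push_module_simps:
  "carrier (push_module V e) = e ` carrier V" "\<zero>\<^bsub>push_module V e\<^esub> = e \<zero>\<^bsub>V\<^esub>"
  by (auto simp: push_module_def mk_module_def)

definition sum_module :: "('k, 'v) module \<Rightarrow> ('k, 'w) module \<Rightarrow> ('k, 'v \<times> 'w) module" where
  "sum_module V W = mk_module (carrier V \<times> carrier W) (\<zero>\<^bsub>V\<^esub>, \<zero>\<^bsub>W\<^esub>)
     (\<lambda>x y. (fst x \<oplus>\<^bsub>V\<^esub> fst y, snd x \<oplus>\<^bsub>W\<^esub> snd y)) (\<lambda>r x. (r \<odot>\<^bsub>V\<^esub> fst x, r \<odot>\<^bsub>W\<^esub> snd x))"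

lemma sum_module_simps [simp]:
  "carrier (sum_module V W) = carrier V \<times> carrier W"
  "\<zero>\<^bsub>sum_module V W\<^esub> = (\<zero>\<^bsub>V\<^esub>, \<zero>\<^bsub>W\<^esub>)"
  "x \<oplus>\<^bsub>sum_module V W\<^esub> y = (fst x \<oplus>\<^bsub>V\<^esub> fst y, snd x \<oplus>\<^bsub>W\<^esub> snd y)"
  "r \<odot>\<^bsub>sum_module V W\<^esub> x = (r \<odot>\<^bsub>V\<^esub> fst x, r \<odot>\<^bsub>W\<^esub> snd x)"
  by (auto simp: sum_module_def mk_module_def)

lemma module_sum_module:
  assumes "module K V" "module K W"
  shows "module K (sum_module V W)"
proof -
  interpret V: module K V by fact
  interpret W: module K W by fact
  show ?thesis
  proof (rule moduleI)
    show "cring K" by (rule V.R.is_cring)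
    show "abelian_group (sum_module V W)"
    proof (rule abelian_groupI)
      fix x assume "x \<in> carrier (sum_module V W)"
      then show "\<exists>y\<in>carrier (sum_module V W). y \<oplus>\<^bsub>sum_module V W\<^esub> x = \<zero>\<^bsub>sum_module V W\<^esub>"
        by (intro bexI[of _ "(\<ominus>\<^bsub>V\<^esub> fst x, \<ominus>\<^bsub>W\<^esub> snd x)"]) (auto simp: V.l_neg W.l_neg)
    qed (auto simp: V.a_ac W.a_ac)
  qed (auto simp: V.smult_l_distr V.smult_r_distr V.smult_assoc1
      W.smult_l_distr W.smult_r_distr W.smult_assoc1)
qed

lemma infinite_Times_lepoll:
  assumes "infinite A" shows "A \<times> A \<lesssim> A"
  using card_of_Times_same_infinite[OF assms] eqpoll_iff_card_of_ordIso eqpoll_imp_lepoll by blast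

context linear_cat
begin

text \<open>Arrows are applied to a preimage; since they preserve \<open>S\<close>, the image of the
  result does not depend on it. The two instances are a choice of coset representatives and an
  injection into \<open>'v\<close>, where \<open>S\<close> is zero.\<close>

lemma push_rep:
  fixes M :: "('o, 'm, 'k, 'w) rep" and e :: "'o \<Rightarrow> 'w \<Rightarrow> 'v"
  assumes M: "is_rep M" and S: "is_subrep M S"
    and e: "\<And>a x y. a \<in> Obj D \<Longrightarrow> x \<in> carrier (fobj M a) \<Longrightarrow> y \<in> carrier (fobj M a) \<Longrightarrow>
      e a x = e a y \<longleftrightarrow> x \<ominus>\<^bsub>fobj M a\<^esub> y \<in> S a"
  obtains N :: "('o, 'm, 'k, 'v) rep" where "is_rep N" "rep_hom M N e" "rep_surj M N e"
    "\<And>a x. a \<in> Obj D \<Longrightarrow> x \<in> carrier (fobj M a) \<Longrightarrow> e a x = \<zero>\<^bsub>fobj N a\<^esub> \<longleftrightarrow> x \<in> S a"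
proof -
  define N :: "('o, 'm, 'k, 'v) rep" where
    "N = \<lparr>fobj = (\<lambda>a. push_module (fobj M a) (e a)),
      farr = (\<lambda>a b f y. e b (farr M a b f (inv_into (carrier (fobj M a)) (e a) y)))\<rparr>"
  have lin: "module K (fobj N a)" "linear_map K (fobj M a) (fobj N a) (e a)" if a: "a \<in> Obj D" for a
    unfolding N_def using push_module[OF rep_module[OF M a] is_subrepD[OF S a] e[OF a]]
    by simp_all
  have car: "carrier (fobj N a) = e a ` carrier (fobj M a)"
    and zero: "\<zero>\<^bsub>fobj N a\<^esub> = e a \<zero>\<^bsub>fobj M a\<^esub>" for a
    by (simp_all add: N_def push_module_simps)
  have arr: "farr N a b f (e a x) = e b (farr M a b f x)"
    if a: "a \<in> Obj D" and b: "b \<in> Obj D" and f: "f \<in> Hom D a b" and x: "x \<in> carrier (fobj M a)"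
        for a b f x
  proof -
    let ?y = "inv_into (carrier (fobj M a)) (e a) (e a x)"
    have y: "?y \<in> carrier (fobj M a)" "e a ?y = e a x"
      using x by (auto intro: inv_into_into f_inv_into_f)
    then have "?y \<ominus>\<^bsub>fobj M a\<^esub> x \<in> S a" using e a x by blast
    then have "farr M a b f (?y \<ominus>\<^bsub>fobj M a\<^esub> x) \<in> S b"
      using S a b f by (simp add: is_subrep_def)
    then have "e b (farr M a b f ?y) = e b (farr M a b f x)"
      using a b f x y e[OF b rep_arr_closed[OF M a b f y(1)] rep_arr_closed[OF M a b f x]]
      by (simp add: rep_arr_minus[OF M])
    then show ?thesis by (simp add: N_def)
  qed
  have eadd: "e a x \<oplus>\<^bsub>fobj N a\<^esub> e a y = e a (x \<oplus>\<^bsub>fobj M a\<^esub> y)"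
    if "a \<in> Obj D" "x \<in> carrier (fobj M a)" "y \<in> carrier (fobj M a)" for a x y
    using linear_map_add[OF lin(2)] that by metis
  have esm: "r \<odot>\<^bsub>fobj N a\<^esub> e a x = e a (r \<odot>\<^bsub>fobj M a\<^esub> x)"
    if "a \<in> Obj D" "x \<in> carrier (fobj M a)" "r \<in> carrier K" for a x r
    using linear_map_smult[OF lin(2)] that by metis
  have mc: "x \<oplus>\<^bsub>fobj M a\<^esub> y \<in> carrier (fobj M a)"
      "r \<in> carrier K \<Longrightarrow> r \<odot>\<^bsub>fobj M a\<^esub> x \<in> carrier (fobj M a)"
    if "a \<in> Obj D" "x \<in> carrier (fobj M a)" "y \<in> carrier (fobj M a)" for a x y r
  proof -
    interpret M: module K "fobj M a" by (rule rep_module[OF M that(1)])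
    show "x \<oplus>\<^bsub>fobj M a\<^esub> y \<in> carrier (fobj M a)"
        "r \<in> carrier K \<Longrightarrow> r \<odot>\<^bsub>fobj M a\<^esub> x \<in> carrier (fobj M a)"
      using that by auto
  qed
  have "is_rep N"
    unfolding is_rep_def
  proof (intro conjI ballI)
    fix a b f assume ab: "a \<in> Obj D" "b \<in> Obj D" "f \<in> Hom D a b"
    show "linear_map K (fobj N a) (fobj N b) (farr N a b f)"
      unfolding linear_map_def car
      using ab by (auto simp: arr eadd esm mc rep_arr_closed[OF M] rep_arr_add[OF M]
          rep_arr_smult[OF M])
  next
    fix a x assume "a \<in> Obj D" "x \<in> carrier (fobj N a)"
    then show "farr N a a (Idn D a) x = x"      by (auto simp: car arr rep_arr_id[OF M] Idn_closed)
  next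
    fix a b c f g x assume "a \<in> Obj D" "b \<in> Obj D" "c \<in> Obj D" "f \<in> Hom D a b" "g \<in> Hom D b c"
        "x \<in> carrier (fobj N a)"
    then show "farr N a c (Cmp D a b c g f) x = farr N b c g (farr N a b f x)"
      by (auto simp: car arr rep_arr_closed[OF M] rep_arr_comp[OF M] Cmp_closed)
  next
    fix a b f g x assume "a \<in> Obj D" "b \<in> Obj D" "f \<in> Hom D a b" "g \<in> Hom D a b"
        "x \<in> carrier (fobj N a)"
    then show "farr N a b (f \<oplus>\<^bsub>HomK D a b\<^esub> g) x = farr N a b f x \<oplus>\<^bsub>fobj N b\<^esub> farr N a b g x"
      by (auto simp: car arr eadd esm rep_arr_closed[OF M] rep_arr_comp[OF M] rep_arr_plus[OF M]
          rep_arr_scale[OF M]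
          Hom_add_closed Hom_smult_closed)
  next
    fix a b r f x assume "a \<in> Obj D" "b \<in> Obj D" "r \<in> carrier K" "f \<in> Hom D a b"
        "x \<in> carrier (fobj N a)"
    then show "farr N a b (r \<odot>\<^bsub>HomK D a b\<^esub> f) x = r \<odot>\<^bsub>fobj N b\<^esub> farr N a b f x"
      by (auto simp: car arr eadd esm rep_arr_closed[OF M] rep_arr_comp[OF M] rep_arr_plus[OF M]
          rep_arr_scale[OF M]
          Hom_add_closed Hom_smult_closed)
  qed (use lin in auto)
  moreover have "rep_hom M N e"
    using lin arr by (simp add: rep_hom_def)
  moreover have "rep_surj M N e"
    by (auto simp: rep_surj_def car)
  moreover have "e a x = \<zero>\<^bsub>fobj N a\<^esub> \<longleftrightarrow> x \<in> S a" if a: "a \<in> Obj D" and x: "x \<in> carrier (fobj M a)"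
      for a x
  proof -
    interpret M: module K "fobj M a" by (rule rep_module[OF M a])
    show ?thesis
      using e[OF a x M.zero_closed] x
      by (simp add: zero M.minus_zero_right)
  qed
  ultimately show ?thesis using that by blast
qed

text \<open>Cosets would be sets of elements of \<open>'v\<close>; one chosen representative per
  coset keeps the quotient inside \<open>'v\<close>.\<close>

lemma quotient_rep:
  fixes M :: "('o, 'm, 'k, 'v) rep"
  assumes M: "is_rep M" and S: "is_subrep M S"
  obtains N :: "('o, 'm, 'k, 'v) rep" and e where "is_rep N" "rep_hom M N e" "rep_surj M N e"
    "\<And>a x. a \<in> Obj D \<Longrightarrow> x \<in> carrier (fobj M a) \<Longrightarrow> e a x = \<zero>\<^bsub>fobj N a\<^esub> \<longleftrightarrow> x \<in> S a"
proof -
  define e where "e = (\<lambda>a x. SOME y. y \<in> carrier (fobj M a) \<and> x \<ominus>\<^bsub>fobj M a\<^esub> y \<in> S a)"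
  have "e a x = e a y \<longleftrightarrow> x \<ominus>\<^bsub>fobj M a\<^esub> y \<in> S a"
    if a: "a \<in> Obj D" and x: "x \<in> carrier (fobj M a)" and y: "y \<in> carrier (fobj M a)" for a x y
  proof -
    interpret M: module K "fobj M a" by (rule rep_module[OF M a])
    note sm = is_subrepD[OF S a]
    have self: "z \<ominus>\<^bsub>fobj M a\<^esub> z \<in> S a" if "z \<in> carrier (fobj M a)" for z
      using that submodule_zero[OF sm] by (simp add: M.minus_eq M.r_neg)
    have e: "e a z \<in> carrier (fobj M a) \<and> z \<ominus>\<^bsub>fobj M a\<^esub> e a z \<in> S a"
        if z: "z \<in> carrier (fobj M a)" for z
      unfolding e_def by (rule someI[of _ z]) (simp add: z self)
    have trans: "w \<ominus>\<^bsub>fobj M a\<^esub> v \<in> S a"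
      if "w \<in> carrier (fobj M a)" "z \<in> carrier (fobj M a)" "v \<in> carrier (fobj M a)"
        "w \<ominus>\<^bsub>fobj M a\<^esub> z \<in> S a" "z \<ominus>\<^bsub>fobj M a\<^esub> v \<in> S a" for w z v
    proof -
      have "w \<ominus>\<^bsub>fobj M a\<^esub> v = (w \<ominus>\<^bsub>fobj M a\<^esub> z) \<oplus>\<^bsub>fobj M a\<^esub> (z \<ominus>\<^bsub>fobj M a\<^esub> v)"
        using that by (simp add: M.minus_eq M.a_assoc M.r_neg1)
      then show ?thesis using submodule_add[OF sm that(4,5)] by simp
    qed
    have sym: "v \<ominus>\<^bsub>fobj M a\<^esub> w \<in> S a"
      if "w \<in> carrier (fobj M a)" "v \<in> carrier (fobj M a)" "w \<ominus>\<^bsub>fobj M a\<^esub> v \<in> S a" for w v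
    proof -
      have "v \<ominus>\<^bsub>fobj M a\<^esub> w = \<ominus>\<^bsub>fobj M a\<^esub> (w \<ominus>\<^bsub>fobj M a\<^esub> v)"
        using that by (simp add: M.minus_eq M.minus_add M.a_comm)
      then show ?thesis using submodule_inv[OF M.module_axioms sm that(3)] by simp
    qed
    show ?thesis
    proof
      assume eq: "e a x = e a y"
      show "x \<ominus>\<^bsub>fobj M a\<^esub> y \<in> S a"
        by (rule trans[OF x _ y, of "e a x"]) (use e[OF x] e[OF y] sym[OF y] eq in auto)
    next
      assume d: "x \<ominus>\<^bsub>fobj M a\<^esub> y \<in> S a"
      \<comment> \<open>Congruent elements have the same candidates for a representative, so
        \<open>SOME\<close> returns the same one for both.\<close>
      have "(z \<in> carrier (fobj M a) \<and> x \<ominus>\<^bsub>fobj M a\<^esub> z \<in> S a) =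
        (z \<in> carrier (fobj M a) \<and> y \<ominus>\<^bsub>fobj M a\<^esub> z \<in> S a)" for z
        using trans[OF x y _ d, of z] trans[OF y x _ sym[OF x y d], of z] by blast
      then show "e a x = e a y" by (simp add: e_def)
    qed
  qed
  from push_rep[OF M S, of e, OF this] obtain N :: "('o, 'm, 'k, 'v) rep" where
    "is_rep N" "rep_hom M N e" "rep_surj M N e"
    "\<And>a x. a \<in> Obj D \<Longrightarrow> x \<in> carrier (fobj M a) \<Longrightarrow> e a x = \<zero>\<^bsub>fobj N a\<^esub> \<longleftrightarrow> x \<in> S a"
    by blast
  then show ?thesis by (rule that)
qed

lemma is_subrep_zero:
  assumes M: "is_rep M"
  shows "is_subrep M (\<lambda>a. {\<zero>\<^bsub>fobj M a\<^esub>})"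
proof -
  have "submodule {\<zero>\<^bsub>fobj M a\<^esub>} K (fobj M a)" if "a \<in> Obj D" for a
  proof -
    interpret M: module K "fobj M a" by (rule rep_module[OF M that])
    show ?thesis by (rule submodule_smultI[OF M.module_axioms]) auto
  qed
  then show ?thesis
    by (simp add: is_subrep_def rep_arr_zero[OF M])
qed

lemma hom_inverse:
  assumes M: "is_rep M" and N: "is_rep N" and e: "rep_hom M N e" "rep_surj M N e"
    and ker: "\<And>a x. a \<in> Obj D \<Longrightarrow> x \<in> carrier (fobj M a) \<Longrightarrow> e a x = \<zero>\<^bsub>fobj N a\<^esub> \<Longrightarrow> x = \<zero>\<^bsub>fobj M a\<^esub>"
  obtains e' where "rep_hom N M e'"
    "\<And>a x. a \<in> Obj D \<Longrightarrow> x \<in> carrier (fobj M a) \<Longrightarrow> e' a (e a x) = x"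
    "\<And>a y. a \<in> Obj D \<Longrightarrow> y \<in> carrier (fobj N a) \<Longrightarrow> e a (e' a y) = y"
proof -
  obtain e' where e': "rep_hom N M e'" "\<And>a x. a \<in> Obj D \<Longrightarrow> x \<in> carrier (fobj M a) \<Longrightarrow> e' a (e a x) = x"
    using hom_factor_surj[OF M N M e hom_id] ker by metis
  show ?thesis
    by (rule that[OF e']) (use e(2) e'(2) in \<open>auto simp: rep_surj_def, metis\<close>)
qed

text \<open>The instance of \<open>push_rep\<close> for an injection and the zero submodule. It is
  the passage from free modules and pairs, which live in function and product types, to modules
  carried by \<open>'v\<close>.\<close>

lemma transport_rep:
  fixes M :: "('o, 'm, 'k, 'w) rep"
  assumes M: "is_rep M" and small: "\<And>a. a \<in> Obj D \<Longrightarrow> carrier (fobj M a) \<lesssim> (UNIV :: 'v set)"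
  obtains N :: "('o, 'm, 'k, 'v) rep" and e e' where "is_rep N" "rep_hom M N e" "rep_hom N M e'"
    "\<And>a x. a \<in> Obj D \<Longrightarrow> x \<in> carrier (fobj M a) \<Longrightarrow> e' a (e a x) = x"
    "\<And>a y. a \<in> Obj D \<Longrightarrow> y \<in> carrier (fobj N a) \<Longrightarrow> e a (e' a y) = y"
proof -
  define e :: "'o \<Rightarrow> 'w \<Rightarrow> 'v" where "e = (\<lambda>a. SOME g. inj_on g (carrier (fobj M a)))"
  have inj: "inj_on (e a) (carrier (fobj M a))" if "a \<in> Obj D" for a
    unfolding e_def using small[OF that]
        by (intro someI_ex[where P = "\<lambda>g. inj_on g _"]) (auto simp: lepoll_def)
  have e: "e a x = e a y \<longleftrightarrow> x \<ominus>\<^bsub>fobj M a\<^esub> y \<in> {\<zero>\<^bsub>fobj M a\<^esub>}"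
    if a: "a \<in> Obj D" and x: "x \<in> carrier (fobj M a)" and y: "y \<in> carrier (fobj M a)" for a x y
  proof -
    interpret M: module K "fobj M a" by (rule rep_module[OF M a])
    show ?thesis
      using inj_on_eq_iff[OF inj[OF a] x y] M.minus_zeroD[OF x y] x y
          by (auto simp: M.minus_eq M.r_neg)
  qed
  obtain N :: "('o, 'm, 'k, 'v) rep" where N: "is_rep N" "rep_hom M N e" "rep_surj M N e"
    "\<And>a x. a \<in> Obj D \<Longrightarrow> x \<in> carrier (fobj M a) \<Longrightarrow> e a x = \<zero>\<^bsub>fobj N a\<^esub> \<longleftrightarrow> x \<in> {\<zero>\<^bsub>fobj M a\<^esub>}"
    using push_rep[OF M is_subrep_zero[OF M], of e] e by metis
  obtain e' where "rep_hom N M e'"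
    "\<And>a x. a \<in> Obj D \<Longrightarrow> x \<in> carrier (fobj M a) \<Longrightarrow> e' a (e a x) = x"
    "\<And>a y. a \<in> Obj D \<Longrightarrow> y \<in> carrier (fobj N a) \<Longrightarrow> e a (e' a y) = y"
    using hom_inverse[OF M N(1-3)] N(4) by (metis singletonD)
  then show ?thesis using that[OF N(1,2)] by blast
qed

text \<open>Described by equations and not as pairs, because pairs of elements of \<open>'v\<close>
  belong to another type.\<close>

definition biprod ::
  "('o, 'm, 'k, 'v) rep \<Rightarrow> ('o, 'm, 'k, 'v) rep \<Rightarrow> ('o, 'm, 'k, 'v) rep \<Rightarrow> ('o \<Rightarrow> 'v \<Rightarrow> 'v) \<Rightarrow>
   ('o \<Rightarrow> 'v \<Rightarrow> 'v) \<Rightarrow> ('o \<Rightarrow> 'v \<Rightarrow> 'v) \<Rightarrow> ('o \<Rightarrow> 'v \<Rightarrow> 'v) \<Rightarrow> bool" where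
  "biprod M N S i j p q \<longleftrightarrow> is_rep S \<and>
     rep_hom M S i \<and> rep_hom N S j \<and> rep_hom S M p \<and> rep_hom S N q \<and>
     (\<forall>a\<in>Obj D. \<forall>x\<in>carrier (fobj M a). p a (i a x) = x \<and> q a (i a x) = \<zero>\<^bsub>fobj N a\<^esub>) \<and>
     (\<forall>a\<in>Obj D. \<forall>y\<in>carrier (fobj N a). q a (j a y) = y \<and> p a (j a y) = \<zero>\<^bsub>fobj M a\<^esub>) \<and>
     (\<forall>a\<in>Obj D. \<forall>z\<in>carrier (fobj S a). i a (p a z) \<oplus>\<^bsub>fobj S a\<^esub> j a (q a z) = z)"

lemma biprodD:
  assumes "biprod M N S i j p q"
  shows "is_rep S" "rep_hom M S i" "rep_hom N S j" "rep_hom S M p" "rep_hom S N q"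
    "\<And>a x. a \<in> Obj D \<Longrightarrow> x \<in> carrier (fobj M a) \<Longrightarrow> p a (i a x) = x"
    "\<And>a x. a \<in> Obj D \<Longrightarrow> x \<in> carrier (fobj M a) \<Longrightarrow> q a (i a x) = \<zero>\<^bsub>fobj N a\<^esub>"
    "\<And>a y. a \<in> Obj D \<Longrightarrow> y \<in> carrier (fobj N a) \<Longrightarrow> q a (j a y) = y"
    "\<And>a y. a \<in> Obj D \<Longrightarrow> y \<in> carrier (fobj N a) \<Longrightarrow> p a (j a y) = \<zero>\<^bsub>fobj M a\<^esub>"
    "\<And>a z. a \<in> Obj D \<Longrightarrow> z \<in> carrier (fobj S a) \<Longrightarrow> i a (p a z) \<oplus>\<^bsub>fobj S a\<^esub> j a (q a z) = z"
  using assms unfolding biprod_def by blast+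

text \<open>Pairs form the sum on \<open>'v \<times> 'v\<close>, and an infinite type
  \<open>'v\<close> has room for a copy of it.\<close>

lemma biprod_exists:
  fixes M N :: "('o, 'm, 'k, 'v) rep"
  assumes inf: "infinite (UNIV :: 'v set)" and M: "is_rep M" and N: "is_rep N"
  shows "\<exists>S i j p q. biprod M N S i j p q"
proof -
  define P :: "('o, 'm, 'k, 'v \<times> 'v) rep" where
    "P = \<lparr>fobj = (\<lambda>a. sum_module (fobj M a) (fobj N a)),
      farr = (\<lambda>a b f x. (farr M a b f (fst x), farr N a b f (snd x)))\<rparr>"
  have P: "is_rep P"
    unfolding is_rep_def linear_map_def
    by (auto simp: P_def module_sum_module rep_module M N rep_arr_closed[OF M] rep_arr_closed[OF N]
        rep_arr_add[OF M] rep_arr_add[OF N] rep_arr_smult[OF M] rep_arr_smult[OF N]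
        rep_arr_id[OF M] rep_arr_id[OF N] rep_arr_comp[OF M] rep_arr_comp[OF N]
        rep_arr_plus[OF M] rep_arr_plus[OF N] rep_arr_scale[OF M] rep_arr_scale[OF N])
  have "carrier (fobj P a) \<lesssim> (UNIV :: 'v set)" for a
    using lepoll_trans[OF subset_imp_lepoll[of _ "UNIV \<times> UNIV"] infinite_Times_lepoll[OF inf]]
        by simp
  then obtain S :: "('o, 'm, 'k, 'v) rep" and e e' where S: "is_rep S" "rep_hom P S e"
      "rep_hom S P e'"
    "\<And>a x. a \<in> Obj D \<Longrightarrow> x \<in> carrier (fobj P a) \<Longrightarrow> e' a (e a x) = x"
    "\<And>a y. a \<in> Obj D \<Longrightarrow> y \<in> carrier (fobj S a) \<Longrightarrow> e a (e' a y) = y"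
    using transport_rep[OF P] by metis
  have mz: "\<zero>\<^bsub>fobj M a\<^esub> \<in> carrier (fobj M a)" "\<zero>\<^bsub>fobj N a\<^esub> \<in> carrier (fobj N a)"
    "x \<in> carrier (fobj M a) \<Longrightarrow> x \<oplus>\<^bsub>fobj M a\<^esub> \<zero>\<^bsub>fobj M a\<^esub> = x"
    "y \<in> carrier (fobj N a) \<Longrightarrow> \<zero>\<^bsub>fobj N a\<^esub> \<oplus>\<^bsub>fobj N a\<^esub> y = y"
    "\<zero>\<^bsub>fobj M a\<^esub> \<oplus>\<^bsub>fobj M a\<^esub> \<zero>\<^bsub>fobj M a\<^esub> = \<zero>\<^bsub>fobj M a\<^esub>"
    "\<zero>\<^bsub>fobj N a\<^esub> \<oplus>\<^bsub>fobj N a\<^esub> \<zero>\<^bsub>fobj N a\<^esub> = \<zero>\<^bsub>fobj N a\<^esub>"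
    "r \<in> carrier K \<Longrightarrow> r \<odot>\<^bsub>fobj M a\<^esub> \<zero>\<^bsub>fobj M a\<^esub> = \<zero>\<^bsub>fobj M a\<^esub>"
    "r \<in> carrier K \<Longrightarrow> r \<odot>\<^bsub>fobj N a\<^esub> \<zero>\<^bsub>fobj N a\<^esub> = \<zero>\<^bsub>fobj N a\<^esub>"
    if "a \<in> Obj D" for a x y r
  proof -
    interpret M: module K "fobj M a" by (rule rep_module[OF M that])
    interpret N: module K "fobj N a" by (rule rep_module[OF N that])
    show "\<zero>\<^bsub>fobj M a\<^esub> \<in> carrier (fobj M a)" "\<zero>\<^bsub>fobj N a\<^esub> \<in> carrier (fobj N a)"
    "x \<in> carrier (fobj M a) \<Longrightarrow> x \<oplus>\<^bsub>fobj M a\<^esub> \<zero>\<^bsub>fobj M a\<^esub> = x"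
    "y \<in> carrier (fobj N a) \<Longrightarrow> \<zero>\<^bsub>fobj N a\<^esub> \<oplus>\<^bsub>fobj N a\<^esub> y = y"
    "\<zero>\<^bsub>fobj M a\<^esub> \<oplus>\<^bsub>fobj M a\<^esub> \<zero>\<^bsub>fobj M a\<^esub> = \<zero>\<^bsub>fobj M a\<^esub>"
    "\<zero>\<^bsub>fobj N a\<^esub> \<oplus>\<^bsub>fobj N a\<^esub> \<zero>\<^bsub>fobj N a\<^esub> = \<zero>\<^bsub>fobj N a\<^esub>"
    "r \<in> carrier K \<Longrightarrow> r \<odot>\<^bsub>fobj M a\<^esub> \<zero>\<^bsub>fobj M a\<^esub> = \<zero>\<^bsub>fobj M a\<^esub>"
    "r \<in> carrier K \<Longrightarrow> r \<odot>\<^bsub>fobj N a\<^esub> \<zero>\<^bsub>fobj N a\<^esub> = \<zero>\<^bsub>fobj N a\<^esub>"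
      by simp_all
  qed
  define i0 :: "'o \<Rightarrow> 'v \<Rightarrow> 'v \<times> 'v" where "i0 = (\<lambda>a x. (x, \<zero>\<^bsub>fobj N a\<^esub>))"
  define j0 :: "'o \<Rightarrow> 'v \<Rightarrow> 'v \<times> 'v" where "j0 = (\<lambda>a y. (\<zero>\<^bsub>fobj M a\<^esub>, y))"
  have hP: "rep_hom M P i0" "rep_hom N P j0" "rep_hom P M (\<lambda>a. fst)" "rep_hom P N (\<lambda>a. snd)"
    using mz M N by (auto simp: rep_hom_def linear_map_def P_def i0_def j0_def rep_arr_zero)
  have i0: "i0 a x \<in> carrier (fobj P a)" if "a \<in> Obj D" "x \<in> carrier (fobj M a)" for a x
    using hom_closed[OF hP(1) that] .
  have j0: "j0 a y \<in> carrier (fobj P a)" if "a \<in> Obj D" "y \<in> carrier (fobj N a)" for a y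
    using hom_closed[OF hP(2) that] .
  have "biprod M N S (\<lambda>a x. e a (i0 a x)) (\<lambda>a y. e a (j0 a y)) (\<lambda>a z. fst (e' a z)) (\<lambda>a z.
      snd (e' a z))"
    unfolding biprod_def
  proof (intro conjI ballI S(1))
    show "rep_hom M S (\<lambda>a x. e a (i0 a x))" by (rule hom_comp[OF hP(1) S(2)])
    show "rep_hom N S (\<lambda>a y. e a (j0 a y))" by (rule hom_comp[OF hP(2) S(2)])
    show "rep_hom S M (\<lambda>a z. fst (e' a z))" by (rule hom_comp[OF S(3) hP(3)])
    show "rep_hom S N (\<lambda>a z. snd (e' a z))" by (rule hom_comp[OF S(3) hP(4)])
  next
    fix a z assume a: "a \<in> Obj D" and z: "z \<in> carrier (fobj S a)"
    have c: "e' a z \<in> carrier (fobj P a)" by (rule hom_closed[OF S(3) a z])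
    then have "e a (i0 a (fst (e' a z))) \<oplus>\<^bsub>fobj S a\<^esub> e a (j0 a (snd (e' a z))) =
      e a (i0 a (fst (e' a z)) \<oplus>\<^bsub>fobj P a\<^esub> j0 a (snd (e' a z)))"
      using a by (simp add: hom_add[OF S(2) a] i0 j0 hom_closed[OF hP(3)] hom_closed[OF hP(4)])
    also have "i0 a (fst (e' a z)) \<oplus>\<^bsub>fobj P a\<^esub> j0 a (snd (e' a z)) = e' a z"
      using c mz[OF a] by (auto simp: i0_def j0_def P_def)
    finally show "e a (i0 a (fst (e' a z))) \<oplus>\<^bsub>fobj S a\<^esub> e a (j0 a (snd (e' a z))) = z"
      using S(5)[OF a z] by simp
  qed (auto simp: S(4) i0 j0, auto simp: i0_def j0_def)
  then show ?thesis by blast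
qed

lemma biprod_eqI:
  assumes b: "biprod M N S i j p q" and a: "a \<in> Obj D" "x \<in> carrier (fobj S a)"
      "y \<in> carrier (fobj S a)"
    and "p a x = p a y" "q a x = q a y"
  shows "x = y"
  using biprodD(10)[OF b a(1,2)] biprodD(10)[OF b a(1,3)] assms(5,6) by metis

lemma proj_biprod:
  assumes b: "biprod M N S i j p q" and "rep_proj M" "rep_proj N"
  shows "rep_proj S"
  by (rule proj_of_sum[OF biprodD(1)[OF b] assms(2,3) biprodD(4,5,2,3)[OF b]]) (simp add:
      biprodD(10)[OF b])

end

section \<open>Comparison of resolutions\<close>

context linear_cat
begin

text \<open>The zero module, cut out of \<open>M\<close>; the zero map lifts every map out of it. It
  fills the degree below the end of a resolution in the mapping cone.\<close>

lemma proj_zero_subrep: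
  fixes M :: "('o, 'm, 'k, 'v) rep"
  assumes M: "is_rep M"
  shows "rep_proj (subrep M (\<lambda>a. {\<zero>\<^bsub>fobj M a\<^esub>}))"
proof -
  let ?Z = "subrep M (\<lambda>a. {\<zero>\<^bsub>fobj M a\<^esub>})"
  have Z: "is_rep ?Z" by (rule is_rep_subrep[OF M is_subrep_zero[OF M]])
  show ?thesis
    unfolding rep_proj_def
  proof (intro conjI allI impI Z; elim conjE)
    fix A B :: "('o, 'm, 'k, 'v) rep" and g f
    assume A: "is_rep A" and B: "is_rep B" and g: "rep_hom A B g" and f: "rep_hom ?Z B f"
    have "g a \<zero>\<^bsub>fobj A a\<^esub> = f a x" if "a \<in> Obj D" "x \<in> carrier (fobj ?Z a)" for a x
      using that hom_zero[OF g A B that(1)] hom_zero[OF f Z B that(1)] by simp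
    then show "\<exists>h. rep_hom ?Z A h \<and> (\<forall>a\<in>Obj D. \<forall>x\<in>carrier (fobj ?Z a). g a (h a x) = f a x)"
      using hom_zero_map[OF Z A] by blast
  qed
qed

text \<open>A projective module presents itself, with \<open>J\<close> zero and both maps the
  identity.\<close>

lemma good_proj:
  fixes S Y :: "('o, 'm, 'k, 'v) rep"
  assumes S: "rep_proj S" and Y: "is_rep Y"
  shows "good Y S"
proof -
  note rS = proj_rep[OF S]
  let ?J = "\<lambda>a. {\<zero>\<^bsub>fobj S a\<^esub>}"
  note Z = is_rep_subrep[OF rS is_subrep_zero[OF rS]]
  have "good_pres Y S S ?J (\<lambda>a x. x) (\<lambda>a x. x)"
  proof (rule good_presI[OF rS S is_subrep_zero[OF rS] proj_zero_subrep[OF rS]])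
    show "t a x = \<zero>\<^bsub>fobj Y a\<^esub>" if "rep_hom (subrep S ?J) Y t" "a \<in> Obj D" "x \<in> ?J a" for t a x
      using hom_zero[OF that(1) Z Y that(2)] that(3) by simp
  qed (auto simp: hom_id rep_surj_def)
  then show ?thesis unfolding good_def by blast
qed

text \<open>Presentations are added componentwise: \<open>W\<close> is the sum of \<open>U\<close>
  and \<open>U'\<close>, and the submodule \<open>T\<close> of elements with components in
  \<open>J\<close> and \<open>J'\<close> takes the role of \<open>J\<close>.\<close>

lemma good_biprod:
  fixes M N S Y :: "('o, 'm, 'k, 'v) rep"
  assumes inf: "infinite (UNIV :: 'v set)" and Y: "is_rep Y"
    and gM: "good Y M" and gN: "good Y N" and b: "biprod M N S i j p q"
  shows "good Y S"
proof -
  obtain U J r \<theta> where "good_pres Y M U J r \<theta>" using gM unfolding good_def by blast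
  note m = good_presD[OF this]
  obtain U' J' r' \<theta>' where "good_pres Y N U' J' r' \<theta>'" using gN unfolding good_def by blast
  note n = good_presD[OF this]
  note bS = biprodD[OF b]
  obtain W I I' P P' where w: "biprod U U' W I I' P P'"
    using biprod_exists[OF inf proj_rep[OF m(2)] proj_rep[OF n(2)]] by blast
  note bW = biprodD[OF w]
  note rU = proj_rep[OF m(2)] and rU' = proj_rep[OF n(2)]
  define T where "T = (\<lambda>a. {z \<in> carrier (fobj W a). P a z \<in> J a \<and> P' a z \<in> J' a})"
  have T: "is_subrep W T"
    unfolding is_subrep_def
  proof (intro conjI ballI)
    fix a assume a: "a \<in> Obj D"
    interpret W: module K "fobj W a" by (rule rep_module[OF bW(1) a])
    note s = is_subrepD[OF m(3) a] and s' = is_subrepD[OF n(3) a]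
    show "submodule (T a) K (fobj W a)"
      by (rule submodule_smultI[OF W.module_axioms])
        (auto simp: T_def hom_zero[OF bW(4) bW(1) rU a] hom_zero[OF bW(5) bW(1) rU' a] a
          hom_add[OF bW(4)] hom_add[OF bW(5)] hom_smult[OF bW(4)] hom_smult[OF bW(5)]
          submodule_zero[OF s] submodule_zero[OF s'] submodule_add[OF s] submodule_add[OF s']
          submodule_smult[OF s] submodule_smult[OF s'])
  next
    fix a b f x assume "a \<in> Obj D" "b \<in> Obj D" "f \<in> Hom D a b" "x \<in> T a"
    then show "farr W a b f x \<in> T b"
      using m(3) n(3) by (auto simp: T_def rep_arr_closed[OF bW(1)] hom_nat[OF bW(4)]
          hom_nat[OF bW(5)] is_subrep_def)
  qed
  note rT = is_rep_subrep[OF bW(1) T]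
  have IT: "I a x \<in> T a" if "a \<in> Obj D" "x \<in> J a" for a x
    using that is_subrep_mem[OF m(3) that] submodule_zero[OF is_subrepD[OF n(3) that(1)]]
    by (auto simp: T_def hom_closed[OF bW(2)] bW(6,7))
  have IT': "I' a x \<in> T a" if "a \<in> Obj D" "x \<in> J' a" for a x
    using that is_subrep_mem[OF n(3) that] submodule_zero[OF is_subrepD[OF m(3) that(1)]]
    by (auto simp: T_def hom_closed[OF bW(3)] bW(8,9))
  have hI: "rep_hom (subrep U J) (subrep W T) I" by (rule hom_restrict_to[OF bW(2) m(3) IT])
  have hI': "rep_hom (subrep U' J') (subrep W T) I'" by (rule hom_restrict_to[OF bW(3) n(3) IT'])
  have hP: "rep_hom (subrep W T) (subrep U J) P"
      by (rule hom_restrict_to[OF bW(4) T]) (auto simp: T_def)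
  have hP': "rep_hom (subrep W T) (subrep U' J') P'"
      by (rule hom_restrict_to[OF bW(5) T]) (auto simp: T_def)
  have Tsum: "I a (P a z) \<oplus>\<^bsub>fobj W a\<^esub> I' a (P' a z) = z" if "a \<in> Obj D" "z \<in> T a" for a z
    using that bW(10) by (auto simp: T_def)
  \<comment> \<open>The structure maps of \<open>W\<close> restrict to \<open>T\<close> and exhibit
    it as the sum of \<open>J\<close> and \<open>J'\<close>, so \<open>proj_of_sum\<close> applies
    without a second biproduct.\<close>
  have pT: "rep_proj (subrep W T)"
    by (rule proj_of_sum[OF rT m(4) n(4) hP hP' hI hI']) (simp add: Tsum)
  define R where "R = (\<lambda>a z. i a (r a (P a z)) \<oplus>\<^bsub>fobj S a\<^esub> j a (r' a (P' a z)))"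
  have R: "rep_hom W S R"
    unfolding R_def by (intro hom_plus bW(1) bS(1) hom_comp[OF hom_comp[OF bW(4) m(6)] bS(2)]
        hom_comp[OF hom_comp[OF bW(5) n(6)] bS(3)])
  define \<Theta> where "\<Theta> = (\<lambda>a z. I a (\<theta> a (P a z)) \<oplus>\<^bsub>fobj W a\<^esub> I' a (\<theta>' a (P' a z)))"
  have \<Theta>: "rep_hom W W \<Theta>"
    unfolding \<Theta>_def by (intro hom_plus bW(1) hom_comp[OF hom_comp[OF bW(4) m(9)] bW(2)]
        hom_comp[OF hom_comp[OF bW(5) n(9)] bW(3)])
  have cl: "P a z \<in> carrier (fobj U a)" "P' a z \<in> carrier (fobj U' a)"
    "r a (P a z) \<in> carrier (fobj M a)" "r' a (P' a z) \<in> carrier (fobj N a)"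
    "\<theta> a (P a z) \<in> carrier (fobj U a)" "\<theta>' a (P' a z) \<in> carrier (fobj U' a)"
    if "a \<in> Obj D" "z \<in> carrier (fobj W a)" for a z
    using that by (auto intro: hom_closed[OF bW(4)] hom_closed[OF bW(5)] hom_closed[OF m(6)]
        hom_closed[OF n(6)] hom_closed[OF m(9)] hom_closed[OF n(9)])
  have pR: "p a (R a z) = r a (P a z)" "q a (R a z) = r' a (P' a z)"
    if a: "a \<in> Obj D" and z: "z \<in> carrier (fobj W a)" for a z
  proof -
    interpret M: module K "fobj M a" by (rule rep_module[OF m(1) a])
    interpret N: module K "fobj N a" by (rule rep_module[OF n(1) a])
    note c = cl[OF a z]
    show "p a (R a z) = r a (P a z)" "q a (R a z) = r' a (P' a z)"
      using a c by (simp_all add: R_def hom_add[OF bS(4)] hom_add[OF bS(5)] hom_closed[OF bS(2)]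
          hom_closed[OF bS(3)] bS(6-9))
  qed
  have PT: "P a (\<Theta> a z) = \<theta> a (P a z)" "P' a (\<Theta> a z) = \<theta>' a (P' a z)"
    if a: "a \<in> Obj D" and z: "z \<in> carrier (fobj W a)" for a z
  proof -
    interpret U: module K "fobj U a" by (rule rep_module[OF rU a])
    interpret U': module K "fobj U' a" by (rule rep_module[OF rU' a])
    note c = cl[OF a z]
    show "P a (\<Theta> a z) = \<theta> a (P a z)" "P' a (\<Theta> a z) = \<theta>' a (P' a z)"
      using a c by (simp_all add: \<Theta>_def hom_add[OF bW(4)] hom_add[OF bW(5)] hom_closed[OF bW(2)]
          hom_closed[OF bW(3)] bW(6-9))
  qed
  have "good_pres Y S W T R \<Theta>"
  proof (rule good_presI[OF bS(1) proj_biprod[OF w m(2) n(2)] T pT _ R _ _ \<Theta>])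
    fix t a x assume t: "rep_hom (subrep W T) Y t" and a: "a \<in> Obj D" and x: "x \<in> T a"
    interpret Y: module K "fobj Y a" by (rule rep_module[OF Y a])
    have PJ: "P a x \<in> J a" "P' a x \<in> J' a" using x by (auto simp: T_def)
    have "t a x = t a (I a (P a x) \<oplus>\<^bsub>fobj W a\<^esub> I' a (P' a x))" using Tsum[OF a x] by simp
    also have "\<dots> = t a (I a (P a x)) \<oplus>\<^bsub>fobj Y a\<^esub> t a (I' a (P' a x))"
      using hom_add[OF t a] IT[OF a PJ(1)] IT'[OF a PJ(2)] by simp
    also have "\<dots> = \<zero>\<^bsub>fobj Y a\<^esub>"
      using m(5)[OF hom_comp[OF hI t] a PJ(1)] n(5)[OF hom_comp[OF hI' t] a PJ(2)] by simp
    finally show "t a x = \<zero>\<^bsub>fobj Y a\<^esub>" .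
  next
    show "rep_surj W S R"
      unfolding rep_surj_def
    proof (intro ballI)
      fix a y assume a: "a \<in> Obj D" and y: "y \<in> carrier (fobj S a)"
      obtain u where u: "u \<in> carrier (fobj U a)" "r a u = p a y"
        using m(7) hom_closed[OF bS(4) a y] a unfolding rep_surj_def by blast
      obtain u' where u': "u' \<in> carrier (fobj U' a)" "r' a u' = q a y"
        using n(7) hom_closed[OF bS(5) a y] a unfolding rep_surj_def by blast
      interpret W: module K "fobj W a" by (rule rep_module[OF bW(1) a])
      interpret U: module K "fobj U a" by (rule rep_module[OF rU a])
      interpret U': module K "fobj U' a" by (rule rep_module[OF rU' a])
      let ?w = "I a u \<oplus>\<^bsub>fobj W a\<^esub> I' a u'"
      have w: "?w \<in> carrier (fobj W a)" using a u u'
          by (simp add: hom_closed[OF bW(2)] hom_closed[OF bW(3)])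
      have "P a ?w = u" "P' a ?w = u'"
        using a u u' by (simp_all add: hom_add[OF bW(4)] hom_add[OF bW(5)] hom_closed[OF bW(2)]
            hom_closed[OF bW(3)] bW(6-9))
      then have "R a ?w = y"
        using pR[OF a w] u u' by (intro biprod_eqI[OF b a hom_closed[OF R a w] y]) auto
      then show "\<exists>x\<in>carrier (fobj W a). R a x = y" using w by blast
    qed
  next
    fix a x assume a: "a \<in> Obj D" and x: "x \<in> T a"
    interpret S: module K "fobj S a" by (rule rep_module[OF bS(1) a])
    show "R a x = \<zero>\<^bsub>fobj S a\<^esub>"
      using x a by (simp add: T_def R_def m(8) n(8) hom_zero[OF bS(2) m(1) bS(1)]
          hom_zero[OF bS(3) n(1) bS(1)])
  next
    fix a x assume a: "a \<in> Obj D" and x: "x \<in> carrier (fobj W a)"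
    have c: "\<Theta> a x \<in> carrier (fobj W a)" by (rule hom_closed[OF \<Theta> a x])
    show "R a (\<Theta> a x) = R a x"
      by (rule biprod_eqI[OF b a hom_closed[OF R a c] hom_closed[OF R a x]])
        (simp_all add: pR a x c PT m(10) n(10) cl)
    assume "R a x = \<zero>\<^bsub>fobj S a\<^esub>"
    then have "r a (P a x) = \<zero>\<^bsub>fobj M a\<^esub>" "r' a (P' a x) = \<zero>\<^bsub>fobj N a\<^esub>"
      using pR[OF a x] hom_zero[OF bS(4) bS(1) m(1) a] hom_zero[OF bS(5) bS(1) n(1) a] by simp_all
    then show "\<Theta> a x \<in> T a"
      using c a by (simp add: T_def PT x m(11) n(11) cl)
  qed
  then show ?thesis unfolding good_def by blast
qed

text \<open>
  \<open>S' n\<close> stands for \<open>S (n - 1)\<close>, with \<open>S' 0 = 0\<close>, and \<open>d'\<close> for its differential; \<open>E n\<close> is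
  \<open>X n \<oplus> S (n - 1)\<close>.
\<close>

definition cone_of ::
  "(nat \<Rightarrow> ('o, 'm, 'k, 'v) rep) \<Rightarrow> (nat \<Rightarrow> 'o \<Rightarrow> 'v \<Rightarrow> 'v) \<Rightarrow> (nat \<Rightarrow> ('o, 'm, 'k, 'v) rep) \<Rightarrow>
   (nat \<Rightarrow> 'o \<Rightarrow> 'v \<Rightarrow> 'v) \<Rightarrow> (nat \<Rightarrow> 'o \<Rightarrow> 'v \<Rightarrow> 'v) \<Rightarrow> (nat \<Rightarrow> ('o, 'm, 'k, 'v) rep) \<Rightarrow>
   (nat \<Rightarrow> 'o \<Rightarrow> 'v \<Rightarrow> 'v) \<Rightarrow> (nat \<Rightarrow> 'o \<Rightarrow> 'v \<Rightarrow> 'v) \<Rightarrow> (nat \<Rightarrow> 'o \<Rightarrow> 'v \<Rightarrow> 'v) \<Rightarrow>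
   (nat \<Rightarrow> 'o \<Rightarrow> 'v \<Rightarrow> 'v) \<Rightarrow> (nat \<Rightarrow> 'o \<Rightarrow> 'v \<Rightarrow> 'v) \<Rightarrow> bool" where
  "cone_of X dX S' d' h E D' i j p q \<longleftrightarrow>
     (\<forall>n. biprod (X n) (S' n) (E n) (i n) (j n) (p n) (q n)) \<and>
     (\<forall>n. rep_hom (E (Suc n)) (E n) (D' n)) \<and>
     (\<forall>n. \<forall>a\<in>Obj D. \<forall>z\<in>carrier (fobj (E (Suc n)) a).
        p n a (D' n a z) = dX n a (p (Suc n) a z) \<oplus>\<^bsub>fobj (X n) a\<^esub> h n a (q (Suc n) a z) \<and>
        q n a (D' n a z) = \<ominus>\<^bsub>fobj (S' n) a\<^esub> d' n a (q (Suc n) a z))"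

lemma cone_ofD:
  assumes "cone_of X dX S' d' h E D' i j p q"
  shows "\<And>n. biprod (X n) (S' n) (E n) (i n) (j n) (p n) (q n)"
    "\<And>n. rep_hom (E (Suc n)) (E n) (D' n)"
    "\<And>n a z. a \<in> Obj D \<Longrightarrow> z \<in> carrier (fobj (E (Suc n)) a) \<Longrightarrow>
      p n a (D' n a z) = dX n a (p (Suc n) a z) \<oplus>\<^bsub>fobj (X n) a\<^esub> h n a (q (Suc n) a z)"
    "\<And>n a z. a \<in> Obj D \<Longrightarrow> z \<in> carrier (fobj (E (Suc n)) a) \<Longrightarrow>
      q n a (D' n a z) = \<ominus>\<^bsub>fobj (S' n) a\<^esub> d' n a (q (Suc n) a z)"
  using assms unfolding cone_of_def by blast+

text \<open>Both complexes resolve \<open>A\<close> and \<open>h\<close> lies over its identity, so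
  \<open>h\<close> is a quasi-isomorphism and its cone is exact. The proof is the element chase for
  \<open>D' (x, s) = (dX x + h s, - d' s)\<close>. The module \<open>A\<close> is not a term of the
  cone, and the augmentations enter only at the lower end.\<close>

lemma mapping_cone:
  fixes X S S' :: "nat \<Rightarrow> ('o, 'm, 'k, 'v) rep" and A Y :: "('o, 'm, 'k, 'v) rep"
  assumes inf: "infinite (UNIV :: 'v set)" and Y: "is_rep Y" and A: "is_rep A"
    and gX: "\<And>n. good Y (X n)" and gS: "\<And>n. rep_proj (S n)"
    and dX: "\<And>n. rep_hom (X (Suc n)) (X n) (dX n)" and dS: "\<And>n. rep_hom (S (Suc n)) (S n) (dS n)"
    and aX: "rep_hom (X 0) A aX" and aS: "rep_hom (S 0) A aS" and sS: "rep_surj (S 0) A aS"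
    and eX: "\<And>n a x. a \<in> Obj D \<Longrightarrow> x \<in> carrier (fobj (X (Suc n)) a) \<Longrightarrow>
      dX n a x = \<zero>\<^bsub>fobj (X n) a\<^esub> \<longleftrightarrow> x \<in> rep_im (X (Suc (Suc n))) (dX (Suc n)) a"
    and eX0: "\<And>a x. a \<in> Obj D \<Longrightarrow> x \<in> carrier (fobj (X 0) a) \<Longrightarrow>
      aX a x = \<zero>\<^bsub>fobj A a\<^esub> \<longleftrightarrow> x \<in> rep_im (X 1) (dX 0) a"
    and eS: "\<And>n a x. a \<in> Obj D \<Longrightarrow> x \<in> carrier (fobj (S (Suc n)) a) \<Longrightarrow>
      dS n a x = \<zero>\<^bsub>fobj (S n) a\<^esub> \<longleftrightarrow> x \<in> rep_im (S (Suc (Suc n))) (dS (Suc n)) a"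
    and eS0: "\<And>a x. a \<in> Obj D \<Longrightarrow> x \<in> carrier (fobj (S 0) a) \<Longrightarrow>
      aS a x = \<zero>\<^bsub>fobj A a\<^esub> \<longleftrightarrow> x \<in> rep_im (S 1) (dS 0) a"
    and h: "\<And>n. rep_hom (S n) (X n) (h n)"
    and h0: "\<And>a x. a \<in> Obj D \<Longrightarrow> x \<in> carrier (fobj (S 0) a) \<Longrightarrow> aX a (h 0 a x) = aS a x"
    and hd: "\<And>n a x. a \<in> Obj D \<Longrightarrow> x \<in> carrier (fobj (S (Suc n)) a) \<Longrightarrow>
      dX n a (h (Suc n) a x) = h n a (dS n a x)"
    and S'_def: "S' = (\<lambda>n. case n of 0 \<Rightarrow> subrep (S 0) (\<lambda>a. {\<zero>\<^bsub>fobj (S 0) a\<^esub>}) | Suc m \<Rightarrow> S m)"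
    and d'_def: "d' = (\<lambda>n. case n of 0 \<Rightarrow> (\<lambda>a x. \<zero>\<^bsub>fobj (S 0) a\<^esub>) | Suc m \<Rightarrow> dS m)"
  shows "rep_hom (S n) (S' n) (d' n)"
    and "\<exists>E D' i j p q. cone_of X dX S' d' h E D' i j p q \<and> (\<forall>n. good Y (E n)) \<and>
        rep_surj (E 1) (E 0) (D' 0) \<and>
      (\<forall>n. \<forall>a\<in>Obj D. \<forall>z\<in>carrier (fobj (E (Suc n)) a).
        D' n a z = \<zero>\<^bsub>fobj (E n) a\<^esub> \<longleftrightarrow> z \<in> rep_im (E (Suc (Suc n))) (D' (Suc n)) a)"
proof -
  have S'S: "S' (Suc n) = S n" for n by (simp add: S'_def)
  have rX: "is_rep (X n)" for n by (rule good_rep[OF gX])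
  have rS: "is_rep (S n)" for n by (rule proj_rep[OF gS])
  have pS': "rep_proj (S' n)" for n
    by (cases n) (simp_all add: S'_def gS proj_zero_subrep[OF rS])
  have rS': "is_rep (S' n)" for n by (rule proj_rep[OF pS'])
  have d': "rep_hom (S n) (S' n) (d' n)" for n
  proof (cases n)
    case 0
    have "rep_hom (S 0) (S' 0) (\<lambda>a x. \<zero>\<^bsub>fobj (S' 0) a\<^esub>)"
      by (rule hom_zero_map[OF rS rS'])
    then show ?thesis by (simp add: 0 d'_def S'_def)
  qed (simp add: d'_def S'_def dS)
  \<comment> \<open>The biproduct and its four maps are packed into one tuple, so that a single use
    of \<open>choice\<close> selects them coherently for every degree.\<close>
  have "\<forall>n. \<exists>T. case T of (E, i, j, p, q) \<Rightarrow> biprod (X n) (S' n) E i j p q"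
    using biprod_exists[OF inf rX rS'] by simp
  from choice[OF this] obtain B
      where B: "\<forall>n. case B n of (E, i, j, p, q) \<Rightarrow> biprod (X n) (S' n) E i j p q" ..
  define E where "E = (\<lambda>n. fst (B n))"
  define i where "i = (\<lambda>n. fst (snd (B n)))"
  define j where "j = (\<lambda>n. fst (snd (snd (B n))))"
  define p where "p = (\<lambda>n. fst (snd (snd (snd (B n)))))"
  define q where "q = (\<lambda>n. snd (snd (snd (snd (B n)))))"
  have b: "biprod (X n) (S' n) (E n) (i n) (j n) (p n) (q n)" for n
    using B[rule_format, of n] by (simp add: E_def i_def j_def p_def q_def split: prod.splits)
  note bD = biprodD[OF b]
  have qS: "rep_hom (E (Suc n)) (S n) (q (Suc n))" for n
    using bD(5)[of "Suc n"] by (simp add: S'S)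
  define D' where "D' = (\<lambda>n a z.
    i n a (dX n a (p (Suc n) a z) \<oplus>\<^bsub>fobj (X n) a\<^esub> h n a (q (Suc n) a z)) \<oplus>\<^bsub>fobj (E n) a\<^esub>
    j n a (\<ominus>\<^bsub>fobj (S' n) a\<^esub> d' n a (q (Suc n) a z)))"
  have u1: "rep_hom (E (Suc n)) (X n) (\<lambda>a z. dX n a (p (Suc n) a z) \<oplus>\<^bsub>fobj (X n) a\<^esub> h n a (q (Suc
      n) a z))" for n
    by (rule hom_plus[OF bD(1) rX hom_comp[OF bD(4) dX] hom_comp[OF qS h]])
  have u2: "rep_hom (E (Suc n)) (S' n) (\<lambda>a z. \<ominus>\<^bsub>fobj (S' n) a\<^esub> d' n a (q (Suc n) a z))" for n
    by (rule hom_uminus[OF bD(1) rS' hom_comp[OF qS d']])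
  have D': "rep_hom (E (Suc n)) (E n) (D' n)" for n
    unfolding D'_def by (rule hom_plus[OF bD(1) bD(1) hom_comp[OF u1 bD(2)] hom_comp[OF u2 bD(3)]])
  have pD: "p n a (D' n a z) = dX n a (p (Suc n) a z) \<oplus>\<^bsub>fobj (X n) a\<^esub> h n a (q (Suc n) a z)"
    and qD: "q n a (D' n a z) = \<ominus>\<^bsub>fobj (S' n) a\<^esub> d' n a (q (Suc n) a z)"
    if a: "a \<in> Obj D" and z: "z \<in> carrier (fobj (E (Suc n)) a)" for n a z
  proof -
    interpret X: module K "fobj (X n) a" by (rule rep_module[OF rX a])
    interpret S': module K "fobj (S' n) a" by (rule rep_module[OF rS' a])
    note c = hom_closed[OF u1 a z] hom_closed[OF u2 a z]
    note c' = hom_closed[OF bD(2) a c(1)] hom_closed[OF bD(3) a c(2)]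
    show "p n a (D' n a z) = dX n a (p (Suc n) a z) \<oplus>\<^bsub>fobj (X n) a\<^esub> h n a (q (Suc n) a z)"
      "q n a (D' n a z) = \<ominus>\<^bsub>fobj (S' n) a\<^esub> d' n a (q (Suc n) a z)"
      unfolding D'_def using hom_add[OF bD(4) a c'] hom_add[OF bD(5) a c'] a c
      by (simp_all add: bD(6-9))
  qed
  have gE: "good Y (E n)" for n
    by (rule good_biprod[OF inf Y gX good_proj[OF pS' Y] b])
  have zE: "z = \<zero>\<^bsub>fobj (E n) a\<^esub> \<longleftrightarrow> p n a z = \<zero>\<^bsub>fobj (X n) a\<^esub> \<and> q n a z = \<zero>\<^bsub>fobj (S' n) a\<^esub>"
    if a: "a \<in> Obj D" and z: "z \<in> carrier (fobj (E n) a)" for n a z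
  proof -
    interpret E: module K "fobj (E n) a" by (rule rep_module[OF bD(1) a])
    show ?thesis
      using biprod_eqI[OF b a z E.zero_closed] hom_zero[OF bD(4) bD(1) rX a]
          hom_zero[OF bD(5) bD(1) rS' a] by auto
  qed
  have mk: "\<exists>z\<in>carrier (fobj (E n) a). p n a z = x \<and> q n a z = s"
    if a: "a \<in> Obj D" and x: "x \<in> carrier (fobj (X n) a)" and s: "s \<in> carrier (fobj (S' n) a)"
        for n a x s
  proof -
    interpret E: module K "fobj (E n) a" by (rule rep_module[OF bD(1) a])
    interpret X: module K "fobj (X n) a" by (rule rep_module[OF rX a])
    interpret S': module K "fobj (S' n) a" by (rule rep_module[OF rS' a])
    have c: "i n a x \<in> carrier (fobj (E n) a)" "j n a s \<in> carrier (fobj (E n) a)"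
      using a x s by (auto intro: hom_closed[OF bD(2)] hom_closed[OF bD(3)])
    show ?thesis
      by (rule bexI[of _ "i n a x \<oplus>\<^bsub>fobj (E n) a\<^esub> j n a s"])
        (use a x s c in \<open>simp_all add: hom_add[OF bD(4)] hom_add[OF bD(5)] bD(6-9)\<close>)
  qed
  have dd: "dX n a (dX (Suc n) a x) = \<zero>\<^bsub>fobj (X n) a\<^esub>"
    if "a \<in> Obj D" "x \<in> carrier (fobj (X (Suc (Suc n))) a)" for n a x
    using eX[OF that(1) hom_closed[OF dX that]] that(2) by (auto simp: rep_im_def)
  have ad: "aX a (dX 0 a x) = \<zero>\<^bsub>fobj A a\<^esub>"
    if "a \<in> Obj D" "x \<in> carrier (fobj (X (Suc 0)) a)" for a x
    using eX0[OF that(1) hom_closed[OF dX that]] that(2) by (auto simp: rep_im_def)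
  have ddS: "d' n a (dS n a x) = \<zero>\<^bsub>fobj (S' n) a\<^esub>"
    if "a \<in> Obj D" "x \<in> carrier (fobj (S (Suc n)) a)" for n a x
  proof (cases n)
    case (Suc m)
    show ?thesis
      using eS[OF that(1), of "dS n a x" m] hom_closed[OF dS that] that(2) Suc
          by (auto simp: rep_im_def d'_def S'_def)
  qed (simp add: d'_def S'_def)
  have surj: "rep_surj (E 1) (E 0) (D' 0)"
    unfolding rep_surj_def
  proof (intro ballI)
    fix a z assume a: "a \<in> Obj D" and z: "z \<in> carrier (fobj (E 0) a)"
    interpret X: module K "fobj (X 0) a" by (rule rep_module[OF rX a])
    interpret A: module K "fobj A a" by (rule rep_module[OF A a])
    interpret S': module K "fobj (S' 0) a" by (rule rep_module[OF rS' a])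
    have x: "p 0 a z \<in> carrier (fobj (X 0) a)" by (rule hom_closed[OF bD(4) a z])
    \<comment> \<open>By exactness at \<open>X 0\<close>, an element of \<open>X 0\<close> agrees up
      to a boundary with \<open>h 0 a s\<close> for any \<open>s\<close> of the same
      augmentation.\<close>
    obtain s where s: "s \<in> carrier (fobj (S 0) a)" "aS a s = aX a (p 0 a z)"
      using sS hom_closed[OF aX a x] a unfolding rep_surj_def by blast
    have hs: "h 0 a s \<in> carrier (fobj (X 0) a)" by (rule hom_closed[OF h a s(1)])
    have "aX a (p 0 a z \<ominus>\<^bsub>fobj (X 0) a\<^esub> h 0 a s) = \<zero>\<^bsub>fobj A a\<^esub>"
      using hom_minus[OF aX rX A a x hs] h0[OF a s(1)] s(2) hom_closed[OF aX a x]
          by (simp add: A.minus_eq A.r_neg)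
    then obtain y where y: "y \<in> carrier (fobj (X (Suc 0)) a)"
        "p 0 a z \<ominus>\<^bsub>fobj (X 0) a\<^esub> h 0 a s = dX 0 a y"
      using eX0[OF a, of "p 0 a z \<ominus>\<^bsub>fobj (X 0) a\<^esub> h 0 a s"] x hs by (auto simp: rep_im_def)
    obtain w where w: "w \<in> carrier (fobj (E (Suc 0)) a)" "p (Suc 0) a w = y" "q (Suc 0) a w = s"
      using mk[OF a y(1), of s] s(1) by (auto simp: S'S)
    have S0: "carrier (fobj (S' 0) a) = {\<zero>\<^bsub>fobj (S' 0) a\<^esub>}" by (simp add: S'_def)
    have "D' 0 a w = z"
    proof (rule biprod_eqI[OF b a hom_closed[OF D' a w(1)] z])
      show "p 0 a (D' 0 a w) = p 0 a z"
        using pD[OF a w(1)] w y x hs by (simp add: y(2)[symmetric] X.minus_eq X.a_assoc X.l_neg)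
      show "q 0 a (D' 0 a w) = q 0 a z"
        using S0 hom_closed[OF bD(5) a z] hom_closed[OF bD(5) a hom_closed[OF D' a w(1)]] by simp
    qed
    then show "\<exists>x\<in>carrier (fobj (E 1) a). D' 0 a x = z" using w(1) by auto
  qed
  have exact: "D' n a z = \<zero>\<^bsub>fobj (E n) a\<^esub> \<longleftrightarrow> z \<in> rep_im (E (Suc (Suc n))) (D' (Suc n)) a"
    if a: "a \<in> Obj D" and z: "z \<in> carrier (fobj (E (Suc n)) a)" for n a z
  proof -
    interpret X: module K "fobj (X n) a" by (rule rep_module[OF rX a])
    interpret X1: module K "fobj (X (Suc n)) a" by (rule rep_module[OF rX a])
    interpret S: module K "fobj (S n) a" by (rule rep_module[OF rS a])
    interpret S1: module K "fobj (S (Suc n)) a" by (rule rep_module[OF rS a])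
    interpret S': module K "fobj (S' n) a" by (rule rep_module[OF rS' a])
    interpret A: module K "fobj A a" by (rule rep_module[OF A a])
    define x where "x = p (Suc n) a z"
    define s where "s = q (Suc n) a z"
    have x: "x \<in> carrier (fobj (X (Suc n)) a)" unfolding x_def by (rule hom_closed[OF bD(4) a z])
    have s: "s \<in> carrier (fobj (S n) a)" unfolding s_def by (rule hom_closed[OF qS a z])
    have D0: "D' n a z = \<zero>\<^bsub>fobj (E n) a\<^esub> \<longleftrightarrow>
      dX n a x \<oplus>\<^bsub>fobj (X n) a\<^esub> h n a s = \<zero>\<^bsub>fobj (X n) a\<^esub> \<and> \<ominus>\<^bsub>fobj (S' n) a\<^esub> d' n a s = \<zero>\<^bsub>fobj (S'
          n) a\<^esub>"
      using zE[OF a hom_closed[OF D' a z]] pD[OF a z] qD[OF a z] by (simp add: x_def s_def)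
    show ?thesis
    proof
      assume "D' n a z = \<zero>\<^bsub>fobj (E n) a\<^esub>"
      then have e1: "dX n a x \<oplus>\<^bsub>fobj (X n) a\<^esub> h n a s = \<zero>\<^bsub>fobj (X n) a\<^esub>"
        and "\<ominus>\<^bsub>fobj (S' n) a\<^esub> d' n a s = \<zero>\<^bsub>fobj (S' n) a\<^esub>"
        using D0 by auto
      then have e2: "d' n a s = \<zero>\<^bsub>fobj (S' n) a\<^esub>"
        using hom_closed[OF d' a s] S'.minus_minus S'.minus_zero_right[OF S'.zero_closed]
        by (metis S'.minus_eq S'.l_zero S'.a_inv_closed S'.zero_closed)
      have "s \<in> rep_im (S (Suc n)) (dS n) a"
      proof (cases n)
        \<comment> \<open>Here \<open>S' 0\<close> is zero and the second component says nothing.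
          That \<open>s\<close> is a boundary comes from the augmentations:
          \<open>aS s = aX (h s) = aX (dX x + h s) = 0\<close>.\<close>
        case 0
        have "aS a s = aX a (dX n a x \<oplus>\<^bsub>fobj (X n) a\<^esub> h n a s)"
          using hom_add[OF aX a] h0[OF a, of s] ad[OF a] s x hom_closed[OF dX a x]
              hom_closed[OF h a s]
            hom_closed[OF aS a] 0 by simp
        also have "\<dots> = \<zero>\<^bsub>fobj A a\<^esub>" using e1 hom_zero[OF aX rX A a] 0 by simp
        finally show ?thesis using eS0[OF a] s 0 by simp
      next
        case (Suc m)
        then show ?thesis using e2 eS[OF a, of s m] s by (simp add: d'_def S'_def)
      qed
      then obtain t where t: "t \<in> carrier (fobj (S (Suc n)) a)" "s = dS n a t"
          by (auto simp: rep_im_def)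
      \<comment> \<open>The sign compensates the one in \<open>D'\<close>. With this choice
        \<open>x - h t'\<close> is a cycle of \<open>X\<close>, hence the boundary of the first
        component \<open>y\<close> of the required preimage.\<close>
      define t' where "t' = \<ominus>\<^bsub>fobj (S (Suc n)) a\<^esub> t"
      have t': "t' \<in> carrier (fobj (S (Suc n)) a)" "dS n a t' = \<ominus>\<^bsub>fobj (S n) a\<^esub> s"
        using t hom_inv[OF dS rS rS a t(1)] by (auto simp: t'_def)
      have ht: "h (Suc n) a t' \<in> carrier (fobj (X (Suc n)) a)" by (rule hom_closed[OF h a t'(1)])
      have "dX n a (x \<ominus>\<^bsub>fobj (X (Suc n)) a\<^esub> h (Suc n) a t') =
          dX n a x \<ominus>\<^bsub>fobj (X n) a\<^esub> h n a (dS n a t')"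
        using hom_minus[OF dX rX rX a x ht] hd[OF a t'(1)] by simp
      also have "\<dots> = dX n a x \<oplus>\<^bsub>fobj (X n) a\<^esub> h n a s"
        using t' hom_inv[OF h rS rX a s] hom_closed[OF h a s] by (simp add: X.minus_eq)
      finally have "dX n a (x \<ominus>\<^bsub>fobj (X (Suc n)) a\<^esub> h (Suc n) a t') = \<zero>\<^bsub>fobj (X n) a\<^esub>" using e1
          by simp
      then obtain y where y: "y \<in> carrier (fobj (X (Suc (Suc n))) a)"
        "x \<ominus>\<^bsub>fobj (X (Suc n)) a\<^esub> h (Suc n) a t' = dX (Suc n) a y"
        using eX[OF a, of "x \<ominus>\<^bsub>fobj (X (Suc n)) a\<^esub> h (Suc n) a t'" n] x ht
            by (auto simp: rep_im_def)
      obtain w where w: "w \<in> carrier (fobj (E (Suc (Suc n))) a)" "p (Suc (Suc n)) a w = y"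
          "q (Suc (Suc n)) a w = t'"
        using mk[OF a y(1), of t'] t'(1) by (auto simp: S'S)
      have "D' (Suc n) a w = z"
      proof (rule biprod_eqI[OF b a hom_closed[OF D' a w(1)] z])
        show "p (Suc n) a (D' (Suc n) a w) = p (Suc n) a z"
          using pD[OF a w(1)] w x ht
              by (simp add: y(2)[symmetric] x_def[symmetric] X1.minus_eq X1.a_assoc X1.l_neg)
        show "q (Suc n) a (D' (Suc n) a w) = q (Suc n) a z"
          using qD[OF a w(1)] w t' s by (simp add: s_def[symmetric] S'S d'_def)
      qed
      then show "z \<in> rep_im (E (Suc (Suc n))) (D' (Suc n)) a" using w(1) by (auto simp: rep_im_def)
    next
      assume "z \<in> rep_im (E (Suc (Suc n))) (D' (Suc n)) a"
      then obtain w where w: "w \<in> carrier (fobj (E (Suc (Suc n))) a)" "z = D' (Suc n) a w"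
          by (auto simp: rep_im_def)
      define y where "y = p (Suc (Suc n)) a w"
      define t where "t = q (Suc (Suc n)) a w"
      have y: "y \<in> carrier (fobj (X (Suc (Suc n))) a)" unfolding y_def
          by (rule hom_closed[OF bD(4) a w(1)])
      have t: "t \<in> carrier (fobj (S (Suc n)) a)" unfolding t_def by (rule hom_closed[OF qS a w(1)])
      have xe: "x = dX (Suc n) a y \<oplus>\<^bsub>fobj (X (Suc n)) a\<^esub> h (Suc n) a t"
        using pD[OF a w(1)] w(2) by (simp add: x_def y_def t_def)
      have se: "s = \<ominus>\<^bsub>fobj (S n) a\<^esub> dS n a t"
        using qD[OF a w(1)] w(2) by (simp add: s_def t_def S'S d'_def)
      note c = hom_closed[OF dX a y] hom_closed[OF h a t] hom_closed[OF dS a t]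
      have "dX n a x = h n a (dS n a t)"
        using hom_add[OF dX a c(1,2)] dd[OF a y] hd[OF a t] hom_closed[OF h a c(3)]
            by (simp add: xe)
      then have 1: "dX n a x \<oplus>\<^bsub>fobj (X n) a\<^esub> h n a s = \<zero>\<^bsub>fobj (X n) a\<^esub>"
        using hom_inv[OF h rS rX a c(3)] hom_closed[OF h a c(3)] by (simp add: se X.r_neg)
      have "d' n a s = \<ominus>\<^bsub>fobj (S' n) a\<^esub> \<zero>\<^bsub>fobj (S' n) a\<^esub>"
        using hom_inv[OF d' rS rS' a c(3)] ddS[OF a t] by (simp add: se)
      then have "\<ominus>\<^bsub>fobj (S' n) a\<^esub> d' n a s = \<zero>\<^bsub>fobj (S' n) a\<^esub>" by simp
      with 1 show "D' n a z = \<zero>\<^bsub>fobj (E n) a\<^esub>" using D0 by simp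
    qed
  qed
  show "rep_hom (S n) (S' n) (d' n)" by (rule d')
  have "cone_of X dX S' d' h E D' i j p q"
    unfolding cone_of_def using b D' pD qD by blast
  then show "\<exists>E D' i j p q. cone_of X dX S' d' h E D' i j p q \<and> (\<forall>n. good Y (E n)) \<and>
      rep_surj (E 1) (E 0) (D' 0) \<and>
      (\<forall>n. \<forall>a\<in>Obj D. \<forall>z\<in>carrier (fobj (E (Suc n)) a).
        D' n a z = \<zero>\<^bsub>fobj (E n) a\<^esub> \<longleftrightarrow> z \<in> rep_im (E (Suc (Suc n))) (D' (Suc n)) a)"
    using gE surj exact by blast
qed


section \<open>Resolutions and chain maps between them\<close>

text \<open>The terms are arbitrary modules, so that a projective resolution over
  \<open>C/I\<close>, restricted to \<open>C\<close>, is still of this form.\<close>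

definition resolves ::
  "('o, 'm, 'k, 'v) rep \<Rightarrow> (nat \<Rightarrow> ('o, 'm, 'k, 'v) rep) \<Rightarrow> (nat \<Rightarrow> 'o \<Rightarrow> 'v \<Rightarrow> 'v) \<Rightarrow> ('o \<Rightarrow> 'v \<Rightarrow> 'v) \<Rightarrow>
      bool" where
  "resolves A X d e \<longleftrightarrow> is_rep A \<and> (\<forall>n. is_rep (X n)) \<and> (\<forall>n. rep_hom (X (Suc n)) (X n) (d n)) \<and>
     rep_hom (X 0) A e \<and> rep_surj (X 0) A e \<and>
     (\<forall>n. \<forall>a\<in>Obj D. \<forall>x\<in>carrier (fobj (X (Suc n)) a).
        d n a x = \<zero>\<^bsub>fobj (X n) a\<^esub> \<longleftrightarrow> x \<in> rep_im (X (Suc (Suc n))) (d (Suc n)) a) \<and>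
     (\<forall>a\<in>Obj D. \<forall>x\<in>carrier (fobj (X 0) a). e a x = \<zero>\<^bsub>fobj A a\<^esub> \<longleftrightarrow> x \<in> rep_im (X 1) (d 0) a)"

lemma resolvesD:
  assumes "resolves A X d e"
  shows "is_rep A" "\<And>n. is_rep (X n)" "\<And>n. rep_hom (X (Suc n)) (X n) (d n)"
    "rep_hom (X 0) A e" "rep_surj (X 0) A e"
    "\<And>n a x. a \<in> Obj D \<Longrightarrow> x \<in> carrier (fobj (X (Suc n)) a) \<Longrightarrow>
        d n a x = \<zero>\<^bsub>fobj (X n) a\<^esub> \<longleftrightarrow> x \<in> rep_im (X (Suc (Suc n))) (d (Suc n)) a"
    "\<And>a x. a \<in> Obj D \<Longrightarrow> x \<in> carrier (fobj (X 0) a) \<Longrightarrow>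
        e a x = \<zero>\<^bsub>fobj A a\<^esub> \<longleftrightarrow> x \<in> rep_im (X 1) (d 0) a"
  using assms unfolding resolves_def by blast+

lemma resolves_dd:
  assumes r: "resolves A X d e" and a: "a \<in> Obj D"
  shows "x \<in> carrier (fobj (X (Suc (Suc n))) a) \<Longrightarrow> d n a (d (Suc n) a x) = \<zero>\<^bsub>fobj (X n) a\<^esub>"
    and "y \<in> carrier (fobj (X 1) a) \<Longrightarrow> e a (d 0 a y) = \<zero>\<^bsub>fobj A a\<^esub>"
proof -
  show "d n a (d (Suc n) a x) = \<zero>\<^bsub>fobj (X n) a\<^esub>" if "x \<in> carrier (fobj (X (Suc (Suc n))) a)"
    using resolvesD(6)[OF r a hom_closed[OF resolvesD(3)[OF r] a that]] that
        by (auto simp: rep_im_def)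
  show "e a (d 0 a y) = \<zero>\<^bsub>fobj A a\<^esub>" if "y \<in> carrier (fobj (X 1) a)"
    using resolvesD(7)[OF r a, of "d 0 a y"] hom_closed[OF resolvesD(3)[OF r, of 0] a, of y] that
    by (auto simp: rep_im_def)
qed

definition chain_map ::
  "('o, 'm, 'k, 'v) rep \<Rightarrow> (nat \<Rightarrow> ('o, 'm, 'k, 'v) rep) \<Rightarrow> (nat \<Rightarrow> 'o \<Rightarrow> 'v \<Rightarrow> 'v) \<Rightarrow> ('o \<Rightarrow> 'v \<Rightarrow> 'v) \<Rightarrow>
   (nat \<Rightarrow> ('o, 'm, 'k, 'v) rep) \<Rightarrow> (nat \<Rightarrow> 'o \<Rightarrow> 'v \<Rightarrow> 'v) \<Rightarrow> ('o \<Rightarrow> 'v \<Rightarrow> 'v) \<Rightarrow> (nat \<Rightarrow> 'o \<Rightarrow> 'v \<Rightarrow> 'v) \<Rightarrow>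
       bool" where
  "chain_map A S dS aS X dX aX h \<longleftrightarrow> (\<forall>n. rep_hom (S n) (X n) (h n)) \<and>
     (\<forall>a\<in>Obj D. \<forall>x\<in>carrier (fobj (S 0) a). aX a (h 0 a x) = aS a x) \<and>
     (\<forall>n. \<forall>a\<in>Obj D. \<forall>x\<in>carrier (fobj (S (Suc n)) a). dX n a (h (Suc n) a x) = h n a (dS n a x))"

text \<open>Both halves are read off from the exactness of \<open>Hom(-, Y)\<close> on the cone of
  \<open>h\<close>: the first is surjectivity and the second injectivity of the map that
  \<open>h\<close> induces on cohomology. In degree 0 there are no coboundaries, whence the case
  distinctions.\<close>

lemma good_comparison:
  fixes X S :: "nat \<Rightarrow> ('o, 'm, 'k, 'v) rep" and A Y :: "('o, 'm, 'k, 'v) rep"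
  assumes inf: "infinite (UNIV :: 'v set)" and Y: "is_rep Y"
    and X: "resolves A X dX aX" "\<And>n. good Y (X n)"
    and S: "resolves A S dS aS" "\<And>n. rep_proj (S n)"
    and h: "chain_map A S dS aS X dX aX h"
  shows
    "\<And>n f. rep_hom (S n) Y f \<Longrightarrow>
       (\<And>a x. a \<in> Obj D \<Longrightarrow> x \<in> carrier (fobj (S (Suc n)) a) \<Longrightarrow> f a (dS n a x) = \<zero>\<^bsub>fobj Y a\<^esub>) \<Longrightarrow>
       \<exists>g. rep_hom (X n) Y g \<and>
         (\<forall>a\<in>Obj D. \<forall>x\<in>carrier (fobj (X (Suc n)) a). g a (dX n a x) = \<zero>\<^bsub>fobj Y a\<^esub>) \<and>
         (case n of 0 \<Rightarrow> \<forall>a\<in>Obj D. \<forall>x\<in>carrier (fobj (S 0) a). f a x = g a (h 0 a x)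
          | Suc m \<Rightarrow> \<exists>u. rep_hom (S m) Y u \<and>
              (\<forall>a\<in>Obj D. \<forall>x\<in>carrier (fobj (S n) a). f a x = g a (h n a x) \<ominus>\<^bsub>fobj Y a\<^esub> u a (dS m a
                  x)))"
    and "\<And>n g. rep_hom (X n) Y g \<Longrightarrow>
       (\<And>a x. a \<in> Obj D \<Longrightarrow> x \<in> carrier (fobj (X (Suc n)) a) \<Longrightarrow> g a (dX n a x) = \<zero>\<^bsub>fobj Y a\<^esub>) \<Longrightarrow>
       (case n of 0 \<Rightarrow> \<forall>a\<in>Obj D. \<forall>x\<in>carrier (fobj (S 0) a). g a (h 0 a x) = \<zero>\<^bsub>fobj Y a\<^esub>
          | Suc m \<Rightarrow> \<exists>u. rep_hom (S m) Y u \<and>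
              (\<forall>a\<in>Obj D. \<forall>x\<in>carrier (fobj (S n) a). g a (h n a x) = u a (dS m a x))) \<Longrightarrow>
       (case n of 0 \<Rightarrow> \<forall>a\<in>Obj D. \<forall>x\<in>carrier (fobj (X 0) a). g a x = \<zero>\<^bsub>fobj Y a\<^esub>
          | Suc m \<Rightarrow> \<exists>v. rep_hom (X m) Y v \<and>
              (\<forall>a\<in>Obj D. \<forall>x\<in>carrier (fobj (X n) a). g a x = v a (dX m a x)))"
proof -
  note rX = resolvesD[OF X(1)] and rS = resolvesD[OF S(1)]
  have hh: "\<And>n. rep_hom (S n) (X n) (h n)"
    "\<And>a x. a \<in> Obj D \<Longrightarrow> x \<in> carrier (fobj (S 0) a) \<Longrightarrow> aX a (h 0 a x) = aS a x"
    "\<And>n a x. a \<in> Obj D \<Longrightarrow> x \<in> carrier (fobj (S (Suc n)) a) \<Longrightarrow> dX n a (h (Suc n) a x) =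
        h n a (dS n a x)"
    using h unfolding chain_map_def by blast+
  define S' where "S' = (\<lambda>n. case n of 0 \<Rightarrow> subrep (S 0) (\<lambda>a. {\<zero>\<^bsub>fobj (S 0) a\<^esub>}) | Suc m \<Rightarrow> S m)"
  define d' where "d' = (\<lambda>n. case n of 0 \<Rightarrow> (\<lambda>a x. \<zero>\<^bsub>fobj (S 0) a\<^esub>) | Suc m \<Rightarrow> dS m)"
  note cone = mapping_cone[OF inf Y rX(1) X(2) S(2) rX(3) rS(3) rX(4) rS(4,5) rX(6,7) rS(6,7) hh
      S'_def d'_def]
  have d': "rep_hom (S n) (S' n) (d' n)" for n by (rule cone(1))
  obtain E D' i j p q where C: "cone_of X dX S' d' h E D' i j p q" and gE: "\<And>n. good Y (E n)"
    and sE: "rep_surj (E 1) (E 0) (D' 0)"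
    and eE: "\<And>n a z. a \<in> Obj D \<Longrightarrow> z \<in> carrier (fobj (E (Suc n)) a) \<Longrightarrow>
      D' n a z = \<zero>\<^bsub>fobj (E n) a\<^esub> \<longleftrightarrow> z \<in> rep_im (E (Suc (Suc n))) (D' (Suc n)) a"
    using cone(2) by blast
  note b = cone_ofD(1)[OF C] and D' = cone_ofD(2)[OF C] and pD = cone_ofD(3)[OF C]
      and qD = cone_ofD(4)[OF C]
  have acyclic: "case n of
      0 \<Rightarrow> \<forall>a\<in>Obj D. \<forall>x\<in>carrier (fobj (E 0) a). f a x = \<zero>\<^bsub>fobj Y a\<^esub>
    | Suc m \<Rightarrow> \<exists>g. rep_hom (E m) Y g \<and> (\<forall>a\<in>Obj D. \<forall>x\<in>carrier (fobj (E n) a). f a x = g a (D' m a x))"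
    if f: "rep_hom (E n) Y f"
      and fd: "\<And>a x. a \<in> Obj D \<Longrightarrow> x \<in> carrier (fobj (E (Suc n)) a) \<Longrightarrow> f a (D' n a x) = \<zero>\<^bsub>fobj Y a\<^esub>"
    for n f
    by (rule good_exact_complex[OF gE Y D' sE _ f]) (use eE fd in blast)+
  note bD = biprodD[OF b]
  have S'S: "S' (Suc n) = S n" for n by (simp add: S'_def)
  have jS: "rep_hom (S n) (E (Suc n)) (j (Suc n))" for n using bD(3)[of "Suc n"] by (simp add: S'S)
  have qS: "rep_hom (E (Suc n)) (S n) (q (Suc n))" for n using bD(5)[of "Suc n"] by (simp add: S'S)
  have rS': "is_rep (S' n)" for n
    using is_rep_subrep[OF rS(2) is_subrep_zero[OF rS(2)]] rS(2)
        by (simp add: S'_def split: nat.split)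
  \<comment> \<open>The inclusions \<open>i\<close> embed \<open>X\<close> as a subcomplex of the
    cone, whereas for \<open>j\<close> a term from \<open>h\<close> appears.\<close>
  have Di: "D' n a (i (Suc n) a x) = i n a (dX n a x)"
    if a: "a \<in> Obj D" and x: "x \<in> carrier (fobj (X (Suc n)) a)" for n a x
  proof -
    interpret X: module K "fobj (X n) a" by (rule rep_module[OF rX(2) a])
    interpret S': module K "fobj (S' n) a" by (rule rep_module[OF rS' a])
    note ix = hom_closed[OF bD(2) a x] and dx = hom_closed[OF rX(3) a x]
    show ?thesis
      by (rule biprod_eqI[OF b a hom_closed[OF D' a ix] hom_closed[OF bD(2) a dx]])
        (use a x dx ix in \<open>simp_all add: pD qD bD(6,7) S'S hom_zero[OF hh(1) rS(2) rX(2)]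
          hom_zero[OF d' rS(2) rS']\<close>)
  qed
  have Dj: "D' n a (j (Suc n) a s) =
      i n a (h n a s) \<oplus>\<^bsub>fobj (E n) a\<^esub> j n a (\<ominus>\<^bsub>fobj (S' n) a\<^esub> d' n a s)"
    if a: "a \<in> Obj D" and s: "s \<in> carrier (fobj (S n) a)" for n a s
  proof -
    interpret X: module K "fobj (X n) a" by (rule rep_module[OF rX(2) a])
    interpret S': module K "fobj (S' n) a" by (rule rep_module[OF rS' a])
    have s1: "s \<in> carrier (fobj (S' (Suc n)) a)" using s by (simp add: S'S)
    note c = hom_closed[OF jS a s] hom_closed[OF hh(1) a s] hom_closed[OF d' a s]
    have "p n a (D' n a (j (Suc n) a s)) = h n a s"
      using pD[OF a c(1)] a c s1 by (simp add: bD(8,9) hom_zero[OF rX(3) rX(2) rX(2)])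
    moreover have "q n a (D' n a (j (Suc n) a s)) = \<ominus>\<^bsub>fobj (S' n) a\<^esub> d' n a s"
      using qD[OF a c(1)] a c s1 by (simp add: bD(8,9))
    ultimately show ?thesis
      using bD(10)[OF a hom_closed[OF D' a c(1)]] by simp
  qed
  show "\<exists>g. rep_hom (X n) Y g \<and>
         (\<forall>a\<in>Obj D. \<forall>x\<in>carrier (fobj (X (Suc n)) a). g a (dX n a x) = \<zero>\<^bsub>fobj Y a\<^esub>) \<and>
         (case n of 0 \<Rightarrow> \<forall>a\<in>Obj D. \<forall>x\<in>carrier (fobj (S 0) a). f a x = g a (h 0 a x)
          | Suc m \<Rightarrow> \<exists>u. rep_hom (S m) Y u \<and>
              (\<forall>a\<in>Obj D. \<forall>x\<in>carrier (fobj (S n) a). f a x = g a (h n a x) \<ominus>\<^bsub>fobj Y a\<^esub> u a (dS m a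
                  x)))"
    if f: "rep_hom (S n) Y f"
      and fd: "\<And>a x. a \<in> Obj D \<Longrightarrow> x \<in> carrier (fobj (S (Suc n)) a) \<Longrightarrow> f a (dS n a x) = \<zero>\<^bsub>fobj Y a\<^esub>"
          for n f
  proof -
    \<comment> \<open>A cocycle on \<open>S n\<close> becomes, through \<open>q\<close>, a cocycle
      on the cone one degree higher. The components \<open>g\<close> and \<open>u\<close> of its
      primitive \<open>G\<close> are the ones wanted: evaluation on \<open>i\<close> gives the
      cocycle condition for \<open>g\<close>, and evaluation on \<open>j\<close> gives
      \<open>f = g h - u d'\<close>.\<close>
    have F: "rep_hom (E (Suc n)) Y (\<lambda>a z. f a (q (Suc n) a z))" by (rule hom_comp[OF qS f])
    have "f a (q (Suc n) a (D' (Suc n) a z)) = \<zero>\<^bsub>fobj Y a\<^esub>"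
      if a: "a \<in> Obj D" and z: "z \<in> carrier (fobj (E (Suc (Suc n))) a)" for a z
    proof -
      interpret Y: module K "fobj Y a" by (rule rep_module[OF Y a])
      show ?thesis
        using qD[OF a z] hom_inv[OF f rS(2) Y a hom_closed[OF rS(3) a hom_closed[OF qS a z]]]
          fd[OF a hom_closed[OF qS a z]]
        by (simp add: S'S d'_def)
    qed
    with acyclic[OF F] obtain G where G: "rep_hom (E n) Y G"
      "\<And>a z. a \<in> Obj D \<Longrightarrow> z \<in> carrier (fobj (E (Suc n)) a) \<Longrightarrow> f a (q (Suc n) a z) = G a (D' n a z)"
      by auto
    define g where "g = (\<lambda>a x. G a (i n a x))"
    define u where "u = (\<lambda>a x. G a (j n a x))"
    have g: "rep_hom (X n) Y g" unfolding g_def by (rule hom_comp[OF bD(2) G(1)])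
    have u: "rep_hom (S' n) Y u" unfolding u_def by (rule hom_comp[OF bD(3) G(1)])
    have gd: "g a (dX n a x) = \<zero>\<^bsub>fobj Y a\<^esub>" if a: "a \<in> Obj D"
        and x: "x \<in> carrier (fobj (X (Suc n)) a)" for a x
      using G(2)[OF a hom_closed[OF bD(2) a x]] Di[OF a x] bD(7)[OF a x] hom_zero[OF f rS(2) Y a]
      by (simp add: g_def S'S)
    have fe: "f a s = g a (h n a s) \<ominus>\<^bsub>fobj Y a\<^esub> u a (d' n a s)"
      if a: "a \<in> Obj D" and s: "s \<in> carrier (fobj (S n) a)" for a s
    proof -
      interpret Y: module K "fobj Y a" by (rule rep_module[OF Y a])
      interpret S': module K "fobj (S' n) a" by (rule rep_module[OF rS' a])
      note c = hom_closed[OF hh(1) a s] hom_closed[OF d' a s]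
      have "f a s = G a (D' n a (j (Suc n) a s))"
        using G(2)[OF a hom_closed[OF jS a s]] bD(8)[OF a, of s "Suc n"] s by (simp add: S'S)
      also have "\<dots> = g a (h n a s) \<oplus>\<^bsub>fobj Y a\<^esub> u a (\<ominus>\<^bsub>fobj (S' n) a\<^esub> d' n a s)"
        unfolding Dj[OF a s] g_def u_def using c
        by (intro hom_add[OF G(1) a]) (auto intro: hom_closed[OF bD(2) a] hom_closed[OF bD(3) a])
      finally show ?thesis
        using hom_inv[OF u rS' Y a c(2)] by (simp add: Y.minus_eq)
    qed
    show ?thesis
    proof (cases n)
      case 0
      have "f a x = g a (h 0 a x)" if a: "a \<in> Obj D" and x: "x \<in> carrier (fobj (S 0) a)" for a x
      proof -
        interpret Y: module K "fobj Y a" by (rule rep_module[OF Y a])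
        have "u a \<zero>\<^bsub>fobj (S 0) a\<^esub> = \<zero>\<^bsub>fobj Y a\<^esub>"
          using hom_zero[OF u rS' Y a] 0 by (simp add: S'_def)
        then show ?thesis
          using fe[OF a] x 0 hom_closed[OF g a hom_closed[OF hh(1) a]]
          by (simp add: d'_def Y.minus_zero_right)
      qed
      then show ?thesis using g gd 0 by auto
    next
      case (Suc m)
      have "rep_hom (S m) Y u" using u Suc by (simp add: S'S)
      then show ?thesis using g gd fe Suc by (auto simp: d'_def)
    qed
  qed
  show "case n of 0 \<Rightarrow> \<forall>a\<in>Obj D. \<forall>x\<in>carrier (fobj (X 0) a). g a x = \<zero>\<^bsub>fobj Y a\<^esub>
          | Suc m \<Rightarrow> \<exists>v. rep_hom (X m) Y v \<and>
              (\<forall>a\<in>Obj D. \<forall>x\<in>carrier (fobj (X n) a). g a x = v a (dX m a x))"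
    if g: "rep_hom (X n) Y g"
      and gd: "\<And>a x. a \<in> Obj D \<Longrightarrow> x \<in> carrier (fobj (X (Suc n)) a) \<Longrightarrow> g a (dX n a x) = \<zero>\<^bsub>fobj Y a\<^esub>"
      and c: "case n of 0 \<Rightarrow> \<forall>a\<in>Obj D. \<forall>x\<in>carrier (fobj (S 0) a). g a (h 0 a x) = \<zero>\<^bsub>fobj Y a\<^esub>
          | Suc m \<Rightarrow> \<exists>u. rep_hom (S m) Y u \<and>
              (\<forall>a\<in>Obj D. \<forall>x\<in>carrier (fobj (S n) a). g a (h n a x) = u a (dS m a x))" for n g
  proof -
    \<comment> \<open>With \<open>S'\<close> and \<open>d'\<close> the two cases take one form; in
      degree 0 the map \<open>u\<close> is zero, on the zero module.\<close>
    have "\<exists>u. rep_hom (S' n) Y u \<and> (\<forall>a\<in>Obj D. \<forall>x\<in>carrier (fobj (S n) a). g a (h n a x) =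
        u a (d' n a x))"
    proof (cases n)
      case 0
      then show ?thesis
        using c hom_zero_map[OF rS' Y, of 0] by auto
    next
      case (Suc m)
      then show ?thesis using c by (simp add: S'S d'_def)
    qed
    then obtain u where u: "rep_hom (S' n) Y u"
      "\<And>a x. a \<in> Obj D \<Longrightarrow> x \<in> carrier (fobj (S n) a) \<Longrightarrow> g a (h n a x) = u a (d' n a x)"
      by blast
    \<comment> \<open>The relation \<open>g h = u d'\<close> makes the pair of \<open>g\<close> and
      \<open>u\<close> a cocycle on the cone, the sign in \<open>D'\<close> cancelling the two
      terms. Its primitive, restricted along \<open>i\<close>, shows that \<open>g\<close> is a
      coboundary; in degree 0 the cocycle itself is zero.\<close>
    define F where "F = (\<lambda>a z. g a (p n a z) \<oplus>\<^bsub>fobj Y a\<^esub> u a (q n a z))"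
    have F: "rep_hom (E n) Y F"
      unfolding F_def by (rule hom_plus[OF bD(1) Y hom_comp[OF bD(4) g] hom_comp[OF bD(5) u(1)]])
    have FD: "F a (D' n a z) = \<zero>\<^bsub>fobj Y a\<^esub>" if a: "a \<in> Obj D"
        and z: "z \<in> carrier (fobj (E (Suc n)) a)" for a z
    proof -
      interpret Y: module K "fobj Y a" by (rule rep_module[OF Y a])
      note x = hom_closed[OF bD(4) a z] and s = hom_closed[OF qS a z]
      note c = hom_closed[OF rX(3) a x] hom_closed[OF hh(1) a s] hom_closed[OF d' a s]
      have "F a (D' n a z) = g a (h n a (q (Suc n) a z)) \<oplus>\<^bsub>fobj Y a\<^esub> \<ominus>\<^bsub>fobj Y a\<^esub> u a (d' n a (q
          (Suc n) a z))"
        unfolding F_def pD[OF a z] qD[OF a z]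
        using hom_add[OF g a c(1,2)] gd[OF a x] hom_inv[OF u(1) rS' Y a c(3)]
            hom_closed[OF g a c(2)] by simp
      then show ?thesis
        using u(2)[OF a s] hom_closed[OF u(1) a c(3)] by (simp add: Y.r_neg)
    qed
    have Fi: "F a (i n a x) = g a x" if a: "a \<in> Obj D" and x: "x \<in> carrier (fobj (X n) a)" for a x
    proof -
      interpret Y: module K "fobj Y a" by (rule rep_module[OF Y a])
      show ?thesis
        using bD(6,7)[OF a x] hom_zero[OF u(1) rS' Y a] hom_closed[OF g a x] by (simp add: F_def)
    qed
    show ?thesis
    proof (cases n)
      case 0
      then show ?thesis
        using acyclic[OF F FD] Fi hom_closed[OF bD(2)] by auto
    next
      case (Suc m)
      then obtain G where G: "rep_hom (E m) Y G"
        "\<And>a z. a \<in> Obj D \<Longrightarrow> z \<in> carrier (fobj (E n) a) \<Longrightarrow> F a z = G a (D' m a z)"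
        using acyclic[OF F FD] by auto
      have "g a x = G a (i m a (dX m a x))" if "a \<in> Obj D" "x \<in> carrier (fobj (X n) a)" for a x
        using G(2)[OF that(1) hom_closed[OF bD(2) that]] Fi[OF that] Di[of a x m] that Suc by simp
      then show ?thesis using hom_comp[OF bD(2) G(1)] Suc by auto
    qed
  qed
qed

text \<open>The usual inductive lifting: the source consists of projectives, while the target is
  only exact.\<close>

lemma chain_map_exists:
  fixes X S :: "nat \<Rightarrow> ('o, 'm, 'k, 'v) rep" and A :: "('o, 'm, 'k, 'v) rep"
  assumes X: "resolves A X dX aX" and S: "resolves A S dS aS" "\<And>n. rep_proj (S n)"
  shows "\<exists>h. chain_map A S dS aS X dX aX h"
proof -
  note rX = resolvesD[OF X(1)] and rS = resolvesD[OF S(1)]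
  \<comment> \<open>\<open>P n h\<close> is what the recursion must remember: it forces
    \<open>h a (dS n a x)\<close> to be a cycle, hence to lie in the image of \<open>dX n\<close>,
    so that the next component can be lifted.\<close>
  define P where "P = (\<lambda>n h. rep_hom (S n) (X n) h \<and>
    (\<forall>a\<in>Obj D. case n of
        0 \<Rightarrow> \<forall>x\<in>carrier (fobj (S 0) a). aX a (h a x) = aS a x
      | Suc m \<Rightarrow> \<forall>x\<in>carrier (fobj (S (Suc n)) a). dX m a (h a (dS n a x)) = \<zero>\<^bsub>fobj (X m) a\<^esub>))"
  obtain h0 where "rep_hom (S 0) (X 0) h0" "\<And>a x. a \<in> Obj D \<Longrightarrow> x \<in> carrier (fobj (S 0) a) \<Longrightarrow>
      aX a (h0 a x) = aS a x"
    by (rule proj_lift[OF S(2) rX(2) rX(1) rX(4,5) rS(4)]) blast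
  then have base: "\<exists>h. P 0 h" by (auto simp: P_def)
  have step: "\<exists>h'. P (Suc n) h' \<and> (\<forall>a\<in>Obj D. \<forall>x\<in>carrier (fobj (S (Suc n)) a). dX n a (h' a x) =
      h a (dS n a x))"
    if Ph: "P n h" for n h
  proof -
    have h: "rep_hom (S n) (X n) h" using Ph by (simp add: P_def)
    have "h a (dS n a x) \<in> rep_im (X (Suc n)) (dX n) a"
      if a: "a \<in> Obj D" and x: "x \<in> carrier (fobj (S (Suc n)) a)" for a x
    proof (cases n)
      case 0
      have "aX a (h a (dS 0 a x)) = \<zero>\<^bsub>fobj A a\<^esub>"
        using Ph a x 0 resolves_dd(2)[OF S(1) a, of x] hom_closed[OF rS(3), of a x 0]
            by (simp add: P_def)
      then show ?thesis
        using rX(7)[OF a, of "h a (dS 0 a x)"] hom_closed[OF h a hom_closed[OF rS(3) a x]] 0 by simp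
    next
      case (Suc m)
      then show ?thesis
        using Ph a x rX(6)[OF a, of "h a (dS n a x)" m] hom_closed[OF h a hom_closed[OF rS(3) a x]]
        by (simp add: P_def)
    qed
    then obtain h' where h': "rep_hom (S (Suc n)) (X (Suc n)) h'"
      "\<And>a x. a \<in> Obj D \<Longrightarrow> x \<in> carrier (fobj (S (Suc n)) a) \<Longrightarrow> dX n a (h' a x) = h a (dS n a x)"
      using proj_lift_im[OF S(2) rX(2) rX(2) rX(3) hom_comp[OF rS(3) h]] by metis
    moreover have "P (Suc n) h'"
      unfolding P_def
      using h' hom_closed[OF rS(3)] resolves_dd(1)[OF S(1)] hom_zero[OF h rS(2) rX(2)] by simp
    ultimately show ?thesis by blast
  qed
  obtain h where "\<And>n. P n (h n)"
    "\<And>n. \<forall>a\<in>Obj D. \<forall>x\<in>carrier (fobj (S (Suc n)) a). dX n a (h (Suc n) a x) = h n a (dS n a x)"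
    using dependent_nat_choice[of P "\<lambda>n h h'. \<forall>a\<in>Obj D. \<forall>x\<in>carrier (fobj (S (Suc n)) a).
        dX n a (h' a x) = h a (dS n a x)"]
      base step by metis
  moreover from this(1) have "\<And>n. rep_hom (S n) (X n) (h n)"
    "\<forall>a\<in>Obj D. \<forall>x\<in>carrier (fobj (S 0) a). aX a (h 0 a x) = aS a x"
    using \<open>P 0 (h 0)\<close> unfolding P_def by auto
  ultimately show ?thesis unfolding chain_map_def by blast
qed

text \<open>Iterated covers: \<open>M n\<close> is the n-th syzygy, and the cover of
  \<open>M (Suc n)\<close>, a submodule of \<open>X n\<close>, serves unchanged as the
  differential.\<close>

lemma resolution_exists:
  fixes A :: "('o, 'm, 'k, 'v) rep"
  assumes enough: "\<And>M :: ('o, 'm, 'k, 'v) rep. is_rep M \<Longrightarrow>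
      \<exists>(Q :: ('o, 'm, 'k, 'v) rep) p. rep_proj Q \<and> rep_hom Q M p \<and> rep_surj Q M p"
    and A: "is_rep A"
  shows "\<exists>(X :: nat \<Rightarrow> ('o, 'm, 'k, 'v) rep) d e. resolves A X d e \<and> (\<forall>n. rep_proj (X n))"
proof -
  define ok where "ok = (\<lambda>M (T :: ('o, 'm, 'k, 'v) rep \<times> ('o \<Rightarrow> 'v \<Rightarrow> 'v)).
    rep_proj (fst T) \<and> rep_hom (fst T) M (snd T) \<and> rep_surj (fst T) M (snd T))"
  define cov where "cov = (\<lambda>M. SOME T. ok M T)"
  have cov: "ok M (cov M)" if "is_rep M" for M
  proof -
    obtain Q :: "('o, 'm, 'k, 'v) rep" and p where "rep_proj Q" "rep_hom Q M p" "rep_surj Q M p"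
        using enough[OF \<open>is_rep M\<close>] by blast
    then have "ok M (Q, p)" by (simp add: ok_def)
    then show ?thesis unfolding cov_def by (rule someI)
  qed
  define M where "M = rec_nat A (\<lambda>_ M. subrep (fst (cov M)) (rep_ker (fst (cov M)) M (snd (cov
      M))))"
  have M0: "M 0 = A" and MS: "\<And>n. M (Suc n) = subrep (fst (cov (M n))) (rep_ker (fst (cov (M n)))
      (M n) (snd (cov (M n))))"
    by (simp_all add: M_def)
  define X where "X = (\<lambda>n. fst (cov (M n)))"
  define p where "p = (\<lambda>n. snd (cov (M n)))"
  have rM: "is_rep (M n)" for n
  proof (induction n)
    case (Suc n)
    have "is_subrep (fst (cov (M n))) (rep_ker (fst (cov (M n))) (M n) (snd (cov (M n))))"
      using cov[OF Suc] by (intro is_subrep_ker Suc) (auto simp: ok_def proj_rep)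
    then show ?case
      unfolding MS using cov[OF Suc] by (intro is_rep_subrep) (auto simp: ok_def proj_rep)
  qed (simp add: M0 A)
  have X: "rep_proj (X n)" "rep_hom (X n) (M n) (p n)" "rep_surj (X n) (M n) (p n)" for n
    using cov[OF rM, of n] by (auto simp: ok_def X_def p_def)
  have MS: "M (Suc n) = subrep (X n) (rep_ker (X n) (M n) (p n))" for n
    by (simp add: MS X_def p_def)
  have sub: "is_subrep (X n) (rep_ker (X n) (M n) (p n))" for n
    by (rule is_subrep_ker[OF proj_rep[OF X(1)] rM X(2)])
  have zM: "\<zero>\<^bsub>fobj (M (Suc n)) a\<^esub> = \<zero>\<^bsub>fobj (X n) a\<^esub>" for n a
    by (simp add: MS)
  have im: "x \<in> carrier (fobj (X n) a) \<Longrightarrow> p n a x = \<zero>\<^bsub>fobj (M n) a\<^esub> \<longleftrightarrow>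
      x \<in> rep_im (X (Suc n)) (p (Suc n)) a"
    if a: "a \<in> Obj D" for n a x
    using X(3)[of "Suc n"] hom_closed[OF X(2)[of "Suc n"] a] a
    unfolding rep_surj_def by (auto simp: MS rep_ker_def rep_im_def)
  have "resolves A X (\<lambda>n. p (Suc n)) (p 0)"
    unfolding resolves_def
  proof (intro conjI allI ballI A)
    show "rep_hom (X (Suc n)) (X n) (p (Suc n))" for n
      using X(2)[of "Suc n"] hom_from_subrep_to[OF _ sub] by (simp add: MS)
    show "p (Suc n) a x = \<zero>\<^bsub>fobj (X n) a\<^esub> \<longleftrightarrow> x \<in> rep_im (X (Suc (Suc n))) (p (Suc (Suc n))) a"
      if "a \<in> Obj D" "x \<in> carrier (fobj (X (Suc n)) a)" for n a x
      using im[OF that] zM by simp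
    show "p 0 a x = \<zero>\<^bsub>fobj A a\<^esub> \<longleftrightarrow> x \<in> rep_im (X 1) (p (Suc 0)) a"
      if "a \<in> Obj D" "x \<in> carrier (fobj (X 0) a)" for a x
      using im[OF that] M0 by simp
  qed (use X[of 0] M0 X(1) proj_rep in auto)
  then show ?thesis using X(1) by blast
qed

end

section \<open>The categorical notions in the functor category\<close>

lemma VectCat_simps:
  "Obj (VectCat K) = {V. module K V}"
  "Hom (VectCat K) V W = {f \<in> extensional (carrier V). linear_map K V W f}"
  "Cmp (VectCat K) U V W g f = compose (carrier U) g f"
  "Idn (VectCat K) V = (\<lambda>x\<in>carrier V. x)"
  "carrier (HomK (VectCat K) V W) = {f \<in> extensional (carrier V). linear_map K V W f}"
  "\<zero>\<^bsub>HomK (VectCat K) V W\<^esub> = (\<lambda>x\<in>carrier V. \<zero>\<^bsub>W\<^esub>)"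
  "f \<oplus>\<^bsub>HomK (VectCat K) V W\<^esub> g = (\<lambda>x\<in>carrier V. f x \<oplus>\<^bsub>W\<^esub> g x)"
  "r \<odot>\<^bsub>HomK (VectCat K) V W\<^esub> f = (\<lambda>x\<in>carrier V. r \<odot>\<^bsub>W\<^esub> f x)"
  by (simp_all add: VectCat_def mk_module_def Let_def)

lemma ModCat_simps:
  "Obj (ModCat K D) = {M. linear_functor K D (VectCat K) M}"
  "Hom (ModCat K D) = nat_trans D (VectCat K)"
  "Cmp (ModCat K D) L M N s t = (\<lambda>a\<in>Obj D. compose (carrier (fobj L a)) (s a) (t a))"
  "carrier (HomK (ModCat K D) M N) = nat_trans D (VectCat K) M N"
  "\<zero>\<^bsub>HomK (ModCat K D) M N\<^esub> = (\<lambda>a\<in>Obj D. \<lambda>x\<in>carrier (fobj M a). \<zero>\<^bsub>fobj N a\<^esub>)"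
  "s \<oplus>\<^bsub>HomK (ModCat K D) M N\<^esub> t = (\<lambda>a\<in>Obj D. \<lambda>x\<in>carrier (fobj M a). s a x \<oplus>\<^bsub>fobj N a\<^esub> t a x)"
  "r \<odot>\<^bsub>HomK (ModCat K D) M N\<^esub> t = (\<lambda>a\<in>Obj D. \<lambda>x\<in>carrier (fobj M a). r \<odot>\<^bsub>fobj N a\<^esub> t a x)"
  by (simp_all add: ModCat_def FunCat_def mk_module_def VectCat_simps)

context linear_cat
begin

text \<open>The normal form of a family of maps, fixed off the carriers as the arrows of
  \<open>ModCat\<close> require; arrows are then equal as soon as they agree on elements.\<close>

definition ext_hom :: "('o, 'm, 'k, 'v) rep \<Rightarrow> ('o \<Rightarrow> 'v \<Rightarrow> 'w) \<Rightarrow> 'o \<Rightarrow> 'v \<Rightarrow> 'w" where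
  "ext_hom M t = (\<lambda>a\<in>Obj D. \<lambda>x\<in>carrier (fobj M a). t a x)"

text \<open>The corresponding normal form for the action of arrows: objects of \<open>ModCat\<close>
  have extensional maps \<open>farr\<close>, which submodules and pushed modules lack in
  general.\<close>

definition ext_rep :: "('o, 'm, 'k, 'v) rep \<Rightarrow> ('o, 'm, 'k, 'v) rep" where
  "ext_rep M = M\<lparr>farr := \<lambda>a b f. \<lambda>x\<in>carrier (fobj M a). farr M a b f x\<rparr>"

lemma ext_hom_apply [simp]:
  "a \<in> Obj D \<Longrightarrow> x \<in> carrier (fobj M a) \<Longrightarrow> ext_hom M t a x = t a x"
  by (simp add: ext_hom_def)

lemma ext_hom_eqI:
  assumes "\<And>a x. a \<in> Obj D \<Longrightarrow> x \<in> carrier (fobj M a) \<Longrightarrow> s a x = t a x"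
  shows "ext_hom M s = ext_hom M t"
  unfolding ext_hom_def using assms by (intro restrict_ext) auto

lemma ext_hom_eq_iff:
  "ext_hom M s = ext_hom M t \<longleftrightarrow> (\<forall>a\<in>Obj D. \<forall>x\<in>carrier (fobj M a). s a x = t a x)"
  using ext_hom_eqI ext_hom_apply by metis

lemma Obj_ModCat_iff:
  "M \<in> Obj (ModCat K D) \<longleftrightarrow> is_rep M \<and>
     (\<forall>a\<in>Obj D. \<forall>b\<in>Obj D. \<forall>f\<in>Hom D a b. farr M a b f \<in> extensional (carrier (fobj M a)))"
    (is "?L \<longleftrightarrow> ?R")
proof
  assume L: ?L
  then have fn: "is_functor D (VectCat K) M"
    and lin: "\<And>a b. a \<in> Obj D \<Longrightarrow> b \<in> Obj D \<Longrightarrow>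
      linear_map K (HomK D a b) (HomK (VectCat K) (fobj M a) (fobj M b)) (farr M a b)"
    by (auto simp: ModCat_simps linear_functor_def)
  show ?R
    unfolding is_rep_def
  proof (intro conjI ballI)
    fix a assume a: "a \<in> Obj D"
    show "module K (fobj M a)" using fn a by (simp add: is_functor_def VectCat_simps)
    show "farr M a a (Idn D a) x = x" if "x \<in> carrier (fobj M a)" for x
      using fn a that by (simp add: is_functor_def VectCat_simps)
    fix b assume b: "b \<in> Obj D"
    note l = lin[OF a b]
    show "linear_map K (fobj M a) (fobj M b) (farr M a b f)"
        "farr M a b f \<in> extensional (carrier (fobj M a))"
      if "f \<in> Hom D a b" for f
      using fn a b that by (simp_all add: is_functor_def VectCat_simps)
    show "farr M a b (f \<oplus>\<^bsub>HomK D a b\<^esub> g) x = farr M a b f x \<oplus>\<^bsub>fobj M b\<^esub> farr M a b g x"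
      if "f \<in> Hom D a b" "g \<in> Hom D a b" "x \<in> carrier (fobj M a)" for f g x
      using linear_map_add[OF l, of f g] that a b by (simp add: carrier_HomK VectCat_simps)
    show "farr M a b (r \<odot>\<^bsub>HomK D a b\<^esub> f) x = r \<odot>\<^bsub>fobj M b\<^esub> farr M a b f x"
      if "r \<in> carrier K" "f \<in> Hom D a b" "x \<in> carrier (fobj M a)" for r f x
      using linear_map_smult[OF l, of r f] that a b by (simp add: carrier_HomK VectCat_simps)
    show "farr M a c (Cmp D a b c g f) x = farr M b c g (farr M a b f x)"
      if "c \<in> Obj D" "f \<in> Hom D a b" "g \<in> Hom D b c" "x \<in> carrier (fobj M a)" for c f g x
      using fn a b that by (simp add: is_functor_def VectCat_simps compose_def)
  qed
next
  assume R: ?R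
  then have r: "is_rep M" and e: "\<And>a b f. a \<in> Obj D \<Longrightarrow> b \<in> Obj D \<Longrightarrow> f \<in> Hom D a b \<Longrightarrow>
    farr M a b f \<in> extensional (carrier (fobj M a))" by auto
  have "farr M a a (Idn D a) = (\<lambda>x\<in>carrier (fobj M a). x)" if "a \<in> Obj D" for a
    by (rule extensionalityI[OF e[OF that that Idn_closed[OF that]]]) (auto simp:
        rep_arr_id[OF r that])
  moreover have "farr M a c (Cmp D a b c g f) = compose (carrier (fobj M a)) (farr M b c g) (farr
      M a b f)"
    if h: "a \<in> Obj D" "b \<in> Obj D" "c \<in> Obj D" "f \<in> Hom D a b" "g \<in> Hom D b c" for a b c f g
    by (rule extensionalityI[OF e[OF h(1,3) Cmp_closed[OF h]]])
      (auto simp: compose_def rep_arr_comp[OF r h])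
  ultimately have "is_functor D (VectCat K) M"
    unfolding is_functor_def VectCat_simps
    using r e by (simp add: rep_module rep_arr_linear)
  moreover have "linear_map K (HomK D a b) (HomK (VectCat K) (fobj M a) (fobj M b)) (farr M a b)"
    if h: "a \<in> Obj D" "b \<in> Obj D" for a b
    unfolding linear_map_def[of K "HomK D a b"] VectCat_simps carrier_HomK[OF h]
  proof (intro conjI ballI)
    show "farr M a b (f \<oplus>\<^bsub>HomK D a b\<^esub> g) = (\<lambda>x\<in>carrier (fobj M a). farr M a b f x \<oplus>\<^bsub>fobj M b\<^esub> farr
        M a b g x)"
      if "f \<in> Hom D a b" "g \<in> Hom D a b" for f g
      by (rule extensionalityI[OF e[OF h Hom_add_closed[OF h that]]]) (auto simp:
          rep_arr_plus[OF r h that])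
    show "farr M a b (k \<odot>\<^bsub>HomK D a b\<^esub> f) = (\<lambda>x\<in>carrier (fobj M a). k \<odot>\<^bsub>fobj M b\<^esub> farr M a b f x)"
      if "k \<in> carrier K" "f \<in> Hom D a b" for k f
      by (rule extensionalityI[OF e[OF h Hom_smult_closed[OF h that]]]) (auto simp:
          rep_arr_scale[OF r h that])
  qed (use e h rep_arr_linear[OF r] in auto)
  ultimately show ?L by (simp add: ModCat_simps linear_functor_def)
qed

lemma Obj_ModCat_rep: "M \<in> Obj (ModCat K D) \<Longrightarrow> is_rep M"
  by (simp add: Obj_ModCat_iff)

lemma Hom_ModCat_iff:
  assumes M: "is_rep M" and N: "N \<in> Obj (ModCat K D)"
  shows "t \<in> Hom (ModCat K D) M N \<longleftrightarrow> rep_hom M N t \<and> t = ext_hom M t"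
proof -
  note rN = Obj_ModCat_rep[OF N]
  have ext: "t = ext_hom M t"
      if "t \<in> extensional (Obj D)" "\<And>a. a \<in> Obj D \<Longrightarrow> t a \<in> extensional (carrier (fobj M a))" for t
    using that by (auto simp: ext_hom_def fun_eq_iff extensional_def restrict_def)
  show ?thesis
  proof
    assume t: "t \<in> Hom (ModCat K D) M N"
    then have 1: "t \<in> extensional (Obj D)"
      "\<And>a. a \<in> Obj D \<Longrightarrow> t a \<in> extensional (carrier (fobj M a)) \<and>
          linear_map K (fobj M a) (fobj N a) (t a)"
      by (auto simp: ModCat_simps nat_trans_def VectCat_simps PiE_def Pi_def)
    have "t b (farr M a b f x) = farr N a b f (t a x)"
      if "a \<in> Obj D" "b \<in> Obj D" "f \<in> Hom D a b" "x \<in> carrier (fobj M a)" for a b f x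
    proof -
      have "compose (carrier (fobj M a)) (t b) (farr M a b f) =
          compose (carrier (fobj M a)) (farr N a b f) (t a)"
        using t that by (simp add: ModCat_simps nat_trans_def VectCat_simps)
      from fun_cong[OF this, of x] show ?thesis using that by (simp add: compose_def)
    qed
    moreover have "t = ext_hom M t" using 1 by (intro ext) auto
    ultimately show "rep_hom M N t \<and> t = ext_hom M t"
      using 1 by (auto simp: rep_hom_def)
  next
    assume t: "rep_hom M N t \<and> t = ext_hom M t"
    have e: "t \<in> extensional (Obj D)" "\<And>a. a \<in> Obj D \<Longrightarrow> t a \<in> extensional (carrier (fobj M a))"
      by (subst conjunct2[OF t], simp add: ext_hom_def)+
    then show "t \<in> Hom (ModCat K D) M N"
      using t unfolding ModCat_simps nat_trans_def VectCat_simps PiE_def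
      by (auto simp: hom_linear hom_nat compose_def intro!: restrict_ext)
  qed
qed

lemma ext_hom_in_Hom:
  assumes M: "is_rep M" and N: "N \<in> Obj (ModCat K D)" and t: "rep_hom M N t"
  shows "ext_hom M t \<in> Hom (ModCat K D) M N"
  unfolding Hom_ModCat_iff[OF M N]
  using hom_cong[OF t M, of "ext_hom M t"] by (auto intro!: ext_hom_eqI)

lemma Hom_ModCat_hom:
  assumes "is_rep M" "N \<in> Obj (ModCat K D)" "t \<in> Hom (ModCat K D) M N"
  shows "rep_hom M N t"
  using assms Hom_ModCat_iff by blast

lemma Hom_ModCat_eqI:
  assumes "is_rep M" "N \<in> Obj (ModCat K D)" "s \<in> Hom (ModCat K D) M N" "t \<in> Hom (ModCat K D) M N"
    and "\<And>a x. a \<in> Obj D \<Longrightarrow> x \<in> carrier (fobj M a) \<Longrightarrow> s a x = t a x"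
  shows "s = t"
  using assms ext_hom_eqI[of M s t] Hom_ModCat_iff by metis

lemma Cmp_ModCat:
  "Cmp (ModCat K D) L M N s t = ext_hom L (\<lambda>a x. s a (t a x))"
  by (simp add: ModCat_simps ext_hom_def compose_def)

lemma zero_ModCat:
  "\<zero>\<^bsub>HomK (ModCat K D) M N\<^esub> = ext_hom M (\<lambda>a x. \<zero>\<^bsub>fobj N a\<^esub>)"
  by (simp add: ModCat_simps ext_hom_def)

lemma ext_rep_simps [simp]:
  "fobj (ext_rep M) = fobj M"
  "x \<in> carrier (fobj M a) \<Longrightarrow> farr (ext_rep M) a b f x = farr M a b f x"
  by (simp_all add: ext_rep_def)

lemma is_rep_ext_rep [simp]: "is_rep (ext_rep M) \<longleftrightarrow> is_rep M"
proof -
  have "linear_map K (fobj M a) (fobj M b) (farr (ext_rep M) a b f) \<longleftrightarrow>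
      linear_map K (fobj M a) (fobj M b) (farr M a b f)" if "module K (fobj M a)" for a b f
  proof -
    interpret module K "fobj M a" by fact
    show ?thesis by (auto simp: linear_map_def Pi_def)
  qed
  then have lin: "(\<forall>a\<in>Obj D. module K (fobj M a)) \<Longrightarrow>
    (\<forall>a\<in>Obj D. \<forall>b\<in>Obj D. \<forall>f\<in>Hom D a b. linear_map K (fobj M a) (fobj M b) (farr (ext_rep M) a b
        f)) \<longleftrightarrow>
    (\<forall>a\<in>Obj D. \<forall>b\<in>Obj D. \<forall>f\<in>Hom D a b. linear_map K (fobj M a) (fobj M b) (farr M a b f))"
    by blast
  show ?thesis
  proof
    assume r: "is_rep M"
    show "is_rep (ext_rep M)"
      unfolding is_rep_def
      using r lin by (auto simp: rep_module rep_arr_linear rep_arr_closed rep_arr_id rep_arr_comp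
          rep_arr_plus rep_arr_scale)
  next
    assume r: "is_rep (ext_rep M)"
    have m: "\<forall>a\<in>Obj D. module K (fobj M a)" using rep_module[OF r] by simp
    have l: "\<forall>a\<in>Obj D. \<forall>b\<in>Obj D. \<forall>f\<in>Hom D a b. linear_map K (fobj M a) (fobj M b) (farr M a b f)"
      using lin[OF m] rep_arr_linear[OF r] by simp
    then have c: "farr M a b f x \<in> carrier (fobj M b)"
      if "a \<in> Obj D" "b \<in> Obj D" "f \<in> Hom D a b" "x \<in> carrier (fobj M a)" for a b f x
      using that by (meson linear_map_closed)
    show "is_rep M"
      unfolding is_rep_def
      using m l c rep_arr_id[OF r] rep_arr_comp[OF r] rep_arr_plus[OF r] rep_arr_scale[OF r] by simp
  qed
qed

lemma ext_rep_in_Obj: "is_rep M \<Longrightarrow> ext_rep M \<in> Obj (ModCat K D)"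
  by (simp add: Obj_ModCat_iff) (simp add: ext_rep_def)

lemma hom_ext_rep [simp]:
  "rep_hom (ext_rep M) N t \<longleftrightarrow> rep_hom M N t"
  by (auto simp: rep_hom_def)

lemma hom_to_ext_rep [simp]:
  assumes "is_rep N"
  shows "rep_hom M (ext_rep N) t \<longleftrightarrow> rep_hom M N t"
proof -
  have "linear_map K (fobj M a) (fobj N a) (t a) \<Longrightarrow> x \<in> carrier (fobj M a) \<Longrightarrow>
      farr (ext_rep N) a b f (t a x) = farr N a b f (t a x)" for a b f x
    by (simp add: linear_map_closed)
  then show ?thesis unfolding rep_hom_def by auto
qed

lemma surj_ext_rep [simp]:
  "rep_surj (ext_rep M) N t \<longleftrightarrow> rep_surj M N t"
  "rep_surj M (ext_rep N) t \<longleftrightarrow> rep_surj M N t"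
  by (auto simp: rep_surj_def)

lemma surj_ext_hom [simp]: "rep_surj M N (ext_hom M t) \<longleftrightarrow> rep_surj M N t"
  by (auto simp: rep_surj_def)

text \<open>The projection onto the quotient by the image and the zero map agree after
  \<open>t\<close>, so for an epimorphism they are equal and the quotient vanishes.
  \<open>quotient_rep\<close> keeps this test object inside \<open>'v\<close>.\<close>

lemma is_epi_ModCat_iff:
  fixes M N :: "('o, 'm, 'k, 'v) rep"
  shows "is_epi (ModCat K D) M N t \<longleftrightarrow> M \<in> Obj (ModCat K D) \<and> N \<in> Obj (ModCat K D) \<and>
     t \<in> Hom (ModCat K D) M N \<and> rep_surj M N t"
proof
  assume epi: "is_epi (ModCat K D) M N t"
  then have M: "M \<in> Obj (ModCat K D)" and N: "N \<in> Obj (ModCat K D)"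
      and t: "t \<in> Hom (ModCat K D) M N"
    and uni: "\<And>x u v. x \<in> Obj (ModCat K D) \<Longrightarrow> u \<in> Hom (ModCat K D) N x \<Longrightarrow> v \<in> Hom (ModCat K D) N x \<Longrightarrow>
      Cmp (ModCat K D) M N x u t = Cmp (ModCat K D) M N x v t \<Longrightarrow> u = v"
    by (auto simp: is_epi_def)
  note rM = Obj_ModCat_rep[OF M] and rN = Obj_ModCat_rep[OF N]
  note ht = Hom_ModCat_hom[OF rM N t]
  obtain Q :: "('o, 'm, 'k, 'v) rep" and e where Q: "is_rep Q" "rep_hom N Q e" "rep_surj N Q e"
    "\<And>a x. a \<in> Obj D \<Longrightarrow> x \<in> carrier (fobj N a) \<Longrightarrow> e a x = \<zero>\<^bsub>fobj Q a\<^esub> \<longleftrightarrow> x \<in> rep_im M t a"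
    using quotient_rep[OF rN is_subrep_im[OF rM rN ht]] by metis
  have e': "rep_hom N (ext_rep Q) e" "rep_hom N (ext_rep Q) (\<lambda>a x. \<zero>\<^bsub>fobj Q a\<^esub>)"
    using Q hom_zero_map[OF rN Q(1)] by simp_all
  have "ext_hom N e = ext_hom N (\<lambda>a x. \<zero>\<^bsub>fobj Q a\<^esub>)"
  proof (rule uni[OF ext_rep_in_Obj[OF Q(1)]])
    show "ext_hom N e \<in> Hom (ModCat K D) N (ext_rep Q)"
      "ext_hom N (\<lambda>a x. \<zero>\<^bsub>fobj Q a\<^esub>) \<in> Hom (ModCat K D) N (ext_rep Q)"
      using e' ext_rep_in_Obj[OF Q(1)] rN by (auto intro: ext_hom_in_Hom)
    show "Cmp (ModCat K D) M N (ext_rep Q) (ext_hom N e) t =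
      Cmp (ModCat K D) M N (ext_rep Q) (ext_hom N (\<lambda>a x. \<zero>\<^bsub>fobj Q a\<^esub>)) t"
      unfolding Cmp_ModCat by (rule ext_hom_eqI) (auto simp: hom_closed[OF ht] Q(4) rep_im_def)
  qed
  then have "e a x = \<zero>\<^bsub>fobj Q a\<^esub>" if "a \<in> Obj D" "x \<in> carrier (fobj N a)" for a x
    using that unfolding ext_hom_eq_iff by blast
  then have "rep_surj M N t"
    unfolding rep_surj_def using Q(4) by (auto simp: rep_im_def)
  then show "M \<in> Obj (ModCat K D) \<and> N \<in> Obj (ModCat K D) \<and> t \<in> Hom (ModCat K D) M N \<and>
      rep_surj M N t"
    using M N t by blast
next
  assume a: "M \<in> Obj (ModCat K D) \<and> N \<in> Obj (ModCat K D) \<and> t \<in> Hom (ModCat K D) M N \<and>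
      rep_surj M N t"
  then have rN: "is_rep N" by (simp add: Obj_ModCat_rep)
  show "is_epi (ModCat K D) M N t"
    unfolding is_epi_def
  proof (intro conjI ballI impI)
    fix x u v assume x: "x \<in> Obj (ModCat K D)" and u: "u \<in> Hom (ModCat K D) N x"
        and v: "v \<in> Hom (ModCat K D) N x"
      and eq: "Cmp (ModCat K D) M N x u t = Cmp (ModCat K D) M N x v t"
    show "u = v"
    proof (rule Hom_ModCat_eqI[OF rN x u v])
      fix b y assume "b \<in> Obj D" "y \<in> carrier (fobj N b)"
      then show "u b y = v b y"
        using a eq unfolding Cmp_ModCat ext_hom_eq_iff rep_surj_def by metis
    qed
  qed (use a in auto)
qed

text \<open>Epimorphisms are the surjections, so both sides express the same lifting property; what
  remains is to pass between families of maps and their normal forms.\<close>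

lemma projective_ModCat_iff:
  fixes Q :: "('o, 'm, 'k, 'v) rep"
  shows "projective (ModCat K D) Q \<longleftrightarrow> Q \<in> Obj (ModCat K D) \<and> rep_proj Q"
proof
  assume pr: "projective (ModCat K D) Q"
  then have Q: "Q \<in> Obj (ModCat K D)" by (simp add: projective_def)
  note rQ = Obj_ModCat_rep[OF Q]
  have "rep_proj Q"
    unfolding rep_proj_def
  proof (intro conjI allI impI rQ; elim conjE)
    fix M N :: "('o, 'm, 'k, 'v) rep" and g f
    assume M: "is_rep M" and N: "is_rep N" and g: "rep_hom M N g" "rep_surj M N g"
        and f: "rep_hom Q N f"
    have "is_epi (ModCat K D) (ext_rep M) (ext_rep N) (ext_hom (ext_rep M) g)"
      unfolding is_epi_ModCat_iff using M N g by (auto intro!: ext_rep_in_Obj ext_hom_in_Hom)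
    moreover have "ext_hom Q f \<in> Hom (ModCat K D) Q (ext_rep N)"
      using N f rQ by (auto intro!: ext_rep_in_Obj ext_hom_in_Hom)
    ultimately obtain h where h: "h \<in> Hom (ModCat K D) Q (ext_rep M)"
      "Cmp (ModCat K D) Q (ext_rep M) (ext_rep N) (ext_hom (ext_rep M) g) h = ext_hom Q f"
      using pr unfolding projective_def by meson
    have hh: "rep_hom Q M h"
      using Hom_ModCat_hom[OF rQ ext_rep_in_Obj[OF M] h(1)] M by simp
    moreover have "\<forall>a\<in>Obj D. \<forall>x\<in>carrier (fobj Q a). g a (h a x) = f a x"
      using h(2) hom_closed[OF hh] unfolding Cmp_ModCat ext_hom_eq_iff by auto
    ultimately show "\<exists>h. rep_hom Q M h \<and> (\<forall>a\<in>Obj D. \<forall>x\<in>carrier (fobj Q a). g a (h a x) = f a x)"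
        by blast
  qed
  with Q show "Q \<in> Obj (ModCat K D) \<and> rep_proj Q" by blast
next
  assume a: "Q \<in> Obj (ModCat K D) \<and> rep_proj Q"
  then have Q: "Q \<in> Obj (ModCat K D)" and rQ: "is_rep Q" by (auto simp: Obj_ModCat_rep)
  show "projective (ModCat K D) Q"
    unfolding projective_def
  proof (intro conjI allI impI ballI Q)
    fix M N g f assume epi: "is_epi (ModCat K D) M N g" and f: "f \<in> Hom (ModCat K D) Q N"
    then have M: "M \<in> Obj (ModCat K D)" and N: "N \<in> Obj (ModCat K D)"
        and g: "g \<in> Hom (ModCat K D) M N" "rep_surj M N g"
      by (auto simp: is_epi_ModCat_iff)
    note rM = Obj_ModCat_rep[OF M] and rN = Obj_ModCat_rep[OF N]
    obtain h where h: "rep_hom Q M h" "\<And>a x. a \<in> Obj D \<Longrightarrow> x \<in> carrier (fobj Q a) \<Longrightarrow>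
        g a (h a x) = f a x"
      using proj_lift[OF conjunct2[OF a] rM rN Hom_ModCat_hom[OF rM N g(1)] g(2) Hom_ModCat_hom[OF
          rQ N f]] by metis
    have "Cmp (ModCat K D) Q M N g (ext_hom Q h) = ext_hom Q f"
      unfolding Cmp_ModCat by (rule ext_hom_eqI) (simp add: h)
    also have "\<dots> = f" using f Hom_ModCat_iff[OF rQ N] by metis
    finally show "\<exists>h\<in>Hom (ModCat K D) Q M. Cmp (ModCat K D) Q M N g h = f"
      using ext_hom_in_Hom[OF rQ M h(1)] by blast
  qed
qed

text \<open>\<open>exact_at\<close> speaks of some kernel of \<open>g\<close>. In one direction the
  universal property of that kernel is applied to the concrete submodule \<open>rep_ker\<close>; in
  the other this submodule is shown to be a kernel, with \<open>f\<close> itself as the induced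
  arrow.\<close>

lemma exact_at_ModCat_iff:
  fixes A B C :: "('o, 'm, 'k, 'v) rep"
  assumes A: "A \<in> Obj (ModCat K D)" and B: "B \<in> Obj (ModCat K D)" and C: "C \<in> Obj (ModCat K D)"
  shows "exact_at (ModCat K D) A B C f g \<longleftrightarrow> f \<in> Hom (ModCat K D) A B \<and> g \<in> Hom (ModCat K D) B C \<and>
     (\<forall>a\<in>Obj D. \<forall>x\<in>carrier (fobj B a). g a x = \<zero>\<^bsub>fobj C a\<^esub> \<longleftrightarrow> x \<in> rep_im A f a)"
proof -
  let ?M = "ModCat K D :: (('o, 'm, 'k, 'v) rep, 'o \<Rightarrow> 'v \<Rightarrow> 'v, 'k) kcat"
  note rA = Obj_ModCat_rep[OF A] and rB = Obj_ModCat_rep[OF B] and rC = Obj_ModCat_rep[OF C]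
  have ker: "is_subrep B (rep_ker B C g)" "is_rep (subrep B (rep_ker B C g))"
    "ext_rep (subrep B (rep_ker B C g)) \<in> Obj ?M"
    "ext_hom (subrep B (rep_ker B C g)) (\<lambda>a x. x) \<in> Hom ?M (ext_rep (subrep B (rep_ker B C g))) B"
    if g: "g \<in> Hom ?M B C" for g
  proof -
    show 1: "is_subrep B (rep_ker B C g)"
        by (rule is_subrep_ker[OF rB rC Hom_ModCat_hom[OF rB C g]])
    show 2: "is_rep (subrep B (rep_ker B C g))" by (rule is_rep_subrep[OF rB 1])
    then show 3: "ext_rep (subrep B (rep_ker B C g)) \<in> Obj ?M" by (rule ext_rep_in_Obj)
    have "ext_hom (ext_rep (subrep B (rep_ker B C g))) (\<lambda>a x. x) \<in> Hom ?M (ext_rep (subrep B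
        (rep_ker B C g))) B"
      using 1 2 by (intro ext_hom_in_Hom B) (auto intro: hom_restrict hom_id)
    then show "ext_hom (subrep B (rep_ker B C g)) (\<lambda>a x. x) \<in> Hom ?M (ext_rep (subrep B (rep_ker B
        C g))) B"
      by (simp add: ext_hom_def)
  qed
  show ?thesis
  proof
    assume ex: "exact_at ?M A B C f g"
    then obtain k m f' where f: "f \<in> Hom ?M A B" and g: "g \<in> Hom ?M B C"
      and gf: "Cmp ?M A B C g f = \<zero>\<^bsub>HomK ?M A C\<^esub>"
      and k: "is_kernel ?M k B C m g" and f': "is_epi ?M A k f'" and mf: "Cmp ?M A k B m f' = f"
      unfolding exact_at_def by blast
    have fx: "f a x = m a (f' a x)" if "a \<in> Obj D" "x \<in> carrier (fobj A a)" for a x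
      using that by (simp add: mf[symmetric] Cmp_ModCat)
    have kO: "k \<in> Obj ?M" using k by (simp add: is_kernel_def)
    let ?k0 = "subrep B (rep_ker B C g)"
    let ?u = "ext_hom ?k0 (\<lambda>a x. x)"
    have "Cmp ?M (ext_rep ?k0) B C g ?u = \<zero>\<^bsub>HomK ?M (ext_rep ?k0) C\<^esub>"
      unfolding Cmp_ModCat zero_ModCat by (rule ext_hom_eqI) (simp add: rep_ker_def)
    then obtain v where v: "v \<in> Hom ?M (ext_rep ?k0) k" "Cmp ?M (ext_rep ?k0) k B m v = ?u"
      using k ker(3,4)[OF g] unfolding is_kernel_def by meson
    have hv: "rep_hom ?k0 k v"
      using Hom_ModCat_hom[OF _ kO v(1)] ker(2)[OF g] by simp
    have mv: "m a (v a x) = x" if "a \<in> Obj D" "x \<in> carrier (fobj B a)" "g a x = \<zero>\<^bsub>fobj C a\<^esub>" for a x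
      using fun_cong[OF fun_cong[OF v(2), of a], of x] that
          by (simp add: Cmp_ModCat ext_hom_def rep_ker_def)
    have "g a x = \<zero>\<^bsub>fobj C a\<^esub> \<longleftrightarrow> x \<in> rep_im A f a" if a: "a \<in> Obj D"
        and x: "x \<in> carrier (fobj B a)" for a x
    proof
      assume z: "g a x = \<zero>\<^bsub>fobj C a\<^esub>"
      have "v a x \<in> carrier (fobj k a)"
        using hom_closed[OF hv a] x z by (simp add: rep_ker_def)
      then obtain y where "y \<in> carrier (fobj A a)" "f' a y = v a x"
        using f' a unfolding is_epi_ModCat_iff rep_surj_def by blast
      then show "x \<in> rep_im A f a" using fx[OF a] mv[OF a x z] by (force simp: rep_im_def)
    next
      assume "x \<in> rep_im A f a"
      then show "g a x = \<zero>\<^bsub>fobj C a\<^esub>"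
        using gf a unfolding Cmp_ModCat zero_ModCat ext_hom_eq_iff by (auto simp: rep_im_def)
    qed
    then show "f \<in> Hom ?M A B \<and> g \<in> Hom ?M B C \<and>
     (\<forall>a\<in>Obj D. \<forall>x\<in>carrier (fobj B a). g a x = \<zero>\<^bsub>fobj C a\<^esub> \<longleftrightarrow> x \<in> rep_im A f a)" using f g by blast
  next
    assume as: "f \<in> Hom ?M A B \<and> g \<in> Hom ?M B C \<and>
     (\<forall>a\<in>Obj D. \<forall>x\<in>carrier (fobj B a). g a x = \<zero>\<^bsub>fobj C a\<^esub> \<longleftrightarrow> x \<in> rep_im A f a)"
    then have f: "f \<in> Hom ?M A B" and g: "g \<in> Hom ?M B C"
      and e: "\<And>a x. a \<in> Obj D \<Longrightarrow> x \<in> carrier (fobj B a) \<Longrightarrow> g a x = \<zero>\<^bsub>fobj C a\<^esub> \<longleftrightarrow> x \<in> rep_im A f a"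
      by blast+
    note hf = Hom_ModCat_hom[OF rA B f]
    let ?k0 = "subrep B (rep_ker B C g)"
    let ?m = "ext_hom ?k0 (\<lambda>a x. x)"
    have gf: "g a (f a x) = \<zero>\<^bsub>fobj C a\<^esub>" if "a \<in> Obj D" "x \<in> carrier (fobj A a)" for a x
      using that e[OF that(1) hom_closed[OF hf that]] by (simp add: rep_im_def)
    have "is_kernel ?M (ext_rep ?k0) B C ?m g"
      unfolding is_kernel_def
    proof (intro conjI ballI impI)
      show "Cmp ?M (ext_rep ?k0) B C g ?m = \<zero>\<^bsub>HomK ?M (ext_rep ?k0) C\<^esub>"
        unfolding Cmp_ModCat zero_ModCat by (rule ext_hom_eqI) (simp add: rep_ker_def)
      fix X u assume X: "X \<in> Obj ?M" and u: "u \<in> Hom ?M X B"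
          and z: "Cmp ?M X B C g u = \<zero>\<^bsub>HomK ?M X C\<^esub>"
      note rX = Obj_ModCat_rep[OF X]
      note hu = Hom_ModCat_hom[OF rX B u]
      have "u a x \<in> rep_ker B C g a" if "a \<in> Obj D" "x \<in> carrier (fobj X a)" for a x
        using z that hom_closed[OF hu that] unfolding Cmp_ModCat zero_ModCat ext_hom_eq_iff
            by (auto simp: rep_ker_def)
      note uk = this
      have "rep_hom X (ext_rep ?k0) u"
        using hom_to_subrep[OF hu uk] ker(2)[OF g] by simp
      then have u': "u \<in> Hom ?M X (ext_rep ?k0)"
        using u Hom_ModCat_iff[OF rX B] Hom_ModCat_iff[OF rX ker(3)[OF g]] by blast
      show "\<exists>!v. v \<in> Hom ?M X (ext_rep ?k0) \<and> Cmp ?M X (ext_rep ?k0) B ?m v = u"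
      proof (rule ex1I[of _ u])
        have "Cmp ?M X (ext_rep ?k0) B ?m u = ext_hom X u"
          unfolding Cmp_ModCat using uk by (intro ext_hom_eqI) simp
        then show "u \<in> Hom ?M X (ext_rep ?k0) \<and> Cmp ?M X (ext_rep ?k0) B ?m u = u"
          using u' u Hom_ModCat_iff[OF rX B] by metis
      next
        fix v assume v: "v \<in> Hom ?M X (ext_rep ?k0) \<and> Cmp ?M X (ext_rep ?k0) B ?m v = u"
        show "v = u"
        proof (rule Hom_ModCat_eqI[OF rX ker(3)[OF g] _ u'])
          fix a x assume a: "a \<in> Obj D" "x \<in> carrier (fobj X a)"
          have "v a x \<in> carrier (fobj (ext_rep ?k0) a)"
            using hom_closed[OF Hom_ModCat_hom[OF rX ker(3)[OF g]] a] v by blast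
          then have "?m a (v a x) = v a x" using a by simp
          moreover have "?m a (v a x) = u a x"
            using fun_cong[OF fun_cong[OF conjunct2[OF v], of a], of x] a by (simp add: Cmp_ModCat)
          ultimately show "v a x = u a x" by simp
        qed (use v in blast)
      qed
    qed (use B C g ker[OF g] in auto)
    moreover have fk: "f a x \<in> rep_ker B C g a" if "a \<in> Obj D" "x \<in> carrier (fobj A a)" for a x
      using gf[OF that] hom_closed[OF hf that] by (simp add: rep_ker_def)
    have "rep_hom A (ext_rep ?k0) f"
      using hom_to_subrep[OF hf fk] ker(2)[OF g] by simp
    then have f': "f \<in> Hom ?M A (ext_rep ?k0)"
      using f Hom_ModCat_iff[OF rA B] Hom_ModCat_iff[OF rA ker(3)[OF g]] by blast
    moreover have "rep_surj A ?k0 f"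
      unfolding rep_surj_def using e by (auto simp: rep_ker_def rep_im_def)
    then have "is_epi ?M A (ext_rep ?k0) f"
      unfolding is_epi_ModCat_iff using A f' ker(3)[OF g] by simp
    moreover have "Cmp ?M A (ext_rep ?k0) B ?m f = ext_hom A f"
      unfolding Cmp_ModCat using fk by (intro ext_hom_eqI) simp
    then have "Cmp ?M A (ext_rep ?k0) B ?m f = f"
      using f Hom_ModCat_iff[OF rA B] by metis
    moreover have "Cmp ?M A B C g f = \<zero>\<^bsub>HomK ?M A C\<^esub>"
      unfolding Cmp_ModCat zero_ModCat by (rule ext_hom_eqI) (simp add: gf)
    ultimately show "exact_at ?M A B C f g"
      unfolding exact_at_def using f g by blast
  qed
qed

end

section \<open>Cosets and quotient spaces\<close>

lemma coset_mem_iff: "y \<in> S +>\<^bsub>V\<^esub> x \<longleftrightarrow> (\<exists>s\<in>S. y = s \<oplus>\<^bsub>V\<^esub> x)"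
  by (auto simp: a_r_coset_def')

lemma coset_eq_iff:
  assumes "module K V" "submodule S K V" "x \<in> carrier V" "y \<in> carrier V"
  shows "S +>\<^bsub>V\<^esub> x = S +>\<^bsub>V\<^esub> y \<longleftrightarrow> x \<ominus>\<^bsub>V\<^esub> y \<in> S"
proof -
  interpret V: module K V by fact
  have sub: "z \<in> carrier V" if "z \<in> S" for z using submodule_subset[OF assms(2) that] .
  have self: "z \<in> S +>\<^bsub>V\<^esub> z" if "z \<in> carrier V" for z
    unfolding coset_mem_iff using that submodule_zero[OF assms(2)] by (intro bexI[of _ "\<zero>\<^bsub>V\<^esub>"]) auto
  have le: "S +>\<^bsub>V\<^esub> v \<subseteq> S +>\<^bsub>V\<^esub> w" if d: "v \<ominus>\<^bsub>V\<^esub> w \<in> S" and v: "v \<in> carrier V"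
      and w: "w \<in> carrier V" for v w
  proof
    fix z assume "z \<in> S +>\<^bsub>V\<^esub> v"
    then obtain s where s: "s \<in> S" "z = s \<oplus>\<^bsub>V\<^esub> v" by (auto simp: coset_mem_iff)
    have "z = (s \<oplus>\<^bsub>V\<^esub> (v \<ominus>\<^bsub>V\<^esub> w)) \<oplus>\<^bsub>V\<^esub> w"
      using s sub v w by (simp add: V.minus_eq V.a_assoc V.l_neg)
    then show "z \<in> S +>\<^bsub>V\<^esub> w" using submodule_add[OF assms(2) s(1) d] by (auto simp: coset_mem_iff)
  qed
  have "y \<ominus>\<^bsub>V\<^esub> x = \<ominus>\<^bsub>V\<^esub> (x \<ominus>\<^bsub>V\<^esub> y)"
    using assms(3,4) by (simp add: V.minus_eq V.minus_add V.a_comm)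
  then have sym: "x \<ominus>\<^bsub>V\<^esub> y \<in> S \<Longrightarrow> y \<ominus>\<^bsub>V\<^esub> x \<in> S"
    using submodule_inv[OF assms(1,2)] by simp
  show ?thesis
  proof
    assume "S +>\<^bsub>V\<^esub> x = S +>\<^bsub>V\<^esub> y"
    then obtain s where s: "s \<in> S" "x = s \<oplus>\<^bsub>V\<^esub> y" using self[OF assms(3)]
        by (auto simp: coset_mem_iff)
    then have "x \<ominus>\<^bsub>V\<^esub> y = s" using sub assms(4) by (simp add: V.minus_eq V.a_assoc V.r_neg)
    then show "x \<ominus>\<^bsub>V\<^esub> y \<in> S" using s by simp
  qed (use le sym assms(3,4) in blast)
qed

lemma coset_minus_mem:
  assumes "module K V" "submodule S K V" "x \<in> carrier V" "y \<in> S +>\<^bsub>V\<^esub> x"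
  shows "y \<in> carrier V" "y \<ominus>\<^bsub>V\<^esub> x \<in> S"
proof -
  interpret V: module K V by fact
  obtain s where s: "s \<in> S" "y = s \<oplus>\<^bsub>V\<^esub> x" using assms(4) by (auto simp: coset_mem_iff)
  note c = submodule_subset[OF assms(2) s(1)]
  show "y \<in> carrier V" using s c assms(3) by simp
  show "y \<ominus>\<^bsub>V\<^esub> x \<in> S" using s c assms(3) by (simp add: V.minus_eq V.a_assoc V.r_neg)
qed

lemma coset_self:
  assumes "module K V" "submodule S K V" "x \<in> carrier V"
  shows "x \<in> S +>\<^bsub>V\<^esub> x"
proof -
  interpret V: module K V by fact
  show ?thesis
    unfolding coset_mem_iff using assms(3) submodule_zero[OF assms(2)]
    by (intro bexI[of _ "\<zero>\<^bsub>V\<^esub>"]) auto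
qed

text \<open>Operations on classes are defined as unions over all representatives; such a union
  collapses once the resulting class does not depend on the representative.\<close>

lemma UN_coset:
  assumes "module K V" "submodule S K V" "x \<in> carrier V" "\<And>y. y \<in> S +>\<^bsub>V\<^esub> x \<Longrightarrow> g y = g x"
  shows "(\<Union>y\<in>S +>\<^bsub>V\<^esub> x. g y) = g x"
  using coset_self[OF assms(1-3)] assms(4) by blast

lemma quot_module_simps:
  "carrier (quot_module V S) = (\<lambda>x. S +>\<^bsub>V\<^esub> x) ` carrier V"
  "\<zero>\<^bsub>quot_module V S\<^esub> = S"
  by (auto simp: quot_module_def mk_module_def A_RCOSETS_def')

lemma quot_module_add:
  assumes "module K V" "submodule S K V" "x \<in> carrier V" "y \<in> carrier V"
  shows "(S +>\<^bsub>V\<^esub> x) \<oplus>\<^bsub>quot_module V S\<^esub> (S +>\<^bsub>V\<^esub> y) = S +>\<^bsub>V\<^esub> (x \<oplus>\<^bsub>V\<^esub> y)"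
proof -
  interpret V: module K V by fact
  have "(S +>\<^bsub>V\<^esub> x) \<oplus>\<^bsub>quot_module V S\<^esub> (S +>\<^bsub>V\<^esub> y) = (S +>\<^bsub>V\<^esub> x) <+>\<^bsub>V\<^esub> (S +>\<^bsub>V\<^esub> y)"
    by (simp add: quot_module_def mk_module_def)
  also have "\<dots> = S +>\<^bsub>V\<^esub> (x \<oplus>\<^bsub>V\<^esub> y)"
  proof (intro equalityI subsetI)
    fix z assume "z \<in> (S +>\<^bsub>V\<^esub> x) <+>\<^bsub>V\<^esub> (S +>\<^bsub>V\<^esub> y)"
    then obtain s t where st: "s \<in> S" "t \<in> S" "z = (s \<oplus>\<^bsub>V\<^esub> x) \<oplus>\<^bsub>V\<^esub> (t \<oplus>\<^bsub>V\<^esub> y)"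
      by (auto simp: set_add_def' coset_mem_iff)
    then have "z = (s \<oplus>\<^bsub>V\<^esub> t) \<oplus>\<^bsub>V\<^esub> (x \<oplus>\<^bsub>V\<^esub> y)"
      using submodule_subset[OF assms(2)] assms(3,4) by (simp add: V.a_ac)
    then show "z \<in> S +>\<^bsub>V\<^esub> (x \<oplus>\<^bsub>V\<^esub> y)" using submodule_add[OF assms(2) st(1,2)]
        by (auto simp: coset_mem_iff)
  next
    fix z assume "z \<in> S +>\<^bsub>V\<^esub> (x \<oplus>\<^bsub>V\<^esub> y)"
    then obtain s where s: "s \<in> S" "z = s \<oplus>\<^bsub>V\<^esub> (x \<oplus>\<^bsub>V\<^esub> y)" by (auto simp: coset_mem_iff)
    then have "z = (s \<oplus>\<^bsub>V\<^esub> x) \<oplus>\<^bsub>V\<^esub> y"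
      using submodule_subset[OF assms(2)] assms(3,4) by (simp add: V.a_assoc)
    moreover have "s \<oplus>\<^bsub>V\<^esub> x \<in> S +>\<^bsub>V\<^esub> x" using s by (auto simp: coset_mem_iff)
    ultimately show "z \<in> (S +>\<^bsub>V\<^esub> x) <+>\<^bsub>V\<^esub> (S +>\<^bsub>V\<^esub> y)"
      using coset_self[OF assms(1,2,4)] by (auto simp: set_add_def')
  qed
  finally show ?thesis .
qed

lemma quot_module_smult:
  assumes "module K V" "submodule S K V" "r \<in> carrier K" "x \<in> carrier V"
  shows "r \<odot>\<^bsub>quot_module V S\<^esub> (S +>\<^bsub>V\<^esub> x) = S +>\<^bsub>V\<^esub> (r \<odot>\<^bsub>V\<^esub> x)"
proof -
  interpret V: module K V by fact
  have "S +>\<^bsub>V\<^esub> (r \<odot>\<^bsub>V\<^esub> y) = S +>\<^bsub>V\<^esub> (r \<odot>\<^bsub>V\<^esub> x)" if "y \<in> S +>\<^bsub>V\<^esub> x" for y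
  proof -
    note y = coset_minus_mem[OF assms(1,2,4) that]
    then show ?thesis
      using assms submodule_smult[OF assms(2,3) y(2)]
      by (subst coset_eq_iff[OF assms(1,2)]) (auto simp: V.smult_minus)
  qed
  then show ?thesis
    unfolding quot_module_def mk_module_def
    using UN_coset[OF assms(1,2,4), of "\<lambda>y. S +>\<^bsub>V\<^esub> (r \<odot>\<^bsub>V\<^esub> y)"] by simp
qed

text \<open>Meant for cocycles modulo coboundaries: a map that preserves and reflects coboundaries
  and is onto modulo them induces an isomorphism. The induced map is written as the union that
  occurs in \<open>Ext_map\<close>.\<close>

lemma linear_iso_quot_module:
  assumes V: "module K V" and W: "module K W" and f: "linear_map K V W f"
    and S: "submodule S K V" and T: "submodule T K W"
    and ST: "\<And>x. x \<in> S \<Longrightarrow> f x \<in> T"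
    and inj: "\<And>x. x \<in> carrier V \<Longrightarrow> f x \<in> T \<Longrightarrow> x \<in> S"
    and surj: "\<And>y. y \<in> carrier W \<Longrightarrow> \<exists>x\<in>carrier V. f x \<ominus>\<^bsub>W\<^esub> y \<in> T"
  shows "linear_iso K (quot_module V S) (quot_module W T) (\<lambda>X. \<Union>x\<in>X. T +>\<^bsub>W\<^esub> f x)"
proof -
  interpret V: module K V by fact
  interpret W: module K W by fact
  note fc = linear_map_closed[OF f]
  let ?F = "\<lambda>X. \<Union>x\<in>X. T +>\<^bsub>W\<^esub> f x"
  have F: "?F (S +>\<^bsub>V\<^esub> x) = T +>\<^bsub>W\<^esub> f x" if x: "x \<in> carrier V" for x
  proof (rule UN_coset[OF V S x, of "\<lambda>x. T +>\<^bsub>W\<^esub> f x"])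
    fix y assume "y \<in> S +>\<^bsub>V\<^esub> x"
    note y = coset_minus_mem[OF V S x this]
    show "T +>\<^bsub>W\<^esub> f y = T +>\<^bsub>W\<^esub> f x"
      using ST[OF y(2)] x y by (simp add: coset_eq_iff[OF W T] fc linear_map_minus[OF V W f])
  qed
  have "linear_map K (quot_module V S) (quot_module W T) ?F"
    unfolding linear_map_def
    by (auto simp: quot_module_simps F fc quot_module_add[OF V S] quot_module_add[OF W T]
        quot_module_smult[OF V S] quot_module_smult[OF W T] linear_map_add[OF f]
            linear_map_smult[OF f])
  moreover have "inj_on ?F (carrier (quot_module V S))"
  proof (rule inj_onI)
    fix X Y assume "X \<in> carrier (quot_module V S)" "Y \<in> carrier (quot_module V S)"
        and eq: "?F X = ?F Y"
    then obtain x y where x: "x \<in> carrier V" "X = S +>\<^bsub>V\<^esub> x" and y: "y \<in> carrier V" "Y = S +>\<^bsub>V\<^esub> y"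
      by (auto simp: quot_module_simps)
    have "f (x \<ominus>\<^bsub>V\<^esub> y) \<in> T"
      using eq F x y by (simp add: coset_eq_iff[OF W T] fc linear_map_minus[OF V W f])
    then have "x \<ominus>\<^bsub>V\<^esub> y \<in> S" using inj x y by simp
    then show "X = Y" using x y by (simp add: coset_eq_iff[OF V S])
  qed
  moreover have "?F ` carrier (quot_module V S) = carrier (quot_module W T)"
  proof (intro equalityI subsetI)
    fix Y assume "Y \<in> carrier (quot_module W T)"
    then obtain y where y: "y \<in> carrier W" "Y = T +>\<^bsub>W\<^esub> y" by (auto simp: quot_module_simps)
    obtain x where x: "x \<in> carrier V" "f x \<ominus>\<^bsub>W\<^esub> y \<in> T" using surj[OF y(1)] by blast
    then have "T +>\<^bsub>W\<^esub> f x = T +>\<^bsub>W\<^esub> y" using y(1) by (simp add: coset_eq_iff[OF W T] fc)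
    then have "Y = ?F (S +>\<^bsub>V\<^esub> x)" using F[OF x(1)] y by simp
    then show "Y \<in> ?F ` carrier (quot_module V S)" using x(1) by (auto simp: quot_module_simps)
  qed (auto simp: quot_module_simps F fc)
  ultimately show ?thesis by (simp add: linear_iso_def bij_betw_def)
qed

lemma coset_carrier_update [simp]: "S +>\<^bsub>V\<lparr>carrier := Z\<rparr>\<^esub> x = S +>\<^bsub>V\<^esub> x"
  by (simp add: a_r_coset_def')

lemma submodule_of_submodule:
  assumes V: "module K V" and Z: "submodule Z K V" and B: "submodule B K V" and "B \<subseteq> Z"
  shows "submodule B K (V\<lparr>carrier := Z\<rparr>)"
  using submodule.submodule_is_module[OF Z V] assms(4) submodule_zero[OF B] submodule_add[OF B]
    submodule_smult[OF B]
  by (intro submodule_smultI) auto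

section \<open>Hom spaces and cohomology in the functor category\<close>

context linear_cat
begin

lemma hom_scale:
  assumes M: "is_rep M" and rN: "is_rep N" and r: "r \<in> carrier K" and t: "rep_hom M N t"
  shows "rep_hom M N (\<lambda>a x. r \<odot>\<^bsub>fobj N a\<^esub> t a x)"
proof -
  have "linear_map K (fobj M a) (fobj N a) (\<lambda>x. r \<odot>\<^bsub>fobj N a\<^esub> t a x)" if a: "a \<in> Obj D" for a
  proof -
    interpret Na: module K "fobj N a" by (rule rep_module[OF rN a])
    show ?thesis
      using r hom_closed[OF t a]
      by (auto simp: linear_map_def hom_add[OF t a] hom_smult[OF t a] Na.smult_r_distr
          Na.smult_assoc1[symmetric] Na.R.m_comm)
  qed
  then show ?thesis
    using r by (auto simp: rep_hom_def[of M N "\<lambda>a x. r \<odot>\<^bsub>fobj N a\<^esub> t a x"] hom_nat[OF t]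
        rep_arr_smult[OF rN] hom_closed[OF t])
qed

lemma module_HomK_ModCat:
  assumes K: "cring K" and M: "is_rep M" and N: "N \<in> Obj (ModCat K D)"
  shows "module K (HomK (ModCat K D) M N)"
proof -
  let ?H = "HomK (ModCat K D) M N"
  note rN = Obj_ModCat_rep[OF N]
  have car: "t \<in> carrier ?H \<longleftrightarrow> rep_hom M N t \<and> t = ext_hom M t" for t
    using Hom_ModCat_iff[OF M N] by (simp add: ModCat_simps)
  have zero: "\<zero>\<^bsub>?H\<^esub> = ext_hom M (\<lambda>a x. \<zero>\<^bsub>fobj N a\<^esub>)" by (rule zero_ModCat)
  have add: "s \<oplus>\<^bsub>?H\<^esub> t = ext_hom M (\<lambda>a x. s a x \<oplus>\<^bsub>fobj N a\<^esub> t a x)" for s t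
    by (simp add: ModCat_simps ext_hom_def)
  have sm: "r \<odot>\<^bsub>?H\<^esub> t = ext_hom M (\<lambda>a x. r \<odot>\<^bsub>fobj N a\<^esub> t a x)" for r t
    by (simp add: ModCat_simps ext_hom_def)
  have ext: "ext_hom M t \<in> carrier ?H" if "rep_hom M N t" for t
    using ext_hom_in_Hom[OF M N that] by (simp add: ModCat_simps)
  have eqI: "ext_hom M s = t" if "t \<in> carrier ?H"
    "\<And>a x. a \<in> Obj D \<Longrightarrow> x \<in> carrier (fobj M a) \<Longrightarrow> s a x = t a x" for s t
    using that ext_hom_eqI[of M s t] unfolding car by metis
  have hc: "t a x \<in> carrier (fobj N a)" if "t \<in> carrier ?H" "a \<in> Obj D" "x \<in> carrier (fobj M a)"
      for t a x
    using that hom_closed[of M N t] by (simp add: car)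
  show ?thesis
  proof (rule moduleI[OF K])
    show "abelian_group ?H"
    proof (rule abelian_groupI)
      show "x \<oplus>\<^bsub>?H\<^esub> y \<in> carrier ?H" if "x \<in> carrier ?H" "y \<in> carrier ?H" for x y
        unfolding add using that by (intro ext hom_plus[OF M rN]) (auto simp: car)
      show "\<zero>\<^bsub>?H\<^esub> \<in> carrier ?H" unfolding zero by (intro ext hom_zero_map M rN)
      show "x \<oplus>\<^bsub>?H\<^esub> y \<oplus>\<^bsub>?H\<^esub> z = x \<oplus>\<^bsub>?H\<^esub> (y \<oplus>\<^bsub>?H\<^esub> z)"
        if "x \<in> carrier ?H" "y \<in> carrier ?H" "z \<in> carrier ?H" for x y z
        unfolding add using that
        by (intro ext_hom_eqI) (simp add: hc
            abelian_monoid.a_assoc[OF abelian_group.axioms(1)[OF rep_group[OF rN]]])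
      show "x \<oplus>\<^bsub>?H\<^esub> y = y \<oplus>\<^bsub>?H\<^esub> x" if "x \<in> carrier ?H" "y \<in> carrier ?H" for x y
        unfolding add using that
        by (intro ext_hom_eqI) (simp add: hc
            abelian_monoid.a_comm[OF abelian_group.axioms(1)[OF rep_group[OF rN]]])
      show "\<zero>\<^bsub>?H\<^esub> \<oplus>\<^bsub>?H\<^esub> x = x" if "x \<in> carrier ?H" for x
        unfolding add zero using that
        by (intro eqI) (simp_all add: hc
            abelian_monoid.l_zero[OF abelian_group.axioms(1)[OF rep_group[OF rN]]])
      show "\<exists>y\<in>carrier ?H. y \<oplus>\<^bsub>?H\<^esub> x = \<zero>\<^bsub>?H\<^esub>" if x: "x \<in> carrier ?H" for x
      proof (rule bexI[of _ "ext_hom M (\<lambda>a y. \<ominus>\<^bsub>fobj N a\<^esub> x a y)"])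
        show "ext_hom M (\<lambda>a y. \<ominus>\<^bsub>fobj N a\<^esub> x a y) \<in> carrier ?H"
          using x by (intro ext hom_uminus M rN) (simp add: car)
        show "ext_hom M (\<lambda>a y. \<ominus>\<^bsub>fobj N a\<^esub> x a y) \<oplus>\<^bsub>?H\<^esub> x = \<zero>\<^bsub>?H\<^esub>"
          unfolding add zero using x
          by (intro ext_hom_eqI) (simp add: hc abelian_group.l_neg[OF rep_group[OF rN]])
      qed
    qed
  next
    show "r \<odot>\<^bsub>?H\<^esub> x \<in> carrier ?H" if "r \<in> carrier K" "x \<in> carrier ?H" for r x
      unfolding sm using that by (intro ext hom_scale M rN) (auto simp: car)
    show "(r \<oplus>\<^bsub>K\<^esub> s) \<odot>\<^bsub>?H\<^esub> x = r \<odot>\<^bsub>?H\<^esub> x \<oplus>\<^bsub>?H\<^esub> s \<odot>\<^bsub>?H\<^esub> x"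
      if "r \<in> carrier K" "s \<in> carrier K" "x \<in> carrier ?H" for r s x
      unfolding sm add using that
      by (intro ext_hom_eqI) (simp add: hc module.smult_l_distr[OF rep_module[OF rN]])
    show "r \<odot>\<^bsub>?H\<^esub> (x \<oplus>\<^bsub>?H\<^esub> y) = r \<odot>\<^bsub>?H\<^esub> x \<oplus>\<^bsub>?H\<^esub> r \<odot>\<^bsub>?H\<^esub> y"
      if "r \<in> carrier K" "x \<in> carrier ?H" "y \<in> carrier ?H" for r x y
      unfolding sm add using that
      by (intro ext_hom_eqI) (simp add: hc module.smult_r_distr[OF rep_module[OF rN]])
    show "r \<otimes>\<^bsub>K\<^esub> s \<odot>\<^bsub>?H\<^esub> x = r \<odot>\<^bsub>?H\<^esub> (s \<odot>\<^bsub>?H\<^esub> x)"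
      if "r \<in> carrier K" "s \<in> carrier K" "x \<in> carrier ?H" for r s x
      unfolding sm using that
      by (intro ext_hom_eqI) (simp add: hc module.smult_assoc1[OF rep_module[OF rN]])
    show "\<one>\<^bsub>K\<^esub> \<odot>\<^bsub>?H\<^esub> x = x" if "x \<in> carrier ?H" for x
      unfolding sm using that
      by (intro eqI) (simp_all add: hc module.smult_one[OF rep_module[OF rN]])
  qed
qed

lemma minus_HomK_ModCat:
  assumes K: "cring K" and M: "is_rep M" and N: "N \<in> Obj (ModCat K D)"
    and s: "s \<in> Hom (ModCat K D) M N" and t: "t \<in> Hom (ModCat K D) M N"
  shows "s \<ominus>\<^bsub>HomK (ModCat K D) M N\<^esub> t = ext_hom M (\<lambda>a x. s a x \<ominus>\<^bsub>fobj N a\<^esub> t a x)"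
proof -
  let ?H = "HomK (ModCat K D) M N"
  interpret H: module K ?H by (rule module_HomK_ModCat[OF K M N])
  note rN = Obj_ModCat_rep[OF N]
  have car: "carrier ?H = Hom (ModCat K D) M N" by (simp add: ModCat_simps)
  have add: "s \<oplus>\<^bsub>?H\<^esub> t = ext_hom M (\<lambda>a x. s a x \<oplus>\<^bsub>fobj N a\<^esub> t a x)" for s t
    by (simp add: ModCat_simps ext_hom_def)
  let ?m = "ext_hom M (\<lambda>a x. \<ominus>\<^bsub>fobj N a\<^esub> t a x)"
  note hs = Hom_ModCat_hom[OF M N s] and ht = Hom_ModCat_hom[OF M N t]
  have m: "?m \<in> Hom (ModCat K D) M N"
    by (intro ext_hom_in_Hom hom_uminus M N rN ht)
  have "?m \<oplus>\<^bsub>?H\<^esub> t = \<zero>\<^bsub>?H\<^esub>"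
    unfolding add zero_ModCat
    by (rule ext_hom_eqI) (simp add: hom_closed[OF ht] abelian_group.l_neg[OF rep_group[OF rN]])
  then have "\<ominus>\<^bsub>?H\<^esub> t = ?m" using m t by (intro H.minus_equality) (simp_all add: car)
  then show ?thesis
    unfolding H.minus_eq add by (intro ext_hom_eqI) (simp add: a_minus_def)
qed

lemma cocycles_ModCat_iff:
  assumes R: "\<And>n. rterm R n \<in> Obj (ModCat K D)" and N: "N \<in> Obj (ModCat K D)"
  shows "f \<in> cocycles (ModCat K D) R N i \<longleftrightarrow> f \<in> Hom (ModCat K D) (rterm R i) N \<and>
    (\<forall>a\<in>Obj D. \<forall>x\<in>carrier (fobj (rterm R (Suc i)) a). f a (rdiff R i a x) = \<zero>\<^bsub>fobj N a\<^esub>)"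
  by (simp add: cocycles_def Cmp_ModCat zero_ModCat ext_hom_eq_iff)

text \<open>The primitive \<open>g\<close> is only asked to be a \<open>rep_hom\<close>, since
  \<open>ext_hom\<close> turns it into an arrow without changing its values on elements. This is the
  form that \<open>good_comparison\<close> delivers and consumes.\<close>

lemma coboundaries_ModCat_iff:
  assumes R: "\<And>n. rterm R n \<in> Obj (ModCat K D)" and N: "N \<in> Obj (ModCat K D)"
    and d: "\<And>n. rdiff R n \<in> Hom (ModCat K D) (rterm R (Suc n)) (rterm R n)"
  shows "f \<in> coboundaries (ModCat K D) R N i \<longleftrightarrow> f \<in> Hom (ModCat K D) (rterm R i) N \<and>
    (case i of 0 \<Rightarrow> \<forall>a\<in>Obj D. \<forall>x\<in>carrier (fobj (rterm R 0) a). f a x = \<zero>\<^bsub>fobj N a\<^esub>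
     | Suc m \<Rightarrow> \<exists>g. rep_hom (rterm R m) N g \<and>
         (\<forall>a\<in>Obj D. \<forall>x\<in>carrier (fobj (rterm R i) a). f a x = g a (rdiff R m a x)))"
proof -
  note rR = Obj_ModCat_rep[OF R] and rN = Obj_ModCat_rep[OF N]
  show ?thesis
  proof (cases i)
    case 0
    have "ext_hom (rterm R 0) (\<lambda>a x. \<zero>\<^bsub>fobj N a\<^esub>) \<in> Hom (ModCat K D) (rterm R 0) N"
      by (intro ext_hom_in_Hom hom_zero_map rR N rN)
    moreover have "f = ext_hom (rterm R 0) (\<lambda>a x. \<zero>\<^bsub>fobj N a\<^esub>)"
      if "f \<in> Hom (ModCat K D) (rterm R 0) N" "\<forall>a\<in>Obj D. \<forall>x\<in>carrier (fobj (rterm R 0) a). f a x =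
          \<zero>\<^bsub>fobj N a\<^esub>"
      using that calculation by (intro Hom_ModCat_eqI[OF rR N]) auto
    ultimately show ?thesis using 0 by (auto simp: zero_ModCat)
  next
    case (Suc m)
    note hd = Hom_ModCat_hom[OF rR R d]
    show ?thesis
    proof
      assume "f \<in> coboundaries (ModCat K D) R N i"
      then obtain g where g: "g \<in> Hom (ModCat K D) (rterm R m) N"
        "f = ext_hom (rterm R i) (\<lambda>a x. g a (rdiff R m a x))"
        using Suc by (auto simp: Cmp_ModCat)
      note hg = Hom_ModCat_hom[OF rR N g(1)]
      have "f \<in> Hom (ModCat K D) (rterm R i) N"
        unfolding g(2) using hom_comp[OF hd hg] Suc by (intro ext_hom_in_Hom rR N) simp
      then show "f \<in> Hom (ModCat K D) (rterm R i) N \<and>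
          (case i of 0 \<Rightarrow> \<forall>a\<in>Obj D. \<forall>x\<in>carrier (fobj (rterm R 0) a). f a x = \<zero>\<^bsub>fobj N a\<^esub>
       | Suc m \<Rightarrow> \<exists>g. rep_hom (rterm R m) N g \<and>
           (\<forall>a\<in>Obj D. \<forall>x\<in>carrier (fobj (rterm R i) a). f a x = g a (rdiff R m a x)))"
        using hg g(2) Suc by auto
    next
      assume "f \<in> Hom (ModCat K D) (rterm R i) N \<and>
          (case i of 0 \<Rightarrow> \<forall>a\<in>Obj D. \<forall>x\<in>carrier (fobj (rterm R 0) a). f a x = \<zero>\<^bsub>fobj N a\<^esub>
       | Suc m \<Rightarrow> \<exists>g. rep_hom (rterm R m) N g \<and>
           (\<forall>a\<in>Obj D. \<forall>x\<in>carrier (fobj (rterm R i) a). f a x = g a (rdiff R m a x)))"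
      then obtain g where f: "f \<in> Hom (ModCat K D) (rterm R i) N" and g: "rep_hom (rterm R m) N g"
        "\<And>a x. a \<in> Obj D \<Longrightarrow> x \<in> carrier (fobj (rterm R i) a) \<Longrightarrow> f a x = g a (rdiff R m a x)"
        using Suc by auto
      have "f = Cmp (ModCat K D) (rterm R i) (rterm R m) N (ext_hom (rterm R m) g) (rdiff R m)"
        unfolding Cmp_ModCat
      proof (rule Hom_ModCat_eqI[OF rR N f])
        have "rep_hom (rterm R i) N (\<lambda>a x. ext_hom (rterm R m) g a (rdiff R m a x))"
          using hom_comp[OF hd Hom_ModCat_hom[OF rR N ext_hom_in_Hom[OF rR N g(1)]]] Suc by simp
        then show "ext_hom (rterm R i) (\<lambda>a x. ext_hom (rterm R m) g a (rdiff R m a x)) \<in> Hom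
            (ModCat K D) (rterm R i) N"
          by (intro ext_hom_in_Hom rR N)
      qed (use g(2) hom_closed[OF hd] Suc in simp)
      then show "f \<in> coboundaries (ModCat K D) R N i"
        using ext_hom_in_Hom[OF rR N g(1)] Suc by auto
    qed
  qed
qed

lemma submodule_cocycles:
  assumes K: "cring K" and R: "\<And>n. rterm R n \<in> Obj (ModCat K D)" and N: "N \<in> Obj (ModCat K D)"
    and d: "\<And>n. rdiff R n \<in> Hom (ModCat K D) (rterm R (Suc n)) (rterm R n)"
  shows "submodule (cocycles (ModCat K D) R N i) K (HomK (ModCat K D) (rterm R i) N)"
proof -
  note rR = Obj_ModCat_rep[OF R] and rN = Obj_ModCat_rep[OF N]
  interpret H: module K "HomK (ModCat K D) (rterm R i) N" by (rule module_HomK_ModCat[OF K rR N])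
  note iff = cocycles_ModCat_iff[OF R N]
  note dc = hom_closed[OF Hom_ModCat_hom[OF rR R d]]
  have car: "carrier (HomK (ModCat K D) (rterm R i) N) = Hom (ModCat K D) (rterm R i) N"
    by (simp add: ModCat_simps)
  show ?thesis
  proof (rule submodule_smultI[OF H.module_axioms])
    show "cocycles (ModCat K D) R N i \<subseteq> carrier (HomK (ModCat K D) (rterm R i) N)"
      by (auto simp: iff car)
    show "\<zero>\<^bsub>HomK (ModCat K D) (rterm R i) N\<^esub> \<in> cocycles (ModCat K D) R N i"
      using H.zero_closed by (auto simp: iff car zero_ModCat dc)
    show "f \<oplus>\<^bsub>HomK (ModCat K D) (rterm R i) N\<^esub> g \<in> cocycles (ModCat K D) R N i"
      if f: "f \<in> cocycles (ModCat K D) R N i" and g: "g \<in> cocycles (ModCat K D) R N i" for f g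
      unfolding iff
    proof (intro conjI ballI)
      show "f \<oplus>\<^bsub>HomK (ModCat K D) (rterm R i) N\<^esub> g \<in> Hom (ModCat K D) (rterm R i) N"
        using f g H.a_closed[of f g] by (simp add: iff car)
      fix a x assume a: "a \<in> Obj D" and x: "x \<in> carrier (fobj (rterm R (Suc i)) a)"
      interpret Na: module K "fobj N a" by (rule rep_module[OF rN a])
      show "(f \<oplus>\<^bsub>HomK (ModCat K D) (rterm R i) N\<^esub> g) a (rdiff R i a x) = \<zero>\<^bsub>fobj N a\<^esub>"
        using f g a x dc[OF a x] by (simp add: iff ModCat_simps(6))
    qed
    show "r \<odot>\<^bsub>HomK (ModCat K D) (rterm R i) N\<^esub> f \<in> cocycles (ModCat K D) R N i"
      if r: "r \<in> carrier K" and f: "f \<in> cocycles (ModCat K D) R N i" for r f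
      unfolding iff
    proof (intro conjI ballI)
      show "r \<odot>\<^bsub>HomK (ModCat K D) (rterm R i) N\<^esub> f \<in> Hom (ModCat K D) (rterm R i) N"
        using f r H.smult_closed[of r f] by (simp add: iff car)
      fix a x assume a: "a \<in> Obj D" and x: "x \<in> carrier (fobj (rterm R (Suc i)) a)"
      interpret Na: module K "fobj N a" by (rule rep_module[OF rN a])
      show "(r \<odot>\<^bsub>HomK (ModCat K D) (rterm R i) N\<^esub> f) a (rdiff R i a x) = \<zero>\<^bsub>fobj N a\<^esub>"
        using f r a x dc[OF a x] by (simp add: iff ModCat_simps(7))
    qed
  qed
qed

lemma submodule_coboundaries:
  assumes K: "cring K" and R: "\<And>n. rterm R n \<in> Obj (ModCat K D)" and N: "N \<in> Obj (ModCat K D)"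
    and d: "\<And>n. rdiff R n \<in> Hom (ModCat K D) (rterm R (Suc n)) (rterm R n)"
  shows "submodule (coboundaries (ModCat K D) R N i) K (HomK (ModCat K D) (rterm R i) N)"
proof -
  note rR = Obj_ModCat_rep[OF R] and rN = Obj_ModCat_rep[OF N]
  interpret H: module K "HomK (ModCat K D) (rterm R i) N" by (rule module_HomK_ModCat[OF K rR N])
  note iff = coboundaries_ModCat_iff[OF R N d]
  have car: "carrier (HomK (ModCat K D) (rterm R i) N) = Hom (ModCat K D) (rterm R i) N"
    by (simp add: ModCat_simps)
  show ?thesis
  proof (cases i)
    case 0
    show ?thesis
      by (rule submodule_smultI[OF H.module_axioms]) (auto simp: 0 intro!: H.zero_closed[unfolded 0]
          H.l_zero[unfolded 0] H.smult_r_null[unfolded 0])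
  next
    case (Suc m)
    show ?thesis
    proof (rule submodule_smultI[OF H.module_axioms])
      show "coboundaries (ModCat K D) R N i \<subseteq> carrier (HomK (ModCat K D) (rterm R i) N)"
        by (auto simp: iff car)
      have "rep_hom (rterm R m) N (\<lambda>a x. \<zero>\<^bsub>fobj N a\<^esub>)" by (rule hom_zero_map[OF rR rN])
      then show "\<zero>\<^bsub>HomK (ModCat K D) (rterm R i) N\<^esub> \<in> coboundaries (ModCat K D) R N i"
        unfolding iff using H.zero_closed[unfolded car] by (auto simp: zero_ModCat Suc)
      show "f \<oplus>\<^bsub>HomK (ModCat K D) (rterm R i) N\<^esub> g \<in> coboundaries (ModCat K D) R N i"
        if f: "f \<in> coboundaries (ModCat K D) R N i" and g: "g \<in> coboundaries (ModCat K D) R N i"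
            for f g
      proof -
        obtain u v where u: "rep_hom (rterm R m) N u"
            "\<And>a x. a \<in> Obj D \<Longrightarrow> x \<in> carrier (fobj (rterm R i) a) \<Longrightarrow> f a x = u a (rdiff R m a x)"
          and v: "rep_hom (rterm R m) N v"
            "\<And>a x. a \<in> Obj D \<Longrightarrow> x \<in> carrier (fobj (rterm R i) a) \<Longrightarrow> g a x = v a (rdiff R m a x)"
          using f g unfolding iff Suc by auto
        have "f \<oplus>\<^bsub>HomK (ModCat K D) (rterm R i) N\<^esub> g \<in> Hom (ModCat K D) (rterm R i) N"
          using f g H.a_closed[of f g] unfolding iff by (simp add: car)
        then show ?thesis
          unfolding iff Suc using hom_plus[OF rR rN u(1) v(1)] u(2) v(2)
          by (auto simp: ModCat_simps(6) Suc)
      qed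
      show "r \<odot>\<^bsub>HomK (ModCat K D) (rterm R i) N\<^esub> f \<in> coboundaries (ModCat K D) R N i"
        if r: "r \<in> carrier K" and f: "f \<in> coboundaries (ModCat K D) R N i" for r f
      proof -
        obtain u where u: "rep_hom (rterm R m) N u"
            "\<And>a x. a \<in> Obj D \<Longrightarrow> x \<in> carrier (fobj (rterm R i) a) \<Longrightarrow> f a x = u a (rdiff R m a x)"
          using f unfolding iff Suc by auto
        have "r \<odot>\<^bsub>HomK (ModCat K D) (rterm R i) N\<^esub> f \<in> Hom (ModCat K D) (rterm R i) N"
          using f r H.smult_closed[of r f] unfolding iff by (simp add: car)
        then show ?thesis
          unfolding iff Suc using hom_scale[OF rR rN r u(1)] u(2)
          by (auto simp: ModCat_simps(7) Suc)
      qed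
    qed
  qed
qed

lemma coboundaries_subset_cocycles:
  assumes R: "\<And>n. rterm R n \<in> Obj (ModCat K D)" and N: "N \<in> Obj (ModCat K D)"
    and d: "\<And>n. rdiff R n \<in> Hom (ModCat K D) (rterm R (Suc n)) (rterm R n)"
    and res: "resolves A (rterm R) (rdiff R) e"
  shows "coboundaries (ModCat K D) R N i \<subseteq> cocycles (ModCat K D) R N i"
proof
  fix f assume f: "f \<in> coboundaries (ModCat K D) R N i"
  note rR = Obj_ModCat_rep[OF R] and rN = Obj_ModCat_rep[OF N]
  note dc = hom_closed[OF Hom_ModCat_hom[OF rR R d]]
  show "f \<in> cocycles (ModCat K D) R N i"
    unfolding cocycles_ModCat_iff[OF R N]
  proof (intro conjI ballI)
    show "f \<in> Hom (ModCat K D) (rterm R i) N" using f unfolding coboundaries_ModCat_iff[OF R N d]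
        by simp
    fix a x assume a: "a \<in> Obj D" and x: "x \<in> carrier (fobj (rterm R (Suc i)) a)"
    show "f a (rdiff R i a x) = \<zero>\<^bsub>fobj N a\<^esub>"
    proof (cases i)
      case 0
      then show ?thesis using f a dc[OF a x] unfolding coboundaries_ModCat_iff[OF R N d] by simp
    next
      case (Suc m)
      then obtain g where g: "rep_hom (rterm R m) N g"
        "\<And>a x. a \<in> Obj D \<Longrightarrow> x \<in> carrier (fobj (rterm R i) a) \<Longrightarrow> f a x = g a (rdiff R m a x)"
        using f unfolding coboundaries_ModCat_iff[OF R N d] by auto
      show ?thesis
        using g(2)[OF a dc[OF a x]] resolves_dd(1)[OF res a, of x m] x hom_zero[OF g(1) rR rN a]
            Suc by simp
    qed
  qed
qed

lemma proj_ext_rep [simp]: "rep_proj (ext_rep M) \<longleftrightarrow> rep_proj M"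
  by (simp add: rep_proj_def)

lemma projective_resolution_ModCatD:
  assumes A: "A \<in> Obj (ModCat K D)" and R: "projective_resolution (ModCat K D) A R"
  shows "\<And>n. rterm R n \<in> Obj (ModCat K D)" "\<And>n. rep_proj (rterm R n)"
    "\<And>n. rdiff R n \<in> Hom (ModCat K D) (rterm R (Suc n)) (rterm R n)"
    "raug R \<in> Hom (ModCat K D) (rterm R 0) A"
    "resolves A (rterm R) (rdiff R) (raug R)"
proof -
  show O: "rterm R n \<in> Obj (ModCat K D)" and P: "rep_proj (rterm R n)" for n
    using R by (auto simp: projective_resolution_def projective_ModCat_iff)
  note rO = Obj_ModCat_rep[OF O]
  have ex: "exact_at (ModCat K D) (rterm R 1) (rterm R 0) A (rdiff R 0) (raug R)"
    "\<And>n. exact_at (ModCat K D) (rterm R (n + 2)) (rterm R (n + 1)) (rterm R n) (rdiff R (n + 1))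
        (rdiff R n)"
    and epi: "is_epi (ModCat K D) (rterm R 0) A (raug R)"
    using R by (auto simp: projective_resolution_def)
  note e0 = ex(1)[unfolded exact_at_ModCat_iff[OF O O A]]
  note e1 = ex(2)[unfolded exact_at_ModCat_iff[OF O O O]]
  show d: "rdiff R n \<in> Hom (ModCat K D) (rterm R (Suc n)) (rterm R n)" for n
    using e1[of n] by simp
  show e: "raug R \<in> Hom (ModCat K D) (rterm R 0) A" using e0 by simp
  show "resolves A (rterm R) (rdiff R) (raug R)"
    unfolding resolves_def
  proof (intro conjI allI ballI)
    show "is_rep A" by (rule Obj_ModCat_rep[OF A])
    show "is_rep (rterm R n)" for n by (rule rO)
    show "rep_hom (rterm R (Suc n)) (rterm R n) (rdiff R n)" for n
        by (rule Hom_ModCat_hom[OF rO O d])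
    show "rep_hom (rterm R 0) A (raug R)" by (rule Hom_ModCat_hom[OF rO A e])
    show "rep_surj (rterm R 0) A (raug R)" using epi by (simp add: is_epi_ModCat_iff)
  qed (use e0 e1 in auto)
qed

text \<open>\<open>the_resolution\<close> is picked by \<open>SOME\<close> and has its property only
  once some resolution is exhibited; the one from \<open>resolution_exists\<close> is normalised to
  objects and arrows of \<open>ModCat\<close>.\<close>

lemma projective_resolution_ModCat_exists:
  fixes A :: "('o, 'm, 'k, 'v) rep"
  assumes enough: "\<And>M :: ('o, 'm, 'k, 'v) rep. is_rep M \<Longrightarrow>
      \<exists>(Q :: ('o, 'm, 'k, 'v) rep) p. rep_proj Q \<and> rep_hom Q M p \<and> rep_surj Q M p"
    and A: "A \<in> Obj (ModCat K D)"
  shows "projective_resolution (ModCat K D) A (the_resolution (ModCat K D) A)"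
proof -
  obtain X :: "nat \<Rightarrow> ('o, 'm, 'k, 'v) rep" and d e where X: "resolves A X d e" "\<And>n. rep_proj (X n)"
    using resolution_exists[OF enough Obj_ModCat_rep[OF A]] by blast
  note r = resolvesD[OF X(1)]
  note O = ext_rep_in_Obj[OF r(2)]
  have h: "ext_hom (ext_rep (X (Suc n))) (d n) \<in> Hom (ModCat K D) (ext_rep (X (Suc n))) (ext_rep
      (X n))" for n
    using r(2,3) by (intro ext_hom_in_Hom O) simp_all
  have h0: "ext_hom (ext_rep (X 0)) e \<in> Hom (ModCat K D) (ext_rep (X 0)) A"
    using r(2,4) A by (intro ext_hom_in_Hom) simp_all
  have im: "rep_im (ext_rep M) (ext_hom (ext_rep M) t) a = rep_im M t a"
    if "a \<in> Obj D" for a and M :: "('o, 'm, 'k, 'v) rep" and t :: "'o \<Rightarrow> 'v \<Rightarrow> 'v"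
    using that by (auto simp: rep_im_def)
  have "projective_resolution (ModCat K D) A
    \<lparr>rterm = (\<lambda>n. ext_rep (X n)), rdiff = (\<lambda>n. ext_hom (ext_rep (X (Suc n))) (d n)), raug =
        ext_hom (ext_rep (X 0)) e\<rparr>"
    unfolding projective_resolution_def
    using O X(2) h h0 r A im
    by (auto simp: projective_ModCat_iff is_epi_ModCat_iff exact_at_ModCat_iff)
  then show ?thesis unfolding the_resolution_def by (rule someI)
qed

end

section \<open>Free modules\<close>

lemma kcategoryD:
  assumes "kcategory K C"
  shows "\<And>a b. a \<in> Obj C \<Longrightarrow> b \<in> Obj C \<Longrightarrow> module K (HomK C a b)"
    "\<And>a b. a \<in> Obj C \<Longrightarrow> b \<in> Obj C \<Longrightarrow> carrier (HomK C a b) = Hom C a b"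
    "\<And>a b c g. a \<in> Obj C \<Longrightarrow> b \<in> Obj C \<Longrightarrow> c \<in> Obj C \<Longrightarrow> g \<in> Hom C b c \<Longrightarrow>
       linear_map K (HomK C a b) (HomK C a c) (\<lambda>f. Cmp C a b c g f)"
    "\<And>a b c f. a \<in> Obj C \<Longrightarrow> b \<in> Obj C \<Longrightarrow> c \<in> Obj C \<Longrightarrow> f \<in> Hom C a b \<Longrightarrow>
       linear_map K (HomK C b c) (HomK C a c) (\<lambda>g. Cmp C a b c g f)"
    "\<And>a. a \<in> Obj C \<Longrightarrow> Idn C a \<in> Hom C a a"
    "\<And>a b c f g. a \<in> Obj C \<Longrightarrow> b \<in> Obj C \<Longrightarrow> c \<in> Obj C \<Longrightarrow> f \<in> Hom C a b \<Longrightarrow> g \<in> Hom C b c \<Longrightarrow>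
       Cmp C a b c g f \<in> Hom C a c"
    "\<And>a b f. a \<in> Obj C \<Longrightarrow> b \<in> Obj C \<Longrightarrow> f \<in> Hom C a b \<Longrightarrow> Cmp C a b b (Idn C b) f = f"
    "\<And>a b f. a \<in> Obj C \<Longrightarrow> b \<in> Obj C \<Longrightarrow> f \<in> Hom C a b \<Longrightarrow> Cmp C a a b f (Idn C a) = f"
    "\<And>a b c d f g h. a \<in> Obj C \<Longrightarrow> b \<in> Obj C \<Longrightarrow> c \<in> Obj C \<Longrightarrow> d \<in> Obj C \<Longrightarrow>
       f \<in> Hom C a b \<Longrightarrow> g \<in> Hom C b c \<Longrightarrow> h \<in> Hom C c d \<Longrightarrow>
       Cmp C a b d (Cmp C b c d h g) f = Cmp C a c d h (Cmp C a b c g f)"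
  using assms by (simp_all add: kcategory_def category_def)

lemma linear_cat_kcategory:
  assumes "kcategory K C"
  shows "linear_cat K C"
proof
  note kc = kcategoryD[OF assms]
  fix a b f g r assume ab: "a \<in> Obj C" "b \<in> Obj C"
  interpret H: module K "HomK C a b" by (rule kc(1)[OF ab])
  show "carrier (HomK C a b) = Hom C a b" by (rule kc(2)[OF ab])
  show "f \<oplus>\<^bsub>HomK C a b\<^esub> g \<in> Hom C a b" if "f \<in> Hom C a b" "g \<in> Hom C a b"
    using H.a_closed that kc(2)[OF ab] by simp
  show "r \<odot>\<^bsub>HomK C a b\<^esub> f \<in> Hom C a b" if "r \<in> carrier K" "f \<in> Hom C a b"
    using H.smult_closed that kc(2)[OF ab] by simp
qed (simp_all add: kcategoryD[OF assms])

section \<open>Cardinality of functions of finite support\<close>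

text \<open>Coding by nested pairs is injective on lists of equal length, but a pair may coincide
  with the end marker \<open>num 0\<close>; hence the length is coded separately.\<close>

lemma lists_lepoll_infinite:
  assumes "infinite (UNIV :: 'v set)"
  shows "(UNIV :: 'v list set) \<lesssim> (UNIV :: 'v set)"
proof -
  obtain pair :: "'v \<times> 'v \<Rightarrow> 'v" where pair: "inj pair"
    using infinite_Times_lepoll[OF assms] by (auto simp: lepoll_def)
  obtain num :: "nat \<Rightarrow> 'v" where num: "inj num"
    using assms infinite_le_lepoll[of "UNIV :: 'v set"] by (auto simp: lepoll_def)
  define code where "code = (\<lambda>xs. foldr (\<lambda>x c. pair (x, c)) xs (num 0))"
  have "length xs = length ys \<Longrightarrow> code xs = code ys \<Longrightarrow> xs = ys" for xs ys
    by (induction xs ys rule: list_induct2) (auto simp: code_def dest: injD[OF pair])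
  then have "inj (\<lambda>xs. pair (num (length xs), code xs))"
    by (auto simp: inj_def dest!: injD[OF pair] injD[OF num])
  then show ?thesis by (auto simp: lepoll_def)
qed

text \<open>A function of finite support is determined by its graph over the support, a finite set
  of coded pairs, and a list enumerating this set is then coded in \<open>'v\<close>.\<close>

lemma finite_support_lepoll:
  fixes X :: "'x set" and H :: "'x \<Rightarrow> 'm set"
  assumes inf: "infinite (UNIV :: 'v set)" and X: "X \<lesssim> (UNIV :: 'v set)"
    and H: "\<And>b. b \<in> X \<Longrightarrow> H b \<lesssim> (UNIV :: 'v set)"
  shows "{\<phi> \<in> Pi\<^sub>E X H. finite {b \<in> X. \<phi> b \<noteq> z b}} \<lesssim> (UNIV :: 'v set)"
proof -
  obtain jX :: "'x \<Rightarrow> 'v" where jX: "inj_on jX X" using X by (auto simp: lepoll_def)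
  obtain jH :: "'x \<Rightarrow> 'm \<Rightarrow> 'v" where jH: "\<And>b. b \<in> X \<Longrightarrow> inj_on (jH b) (H b)"
    using H unfolding lepoll_def by metis
  obtain pair :: "'v \<times> 'v \<Rightarrow> 'v" where pair: "inj pair"
    using infinite_Times_lepoll[OF inf] by (auto simp: lepoll_def)
  define code where "code = (\<lambda>\<phi>. SOME xs. set xs = (\<lambda>b. pair (jX b, jH b (\<phi> b))) ` {b \<in> X.
      \<phi> b \<noteq> z b})"
  let ?F = "{\<phi> \<in> Pi\<^sub>E X H. finite {b \<in> X. \<phi> b \<noteq> z b}}"
  have code: "set (code \<phi>) = (\<lambda>b. pair (jX b, jH b (\<phi> b))) ` {b \<in> X. \<phi> b \<noteq> z b}" if "\<phi> \<in> ?F" for \<phi>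
    unfolding code_def using that by (intro someI_ex[of "\<lambda>xs. set xs = _"] finite_list) auto
  have graph: "\<psi> b = \<phi> b" if \<phi>: "\<phi> \<in> ?F" and \<psi>: "\<psi> \<in> ?F" and eq: "code \<phi> = code \<psi>"
      and b: "b \<in> X" "\<phi> b \<noteq> z b" for \<phi> \<psi> b
  proof -
    have "pair (jX b, jH b (\<phi> b)) \<in> set (code \<psi>)" using code[OF \<phi>] b eq by auto
    then obtain b' where b': "b' \<in> X" "pair (jX b, jH b (\<phi> b)) = pair (jX b', jH b' (\<psi> b'))"
      using code[OF \<psi>] by auto
    then have "b' = b" using injD[OF pair b'(2)] inj_onD[OF jX] b(1) by auto
    moreover have "\<phi> b \<in> H b" "\<psi> b \<in> H b" using \<phi> \<psi> b(1) by auto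
    ultimately show ?thesis using injD[OF pair b'(2)] inj_onD[OF jH[OF b(1)]] by auto
  qed
  have "inj_on code ?F"
  proof (rule inj_onI)
    fix \<phi> \<psi> assume \<phi>: "\<phi> \<in> ?F" and \<psi>: "\<psi> \<in> ?F" and eq: "code \<phi> = code \<psi>"
    show "\<phi> = \<psi>"
    proof (rule PiE_ext[of \<phi> X H \<psi>])
      fix b assume b: "b \<in> X"
      \<comment> \<open>If \<open>b\<close> lies in one of the supports, the common graph decides;
        off both supports the two values are \<open>z b\<close>.\<close>
      show "\<phi> b = \<psi> b"
        using graph[OF \<phi> \<psi> eq b] graph[OF \<psi> \<phi> eq[symmetric] b] by metis
    qed (use \<phi> \<psi> in auto)
  qed
  then have "?F \<lesssim> (UNIV :: 'v list set)" by (auto simp: lepoll_def)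
  then show ?thesis using lists_lepoll_infinite[OF inf] lepoll_trans by blast
qed

lemma linear_map_finsum:
  assumes "module K V" "module K W" "linear_map K V W f" "finite A" "g \<in> A \<rightarrow> carrier V"
  shows "f (finsum V g A) = finsum W (\<lambda>b. f (g b)) A"
proof -
  interpret V: module K V by fact
  interpret W: module K W by fact
  show ?thesis
    using assms(4,5)
  proof (induction A rule: finite_induct)
    case empty
    then show ?case by (simp add: V.finsum_empty W.finsum_empty linear_map_zero[OF assms(1-3)])
  next
    case (insert x A)
    have g: "g \<in> A \<rightarrow> carrier V" "g x \<in> carrier V" using insert.prems by auto
    have fg: "(\<lambda>b. f (g b)) \<in> A \<rightarrow> carrier W" "f (g x) \<in> carrier W"
      using g linear_map_closed[OF assms(3)] by auto
    show ?case
      using insert.IH[OF g(1)] linear_map_add[OF assms(3) g(2) V.finsum_closed[OF g(1)]]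
      by (simp add: V.finsum_insert[OF insert.hyps g] W.finsum_insert[OF insert.hyps fg])
  qed
qed

locale linear_kcat =
  fixes K :: "'k ring" and C :: "('o, 'm, 'k) kcat"
  assumes cring_K: "cring K" and kcat: "kcategory K C"
begin

lemmas kcD = kcategoryD[OF kcat]

sublocale linear_cat K C
  by (rule linear_cat_kcategory[OF kcat])

lemma Hom_zero: "a \<in> Obj C \<Longrightarrow> b \<in> Obj C \<Longrightarrow> \<zero>\<^bsub>HomK C a b\<^esub> \<in> Hom C a b"
proof -
  assume ab: "a \<in> Obj C" "b \<in> Obj C"
  interpret H: module K "HomK C a b" by (rule kcD(1)[OF ab])
  show ?thesis using H.zero_closed kcD(2)[OF ab] by simp
qed

lemma Cmp_zero_left:
  assumes "a \<in> Obj C" "b \<in> Obj C" "c \<in> Obj C" "f \<in> Hom C a b"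
  shows "Cmp C a b c \<zero>\<^bsub>HomK C b c\<^esub> f = \<zero>\<^bsub>HomK C a c\<^esub>"
  using linear_map_zero[OF kcD(1) kcD(1) kcD(4)] assms by blast

lemma Cmp_zero_right:
  assumes "a \<in> Obj C" "b \<in> Obj C" "c \<in> Obj C" "g \<in> Hom C b c"
  shows "Cmp C a b c g \<zero>\<^bsub>HomK C a b\<^esub> = \<zero>\<^bsub>HomK C a c\<^esub>"
  using linear_map_zero[OF kcD(1) kcD(1) kcD(3)] assms by blast

lemma rep_zero_arr:
  assumes M: "is_rep M" and ab: "a \<in> Obj C" "b \<in> Obj C" and x: "x \<in> carrier (fobj M a)"
  shows "farr M a b \<zero>\<^bsub>HomK C a b\<^esub> x = \<zero>\<^bsub>fobj M b\<^esub>"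
proof -
  interpret H: module K "HomK C a b" by (rule kcD(1)[OF ab])
  interpret M: module K "fobj M b" by (rule rep_module[OF M ab(2)])
  have "farr M a b (\<zero>\<^bsub>K\<^esub> \<odot>\<^bsub>HomK C a b\<^esub> \<zero>\<^bsub>HomK C a b\<^esub>) x =
      \<zero>\<^bsub>K\<^esub> \<odot>\<^bsub>fobj M b\<^esub> farr M a b \<zero>\<^bsub>HomK C a b\<^esub> x"
    using Hom_zero[OF ab] x by (intro rep_arr_scale[OF M ab]) auto
  then show ?thesis using rep_arr_closed[OF M ab Hom_zero[OF ab] x] by simp
qed

section \<open>Sums of representable functors\<close>

text \<open>The value at \<open>d\<close> of the direct sum of the representable functors
  \<open>C(c b, -)\<close> over \<open>b\<close> in \<open>X\<close>. The index type is arbitrary; a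
  copy in \<open>'v\<close> is made afterwards by \<open>transport_rep\<close>.\<close>

definition free_mod :: "'x set \<Rightarrow> ('x \<Rightarrow> 'o) \<Rightarrow> 'o \<Rightarrow> ('k, 'x \<Rightarrow> 'm) module" where
  "free_mod X c d = mk_module
     {\<phi> \<in> \<Pi>\<^sub>E b\<in>X. Hom C (c b) d. finite {b \<in> X. \<phi> b \<noteq> \<zero>\<^bsub>HomK C (c b) d\<^esub>}}
     (\<lambda>b\<in>X. \<zero>\<^bsub>HomK C (c b) d\<^esub>) (\<lambda>\<phi> \<psi>. \<lambda>b\<in>X. \<phi> b \<oplus>\<^bsub>HomK C (c b) d\<^esub> \<psi> b)
     (\<lambda>r \<phi>. \<lambda>b\<in>X. r \<odot>\<^bsub>HomK C (c b) d\<^esub> \<phi> b)"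

definition free_rep :: "'x set \<Rightarrow> ('x \<Rightarrow> 'o) \<Rightarrow> ('o, 'm, 'k, 'x \<Rightarrow> 'm) rep" where
  "free_rep X c = \<lparr>fobj = free_mod X c,
     farr = (\<lambda>d e f \<phi>. \<lambda>b\<in>X. Cmp C (c b) d e f (\<phi> b))\<rparr>"

text \<open>The universal element of the summand \<open>b\<close> in the sense of Yoneda.\<close>

definition free_gen :: "'x set \<Rightarrow> ('x \<Rightarrow> 'o) \<Rightarrow> 'x \<Rightarrow> 'x \<Rightarrow> 'm" where
  "free_gen X c b = (\<lambda>b'\<in>X. if b' = b then Idn C (c b) else \<zero>\<^bsub>HomK C (c b') (c b)\<^esub>)"

lemma free_simps:
  "fobj (free_rep X c) d = free_mod X c d"
  "farr (free_rep X c) d e f \<phi> = (\<lambda>b\<in>X. Cmp C (c b) d e f (\<phi> b))"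
  "carrier (free_mod X c d) = {\<phi> \<in> \<Pi>\<^sub>E b\<in>X. Hom C (c b) d. finite {b \<in> X. \<phi> b \<noteq> \<zero>\<^bsub>HomK C (c b) d\<^esub>}}"
  "\<zero>\<^bsub>free_mod X c d\<^esub> = (\<lambda>b\<in>X. \<zero>\<^bsub>HomK C (c b) d\<^esub>)"
  "\<phi> \<oplus>\<^bsub>free_mod X c d\<^esub> \<psi> = (\<lambda>b\<in>X. \<phi> b \<oplus>\<^bsub>HomK C (c b) d\<^esub> \<psi> b)"
  "r \<odot>\<^bsub>free_mod X c d\<^esub> \<phi> = (\<lambda>b\<in>X. r \<odot>\<^bsub>HomK C (c b) d\<^esub> \<phi> b)"
  by (simp_all add: free_rep_def free_mod_def mk_module_def)

lemma free_Hom: "\<phi> \<in> carrier (free_mod X c d) \<Longrightarrow> b \<in> X \<Longrightarrow> \<phi> b \<in> Hom C (c b) d"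
  by (auto simp: free_simps)

lemma free_eqI:
  assumes "\<phi> \<in> carrier (free_mod X c d)" "\<psi> \<in> carrier (free_mod X c d)" "\<And>b. b \<in> X \<Longrightarrow> \<phi> b = \<psi> b"
  shows "\<phi> = \<psi>"
  using assms by (intro PiE_ext[of \<phi> X "\<lambda>b. Hom C (c b) d" \<psi>]) (auto simp: free_simps)

lemma free_mod_module:
  assumes c: "\<And>b. b \<in> X \<Longrightarrow> c b \<in> Obj C" and d: "d \<in> Obj C"
  shows "module K (free_mod X c d)"
proof -
  have H: "module K (HomK C (c b) d)" if "b \<in> X" for b using kcD(1) c that d by simp
  have car: "carrier (HomK C (c b) d) = Hom C (c b) d" if "b \<in> X" for b using kcD(2) c that d
      by simp
  note ab = module.axioms(2)[OF H]
  have addc: "\<phi> b \<oplus>\<^bsub>HomK C (c b) d\<^esub> \<psi> b \<in> Hom C (c b) d" if "b \<in> X" "\<phi> b \<in> Hom C (c b) d"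
      "\<psi> b \<in> Hom C (c b) d" for \<phi> \<psi> b
    using Hom_add_closed c d that by simp
  have smc: "r \<odot>\<^bsub>HomK C (c b) d\<^esub> \<phi> b \<in> Hom C (c b) d" if "b \<in> X" "\<phi> b \<in> Hom C (c b) d"
      "r \<in> carrier K" for \<phi> b r
    using Hom_smult_closed c d that by simp
  have zz: "\<zero>\<^bsub>HomK C (c b) d\<^esub> \<in> Hom C (c b) d" if "b \<in> X" for b using Hom_zero c that d by simp
  have alg: "\<zero>\<^bsub>HomK C (c b) d\<^esub> \<oplus>\<^bsub>HomK C (c b) d\<^esub> \<zero>\<^bsub>HomK C (c b) d\<^esub> = \<zero>\<^bsub>HomK C (c b) d\<^esub>"
    "\<And>r. r \<in> carrier K \<Longrightarrow> r \<odot>\<^bsub>HomK C (c b) d\<^esub> \<zero>\<^bsub>HomK C (c b) d\<^esub> = \<zero>\<^bsub>HomK C (c b) d\<^esub>"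
    "\<And>f g h. f \<in> Hom C (c b) d \<Longrightarrow> g \<in> Hom C (c b) d \<Longrightarrow> h \<in> Hom C (c b) d \<Longrightarrow>
      f \<oplus>\<^bsub>HomK C (c b) d\<^esub> g \<oplus>\<^bsub>HomK C (c b) d\<^esub> h = f \<oplus>\<^bsub>HomK C (c b) d\<^esub> (g \<oplus>\<^bsub>HomK C (c b) d\<^esub> h)"
    "\<And>f g. f \<in> Hom C (c b) d \<Longrightarrow> g \<in> Hom C (c b) d \<Longrightarrow> f \<oplus>\<^bsub>HomK C (c b) d\<^esub> g = g \<oplus>\<^bsub>HomK C (c b) d\<^esub> f"
    "\<And>f. f \<in> Hom C (c b) d \<Longrightarrow> \<zero>\<^bsub>HomK C (c b) d\<^esub> \<oplus>\<^bsub>HomK C (c b) d\<^esub> f = f"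
    "\<And>f. f \<in> Hom C (c b) d \<Longrightarrow> (\<ominus>\<^bsub>K\<^esub> \<one>\<^bsub>K\<^esub>) \<odot>\<^bsub>HomK C (c b) d\<^esub> f \<oplus>\<^bsub>HomK C (c b) d\<^esub> f =
        \<zero>\<^bsub>HomK C (c b) d\<^esub>"
    if "b \<in> X" for b
  proof -
    interpret Hb: module K "HomK C (c b) d" by (rule H[OF that])
    note car' = car[OF that]
    show "\<zero>\<^bsub>HomK C (c b) d\<^esub> \<oplus>\<^bsub>HomK C (c b) d\<^esub> \<zero>\<^bsub>HomK C (c b) d\<^esub> = \<zero>\<^bsub>HomK C (c b) d\<^esub>"
      "\<And>r. r \<in> carrier K \<Longrightarrow> r \<odot>\<^bsub>HomK C (c b) d\<^esub> \<zero>\<^bsub>HomK C (c b) d\<^esub> = \<zero>\<^bsub>HomK C (c b) d\<^esub>" by simp_all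
    show "f \<oplus>\<^bsub>HomK C (c b) d\<^esub> g \<oplus>\<^bsub>HomK C (c b) d\<^esub> h = f \<oplus>\<^bsub>HomK C (c b) d\<^esub> (g \<oplus>\<^bsub>HomK C (c b) d\<^esub> h)"
      if "f \<in> Hom C (c b) d" "g \<in> Hom C (c b) d" "h \<in> Hom C (c b) d" for f g h
      using that Hb.a_assoc by (simp add: car'[symmetric])
    show "f \<oplus>\<^bsub>HomK C (c b) d\<^esub> g = g \<oplus>\<^bsub>HomK C (c b) d\<^esub> f"
        if "f \<in> Hom C (c b) d" "g \<in> Hom C (c b) d" for f g
      using that Hb.a_comm by (simp add: car'[symmetric])
    show "\<zero>\<^bsub>HomK C (c b) d\<^esub> \<oplus>\<^bsub>HomK C (c b) d\<^esub> f = f" if "f \<in> Hom C (c b) d" for f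
      using that Hb.l_zero by (simp add: car'[symmetric])
    show "(\<ominus>\<^bsub>K\<^esub> \<one>\<^bsub>K\<^esub>) \<odot>\<^bsub>HomK C (c b) d\<^esub> f \<oplus>\<^bsub>HomK C (c b) d\<^esub> f = \<zero>\<^bsub>HomK C (c b) d\<^esub>"
        if "f \<in> Hom C (c b) d" for f
      using that by (simp add: car'[symmetric] Hb.smult_l_minus Hb.l_neg)
  qed
  have finadd: "finite {b \<in> X. \<phi> b \<oplus>\<^bsub>HomK C (c b) d\<^esub> \<psi> b \<noteq> \<zero>\<^bsub>HomK C (c b) d\<^esub>}"
    if "finite {b \<in> X. \<phi> b \<noteq> \<zero>\<^bsub>HomK C (c b) d\<^esub>}" "finite {b \<in> X. \<psi> b \<noteq> \<zero>\<^bsub>HomK C (c b) d\<^esub>}" for \<phi> \<psi>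
    by (rule finite_subset[OF _ finite_UnI[OF that]]) (auto simp: alg(1))
  have finsm: "finite {b \<in> X. r \<odot>\<^bsub>HomK C (c b) d\<^esub> \<phi> b \<noteq> \<zero>\<^bsub>HomK C (c b) d\<^esub>}"
    if "finite {b \<in> X. \<phi> b \<noteq> \<zero>\<^bsub>HomK C (c b) d\<^esub>}" "r \<in> carrier K" for \<phi> r
    by (rule finite_subset[OF _ that(1)]) (auto simp: alg(2) that(2))
  have cadd: "\<phi> \<oplus>\<^bsub>free_mod X c d\<^esub> \<psi> \<in> carrier (free_mod X c d)"
    if "\<phi> \<in> carrier (free_mod X c d)" "\<psi> \<in> carrier (free_mod X c d)" for \<phi> \<psi>
    using that finadd[of \<phi> \<psi>] by (auto simp: free_simps intro!: addc elim!: rev_finite_subset)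
  have csm: "r \<odot>\<^bsub>free_mod X c d\<^esub> \<phi> \<in> carrier (free_mod X c d)"
    if "r \<in> carrier K" "\<phi> \<in> carrier (free_mod X c d)" for \<phi> r
    using that finsm[of \<phi> r] by (auto simp: free_simps intro!: smc elim!: rev_finite_subset)
  have cz: "\<zero>\<^bsub>free_mod X c d\<^esub> \<in> carrier (free_mod X c d)"
    by (auto simp: free_simps zz)
  interpret Kc: cring K by (rule cring_K)
  show ?thesis
  proof (rule moduleI[OF cring_K])
    show "abelian_group (free_mod X c d)"
    proof (rule abelian_groupI)
      show "\<exists>\<psi>\<in>carrier (free_mod X c d). \<psi> \<oplus>\<^bsub>free_mod X c d\<^esub> \<phi> = \<zero>\<^bsub>free_mod X c d\<^esub>"
        if \<phi>: "\<phi> \<in> carrier (free_mod X c d)" for \<phi>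
        by (rule bexI[OF _ csm[of "\<ominus>\<^bsub>K\<^esub> \<one>\<^bsub>K\<^esub>", OF _ \<phi>]])
          (use free_Hom[OF \<phi>] in \<open>auto simp: free_simps alg intro!: restrict_ext\<close>)
      show "\<phi> \<oplus>\<^bsub>free_mod X c d\<^esub> \<psi> \<oplus>\<^bsub>free_mod X c d\<^esub> \<chi> = \<phi> \<oplus>\<^bsub>free_mod X c d\<^esub> (\<psi> \<oplus>\<^bsub>free_mod X c d\<^esub> \<chi>)"
        if "\<phi> \<in> carrier (free_mod X c d)" "\<psi> \<in> carrier (free_mod X c d)"
            "\<chi> \<in> carrier (free_mod X c d)" for \<phi> \<psi> \<chi>
        using free_Hom[OF that(1)] free_Hom[OF that(2)] free_Hom[OF that(3)]
        by (auto simp: free_simps(5) alg(3) intro!: restrict_ext)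
      show "\<phi> \<oplus>\<^bsub>free_mod X c d\<^esub> \<psi> = \<psi> \<oplus>\<^bsub>free_mod X c d\<^esub> \<phi>"
        if "\<phi> \<in> carrier (free_mod X c d)" "\<psi> \<in> carrier (free_mod X c d)" for \<phi> \<psi>
        using free_Hom[OF that(1)] free_Hom[OF that(2)]
        by (auto simp: free_simps(5) alg(4) intro!: restrict_ext)
      show "\<zero>\<^bsub>free_mod X c d\<^esub> \<oplus>\<^bsub>free_mod X c d\<^esub> \<phi> = \<phi>" if \<phi>: "\<phi> \<in> carrier (free_mod X c d)" for \<phi>
        using free_Hom[OF \<phi>] by (intro free_eqI[OF cadd[OF cz \<phi>] \<phi>]) (auto simp: free_simps(4,5)
            alg(5))
    qed (use cadd cz in auto)
  next
    show "(r \<oplus>\<^bsub>K\<^esub> s) \<odot>\<^bsub>free_mod X c d\<^esub> \<phi> = r \<odot>\<^bsub>free_mod X c d\<^esub> \<phi> \<oplus>\<^bsub>free_mod X c d\<^esub> s \<odot>\<^bsub>free_mod X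
        c d\<^esub> \<phi>"
      if "r \<in> carrier K" "s \<in> carrier K" "\<phi> \<in> carrier (free_mod X c d)" for r s \<phi>
      using that free_Hom[OF that(3)] module.smult_l_distr[OF H] car
      by (auto simp: free_simps(5,6) intro!: restrict_ext)
    show "r \<odot>\<^bsub>free_mod X c d\<^esub> (\<phi> \<oplus>\<^bsub>free_mod X c d\<^esub> \<psi>) = r \<odot>\<^bsub>free_mod X c d\<^esub> \<phi> \<oplus>\<^bsub>free_mod X c d\<^esub> r
        \<odot>\<^bsub>free_mod X c d\<^esub> \<psi>"
      if "r \<in> carrier K" "\<phi> \<in> carrier (free_mod X c d)" "\<psi> \<in> carrier (free_mod X c d)" for r \<phi> \<psi>
      using that free_Hom[OF that(2)] free_Hom[OF that(3)] module.smult_r_distr[OF H] car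
      by (auto simp: free_simps(5,6) intro!: restrict_ext)
    show "r \<otimes>\<^bsub>K\<^esub> s \<odot>\<^bsub>free_mod X c d\<^esub> \<phi> = r \<odot>\<^bsub>free_mod X c d\<^esub> (s \<odot>\<^bsub>free_mod X c d\<^esub> \<phi>)"
      if "r \<in> carrier K" "s \<in> carrier K" "\<phi> \<in> carrier (free_mod X c d)" for r s \<phi>
      using that free_Hom[OF that(3)] module.smult_assoc1[OF H] car
      by (auto simp: free_simps(6) intro!: restrict_ext)
    show "\<one>\<^bsub>K\<^esub> \<odot>\<^bsub>free_mod X c d\<^esub> \<phi> = \<phi>" if \<phi>: "\<phi> \<in> carrier (free_mod X c d)" for \<phi>
      using free_Hom[OF \<phi>] module.smult_one[OF H] car
      by (intro free_eqI[OF csm[OF _ \<phi>] \<phi>]) (auto simp: free_simps(6))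
  qed (use csm in auto)
qed

lemma free_arr_closed:
  assumes c: "\<And>b. b \<in> X \<Longrightarrow> c b \<in> Obj C" and de: "d \<in> Obj C" "e \<in> Obj C" and f: "f \<in> Hom C d e"
    and \<phi>: "\<phi> \<in> carrier (free_mod X c d)"
  shows "(\<lambda>b\<in>X. Cmp C (c b) d e f (\<phi> b)) \<in> carrier (free_mod X c e)"
proof -
  have "finite {b \<in> X. Cmp C (c b) d e f (\<phi> b) \<noteq> \<zero>\<^bsub>HomK C (c b) e\<^esub>}"
    by (rule finite_subset[of _ "{b \<in> X. \<phi> b \<noteq> \<zero>\<^bsub>HomK C (c b) d\<^esub>}"])
      (use \<phi> c de f in \<open>auto simp: free_simps Cmp_zero_right\<close>)
  then show ?thesis
    using free_Hom[OF \<phi>] c de f by (auto simp: free_simps kcD(6) elim!: rev_finite_subset)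
qed

lemma is_rep_free:
  assumes c: "\<And>b. b \<in> X \<Longrightarrow> c b \<in> Obj C"
  shows "is_rep (free_rep X c)"
  unfolding is_rep_def linear_map_def free_simps(1,2)
proof (intro conjI ballI)
  fix d assume d: "d \<in> Obj C"
  show "module K (free_mod X c d)" by (rule free_mod_module[OF c d])
  show "(\<lambda>b\<in>X. Cmp C (c b) d d (Idn C d) (\<phi> b)) = \<phi>" if \<phi>: "\<phi> \<in> carrier (free_mod X c d)" for \<phi>
    using free_Hom[OF \<phi>] c d
    by (intro free_eqI[OF free_arr_closed[OF c d d kcD(5)[OF d] \<phi>] \<phi>]) (auto simp: kcD(7))
  fix e assume e: "e \<in> Obj C"
  show "(\<lambda>\<phi>. \<lambda>b\<in>X. Cmp C (c b) d e f (\<phi> b)) \<in> carrier (free_mod X c d) \<rightarrow> carrier (free_mod X c e)"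
    if f: "f \<in> Hom C d e" for f
    using free_arr_closed[OF c d e f] by auto
  show "(\<lambda>b\<in>X. Cmp C (c b) d e f ((\<phi> \<oplus>\<^bsub>free_mod X c d\<^esub> \<psi>) b)) =
      (\<lambda>b\<in>X. Cmp C (c b) d e f (\<phi> b)) \<oplus>\<^bsub>free_mod X c e\<^esub> (\<lambda>b\<in>X. Cmp C (c b) d e f (\<psi> b))"
    if f: "f \<in> Hom C d e" and \<phi>: "\<phi> \<in> carrier (free_mod X c d)"
        and \<psi>: "\<psi> \<in> carrier (free_mod X c d)" for f \<phi> \<psi>
    using free_Hom[OF \<phi>] free_Hom[OF \<psi>] c d e f linear_map_add[OF kcD(3)] kcD(2)
    by (auto simp: free_simps(5) intro!: restrict_ext)
  show "(\<lambda>b\<in>X. Cmp C (c b) d e f ((r \<odot>\<^bsub>free_mod X c d\<^esub> \<phi>) b)) =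
      r \<odot>\<^bsub>free_mod X c e\<^esub> (\<lambda>b\<in>X. Cmp C (c b) d e f (\<phi> b))"
    if f: "f \<in> Hom C d e" and r: "r \<in> carrier K" and \<phi>: "\<phi> \<in> carrier (free_mod X c d)" for f r \<phi>
    using free_Hom[OF \<phi>] c d e f r linear_map_smult[OF kcD(3)] kcD(2)
    by (auto simp: free_simps(6) intro!: restrict_ext)
  show "(\<lambda>b\<in>X. Cmp C (c b) d e (f \<oplus>\<^bsub>HomK C d e\<^esub> g) (\<phi> b)) =
      (\<lambda>b\<in>X. Cmp C (c b) d e f (\<phi> b)) \<oplus>\<^bsub>free_mod X c e\<^esub> (\<lambda>b\<in>X. Cmp C (c b) d e g (\<phi> b))"
    if f: "f \<in> Hom C d e" and g: "g \<in> Hom C d e" and \<phi>: "\<phi> \<in> carrier (free_mod X c d)" for f g \<phi>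
    using free_Hom[OF \<phi>] c d e f g linear_map_add[OF kcD(4)] kcD(2)
    by (auto simp: free_simps(5) intro!: restrict_ext)
  show "(\<lambda>b\<in>X. Cmp C (c b) d e (r \<odot>\<^bsub>HomK C d e\<^esub> f) (\<phi> b)) =
      r \<odot>\<^bsub>free_mod X c e\<^esub> (\<lambda>b\<in>X. Cmp C (c b) d e f (\<phi> b))"
    if r: "r \<in> carrier K" and f: "f \<in> Hom C d e" and \<phi>: "\<phi> \<in> carrier (free_mod X c d)" for f r \<phi>
    using free_Hom[OF \<phi>] c d e f r linear_map_smult[OF kcD(4)] kcD(2)
    by (auto simp: free_simps(6) intro!: restrict_ext)
  show "(\<lambda>b\<in>X. Cmp C (c b) d l (Cmp C d e l g f) (\<phi> b)) =
      (\<lambda>b\<in>X. Cmp C (c b) e l g ((\<lambda>b\<in>X. Cmp C (c b) d e f (\<phi> b)) b))"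
    if l: "l \<in> Obj C" and f: "f \<in> Hom C d e" and g: "g \<in> Hom C e l"
        and \<phi>: "\<phi> \<in> carrier (free_mod X c d)" for l f g \<phi>
    using free_Hom[OF \<phi>] c d e l f g by (auto simp: kcD(9) intro!: restrict_ext)
qed

lemma free_gen_closed:
  assumes c: "\<And>b. b \<in> X \<Longrightarrow> c b \<in> Obj C" and b: "b \<in> X"
  shows "free_gen X c b \<in> carrier (fobj (free_rep X c) (c b))"
proof -
  have "finite {b' \<in> X. free_gen X c b b' \<noteq> \<zero>\<^bsub>HomK C (c b') (c b)\<^esub>}"
    by (rule finite_subset[of _ "{b}"]) (auto simp: free_gen_def)
  then show ?thesis
    using c b by (auto simp: free_simps free_gen_def kcD(5) Hom_zero elim!: rev_finite_subset)
qed

text \<open>Yoneda for sums: an element \<phi> goes to the sum of the \<open>farr N\<close> images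
  of the \<open>n b\<close> under its coordinates, a finite sum because the support is
  finite.\<close>

lemma free_lift:
  fixes N :: "('o, 'm, 'k, 'w) rep" and X :: "'x set"
  assumes c: "\<And>b. b \<in> X \<Longrightarrow> c b \<in> Obj C" and N: "is_rep N"
    and n: "\<And>b. b \<in> X \<Longrightarrow> n b \<in> carrier (fobj N (c b))"
  obtains t where "rep_hom (free_rep X c) N t" "\<And>b. b \<in> X \<Longrightarrow> t (c b) (free_gen X c b) = n b"
proof -
  define supp where "supp = (\<lambda>d \<phi>. {b \<in> X. \<phi> b \<noteq> \<zero>\<^bsub>HomK C (c b) d\<^esub>})"
  define t where "t = (\<lambda>d \<phi>. finsum (fobj N d) (\<lambda>b. farr N (c b) d (\<phi> b) (n b)) (supp d \<phi>))"
  have fin: "finite (supp d \<phi>)" if "\<phi> \<in> carrier (free_mod X c d)" for d \<phi>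
    using that by (simp add: supp_def free_simps)
  have cl: "farr N (c b) d (\<phi> b) (n b) \<in> carrier (fobj N d)"
      if "d \<in> Obj C" "\<phi> \<in> carrier (free_mod X c d)" "b \<in> X" for d \<phi> b
    using that free_Hom[OF that(2,3)] by (intro rep_arr_closed[OF N]) (auto simp: c n)
  \<comment> \<open>The support of a sum or of an image differs from that of the arguments. As zero
    arrows act by zero, the sum may be taken over any finite set of indices containing the support,
    so both sides of an identity can be summed over a common set.\<close>
  have t_eq: "t d \<phi> = finsum (fobj N d) (\<lambda>b. farr N (c b) d (\<phi> b) (n b)) A"
    if d: "d \<in> Obj C" and \<phi>: "\<phi> \<in> carrier (free_mod X c d)" and A: "finite A" "supp d \<phi> \<subseteq> A"
        "A \<subseteq> X" for d \<phi> A
  proof -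
    interpret Nd: module K "fobj N d" by (rule rep_module[OF N d])
    show ?thesis
      unfolding t_def
      by (rule Nd.add.finprod_mono_neutral_cong_left)
        (use A cl[OF d \<phi>] c n d in \<open>auto simp: supp_def rep_zero_arr[OF N]\<close>)
  qed
  have "rep_hom (free_rep X c) N t"
    unfolding rep_hom_def linear_map_def free_simps(1,2)
  proof (intro conjI ballI)
    fix d assume d: "d \<in> Obj C"
    interpret Nd: module K "fobj N d" by (rule rep_module[OF N d])
    interpret Fd: module K "free_mod X c d" by (rule free_mod_module[OF c d])
    show "t d \<in> carrier (free_mod X c d) \<rightarrow> carrier (fobj N d)"
      unfolding t_def using cl[OF d] by (auto simp: supp_def intro!: Nd.finsum_closed)
    show "t d (\<phi> \<oplus>\<^bsub>free_mod X c d\<^esub> \<psi>) = t d \<phi> \<oplus>\<^bsub>fobj N d\<^esub> t d \<psi>"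
      if \<phi>: "\<phi> \<in> carrier (free_mod X c d)" and \<psi>: "\<psi> \<in> carrier (free_mod X c d)" for \<phi> \<psi>
    proof -
      let ?s = "\<phi> \<oplus>\<^bsub>free_mod X c d\<^esub> \<psi>"
      let ?A = "supp d \<phi> \<union> supp d \<psi> \<union> supp d ?s"
      have s: "?s \<in> carrier (free_mod X c d)" using \<phi> \<psi> by simp
      have A: "finite ?A" "?A \<subseteq> X" using fin[OF \<phi>] fin[OF \<psi>] fin[OF s] by (auto simp: supp_def)
      have "farr N (c b) d (?s b) (n b) = farr N (c b) d (\<phi> b) (n b) \<oplus>\<^bsub>fobj N d\<^esub> farr N (c b) d (\<psi>
          b) (n b)"
        if "b \<in> ?A" for b
        using that A(2) free_Hom[OF \<phi>] free_Hom[OF \<psi>] c n d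
            by (auto simp: free_simps(5) rep_arr_plus[OF N])
      then have "t d ?s = finsum (fobj N d) (\<lambda>b. farr N (c b) d (\<phi> b) (n b) \<oplus>\<^bsub>fobj N d\<^esub> farr N (c
          b) d (\<psi> b) (n b)) ?A"
        using t_eq[OF d s A(1) _ A(2)] cl[OF d s] cl[OF d \<phi>] cl[OF d \<psi>] A(2)
        by (auto intro!: Nd.finsum_cong')
      also have "\<dots> = t d \<phi> \<oplus>\<^bsub>fobj N d\<^esub> t d \<psi>"
      proof -
        have "t d \<phi> = finsum (fobj N d) (\<lambda>b. farr N (c b) d (\<phi> b) (n b)) ?A"
          "t d \<psi> = finsum (fobj N d) (\<lambda>b. farr N (c b) d (\<psi> b) (n b)) ?A"
          by (rule t_eq[OF d \<phi> A(1) _ A(2)], blast, rule t_eq[OF d \<psi> A(1) _ A(2)], blast)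
        then show ?thesis
          using cl[OF d \<phi>] cl[OF d \<psi>] A(2) by (simp only:) (rule Nd.finsum_addf; auto)
      qed
      finally show ?thesis .
    qed
    show "t d (r \<odot>\<^bsub>free_mod X c d\<^esub> \<phi>) = r \<odot>\<^bsub>fobj N d\<^esub> t d \<phi>"
      if r: "r \<in> carrier K" and \<phi>: "\<phi> \<in> carrier (free_mod X c d)" for r \<phi>
    proof -
      let ?s = "r \<odot>\<^bsub>free_mod X c d\<^esub> \<phi>"
      let ?A = "supp d \<phi> \<union> supp d ?s"
      have s: "?s \<in> carrier (free_mod X c d)" using r \<phi> by simp
      have A: "finite ?A" "?A \<subseteq> X" using fin[OF \<phi>] fin[OF s] by (auto simp: supp_def)
      have "farr N (c b) d (?s b) (n b) = r \<odot>\<^bsub>fobj N d\<^esub> farr N (c b) d (\<phi> b) (n b)"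
        if "b \<in> ?A" for b
        using that A(2) free_Hom[OF \<phi>] c n d r by (auto simp: free_simps(6) rep_arr_scale[OF N])
      then have "t d ?s = finsum (fobj N d) (\<lambda>b. r \<odot>\<^bsub>fobj N d\<^esub> farr N (c b) d (\<phi> b) (n b)) ?A"
        using t_eq[OF d s A(1) _ A(2)] cl[OF d s] cl[OF d \<phi>] A(2) r
        by (auto intro!: Nd.finsum_cong')
      also have "\<dots> = r \<odot>\<^bsub>fobj N d\<^esub> t d \<phi>"
      proof -
        have "t d \<phi> = finsum (fobj N d) (\<lambda>b. farr N (c b) d (\<phi> b) (n b)) ?A"
          by (rule t_eq[OF d \<phi> A(1) _ A(2)], blast)
        then show ?thesis
          using cl[OF d \<phi>] A r by (simp only:) (rule Nd.finsum_smult_ldistr[symmetric]; auto)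
      qed
      finally show ?thesis .
    qed
    fix e f \<phi> assume e: "e \<in> Obj C" and f: "f \<in> Hom C d e" and \<phi>: "\<phi> \<in> carrier (free_mod X c d)"
    interpret Ne: module K "fobj N e" by (rule rep_module[OF N e])
    let ?s = "\<lambda>b\<in>X. Cmp C (c b) d e f (\<phi> b)"
    have s: "?s \<in> carrier (free_mod X c e)" by (rule free_arr_closed[OF c d e f \<phi>])
    let ?A = "supp d \<phi> \<union> supp e ?s"
    have A: "finite ?A" "?A \<subseteq> X" using fin[OF \<phi>] fin[OF s] by (auto simp: supp_def)
    have "farr N (c b) e (?s b) (n b) = farr N d e f (farr N (c b) d (\<phi> b) (n b))" if "b \<in> ?A" for b
      using that A(2) free_Hom[OF \<phi>] c n d e f by (auto simp: rep_arr_comp[OF N])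
    then have "t e ?s = finsum (fobj N e) (\<lambda>b. farr N d e f (farr N (c b) d (\<phi> b) (n b))) ?A"
      using t_eq[OF e s A(1) _ A(2)] cl[OF e s] cl[OF d \<phi>] A(2) rep_arr_closed[OF N d e f]
      by (auto intro!: Ne.finsum_cong')
    also have "\<dots> = farr N d e f (t d \<phi>)"
    proof -
      have "t d \<phi> = finsum (fobj N d) (\<lambda>b. farr N (c b) d (\<phi> b) (n b)) ?A"
        by (rule t_eq[OF d \<phi> A(1) _ A(2)], blast)
      then show ?thesis
        using cl[OF d \<phi>] A by (simp only:)
          (rule linear_map_finsum[OF rep_module[OF N d] rep_module[OF N e] rep_arr_linear[OF N d e
              f], symmetric]; auto)
    qed
    finally show "t e ?s = farr N d e f (t d \<phi>)" .
  qed
  moreover have "t (c b) (free_gen X c b) = n b" if b: "b \<in> X" for b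
  proof -
    interpret Nb: module K "fobj N (c b)" by (rule rep_module[OF N c[OF b]])
    have g: "free_gen X c b \<in> carrier (free_mod X c (c b))"
      using free_gen_closed[OF c b] by (simp add: free_simps(1))
    have "t (c b) (free_gen X c b) = finsum (fobj N (c b)) (\<lambda>b'. farr N (c b') (c b) (free_gen X c
        b b') (n b')) {b}"
      by (rule t_eq[OF c[OF b] g]) (use b in \<open>auto simp: supp_def free_gen_def\<close>)
    also have "\<dots> = farr N (c b) (c b) (free_gen X c b b) (n b)"
      using cl[OF c[OF b] g b] by (simp add: Nb.finsum_insert)
    also have "\<dots> = n b" using b rep_arr_id[OF N c[OF b] n[OF b]] by (simp add: free_gen_def)
    finally show ?thesis .
  qed
  ultimately show ?thesis by (rule that)
qed

text \<open>Splitting off one coordinate at a time writes every element as a finite sum of arrows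
  applied to generators; the induction is over a finite set that contains the support.\<close>

lemma free_hom_unique:
  fixes N :: "('o, 'm, 'k, 'w) rep" and X :: "'x set"
  assumes c: "\<And>b. b \<in> X \<Longrightarrow> c b \<in> Obj C" and N: "is_rep N"
    and s: "rep_hom (free_rep X c) N s" and t: "rep_hom (free_rep X c) N t"
    and eq: "\<And>b. b \<in> X \<Longrightarrow> s (c b) (free_gen X c b) = t (c b) (free_gen X c b)"
    and d: "d \<in> Obj C" and \<phi>: "\<phi> \<in> carrier (fobj (free_rep X c) d)"
  shows "s d \<phi> = t d \<phi>"
proof -
  note F = is_rep_free[OF c]
  interpret Fd: module K "free_mod X c d" by (rule free_mod_module[OF c d])
  have "s d \<phi> = t d \<phi>"
    if "finite A" "\<phi> \<in> carrier (free_mod X c d)" "{b \<in> X. \<phi> b \<noteq> \<zero>\<^bsub>HomK C (c b) d\<^esub>} \<subseteq> A" for A \<phi>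
    using that
  proof (induction A arbitrary: \<phi> rule: finite_induct)
    case empty
    have "\<phi> = \<zero>\<^bsub>free_mod X c d\<^esub>"
      by (rule free_eqI[OF empty(1) Fd.zero_closed]) (use empty(2) in \<open>auto simp: free_simps(4)\<close>)
    then show ?case using hom_zero[OF s F N d] hom_zero[OF t F N d] by (simp add: free_simps(1))
  next
    case (insert b A)
    show ?case
    proof (cases "b \<in> X")
      case False
      then show ?thesis using insert.prems by (intro insert.IH) auto
    next
      case b: True
      note \<phi> = insert.prems(1)
      have fb: "\<phi> b \<in> Hom C (c b) d" by (rule free_Hom[OF \<phi> b])
      \<comment> \<open>\<psi> erases the coordinate \<open>b\<close>, and \<chi> is this coordinate
        alone, obtained by applying the arrow \<open>\<phi> b\<close> to the generator.\<close>
      define \<psi> where "\<psi> = \<phi>(b := \<zero>\<^bsub>HomK C (c b) d\<^esub>)"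
      define \<chi> where "\<chi> = farr (free_rep X c) (c b) d (\<phi> b) (free_gen X c b)"
      have "finite {b' \<in> X. \<psi> b' \<noteq> \<zero>\<^bsub>HomK C (c b') d\<^esub>}"
        by (rule finite_subset[of _ "{b \<in> X. \<phi> b \<noteq> \<zero>\<^bsub>HomK C (c b) d\<^esub>}"])
          (use \<phi> in \<open>auto simp: \<psi>_def free_simps(3)\<close>)
      then have \<psi>: "\<psi> \<in> carrier (free_mod X c d)"
        using \<phi> b Hom_zero[OF c[OF b] d] by (auto simp: \<psi>_def free_simps(3) PiE_def extensional_def)
      have g: "free_gen X c b \<in> carrier (fobj (free_rep X c) (c b))"
          by (rule free_gen_closed[OF c b])
      have \<chi>: "\<chi> \<in> carrier (free_mod X c d)"
        using rep_arr_closed[OF F c[OF b] d fb g] by (simp add: \<chi>_def free_simps(1))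
      have "\<phi> = \<psi> \<oplus>\<^bsub>free_mod X c d\<^esub> \<chi>"
      proof (rule free_eqI[OF \<phi> Fd.a_closed[OF \<psi> \<chi>]])
        fix b' assume b': "b' \<in> X"
        interpret H: module K "HomK C (c b') d" by (rule kcD(1)[OF c[OF b'] d])
        have fb': "\<phi> b' \<in> carrier (HomK C (c b') d)" using free_Hom[OF \<phi> b'] kcD(2)[OF c[OF b'] d]
            by simp
        show "\<phi> b' = (\<psi> \<oplus>\<^bsub>free_mod X c d\<^esub> \<chi>) b'"
          using b b' c d fb fb' free_Hom[OF \<phi> b'] H.l_zero[OF fb'] H.r_zero[OF fb']
          by (cases "b' = b") (auto simp: free_simps \<psi>_def \<chi>_def free_gen_def kcD(8) Cmp_zero_right)
      qed
      moreover have "s d \<psi> = t d \<psi>"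
        by (rule insert.IH[OF \<psi>]) (use insert.prems(2) in \<open>auto simp: \<psi>_def\<close>)
      moreover have "s d \<chi> = t d \<chi>"
        unfolding \<chi>_def hom_nat[OF s c[OF b] d fb g] hom_nat[OF t c[OF b] d fb g] using eq[OF b]
            by simp
      ultimately show ?thesis
        using hom_add[OF s d, of \<psi> \<chi>] hom_add[OF t d, of \<psi> \<chi>] \<psi> \<chi> by (simp add: free_simps(1))
    qed
  qed
  then show ?thesis using \<phi> by (auto simp: free_simps(1,3))
qed

lemma free_lepoll:
  assumes small: "small_in TYPE('v) C" and X: "X \<lesssim> (UNIV :: 'v set)"
    and c: "\<And>b. b \<in> X \<Longrightarrow> c b \<in> Obj C" and d: "d \<in> Obj C"
  shows "carrier (fobj (free_rep X c) d) \<lesssim> (UNIV :: 'v set)"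
  unfolding free_simps
  using small c d by (intro finite_support_lepoll X) (auto simp: small_in_def)

text \<open>\<open>U\<close> is a retract in \<open>'v\<close> of a free module of another type,
  whose own \<open>rep_proj\<close> would test modules of that type only. The lift is therefore
  built by hand: preimages are chosen for the images of the generators, and
  \<open>free_hom_unique\<close> shows that this suffices.\<close>

lemma proj_of_free:
  fixes U :: "('o, 'm, 'k, 'v) rep"
  assumes c: "\<And>b. b \<in> X \<Longrightarrow> c b \<in> Obj C" and U: "is_rep U"
    and e: "rep_hom (free_rep X c) U e" and e': "rep_hom U (free_rep X c) e'"
    and inv: "\<And>a y. a \<in> Obj C \<Longrightarrow> y \<in> carrier (fobj U a) \<Longrightarrow> e a (e' a y) = y"
  shows "rep_proj U"
  unfolding rep_proj_def
proof (intro conjI U allI impI; elim conjE)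
  fix M N :: "('o, 'm, 'k, 'v) rep" and g f
  assume M: "is_rep M" and N: "is_rep N" and g: "rep_hom M N g" "rep_surj M N g"
      and f: "rep_hom U N f"
  let ?F = "free_rep X c"
  have fe: "rep_hom ?F N (\<lambda>a x. f a (e a x))" by (rule hom_comp[OF e f])
  have "\<forall>b\<in>X. \<exists>x\<in>carrier (fobj M (c b)). g (c b) x = f (c b) (e (c b) (free_gen X c b))"
    using g(2) c hom_closed[OF fe c free_gen_closed[OF c]] unfolding rep_surj_def by blast
  then obtain n where n: "\<And>b. b \<in> X \<Longrightarrow> n b \<in> carrier (fobj M (c b))"
    "\<And>b. b \<in> X \<Longrightarrow> g (c b) (n b) = f (c b) (e (c b) (free_gen X c b))" by metis
  obtain t where t: "rep_hom ?F M t" "\<And>b. b \<in> X \<Longrightarrow> t (c b) (free_gen X c b) = n b"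
    using free_lift[of X c M n, OF c M n(1)] by metis
  have "g a (t a x) = f a (e a x)" if "a \<in> Obj C" "x \<in> carrier (fobj ?F a)" for a x
  proof (rule free_hom_unique[OF c N hom_comp[OF t(1) g(1)] fe _ that])
    fix b assume b: "b \<in> X"
    show "g (c b) (t (c b) (free_gen X c b)) = f (c b) (e (c b) (free_gen X c b))"
      using t(2)[OF b] n(2)[OF b] by metis
  qed
  then have "\<forall>a\<in>Obj C. \<forall>x\<in>carrier (fobj U a). g a (t a (e' a x)) = f a x"
    using inv hom_closed[OF e'] by simp
  then show "\<exists>h. rep_hom U M h \<and> (\<forall>a\<in>Obj C. \<forall>x\<in>carrier (fobj U a). g a (h a x) = f a x)"
    using hom_comp[OF e' t(1)] by blast
qed

text \<open>There is one generator for each element of \<open>M\<close>, sent to that element. The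
  isomorphisms \<open>e\<close> and \<open>e'\<close> stay in the conclusion because the action of
  the ideal is later described in coordinates.\<close>

lemma free_cover:
  fixes M :: "('o, 'm, 'k, 'v) rep"
  assumes small: "small_in TYPE('v) C" and M: "is_rep M"
  defines "X \<equiv> SIGMA a:Obj C. carrier (fobj M a)"
  obtains U :: "('o, 'm, 'k, 'v) rep" and e e' p where
    "is_rep U" "rep_hom (free_rep X fst) U e" "rep_hom U (free_rep X fst) e'"
    "\<And>a x. a \<in> Obj C \<Longrightarrow> x \<in> carrier (fobj (free_rep X fst) a) \<Longrightarrow> e' a (e a x) = x"
    "\<And>a y. a \<in> Obj C \<Longrightarrow> y \<in> carrier (fobj U a) \<Longrightarrow> e a (e' a y) = y"
    "rep_proj U" "rep_hom U M p" "rep_surj U M p" "X \<lesssim> (UNIV :: 'v set)"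
proof -
  have c: "\<And>b. b \<in> X \<Longrightarrow> fst b \<in> Obj C" by (auto simp: X_def)
  have inf: "infinite (UNIV :: 'v set)" using small by (simp add: small_in_def)
  have "X \<lesssim> Obj C \<times> (UNIV :: 'v set)" unfolding X_def by (intro subset_imp_lepoll) auto
  also have "\<dots> \<lesssim> (UNIV :: 'v set) \<times> (UNIV :: 'v set)"
    using small by (intro times_lepoll_mono) (auto simp: small_in_def)
  also have "\<dots> \<lesssim> (UNIV :: 'v set)" by (rule infinite_Times_lepoll[OF inf])
  finally have X: "X \<lesssim> (UNIV :: 'v set)" .
  note F = is_rep_free[of X fst, OF c]
  obtain U :: "('o, 'm, 'k, 'v) rep" and e e' where U: "is_rep U" "rep_hom (free_rep X fst) U e"
      "rep_hom U (free_rep X fst) e'"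
    "\<And>a x. a \<in> Obj C \<Longrightarrow> x \<in> carrier (fobj (free_rep X fst) a) \<Longrightarrow> e' a (e a x) = x"
    "\<And>a y. a \<in> Obj C \<Longrightarrow> y \<in> carrier (fobj U a) \<Longrightarrow> e a (e' a y) = y"
    using transport_rep[OF F free_lepoll[OF small X c]] by metis
  have pU: "rep_proj U" by (rule proj_of_free[of X fst, OF c U(1,2,3,5)])
  have snd: "\<And>b. b \<in> X \<Longrightarrow> snd b \<in> carrier (fobj M (fst b))" by (auto simp: X_def)
  obtain t where t: "rep_hom (free_rep X fst) M t"
      "\<And>b. b \<in> X \<Longrightarrow> t (fst b) (free_gen X fst b) = snd b"
    using free_lift[of X fst M snd, OF c M snd] by metis
  have "rep_surj U M (\<lambda>a x. t a (e' a x))"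
    unfolding rep_surj_def
  proof (intro ballI)
    fix a y assume a: "a \<in> Obj C" and y: "y \<in> carrier (fobj M a)"
    then have b: "(a, y) \<in> X" by (simp add: X_def)
    note g = free_gen_closed[of X fst, OF c b]
    have "t a (e' a (e a (free_gen X fst (a, y)))) = y"
      using U(4)[OF a, of "free_gen X fst (a, y)"] g t(2)[OF b] by simp
    then show "\<exists>x\<in>carrier (fobj U a). t a (e' a x) = y"
      using hom_closed[OF U(2) a, of "free_gen X fst (a, y)"] g by auto
  qed
  then show ?thesis
    using U pU hom_comp[OF U(3) t(1)] X
    by (intro that[of U e e' "\<lambda>a x. t a (e' a x)"]) auto
qed

end

section \<open>Modules over a quotient category\<close>

locale linear_quotient =
  fixes K :: "'k ring" and C :: "('o, 'm, 'k) kcat" and I :: "'o \<Rightarrow> 'o \<Rightarrow> 'm set"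
  assumes cring_K: "cring K" and kcat: "kcategory K C" and ideal: "two_sided_ideal K C I"
begin

abbreviation cls :: "'o \<Rightarrow> 'o \<Rightarrow> 'm \<Rightarrow> 'm set" where
  "cls a b f \<equiv> I a b +>\<^bsub>HomK C a b\<^esub> f"

lemmas kc = kcategoryD[OF kcat]

lemma sub_I: "a \<in> Obj C \<Longrightarrow> b \<in> Obj C \<Longrightarrow> submodule (I a b) K (HomK C a b)"
  using ideal by (simp add: two_sided_ideal_def)

lemma I_Cmp:
  assumes "a \<in> Obj C" "b \<in> Obj C" "c \<in> Obj C" "f \<in> Hom C a b" "g \<in> Hom C b c"
      "f \<in> I a b \<or> g \<in> I b c"
  shows "Cmp C a b c g f \<in> I a c"
  using ideal assms unfolding two_sided_ideal_def by blast

lemma I_Hom: "a \<in> Obj C \<Longrightarrow> b \<in> Obj C \<Longrightarrow> f \<in> I a b \<Longrightarrow> f \<in> Hom C a b"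
  using submodule_subset[OF sub_I] kc(2) by blast

lemma cls_eq_iff:
  assumes "a \<in> Obj C" "b \<in> Obj C" "f \<in> Hom C a b" "g \<in> Hom C a b"
  shows "cls a b f = cls a b g \<longleftrightarrow> f \<ominus>\<^bsub>HomK C a b\<^esub> g \<in> I a b"
  using coset_eq_iff[OF kc(1) sub_I, of a b f g] assms kc(2) by simp

lemma quot_Obj [simp]: "Obj (quot_cat C I) = Obj C"
  by (simp add: quot_cat_def)

lemma quot_Hom: "a \<in> Obj C \<Longrightarrow> b \<in> Obj C \<Longrightarrow> Hom (quot_cat C I) a b = cls a b ` Hom C a b"
  using kc(2) by (simp add: quot_cat_def quot_module_simps)

lemma quot_Idn: "Idn (quot_cat C I) a = cls a a (Idn C a)"
  by (simp add: quot_cat_def)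

lemma quot_HomK: "HomK (quot_cat C I) a b = quot_module (HomK C a b) (I a b)"
  by (simp add: quot_cat_def)

text \<open>Changing one factor at a time alters the composite by a composite with a member of
  \<open>I\<close>, so its class is independent of the representatives and the unions in the
  definition collapse.\<close>

lemma quot_Cmp:
  assumes abc: "a \<in> Obj C" "b \<in> Obj C" "c \<in> Obj C" and f: "f \<in> Hom C a b" and g: "g \<in> Hom C b c"
  shows "Cmp (quot_cat C I) a b c (cls b c g) (cls a b f) = cls a c (Cmp C a b c g f)"
proof -
  interpret H: module K "HomK C a c" by (rule kc(1)[OF abc(1,3)])
  have fH: "f \<in> carrier (HomK C a b)" and gH: "g \<in> carrier (HomK C b c)" using f g abc kc(2) by auto
  have eq: "cls a c (Cmp C a b c g' f') = cls a c (Cmp C a b c g f)"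
    if g': "g' \<in> cls b c g" and f': "f' \<in> cls a b f" for g' f'
  proof -
    note f' = coset_minus_mem[OF kc(1)[OF abc(1,2)] sub_I[OF abc(1,2)] fH f']
    note g' = coset_minus_mem[OF kc(1)[OF abc(2,3)] sub_I[OF abc(2,3)] gH g']
    have f'h: "f' \<in> Hom C a b" and g'h: "g' \<in> Hom C b c" using f' g' abc kc(2) by auto
    have "Cmp C a b c g' f' \<ominus>\<^bsub>HomK C a c\<^esub> Cmp C a b c g f' = Cmp C a b c (g' \<ominus>\<^bsub>HomK C b c\<^esub> g) f'"
      using linear_map_minus[OF kc(1)[OF abc(2,3)] kc(1)[OF abc(1,3)] kc(4)[OF abc f'h] g'(1) gH]
          by simp
    then have "Cmp C a b c g' f' \<ominus>\<^bsub>HomK C a c\<^esub> Cmp C a b c g f' \<in> I a c"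
      using I_Cmp[OF abc f'h I_Hom[OF abc(2,3) g'(2)]] g'(2) by simp
    then have 1: "cls a c (Cmp C a b c g' f') = cls a c (Cmp C a b c g f')"
      using cls_eq_iff[OF abc(1,3) kc(6)[OF abc f'h g'h] kc(6)[OF abc f'h g]] by simp
    have "Cmp C a b c g f' \<ominus>\<^bsub>HomK C a c\<^esub> Cmp C a b c g f = Cmp C a b c g (f' \<ominus>\<^bsub>HomK C a b\<^esub> f)"
      using linear_map_minus[OF kc(1)[OF abc(1,2)] kc(1)[OF abc(1,3)] kc(3)[OF abc g] f'(1) fH]
          by simp
    then have "Cmp C a b c g f' \<ominus>\<^bsub>HomK C a c\<^esub> Cmp C a b c g f \<in> I a c"
      using I_Cmp[OF abc I_Hom[OF abc(1,2) f'(2)] g] f'(2) by simp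
    then have "cls a c (Cmp C a b c g f') = cls a c (Cmp C a b c g f)"
      using cls_eq_iff[OF abc(1,3) kc(6)[OF abc f'h g] kc(6)[OF abc f g]] by simp
    with 1 show ?thesis by simp
  qed
  show ?thesis
  proof -
    have "(\<Union>f'\<in>cls a b f. cls a c (Cmp C a b c g' f')) = cls a c (Cmp C a b c g f)"
        if "g' \<in> cls b c g" for g'
      using UN_coset[OF kc(1)[OF abc(1,2)] sub_I[OF abc(1,2)] fH, of "\<lambda>f'.
          cls a c (Cmp C a b c g' f')"]
        eq[OF that] coset_self[OF kc(1)[OF abc(1,2)] sub_I[OF abc(1,2)] fH] by metis
    then have "(\<Union>g'\<in>cls b c g. \<Union>f'\<in>cls a b f. cls a c (Cmp C a b c g' f')) =
        cls a c (Cmp C a b c g f)"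
      using UN_coset[OF kc(1)[OF abc(2,3)] sub_I[OF abc(2,3)] gH,
          of "\<lambda>g'. \<Union>f'\<in>cls a b f. cls a c (Cmp C a b c g' f')"]
        coset_self[OF kc(1)[OF abc(2,3)] sub_I[OF abc(2,3)] gH] by metis
    then show ?thesis by (simp add: quot_cat_def)
  qed
qed

lemma quot_add:
  assumes "a \<in> Obj C" "b \<in> Obj C" "f \<in> Hom C a b" "g \<in> Hom C a b"
  shows "cls a b f \<oplus>\<^bsub>HomK (quot_cat C I) a b\<^esub> cls a b g = cls a b (f \<oplus>\<^bsub>HomK C a b\<^esub> g)"
  unfolding quot_HomK using assms kc(2)[OF assms(1,2)]
  by (intro quot_module_add[OF kc(1)[OF assms(1,2)] sub_I[OF assms(1,2)]]) auto

lemma quot_smult: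
  assumes "a \<in> Obj C" "b \<in> Obj C" "r \<in> carrier K" "f \<in> Hom C a b"
  shows "r \<odot>\<^bsub>HomK (quot_cat C I) a b\<^esub> cls a b f = cls a b (r \<odot>\<^bsub>HomK C a b\<^esub> f)"
  unfolding quot_HomK using assms kc(2)[OF assms(1,2)]
  by (intro quot_module_smult[OF kc(1)[OF assms(1,2)] sub_I[OF assms(1,2)]]) auto

sublocale C: linear_kcat K C
  by (rule linear_kcat.intro[OF cring_K kcat])

text \<open>\<open>linear_cat\<close> asks for closure of the Hom-sets, which the formulas for
  operations on classes provide. All its results then hold over \<open>C/I\<close> as well as over
  \<open>C\<close>.\<close>

sublocale Q: linear_cat K "quot_cat C I"
proof
  fix a b assume "a \<in> Obj (quot_cat C I)" "b \<in> Obj (quot_cat C I)"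
  show "carrier (HomK (quot_cat C I) a b) = Hom (quot_cat C I) a b" by (simp add: quot_cat_def)
next
  fix a assume "a \<in> Obj (quot_cat C I)"
  then show "Idn (quot_cat C I) a \<in> Hom (quot_cat C I) a a" by (simp add: quot_Hom quot_Idn kc(5))
next
  fix a b c f g
  assume "a \<in> Obj (quot_cat C I)" "b \<in> Obj (quot_cat C I)" "c \<in> Obj (quot_cat C I)"
    "f \<in> Hom (quot_cat C I) a b" "g \<in> Hom (quot_cat C I) b c"
  then show "Cmp (quot_cat C I) a b c g f \<in> Hom (quot_cat C I) a c"
      by (auto simp: quot_Hom quot_Cmp kc(6))
next
  fix a b f g
  assume "a \<in> Obj (quot_cat C I)" "b \<in> Obj (quot_cat C I)" "f \<in> Hom (quot_cat C I) a b"
      "g \<in> Hom (quot_cat C I) a b"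
  then show "f \<oplus>\<^bsub>HomK (quot_cat C I) a b\<^esub> g \<in> Hom (quot_cat C I) a b"
    by (auto simp: quot_Hom quot_add C.Hom_add_closed)
next
  fix a b r f
  assume "a \<in> Obj (quot_cat C I)" "b \<in> Obj (quot_cat C I)" "r \<in> carrier K"
      "f \<in> Hom (quot_cat C I) a b"
  then show "r \<odot>\<^bsub>HomK (quot_cat C I) a b\<^esub> f \<in> Hom (quot_cat C I) a b"
    by (auto simp: quot_Hom quot_smult C.Hom_smult_closed)
qed

section \<open>Restriction along the projection, and modules annihilated by the ideal\<close>

abbreviation pull :: "('o, 'm set, 'k, 'v) rep \<Rightarrow> ('o, 'm, 'k, 'v) rep" where
  "pull M \<equiv> fcomp M (quot_proj C I)"

lemma pull_simps [simp]:
  "fobj (pull M) = fobj M" "farr (pull M) a b f = farr M a b (cls a b f)"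
  by (simp_all add: fcomp_def quot_proj_def)

lemma cls_Hom: "a \<in> Obj C \<Longrightarrow> b \<in> Obj C \<Longrightarrow> f \<in> Hom C a b \<Longrightarrow> cls a b f \<in> Hom (quot_cat C I) a b"
  by (simp add: quot_Hom)

lemma rep_pull:
  assumes "Q.is_rep M"
  shows "C.is_rep (pull M)"
  unfolding C.is_rep_def
  using assms
  by (simp add: Q.rep_module Q.rep_arr_linear cls_Hom quot_Idn[symmetric] Q.rep_arr_id
      quot_Cmp[symmetric]
      Q.rep_arr_comp quot_add[symmetric] quot_smult[symmetric] Q.rep_arr_plus Q.rep_arr_scale)

text \<open>Restriction is fully faithful, with the very same families of maps, since every arrow of
  the quotient is the class of an arrow of \<open>C\<close>.\<close>

lemma hom_pull: "C.rep_hom (pull M) (pull N) t \<longleftrightarrow> Q.rep_hom M N t"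
  by (auto simp: C.rep_hom_def Q.rep_hom_def quot_Hom)

lemma surj_pull: "C.rep_surj (pull M) (pull N) t \<longleftrightarrow> Q.rep_surj M N t"
  by (simp add: C.rep_surj_def Q.rep_surj_def)

lemma cls_zero:
  assumes "a \<in> Obj C" "b \<in> Obj C" "f \<in> I a b"
  shows "cls a b f = cls a b \<zero>\<^bsub>HomK C a b\<^esub>"
proof -
  interpret H: module K "HomK C a b" by (rule kc(1)[OF assms(1,2)])
  have z: "\<zero>\<^bsub>HomK C a b\<^esub> \<in> Hom C a b" using kc(2)[OF assms(1,2)] H.zero_closed by simp
  have f: "f \<in> Hom C a b" "f \<in> carrier (HomK C a b)" using I_Hom[OF assms] kc(2)[OF assms(1,2)]
      by auto
  show ?thesis
    using assms(3) f by (simp add: cls_eq_iff[OF assms(1,2) f(1) z] H.minus_zero_right)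
qed

text \<open>The modules annihilated by \<open>I\<close>. They amount to the modules over
  \<open>C/I\<close>, by \<open>kills_pull\<close> in one direction and \<open>descend\<close> in
  the other.\<close>

definition kills :: "('o, 'm, 'k, 'v) rep \<Rightarrow> bool" where
  "kills U \<longleftrightarrow> (\<forall>a\<in>Obj C. \<forall>b\<in>Obj C. \<forall>f\<in>I a b. \<forall>x\<in>carrier (fobj U a). farr U a b f x = \<zero>\<^bsub>fobj U b\<^esub>)"

lemma kills_pull:
  assumes M: "Q.is_rep M"
  shows "kills (pull M)"
  unfolding kills_def
proof (intro ballI)
  fix a b f x assume ab: "a \<in> Obj C" "b \<in> Obj C" and f: "f \<in> I a b"
      and x: "x \<in> carrier (fobj (pull M) a)"
  have "farr (pull M) a b f x = farr (pull M) a b \<zero>\<^bsub>HomK C a b\<^esub> x"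
    using cls_zero[OF ab f] by simp
  also have "\<dots> = \<zero>\<^bsub>fobj (pull M) b\<^esub>" by (rule C.rep_zero_arr[OF rep_pull[OF M] ab x])
  finally show "farr (pull M) a b f x = \<zero>\<^bsub>fobj (pull M) b\<^esub>" .
qed

text \<open>The choice of a representative is harmless only for functors that vanish on \<open>I\<close>.\<close>

definition descend :: "('o, 'm, 'k, 'v) rep \<Rightarrow> ('o, 'm set, 'k, 'v) rep" where
  "descend U = \<lparr>fobj = fobj U, farr = (\<lambda>a b X. farr U a b (SOME f. f \<in> X))\<rparr>"

lemma fobj_descend [simp]: "fobj (descend U) = fobj U"
  by (simp add: descend_def)

lemma farr_descend:
  assumes U: "C.is_rep U" "kills U" and ab: "a \<in> Obj C" "b \<in> Obj C" and f: "f \<in> Hom C a b"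
    and x: "x \<in> carrier (fobj U a)"
  shows "farr (descend U) a b (cls a b f) x = farr U a b f x"
proof -
  interpret H: module K "HomK C a b" by (rule kc(1)[OF ab])
  interpret U: module K "fobj U b" by (rule C.rep_module[OF U(1) ab(2)])
  define g where "g = (SOME g. g \<in> cls a b f)"
  have fH: "f \<in> carrier (HomK C a b)" using f kc(2)[OF ab] by simp
  have "g \<in> cls a b f"
    unfolding g_def using coset_self[OF kc(1)[OF ab] sub_I[OF ab] fH] by (rule someI)
  then obtain i where i: "i \<in> I a b" "g = i \<oplus>\<^bsub>HomK C a b\<^esub> f" by (auto simp: coset_mem_iff)
  have "farr U a b g x = farr U a b i x \<oplus>\<^bsub>fobj U b\<^esub> farr U a b f x"
    unfolding i(2) by (rule C.rep_arr_plus[OF U(1) ab I_Hom[OF ab i(1)] f x])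
  also have "\<dots> = farr U a b f x"
    using U(2) ab i(1) x C.rep_arr_closed[OF U(1) ab f x] by (simp add: kills_def)
  finally show ?thesis by (simp add: descend_def g_def)
qed

lemma rep_descend:
  assumes U: "C.is_rep U" "kills U"
  shows "Q.is_rep (descend U)"
proof -
  have "linear_map K (fobj U a) (fobj U b) (farr (descend U) a b (cls a b f))"
    if ab: "a \<in> Obj C" "b \<in> Obj C" and f: "f \<in> Hom C a b" for a b f
  proof -
    interpret U: module K "fobj U a" by (rule C.rep_module[OF U(1) ab(1)])
    show ?thesis
      using C.rep_arr_linear[OF U(1) ab f] farr_descend[OF U ab f]
          by (auto simp: linear_map_def Pi_def)
  qed
  then show ?thesis
    unfolding Q.is_rep_def
    using U
    by (auto simp: quot_Hom quot_Idn quot_Cmp quot_add quot_smult farr_descend C.rep_module kc(5,6)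
        C.Hom_add_closed C.Hom_smult_closed C.rep_arr_closed C.rep_arr_id C.rep_arr_comp
            C.rep_arr_plus C.rep_arr_scale)
qed

lemma hom_from_descend:
  assumes U: "C.is_rep U" "kills U"
  shows "Q.rep_hom (descend U) M t \<longleftrightarrow> C.rep_hom U (pull M) t"
  using U by (auto simp: Q.rep_hom_def C.rep_hom_def quot_Hom farr_descend)

lemma hom_to_descend:
  assumes U: "C.is_rep U" "kills U"
  shows "Q.rep_hom M (descend U) t \<longleftrightarrow> C.rep_hom (pull M) U t"
proof -
  have "linear_map K (fobj M a) (fobj U a) (t a) \<Longrightarrow> a \<in> Obj C \<Longrightarrow> b \<in> Obj C \<Longrightarrow> f \<in> Hom C a b \<Longrightarrow>
    x \<in> carrier (fobj M a) \<Longrightarrow> farr (descend U) a b (cls a b f) (t a x) = farr U a b f (t a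
        x)" for a b f x
    by (simp add: farr_descend[OF U] linear_map_closed)
  then show ?thesis by (auto simp: Q.rep_hom_def C.rep_hom_def quot_Hom)
qed

section \<open>Comparison of Ext over the two categories\<close>

lemma resolves_pull:
  assumes "Q.resolves A X d e"
  shows "C.resolves (pull A) (\<lambda>n. pull (X n)) d e"
  using assms rep_pull
  unfolding C.resolves_def Q.resolves_def hom_pull surj_pull
  by (auto simp: C.rep_im_def Q.rep_im_def)

lemma Obj_pull:
  assumes "M \<in> Obj (ModCat K (quot_cat C I))"
  shows "pull M \<in> Obj (ModCat K C)"
  using assms rep_pull by (auto simp: C.Obj_ModCat_iff Q.Obj_ModCat_iff quot_Hom)

text \<open>A projective resolution over \<open>C/I\<close> restricts to a resolution with good
  terms, so \<open>good_comparison\<close> with \<open>pull N\<close> shows that composition of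
  cocycles with \<open>h\<close> is bijective modulo coboundaries. As this holds for every
  comparison, the objects chosen by \<open>SOME\<close> only have to be shown to exist.\<close>

lemma Ext_map_linear_iso:
  fixes M N :: "('o, 'm set, 'k, 'v) rep"
  assumes inf: "infinite (UNIV :: 'v set)"
    and enoughC: "\<And>M :: ('o, 'm, 'k, 'v) rep. C.is_rep M \<Longrightarrow>
      \<exists>(Q :: ('o, 'm, 'k, 'v) rep) p. C.rep_proj Q \<and> C.rep_hom Q M p \<and> C.rep_surj Q M p"
    and enoughQ: "\<And>M :: ('o, 'm set, 'k, 'v) rep. Q.is_rep M \<Longrightarrow>
      \<exists>(Q :: ('o, 'm set, 'k, 'v) rep) p. Q.rep_proj Q \<and> Q.rep_hom Q M p \<and> Q.rep_surj Q M p"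
    and good: "\<And>(Q :: ('o, 'm set, 'k, 'v) rep) (N :: ('o, 'm set, 'k, 'v) rep).
      Q.rep_proj Q \<Longrightarrow> Q.is_rep N \<Longrightarrow> C.good (pull N) (pull Q)"
    and M: "M \<in> Obj (ModCat K (quot_cat C I))" and N: "N \<in> Obj (ModCat K (quot_cat C I))"
  defines "P \<equiv> precomp C (quot_proj C I)"
  shows "linear_iso K (Ext (ModCat K (quot_cat C I)) M N i) (Ext (ModCat K C) (fobj P M) (fobj P
      N) i)
    (Ext_map (ModCat K (quot_cat C I)) (ModCat K C) P M N i)"
proof -
  let ?A = "ModCat K (quot_cat C I) :: (('o, 'm set, 'k, 'v) rep, 'o \<Rightarrow> 'v \<Rightarrow> 'v, 'k) kcat"
  let ?B = "ModCat K C :: (('o, 'm, 'k, 'v) rep, 'o \<Rightarrow> 'v \<Rightarrow> 'v, 'k) kcat"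
  have P: "fobj P L = pull L" for L by (simp add: P_def precomp_def)
  have Pa: "farr P L L' t a = t a" if "a \<in> Obj C" for L L' t a
    using that by (simp add: P_def precomp_def quot_proj_def)
  define R where "R = the_resolution ?A M"
  define S where "S = the_resolution ?B (pull M)"
  note rM = Q.Obj_ModCat_rep[OF M] and rN = Q.Obj_ModCat_rep[OF N]
  have pM: "pull M \<in> Obj ?B" and pN: "pull N \<in> Obj ?B" using Obj_pull M N by auto
  have prR: "projective_resolution ?A M R"
    unfolding R_def by (rule Q.projective_resolution_ModCat_exists[OF enoughQ M])
  have prS: "projective_resolution ?B (pull M) S"
    unfolding S_def by (rule C.projective_resolution_ModCat_exists[OF enoughC pM])
  note R = Q.projective_resolution_ModCatD[OF M prR]
  note S = C.projective_resolution_ModCatD[OF pM prS]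
  note rR = Q.Obj_ModCat_rep[OF R(1)] and rS = C.Obj_ModCat_rep[OF S(1)]
  note resX = resolves_pull[OF R(5)]
  note pR = Obj_pull[OF R(1)]
  have goodX: "C.good (pull N) (pull (rterm R n))" for n by (rule good[OF R(2) rN])
  define h where "h = (SOME h. comparison ?A ?B P M R S h)"
  \<comment> \<open>This gives meaning to the choice of \<open>h\<close>: the chain map from
    \<open>chain_map_exists\<close>, normalised by \<open>ext_hom\<close>, is a comparison.\<close>
  have "\<exists>h. comparison ?A ?B P M R S h"
  proof -
    obtain h0 where h0: "C.chain_map (pull M) (rterm S) (rdiff S) (raug S) (\<lambda>n.
        pull (rterm R n)) (rdiff R) (raug R) h0"
      using C.chain_map_exists[OF resX S(5,2)] by blast
    then have h0h: "C.rep_hom (rterm S n) (pull (rterm R n)) (h0 n)" for n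
        by (simp add: C.chain_map_def)
    have dS: "rdiff S n a x \<in> carrier (fobj (rterm S n) a)"
      if "a \<in> Obj C" "x \<in> carrier (fobj (rterm S (Suc n)) a)" for n a x
      using C.hom_closed[OF C.Hom_ModCat_hom[OF rS S(1) S(3)] that] .
    have "comparison ?A ?B P M R S (\<lambda>n. C.ext_hom (rterm S n) (h0 n))"
      unfolding comparison_def P
    proof (intro conjI allI)
      show "C.ext_hom (rterm S n) (h0 n) \<in> Hom ?B (rterm S n) (pull (rterm R n))" for n
        by (rule C.ext_hom_in_Hom[OF rS pR h0h])
      show "Cmp ?B (rterm S 0) (pull (rterm R 0)) (pull M) (farr P (rterm R 0) M (raug R))
          (C.ext_hom (rterm S 0) (h0 0)) = raug S"
      proof -
        have "raug S = C.ext_hom (rterm S 0) (raug S)" using S(4) C.Hom_ModCat_iff[OF rS pM]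
            by blast
        then show ?thesis
          unfolding C.Cmp_ModCat using h0
              by (subst \<open>raug S = _\<close>, intro C.ext_hom_eqI) (simp add: Pa C.chain_map_def)
      qed
      show "Cmp ?B (rterm S (Suc n)) (pull (rterm R (Suc n))) (pull (rterm R n))
          (farr P (rterm R (Suc n)) (rterm R n) (rdiff R n)) (C.ext_hom (rterm S (Suc n)) (h0 (Suc
              n))) =
        Cmp ?B (rterm S (Suc n)) (rterm S n) (pull (rterm R n)) (C.ext_hom (rterm S n) (h0 n))
            (rdiff S n)" for n
        unfolding C.Cmp_ModCat using h0 dS by (intro C.ext_hom_eqI) (simp add: Pa C.chain_map_def)
    qed
    then show ?thesis by blast
  qed
  then have cmp: "comparison ?A ?B P M R S h" unfolding h_def by (rule someI_ex)
  have hH: "h n \<in> Hom ?B (rterm S n) (pull (rterm R n))" for n using cmp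
      by (simp add: comparison_def P)
  note hh = C.Hom_ModCat_hom[OF rS pR hH]
  have chain: "C.chain_map (pull M) (rterm S) (rdiff S) (raug S) (\<lambda>n. pull (rterm R n)) (rdiff R)
      (raug R) h"
    unfolding C.chain_map_def
  proof (intro conjI allI ballI hh)
    show "raug R a (h 0 a x) = raug S a x" if "a \<in> Obj C" "x \<in> carrier (fobj (rterm S 0) a)" for a x
    proof -
      have "Cmp ?B (rterm S 0) (pull (rterm R 0)) (pull M) (farr P (rterm R 0) M (raug R)) (h 0) a
          x = raug S a x"
        using cmp by (simp add: comparison_def P)
      then show ?thesis using that by (simp add: C.Cmp_ModCat Pa)
    qed
    show "rdiff R n a (h (Suc n) a x) = h n a (rdiff S n a x)"
      if "a \<in> Obj C" "x \<in> carrier (fobj (rterm S (Suc n)) a)" for n a x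
    proof -
      have "Cmp ?B (rterm S (Suc n)) (pull (rterm R (Suc n))) (pull (rterm R n))
          (farr P (rterm R (Suc n)) (rterm R n) (rdiff R n)) (h (Suc n)) a x =
        Cmp ?B (rterm S (Suc n)) (rterm S n) (pull (rterm R n)) (h n) (rdiff S n) a x"
        using cmp by (simp add: comparison_def P)
      then show ?thesis using that by (simp add: C.Cmp_ModCat Pa)
    qed
  qed
  note gc = C.good_comparison[OF inf rep_pull[OF rN] resX goodX S(5,2) chain]
  let ?V = "HomK ?A (rterm R i) N" and ?W = "HomK ?B (rterm S i) (pull N)"
  let ?ZV = "cocycles ?A R N i" and ?BV = "coboundaries ?A R N i"
  let ?ZW = "cocycles ?B S (pull N) i" and ?BW = "coboundaries ?B S (pull N) i"
  \<comment> \<open>The map on cochains that induces \<open>Ext_map\<close>; on elements it is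
    composition with \<open>h i\<close>.\<close>
  define \<phi> where "\<phi> = (\<lambda>f. Cmp ?B (rterm S i) (pull (rterm R i)) (pull N) (farr P (rterm R i) N f)
      (h i))"
  have V: "module K ?V" by (rule Q.module_HomK_ModCat[OF cring_K rR N])
  have W: "module K ?W" by (rule C.module_HomK_ModCat[OF cring_K rS pN])
  have ZV: "submodule ?ZV K ?V" by (rule Q.submodule_cocycles[OF cring_K R(1) N R(3)])
  have BV: "submodule ?BV K ?V" by (rule Q.submodule_coboundaries[OF cring_K R(1) N R(3)])
  have ZW: "submodule ?ZW K ?W" by (rule C.submodule_cocycles[OF cring_K S(1) pN S(3)])
  have BW: "submodule ?BW K ?W" by (rule C.submodule_coboundaries[OF cring_K S(1) pN S(3)])
  have BZV: "?BV \<subseteq> ?ZV" by (rule Q.coboundaries_subset_cocycles[OF R(1) N R(3) R(5)])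
  have BZW: "?BW \<subseteq> ?ZW" by (rule C.coboundaries_subset_cocycles[OF S(1) pN S(3) S(5)])
  note ZViff = Q.cocycles_ModCat_iff[OF R(1) N] and ZWiff = C.cocycles_ModCat_iff[OF S(1) pN]
  note BViff = Q.coboundaries_ModCat_iff[OF R(1) N R(3)]
      and BWiff = C.coboundaries_ModCat_iff[OF S(1) pN S(3)]
  have \<phi>: "\<phi> f a x = f a (h i a x)" if "a \<in> Obj C" "x \<in> carrier (fobj (rterm S i) a)" for f a x
    using that by (simp add: \<phi>_def C.Cmp_ModCat Pa)
  have homV: "C.rep_hom (pull (rterm R n)) (pull N) f" if "f \<in> Hom ?A (rterm R n) N" for f n
    unfolding hom_pull by (rule Q.Hom_ModCat_hom[OF rR N that])
  have \<phi>_Hom: "\<phi> f \<in> Hom ?B (rterm S i) (pull N)" if f: "f \<in> Hom ?A (rterm R i) N" for f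
  proof -
    have "\<phi> f = C.ext_hom (rterm S i) (\<lambda>a x. f a (h i a x))"
      unfolding \<phi>_def C.Cmp_ModCat by (rule C.ext_hom_eqI) (simp add: Pa)
    then show ?thesis using C.ext_hom_in_Hom[OF rS pN C.hom_comp[OF hh homV[OF f]]] by simp
  qed
  have hd: "dSx \<in> carrier (fobj (rterm S i) a)"
      if "a \<in> Obj C" "x \<in> carrier (fobj (rterm S (Suc i)) a)"
    "dSx = rdiff S i a x" for a x dSx
    using C.hom_closed[OF C.Hom_ModCat_hom[OF rS S(1) S(3)] that(1,2)] that(3) by simp
  have ch: "rdiff R n a (h (Suc n) a x) = h n a (rdiff S n a x)"
    if "a \<in> Obj C" "x \<in> carrier (fobj (rterm S (Suc n)) a)" for n a x
    using chain that by (simp add: C.chain_map_def)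
  have hc: "h n a x \<in> carrier (fobj (rterm R n) a)"
      if "a \<in> Obj C" "x \<in> carrier (fobj (rterm S n) a)" for n a x
    using C.hom_closed[OF hh that] by simp
  have \<phi>_Z: "\<phi> f \<in> ?ZW" if f: "f \<in> ?ZV" for f
    unfolding ZWiff
  proof (intro conjI ballI)
    show "\<phi> f \<in> Hom ?B (rterm S i) (pull N)" using f \<phi>_Hom by (simp add: ZViff)
    fix a x assume a: "a \<in> Obj C" and x: "x \<in> carrier (fobj (rterm S (Suc i)) a)"
    show "\<phi> f a (rdiff S i a x) = \<zero>\<^bsub>fobj (pull N) a\<^esub>"
      using f hc[OF a x] ch[OF a x, symmetric] hd[OF a x refl] a by (simp add: \<phi> ZViff)
  qed
  have \<phi>_B: "\<phi> f \<in> ?BW" if f: "f \<in> ?BV" for f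
    unfolding BWiff
  proof (intro conjI)
    show "\<phi> f \<in> Hom ?B (rterm S i) (pull N)" using f \<phi>_Hom by (simp add: BViff)
    show "case i of 0 \<Rightarrow> \<forall>a\<in>Obj C. \<forall>x\<in>carrier (fobj (rterm S 0) a). \<phi> f a x = \<zero>\<^bsub>fobj (pull N) a\<^esub>
     | Suc m \<Rightarrow> \<exists>g. C.rep_hom (rterm S m) (pull N) g \<and>
         (\<forall>a\<in>Obj C. \<forall>x\<in>carrier (fobj (rterm S i) a). \<phi> f a x = g a (rdiff S m a x))"
    proof (cases i)
      case 0
      then show ?thesis using f[unfolded BViff] \<phi>[of _ _ f] hc by auto
    next
      case (Suc m)
      then obtain g where g: "Q.rep_hom (rterm R m) N g"
        "\<And>a x. a \<in> Obj C \<Longrightarrow> x \<in> carrier (fobj (rterm R i) a) \<Longrightarrow> f a x = g a (rdiff R m a x)"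
        using f unfolding BViff by auto
      have "C.rep_hom (rterm S m) (pull N) (\<lambda>a x. g a (h m a x))"
        using g(1) by (intro C.hom_comp[OF hh]) (simp add: hom_pull)
      moreover have "\<phi> f a x = g a (h m a (rdiff S m a x))"
        if "a \<in> Obj C" "x \<in> carrier (fobj (rterm S i) a)" for a x
        using that g(2)[OF that(1) hc[OF that]] ch[of a x m] Suc by (simp add: \<phi>)
      ultimately show ?thesis using Suc by auto
    qed
  qed
  have carV: "carrier (?V\<lparr>carrier := ?ZV\<rparr>) = ?ZV" and carW: "carrier (?W\<lparr>carrier := ?ZW\<rparr>) = ?ZW"
      by simp_all
  have "linear_iso K (quot_module (?V\<lparr>carrier := ?ZV\<rparr>) ?BV) (quot_module (?W\<lparr>carrier := ?ZW\<rparr>) ?BW)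
    (\<lambda>X. \<Union>f\<in>X. ?BW +>\<^bsub>?W\<lparr>carrier := ?ZW\<rparr>\<^esub> \<phi> f)"
  proof (rule linear_iso_quot_module)
    show "module K (?V\<lparr>carrier := ?ZV\<rparr>)" by (rule submodule.submodule_is_module[OF ZV V])
    show "module K (?W\<lparr>carrier := ?ZW\<rparr>)" by (rule submodule.submodule_is_module[OF ZW W])
    show "submodule ?BV K (?V\<lparr>carrier := ?ZV\<rparr>)" by (rule submodule_of_submodule[OF V ZV BV BZV])
    show "submodule ?BW K (?W\<lparr>carrier := ?ZW\<rparr>)" by (rule submodule_of_submodule[OF W ZW BW BZW])
    show "linear_map K (?V\<lparr>carrier := ?ZV\<rparr>) (?W\<lparr>carrier := ?ZW\<rparr>) \<phi>"
      unfolding linear_map_def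
    proof (intro conjI ballI)
      show "\<phi> \<in> carrier (?V\<lparr>carrier := ?ZV\<rparr>) \<rightarrow> carrier (?W\<lparr>carrier := ?ZW\<rparr>)" using \<phi>_Z by simp
      show "\<phi> (f \<oplus>\<^bsub>?V\<lparr>carrier := ?ZV\<rparr>\<^esub> g) = \<phi> f \<oplus>\<^bsub>?W\<lparr>carrier := ?ZW\<rparr>\<^esub> \<phi> g"
        if "f \<in> carrier (?V\<lparr>carrier := ?ZV\<rparr>)" "g \<in> carrier (?V\<lparr>carrier := ?ZV\<rparr>)" for f g
      proof -
        have "\<phi> (f \<oplus>\<^bsub>?V\<^esub> g) = C.ext_hom (rterm S i) (\<lambda>a x. \<phi> f a x \<oplus>\<^bsub>fobj (pull N) a\<^esub> \<phi> g a x)"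
          unfolding fun_cong[OF \<phi>_def, of "f \<oplus>\<^bsub>?V\<^esub> g"] C.Cmp_ModCat
          by (rule C.ext_hom_eqI) (simp add: Pa \<phi> ModCat_simps hc)
        then show ?thesis by (simp add: ModCat_simps C.ext_hom_def)
      qed
      show "\<phi> (r \<odot>\<^bsub>?V\<lparr>carrier := ?ZV\<rparr>\<^esub> f) = r \<odot>\<^bsub>?W\<lparr>carrier := ?ZW\<rparr>\<^esub> \<phi> f"
        if "r \<in> carrier K" "f \<in> carrier (?V\<lparr>carrier := ?ZV\<rparr>)" for r f
      proof -
        have "\<phi> (r \<odot>\<^bsub>?V\<^esub> f) = C.ext_hom (rterm S i) (\<lambda>a x. r \<odot>\<^bsub>fobj (pull N) a\<^esub> \<phi> f a x)"
          unfolding fun_cong[OF \<phi>_def, of "r \<odot>\<^bsub>?V\<^esub> f"] C.Cmp_ModCat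
          by (rule C.ext_hom_eqI) (simp add: Pa \<phi> ModCat_simps hc)
        then show ?thesis by (simp add: ModCat_simps C.ext_hom_def)
      qed
    qed
    show "\<phi> f \<in> ?BW" if "f \<in> ?BV" for f by (rule \<phi>_B[OF that])
    show "f \<in> ?BV" if "f \<in> carrier (?V\<lparr>carrier := ?ZV\<rparr>)" and fB: "\<phi> f \<in> ?BW" for f
    proof -
      have f: "f \<in> Hom ?A (rterm R i) N"
        "\<And>a x. a \<in> Obj C \<Longrightarrow> x \<in> carrier (fobj (rterm R (Suc i)) a) \<Longrightarrow> f a (rdiff R i a x) =
            \<zero>\<^bsub>fobj N a\<^esub>"
        using that(1) by (auto simp: ZViff)
      have "case i of 0 \<Rightarrow> \<forall>a\<in>Obj C. \<forall>x\<in>carrier (fobj (rterm S 0) a). f a (h 0 a x) =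
          \<zero>\<^bsub>fobj (pull N) a\<^esub>
          | Suc m \<Rightarrow> \<exists>u. C.rep_hom (rterm S m) (pull N) u \<and>
              (\<forall>a\<in>Obj C. \<forall>x\<in>carrier (fobj (rterm S i) a). f a (h i a x) = u a (rdiff S m a x))"
        using fB \<phi>[of _ _ f] unfolding BWiff by (auto split: nat.splits)
      \<comment> \<open>The second half of \<open>good_comparison\<close> supplies the primitive
        over \<open>C\<close>; by \<open>hom_pull\<close> the same family is one over
        \<open>C/I\<close>.\<close>
      from gc(2)[OF homV[OF f(1)] _ this] f(2)
      show ?thesis unfolding BViff using f(1) by (auto simp: hom_pull split: nat.splits)
    qed
    show "\<exists>g\<in>carrier (?V\<lparr>carrier := ?ZV\<rparr>). \<phi> g \<ominus>\<^bsub>?W\<lparr>carrier := ?ZW\<rparr>\<^esub> f \<in> ?BW"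
      if "f \<in> carrier (?W\<lparr>carrier := ?ZW\<rparr>)" for f
    proof -
      have fZ: "f \<in> ?ZW" using that by simp
      then have f: "f \<in> Hom ?B (rterm S i) (pull N)"
        "\<And>a x. a \<in> Obj C \<Longrightarrow> x \<in> carrier (fobj (rterm S (Suc i)) a) \<Longrightarrow> f a (rdiff S i a x) =
            \<zero>\<^bsub>fobj (pull N) a\<^esub>"
        by (auto simp: ZWiff)
      obtain g where g: "C.rep_hom (pull (rterm R i)) (pull N) g"
        "\<forall>a\<in>Obj C. \<forall>x\<in>carrier (fobj (pull (rterm R (Suc i))) a). g a (rdiff R i a x) =
            \<zero>\<^bsub>fobj (pull N) a\<^esub>"
        "case i of 0 \<Rightarrow> \<forall>a\<in>Obj C. \<forall>x\<in>carrier (fobj (rterm S 0) a). f a x = g a (h 0 a x)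
          | Suc m \<Rightarrow> \<exists>u. C.rep_hom (rterm S m) (pull N) u \<and>
              (\<forall>a\<in>Obj C. \<forall>x\<in>carrier (fobj (rterm S i) a). f a x = g a (h i a x) \<ominus>\<^bsub>fobj (pull N) a\<^esub>
                  u a (rdiff S m a x))"
        using gc(1)[OF C.Hom_ModCat_hom[OF rS pN f(1)] f(2)] by blast
      \<comment> \<open>\<open>g\<close> is a map between restricted modules; the same family in
        normal form is an arrow over \<open>C/I\<close>.\<close>
      define g' where "g' = Q.ext_hom (rterm R i) g"
      have g': "g' \<in> Hom ?A (rterm R i) N"
        unfolding g'_def using g(1) by (intro Q.ext_hom_in_Hom rR N) (simp add: hom_pull)
      have dR: "rdiff R i a x \<in> carrier (fobj (rterm R i) a)"
          if "a \<in> Obj C" "x \<in> carrier (fobj (rterm R (Suc i)) a)" for a x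
        using Q.hom_closed[OF Q.Hom_ModCat_hom[OF rR R(1) R(3)], of a x i] that by simp
      have g'Z: "g' \<in> ?ZV" unfolding ZViff using g' g(2) dR by (simp add: g'_def)
      have \<phi>g: "\<phi> g' a x = g a (h i a x)" if "a \<in> Obj C" "x \<in> carrier (fobj (rterm S i) a)" for a x
        using that hc[OF that] by (simp add: \<phi> g'_def)
      have gc': "g a (h i a x) \<in> carrier (fobj (pull N) a)"
          if "a \<in> Obj C" "x \<in> carrier (fobj (rterm S i) a)" for a x
        using C.hom_closed[OF g(1) that(1)] hc[OF that] by simp
      \<comment> \<open>Subtraction within the space of cocycles is replaced by subtraction in the
        full Hom space, where it can be evaluated on elements.\<close>
      have diff: "\<phi> g' \<ominus>\<^bsub>?W\<lparr>carrier := ?ZW\<rparr>\<^esub> f = \<phi> g' \<ominus>\<^bsub>?W\<^esub> f"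
        unfolding a_minus_def submodule_inv_eq[OF W ZW fZ] by simp
      interpret W: module K ?W by (rule W)
      \<comment> \<open>From \<open>f = g h - u d\<close> the difference is the coboundary of
        \<open>u\<close>; in degree 0 it is zero.\<close>
      have "\<phi> g' \<ominus>\<^bsub>?W\<^esub> f \<in> ?BW"
        unfolding BWiff
      proof (intro conjI)
        show "\<phi> g' \<ominus>\<^bsub>?W\<^esub> f \<in> Hom ?B (rterm S i) (pull N)"
          using W.minus_closed[of "\<phi> g'" f] \<phi>_Hom[OF g'] f(1) by (simp add: ModCat_simps)
        have mv: "(\<phi> g' \<ominus>\<^bsub>?W\<^esub> f) a x = g a (h i a x) \<ominus>\<^bsub>fobj (pull N) a\<^esub> f a x"
          if "a \<in> Obj C" "x \<in> carrier (fobj (rterm S i) a)" for a x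
          using that by (simp add: C.minus_HomK_ModCat[OF cring_K rS pN \<phi>_Hom[OF g'] f(1)] \<phi>g)
        show "case i of 0 \<Rightarrow> \<forall>a\<in>Obj C. \<forall>x\<in>carrier (fobj (rterm S 0) a). (\<phi> g' \<ominus>\<^bsub>?W\<^esub> f) a x =
            \<zero>\<^bsub>fobj (pull N) a\<^esub>
         | Suc m \<Rightarrow> \<exists>u. C.rep_hom (rterm S m) (pull N) u \<and>
             (\<forall>a\<in>Obj C. \<forall>x\<in>carrier (fobj (rterm S i) a). (\<phi> g' \<ominus>\<^bsub>?W\<^esub> f) a x = u a (rdiff S m a x))"
        proof (cases i)
          case 0
          have "(\<phi> g' \<ominus>\<^bsub>?W\<^esub> f) a x = \<zero>\<^bsub>fobj (pull N) a\<^esub>"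
            if a: "a \<in> Obj C" and x: "x \<in> carrier (fobj (rterm S i) a)" for a x
          proof -
            interpret Na: module K "fobj N a" using C.rep_module[OF rep_pull[OF rN] a] by simp
            have "f a x = g a (h i a x)" using g(3) a x 0 by simp
            then show ?thesis using mv[OF a x] gc'[OF a x] by (simp add: Na.minus_eq Na.r_neg)
          qed
          then show ?thesis using 0 by simp
        next
          case (Suc m)
          then obtain u where u: "C.rep_hom (rterm S m) (pull N) u"
            "\<And>a x. a \<in> Obj C \<Longrightarrow> x \<in> carrier (fobj (rterm S i) a) \<Longrightarrow>
                f a x = g a (h i a x) \<ominus>\<^bsub>fobj (pull N) a\<^esub> u a (rdiff S m a x)"
            using g(3) by auto
          have "(\<phi> g' \<ominus>\<^bsub>?W\<^esub> f) a x = u a (rdiff S m a x)"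
            if a: "a \<in> Obj C" and x: "x \<in> carrier (fobj (rterm S i) a)" for a x
          proof -
            interpret Na: module K "fobj N a" using C.rep_module[OF rep_pull[OF rN] a] by simp
            have "u a (rdiff S m a x) \<in> carrier (fobj (pull N) a)"
              using C.hom_closed[OF u(1) a]
                  C.hom_closed[OF C.Hom_ModCat_hom[OF rS S(1) S(3)] a, of x m] x Suc by simp
            then show ?thesis
              using mv[OF a x] gc'[OF a x] u(2)[OF a x]
              by (simp add: Na.minus_eq Na.minus_add Na.a_assoc[symmetric] Na.r_neg)
          qed
          then show ?thesis using u(1) Suc by auto
        qed
      qed
      then show ?thesis using g'Z by (intro bexI[of _ g']) (simp_all add: diff)
    qed
  qed
  moreover have "Ext_map ?A ?B P M N i = (\<lambda>X. \<Union>f\<in>X. ?BW +>\<^bsub>?W\<lparr>carrier := ?ZW\<rparr>\<^esub> \<phi> f)"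
    by (rule ext) (simp add: Ext_map_def Let_def P R_def[symmetric] S_def[symmetric]
        h_def[symmetric] \<phi>_def)
  ultimately show ?thesis
    by (simp add: Ext_def cohomology_def P R_def[symmetric] S_def[symmetric])
qed

end

section \<open>Ideals that are representable on the left\<close>

text \<open>What the argument draws from a torsion pair. Composition with \<epsilon> is an
  isomorphism from \<open>C(Z c, -)\<close> to \<open>I(c, -)\<close>: onto by
  \<open>factor\<close>, injective by \<open>eps_cancel\<close>. \<open>Idn_Z\<close> puts
  \<epsilon> into the ideal and makes modules annihilated by \<open>I\<close> vanish at
  \<open>Z c\<close>.\<close>

locale representable_ideal = linear_quotient K C I
  for K :: "'k ring" and C :: "('o, 'm, 'k) kcat" and I :: "'o \<Rightarrow> 'o \<Rightarrow> 'm set" +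
  fixes Z :: "'o \<Rightarrow> 'o" and \<epsilon> :: "'o \<Rightarrow> 'm"
  assumes Z_Obj: "\<And>c. c \<in> Obj C \<Longrightarrow> Z c \<in> Obj C"
    and eps_Hom: "\<And>c. c \<in> Obj C \<Longrightarrow> \<epsilon> c \<in> Hom C c (Z c)"
    and Idn_Z: "\<And>c. c \<in> Obj C \<Longrightarrow> Idn C (Z c) \<in> I (Z c) (Z c)"
    and factor: "\<And>c d f. c \<in> Obj C \<Longrightarrow> d \<in> Obj C \<Longrightarrow> f \<in> I c d \<Longrightarrow>
      \<exists>w\<in>Hom C (Z c) d. f = Cmp C c (Z c) d w (\<epsilon> c)"
    and eps_cancel: "\<And>c d w. c \<in> Obj C \<Longrightarrow> d \<in> Obj C \<Longrightarrow> w \<in> Hom C (Z c) d \<Longrightarrow>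
      Cmp C c (Z c) d w (\<epsilon> c) = \<zero>\<^bsub>HomK C c d\<^esub> \<Longrightarrow> w = \<zero>\<^bsub>HomK C (Z c) d\<^esub>"
begin

lemma eps_I: "c \<in> Obj C \<Longrightarrow> \<epsilon> c \<in> I c (Z c)"
  using I_Cmp[of c "Z c" "Z c" "\<epsilon> c" "Idn C (Z c)"] kc(7)[of c "Z c" "\<epsilon> c"] Z_Obj eps_Hom Idn_Z
    kc(5)[of "Z c"] by simp

text \<open>The identity of \<open>Z c\<close> lies in \<open>I\<close>, so it acts both as the
  identity and as zero.\<close>

lemma kills_Z:
  assumes Y: "C.is_rep Y" "kills Y" and c: "c \<in> Obj C" and y: "y \<in> carrier (fobj Y (Z c))"
  shows "y = \<zero>\<^bsub>fobj Y (Z c)\<^esub>"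
  using C.rep_arr_id[OF Y(1) Z_Obj[OF c] y] Y(2) Z_Obj[OF c] Idn_Z[OF c] y by (auto simp: kills_def)

text \<open>Here \<open>J = I U\<close>, which is isomorphic to the free module on the objects \<open>Z c\<close>.\<close>

lemma ideal_cover:
  fixes M :: "('o, 'm, 'k, 'v) rep"
  assumes small: "small_in TYPE('v) C" and M: "C.is_rep M"
  obtains U :: "('o, 'm, 'k, 'v) rep" and J p where
    "C.rep_proj U" "C.rep_hom U M p" "C.rep_surj U M p" "C.is_subrep U J"
        "C.rep_proj (C.subrep U J)"
    "\<forall>(Y :: ('o, 'm, 'k, 'v) rep) t. C.is_rep Y \<and> kills Y \<and> C.rep_hom (C.subrep U J) Y t \<longrightarrow>
      (\<forall>a\<in>Obj C. \<forall>x\<in>J a. t a x = \<zero>\<^bsub>fobj Y a\<^esub>)"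
    "\<forall>a\<in>Obj C. \<forall>b\<in>Obj C. \<forall>f\<in>I a b. \<forall>x\<in>carrier (fobj U a). farr U a b f x \<in> J b"
proof -
  define X where "X = (SIGMA a:Obj C. carrier (fobj M a))"
  have c: "\<And>b. b \<in> X \<Longrightarrow> fst b \<in> Obj C" by (auto simp: X_def)
  have Zc: "\<And>b. b \<in> X \<Longrightarrow> Z (fst b) \<in> Obj C" using c Z_Obj by simp
  let ?F = "C.free_rep X fst" and ?G = "C.free_rep X (\<lambda>b. Z (fst b))"
  obtain U :: "('o, 'm, 'k, 'v) rep" and e e' p where
    U: "C.is_rep U" "C.rep_hom ?F U e" "C.rep_hom U ?F e'"
    and ee: "\<And>a x. a \<in> Obj C \<Longrightarrow> x \<in> carrier (fobj ?F a) \<Longrightarrow> e' a (e a x) = x"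
      "\<And>a y. a \<in> Obj C \<Longrightarrow> y \<in> carrier (fobj U a) \<Longrightarrow> e a (e' a y) = y"
    and pU: "C.rep_proj U" and p: "C.rep_hom U M p" "C.rep_surj U M p" and X: "X \<lesssim> (UNIV :: 'v set)"
    by (fact C.free_cover[OF small M, folded X_def])
  have rF: "C.is_rep ?F" by (rule C.is_rep_free[OF c])
  have rG: "C.is_rep ?G" by (rule C.is_rep_free[OF Zc])
  obtain W :: "('o, 'm, 'k, 'v) rep" and w w' where
    W: "C.is_rep W" "C.rep_hom ?G W w" "C.rep_hom W ?G w'"
    "\<And>a x. a \<in> Obj C \<Longrightarrow> x \<in> carrier (fobj ?G a) \<Longrightarrow> w' a (w a x) = x"
    "\<And>a y. a \<in> Obj C \<Longrightarrow> y \<in> carrier (fobj W a) \<Longrightarrow> w a (w' a y) = y"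
    using C.transport_rep[OF rG C.free_lepoll[OF small X Zc]] by metis
  have pW: "C.rep_proj W" by (rule C.proj_of_free[of X "\<lambda>b. Z (fst b)", OF Zc W(1,2,3,5)])
  \<comment> \<open>Each coordinate is composed with \<epsilon>: this is the sum of the embeddings
    of \<open>C(Z c, -)\<close> into \<open>C(c, -)\<close>.\<close>
  define \<iota> where "\<iota> = (\<lambda>d \<phi>. \<lambda>b\<in>X. Cmp C (fst b) (Z (fst b)) d (\<phi> b) (\<epsilon> (fst b)))"
  have \<iota>c: "\<iota> d \<phi> \<in> carrier (C.free_mod X fst d)" if d: "d \<in> Obj C"
      and \<phi>: "\<phi> \<in> carrier (C.free_mod X (\<lambda>b. Z (fst b)) d)" for d \<phi>
  proof -
    have "finite {b \<in> X. \<iota> d \<phi> b \<noteq> \<zero>\<^bsub>HomK C (fst b) d\<^esub>}"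
      by (rule finite_subset[of _ "{b \<in> X. \<phi> b \<noteq> \<zero>\<^bsub>HomK C (Z (fst b)) d\<^esub>}"])
        (use \<phi> c d Z_Obj eps_Hom in \<open>auto simp: \<iota>_def C.free_simps C.Cmp_zero_left\<close>)
    moreover have "\<iota> d \<phi> \<in> (\<Pi>\<^sub>E b\<in>X. Hom C (fst b) d)"
      unfolding \<iota>_def using C.free_Hom[OF \<phi>] c d Z_Obj eps_Hom kc(6) by auto
    ultimately show ?thesis by (simp add: C.free_simps)
  qed
  have \<iota>: "C.rep_hom ?G ?F \<iota>"
    unfolding C.rep_hom_def linear_map_def C.free_simps(1,2)
  proof (intro conjI ballI)
    fix d assume d: "d \<in> Obj C"
    show "\<iota> d \<in> carrier (C.free_mod X (\<lambda>b. Z (fst b)) d) \<rightarrow> carrier (C.free_mod X fst d)"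
        using \<iota>c[OF d] by blast
    show "\<iota> d (\<phi> \<oplus>\<^bsub>C.free_mod X (\<lambda>b. Z (fst b)) d\<^esub> \<psi>) = \<iota> d \<phi> \<oplus>\<^bsub>C.free_mod X fst d\<^esub> \<iota> d \<psi>"
      if "\<phi> \<in> carrier (C.free_mod X (\<lambda>b. Z (fst b)) d)"
          "\<psi> \<in> carrier (C.free_mod X (\<lambda>b. Z (fst b)) d)" for \<phi> \<psi>
      using C.free_Hom[OF that(1)] C.free_Hom[OF that(2)] c d Z_Obj eps_Hom
          linear_map_add[OF kc(4)] kc(2)
      by (auto simp: \<iota>_def C.free_simps(5) intro!: restrict_ext)
    show "\<iota> d (r \<odot>\<^bsub>C.free_mod X (\<lambda>b. Z (fst b)) d\<^esub> \<phi>) = r \<odot>\<^bsub>C.free_mod X fst d\<^esub> \<iota> d \<phi>"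
      if "r \<in> carrier K" "\<phi> \<in> carrier (C.free_mod X (\<lambda>b. Z (fst b)) d)" for r \<phi>
      using C.free_Hom[OF that(2)] that(1) c d Z_Obj eps_Hom linear_map_smult[OF kc(4)] kc(2)
      by (auto simp: \<iota>_def C.free_simps(6) intro!: restrict_ext)
    show "\<iota> d' (\<lambda>b\<in>X. Cmp C (Z (fst b)) d d' f (\<phi> b)) = (\<lambda>b\<in>X. Cmp C (fst b) d d' f (\<iota> d \<phi> b))"
      if "d' \<in> Obj C" "f \<in> Hom C d d'" "\<phi> \<in> carrier (C.free_mod X (\<lambda>b. Z (fst b)) d)" for d' f \<phi>
      using C.free_Hom[OF that(3)] that(1,2) c d Z_Obj eps_Hom
      by (auto simp: \<iota>_def kc(9) intro!: restrict_ext)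
  qed
  \<comment> \<open>This is \<open>I\<close> times the free module, described in coordinates; it
    turns out to be the image of \<iota>.\<close>
  define J0 where "J0 = (\<lambda>d. {\<phi> \<in> carrier (C.free_mod X fst d). \<forall>b\<in>X. \<phi> b \<in> I (fst b) d})"
  have \<iota>J: "\<iota> d \<phi> \<in> J0 d" if d: "d \<in> Obj C" and \<phi>: "\<phi> \<in> carrier (C.free_mod X (\<lambda>b. Z (fst b)) d)"
      for d \<phi>
    using \<iota>c[OF d \<phi>] C.free_Hom[OF \<phi>] c d Z_Obj eps_Hom eps_I
    by (auto simp: J0_def \<iota>_def intro!: I_Cmp)
  have J\<iota>: "\<exists>\<phi>\<in>carrier (C.free_mod X (\<lambda>b. Z (fst b)) d). \<iota> d \<phi> = \<psi>" if d: "d \<in> Obj C"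
      and \<psi>: "\<psi> \<in> J0 d" for d \<psi>
  proof -
    have "\<forall>b\<in>X. \<exists>w\<in>Hom C (Z (fst b)) d. \<psi> b = Cmp C (fst b) (Z (fst b)) d w (\<epsilon> (fst b))"
      using \<psi> factor[OF c d] by (auto simp: J0_def)
    then obtain \<phi> where \<phi>: "\<And>b. b \<in> X \<Longrightarrow> \<phi> b \<in> Hom C (Z (fst b)) d"
      "\<And>b. b \<in> X \<Longrightarrow> \<psi> b = Cmp C (fst b) (Z (fst b)) d (\<phi> b) (\<epsilon> (fst b))" by metis
    \<comment> \<open>The preimage inherits finite support: by \<open>eps_cancel\<close> its
      coordinate vanishes wherever that of \<psi> does.\<close>
    have "finite {b \<in> X. restrict \<phi> X b \<noteq> \<zero>\<^bsub>HomK C (Z (fst b)) d\<^esub>}"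
      by (rule finite_subset[of _ "{b \<in> X. \<psi> b \<noteq> \<zero>\<^bsub>HomK C (fst b) d\<^esub>}"])
        (use \<psi> \<phi> eps_cancel[OF c d] in \<open>auto simp: J0_def C.free_simps\<close>)
    then have r: "restrict \<phi> X \<in> carrier (C.free_mod X (\<lambda>b. Z (fst b)) d)"
      using \<phi>(1) by (simp add: C.free_simps)
    have "\<iota> d (restrict \<phi> X) = \<psi>"
      by (rule C.free_eqI[OF \<iota>c[OF d r]]) (use \<psi> \<phi> in \<open>auto simp: J0_def \<iota>_def\<close>)
    with r show ?thesis by blast
  qed
  have \<iota>inj: "\<phi> = \<zero>\<^bsub>fobj ?G d\<^esub>"
    if d: "d \<in> Obj C" and \<phi>: "\<phi> \<in> carrier (fobj ?G d)" and z: "\<iota> d \<phi> = \<zero>\<^bsub>fobj ?F d\<^esub>" for d \<phi>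
  proof -
    interpret G: module K "C.free_mod X (\<lambda>b. Z (fst b)) d" by (rule C.free_mod_module[OF Zc d])
    have \<phi>': "\<phi> \<in> carrier (C.free_mod X (\<lambda>b. Z (fst b)) d)" using \<phi> by (simp add: C.free_simps(1))
    have "\<phi> = \<zero>\<^bsub>C.free_mod X (\<lambda>b. Z (fst b)) d\<^esub>"
    proof (rule C.free_eqI[OF \<phi>' G.zero_closed])
      fix b assume b: "b \<in> X"
      have "Cmp C (fst b) (Z (fst b)) d (\<phi> b) (\<epsilon> (fst b)) = \<zero>\<^bsub>HomK C (fst b) d\<^esub>"
        using fun_cong[OF z, of b] b by (simp add: \<iota>_def C.free_simps)
      then show "\<phi> b = \<zero>\<^bsub>C.free_mod X (\<lambda>b. Z (fst b)) d\<^esub> b"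
        using eps_cancel[OF c[OF b] d C.free_Hom[OF \<phi>' b]] b by (simp add: C.free_simps)
    qed
    then show ?thesis by (simp add: C.free_simps(1))
  qed
  have J0: "J0 d = C.rep_im ?G \<iota> d" if "d \<in> Obj C" for d
    using \<iota>J[OF that] J\<iota>[OF that] by (auto simp: C.rep_im_def C.free_simps(1))
  have sJ0: "C.is_subrep ?F J0"
    using C.is_subrep_im[OF rG rF \<iota>] J0 by (simp add: C.is_subrep_def)
  have rJ0: "C.is_rep (C.subrep ?F J0)" by (rule C.is_rep_subrep[OF rF sJ0])
  have \<iota>': "C.rep_hom ?G (C.subrep ?F J0) \<iota>"
    by (rule C.hom_to_subrep[OF \<iota>]) (simp add: \<iota>J C.free_simps(1))
  have \<iota>s: "C.rep_surj ?G (C.subrep ?F J0) \<iota>"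
    using J\<iota> by (simp add: C.rep_surj_def C.free_simps(1))
  obtain \<kappa> where \<kappa>: "C.rep_hom (C.subrep ?F J0) ?G \<kappa>"
    "\<And>a x. a \<in> Obj C \<Longrightarrow> x \<in> J0 a \<Longrightarrow> \<iota> a (\<kappa> a x) = x"
    using C.hom_inverse[OF rG rJ0 \<iota>' \<iota>s] \<iota>inj by (metis C.subrep_simps(1,2))
  \<comment> \<open>\<open>J0\<close> is carried over to the copy \<open>U\<close> of the free
    module along \<open>e'\<close>.\<close>
  define J where "J = (\<lambda>a. {u \<in> carrier (fobj U a). e' a u \<in> J0 a})"
  have J: "C.is_subrep U J"
    unfolding C.is_subrep_def
  proof (intro conjI ballI)
    fix a assume a: "a \<in> Obj C"
    interpret Ua: module K "fobj U a" by (rule C.rep_module[OF U(1) a])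
    note sm = C.is_subrepD[OF sJ0 a]
    show "submodule (J a) K (fobj U a)"
      by (rule submodule_smultI[OF Ua.module_axioms])
        (auto simp: J_def C.hom_zero[OF U(3,1) rF a] C.hom_add[OF U(3) a] C.hom_smult[OF U(3) a]
          submodule_zero[OF sm] submodule_add[OF sm] submodule_smult[OF sm])
  next
    fix a b f x assume "a \<in> Obj C" "b \<in> Obj C" "f \<in> Hom C a b" "x \<in> J a"
    then show "farr U a b f x \<in> J b"
      using sJ0 unfolding C.is_subrep_def
      by (auto simp: J_def C.rep_arr_closed[OF U(1)] C.hom_nat[OF U(3)])
  qed
  have rJ: "C.is_rep (C.subrep U J)" by (rule C.is_rep_subrep[OF U(1) J])
  have e'J: "C.rep_hom (C.subrep U J) (C.subrep ?F J0) e'"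
    by (rule C.hom_restrict_to[OF U(3) J]) (simp add: J_def)
  have eJ: "C.rep_hom (C.subrep ?F J0) (C.subrep U J) e"
    by (rule C.hom_restrict_to[OF U(2) sJ0])
      (use C.is_subrep_mem[OF sJ0] ee(1) C.hom_closed[OF U(2)] in \<open>auto simp: J_def\<close>)
  have GJ: "C.rep_hom ?G (C.subrep U J) (\<lambda>a x. e a (\<iota> a x))" by (rule C.hom_comp[OF \<iota>' eJ])
  have retr: "e a (\<iota> a (\<kappa> a (e' a x))) = x" if "a \<in> Obj C" "x \<in> J a" for a x
    using that \<kappa>(2)[of a "e' a x"] ee(2) by (simp add: J_def)
  have \<kappa>c: "\<kappa> a (e' a x) \<in> carrier (fobj ?G a)" if "a \<in> Obj C" "x \<in> J a" for a x
    using C.hom_closed[OF C.hom_comp[OF e'J \<kappa>(1)]] that by simp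
  \<comment> \<open>\<open>J\<close> is a retract of \<open>W\<close>, the copy in \<open>'v\<close>
    of the sum of the functors \<open>C(Z c, -)\<close>.\<close>
  have pJ: "C.rep_proj (C.subrep U J)"
  proof (rule C.proj_retract[OF rJ pW])
    show "C.rep_hom (C.subrep U J) W (\<lambda>a x. w a (\<kappa> a (e' a x)))"
      by (rule C.hom_comp[OF C.hom_comp[OF e'J \<kappa>(1)] W(2)])
    show "C.rep_hom W (C.subrep U J) (\<lambda>a x. e a (\<iota> a (w' a x)))"
      by (rule C.hom_comp[OF W(3) GJ])
    show "e a (\<iota> a (w' a (w a (\<kappa> a (e' a x))))) = x"
        if "a \<in> Obj C" "x \<in> carrier (fobj (C.subrep U J) a)" for a x
      using that W(4)[OF that(1) \<kappa>c] retr by simp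
  qed
  have zero: "t a x = \<zero>\<^bsub>fobj Y a\<^esub>"
    if Y: "C.is_rep Y" "kills Y" and t: "C.rep_hom (C.subrep U J) Y t" and a: "a \<in> Obj C"
        and x: "x \<in> J a"
    for Y :: "('o, 'm, 'k, 'v) rep" and t a x
  proof -
    have tG: "C.rep_hom ?G Y (\<lambda>a x. t a (e a (\<iota> a x)))" by (rule C.hom_comp[OF GJ t])
    \<comment> \<open>A map out of this sum is determined by the generators, and their images lie in
      the values of \<open>Y\<close> at the objects \<open>Z c\<close>, which are zero by
      \<open>kills_Z\<close>.\<close>
    have "t a (e a (\<iota> a (\<kappa> a (e' a x)))) = \<zero>\<^bsub>fobj Y a\<^esub>"
    proof (rule C.free_hom_unique[OF Zc Y(1) tG C.hom_zero_map[OF rG Y(1)] _ a \<kappa>c[OF a x]])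
      fix b assume b: "b \<in> X"
      show "t (Z (fst b)) (e (Z (fst b)) (\<iota> (Z (fst b)) (C.free_gen X (\<lambda>b. Z (fst b)) b))) =
          \<zero>\<^bsub>fobj Y (Z (fst b))\<^esub>"
        by (rule kills_Z[OF Y c[OF b] C.hom_closed[OF tG Zc[OF b] C.free_gen_closed[of X "\<lambda>b.
            Z (fst b)", OF Zc b]]])
    qed
    then show ?thesis using retr[OF a x] by simp
  qed
  have IU: "farr U a b f x \<in> J b" if a: "a \<in> Obj C" and b: "b \<in> Obj C" and f: "f \<in> I a b"
      and x: "x \<in> carrier (fobj U a)" for a b f x
  proof -
    note fH = I_Hom[OF a b f]
    have e'x: "e' a x \<in> carrier (C.free_mod X fst a)" using C.hom_closed[OF U(3) a x]
        by (simp add: C.free_simps(1))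
    have "e' b (farr U a b f x) = (\<lambda>d\<in>X. Cmp C (fst d) a b f (e' a x d))"
      using C.hom_nat[OF U(3) a b fH x] by (simp add: C.free_simps(2))
    moreover have "(\<lambda>d\<in>X. Cmp C (fst d) a b f (e' a x d)) \<in> J0 b"
      using C.free_arr_closed[of X fst, OF c a b fH e'x] C.free_Hom[OF e'x] c a b f fH
      by (auto simp: J0_def intro!: I_Cmp)
    ultimately show ?thesis
      using C.rep_arr_closed[OF U(1) a b fH x] by (simp add: J_def)
  qed
  show ?thesis
    using zero IU by (intro that[OF pU p J pJ]) auto
qed

text \<open>\<open>I\<close> maps \<open>U\<close> into \<open>J\<close>, which dies in
  \<open>V\<close>; as \<open>q\<close> is onto, \<open>I\<close> annihilates
  \<open>V\<close>.\<close>

lemma kills_quotient: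
  assumes U: "C.is_rep U" and V: "C.is_rep V" and q: "C.rep_hom U V q" "C.rep_surj U V q"
    and J: "\<And>a x. a \<in> Obj C \<Longrightarrow> x \<in> J a \<Longrightarrow> q a x = \<zero>\<^bsub>fobj V a\<^esub>"
    and IU: "\<And>a b f x. a \<in> Obj C \<Longrightarrow> b \<in> Obj C \<Longrightarrow> f \<in> I a b \<Longrightarrow> x \<in> carrier (fobj U a) \<Longrightarrow>
        farr U a b f x \<in> J b"
  shows "kills V"
  unfolding kills_def
proof (intro ballI)
  fix a b f y assume a: "a \<in> Obj C" and b: "b \<in> Obj C" and f: "f \<in> I a b"
      and y: "y \<in> carrier (fobj V a)"
  obtain x where x: "x \<in> carrier (fobj U a)" "q a x = y" using q(2) a y unfolding C.rep_surj_def
      by blast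
  show "farr V a b f y = \<zero>\<^bsub>fobj V b\<^esub>"
    using C.hom_nat[OF q(1) a b I_Hom[OF a b f] x(1)] J[OF b IU[OF a b f x(1)]] x(2) by simp
qed

text \<open>\<open>V\<close> is \<open>U / J\<close>, a module annihilated by \<open>I\<close>. The
  cover \<open>p\<close> factors through it as \<open>r\<close>, because \<open>pull M\<close> is
  annihilated by \<open>I\<close> and so receives only zero from \<open>J\<close>. The same data
  serve for projectives over \<open>C/I\<close> and for presentations of their restrictions.\<close>

lemma quotient_cover:
  fixes M :: "('o, 'm set, 'k, 'v) rep"
  assumes small: "small_in TYPE('v) C" and M: "Q.is_rep M"
  obtains U V :: "('o, 'm, 'k, 'v) rep" and J p q r where
    "C.rep_proj U" "C.rep_hom U (pull M) p" "C.rep_surj U (pull M) p" "C.is_subrep U J"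
        "C.rep_proj (C.subrep U J)"
    "\<forall>(Y :: ('o, 'm, 'k, 'v) rep) t. C.is_rep Y \<and> kills Y \<and> C.rep_hom (C.subrep U J) Y t \<longrightarrow>
      (\<forall>a\<in>Obj C. \<forall>x\<in>J a. t a x = \<zero>\<^bsub>fobj Y a\<^esub>)"
    "C.is_rep V" "kills V" "C.rep_hom U V q" "C.rep_surj U V q"
    "\<forall>a\<in>Obj C. \<forall>x\<in>carrier (fobj U a). q a x = \<zero>\<^bsub>fobj V a\<^esub> \<longleftrightarrow> x \<in> J a"
    "C.rep_hom V (pull M) r" "\<forall>a\<in>Obj C. \<forall>x\<in>carrier (fobj U a). r a (q a x) = p a x"
proof -
  note pM = rep_pull[OF M]
  obtain U :: "('o, 'm, 'k, 'v) rep" and J p where U: "C.rep_proj U" "C.rep_hom U (pull M) p"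
      "C.rep_surj U (pull M) p"
    and J: "C.is_subrep U J" "C.rep_proj (C.subrep U J)"
    and JY: "\<forall>(Y :: ('o, 'm, 'k, 'v) rep) t. C.is_rep Y \<and> kills Y \<and> C.rep_hom (C.subrep U J) Y t \<longrightarrow>
      (\<forall>a\<in>Obj C. \<forall>x\<in>J a. t a x = \<zero>\<^bsub>fobj Y a\<^esub>)"
    and IU: "\<forall>a\<in>Obj C. \<forall>b\<in>Obj C. \<forall>f\<in>I a b. \<forall>x\<in>carrier (fobj U a). farr U a b f x \<in> J b"
    by (rule ideal_cover[OF small pM]) (rule that; assumption)
  note rU = C.proj_rep[OF U(1)]
  obtain V :: "('o, 'm, 'k, 'v) rep" and q where V: "C.is_rep V" "C.rep_hom U V q"
      "C.rep_surj U V q"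
    "\<And>a x. a \<in> Obj C \<Longrightarrow> x \<in> carrier (fobj U a) \<Longrightarrow> q a x = \<zero>\<^bsub>fobj V a\<^esub> \<longleftrightarrow> x \<in> J a"
    using C.quotient_rep[OF rU J(1)] by metis
  have kV: "kills V"
    by (rule kills_quotient[OF rU V(1-3), of J]) (use V(4) C.is_subrep_mem[OF J(1)] IU in auto)
  have pJ: "p a x = \<zero>\<^bsub>fobj (pull M) a\<^esub>" if "a \<in> Obj C" "x \<in> carrier (fobj U a)"
      "q a x = \<zero>\<^bsub>fobj V a\<^esub>" for a x
    using JY pM kills_pull[OF M] C.hom_restrict[OF U(2) J(1)] that V(4) by blast
  obtain r where "C.rep_hom V (pull M) r" "\<And>a x. a \<in> Obj C \<Longrightarrow> x \<in> carrier (fobj U a) \<Longrightarrow>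
      r a (q a x) = p a x"
    using C.hom_factor_surj[OF rU V(1) pM V(2,3) U(2) pJ] by metis
  then show ?thesis
    using V kV by (intro that[OF U J JY]) auto
qed

text \<open>\<open>V\<close>, seen over \<open>C/I\<close>, is projective: a map out of
  \<open>V\<close> is lifted from \<open>U\<close> over \<open>C\<close>, the lift vanishes on
  \<open>J\<close> since its target is annihilated by \<open>I\<close>, and so it factors through
  \<open>V\<close>.\<close>

lemma enough_projectives_quotient:
  fixes M :: "('o, 'm set, 'k, 'v) rep"
  assumes small: "small_in TYPE('v) C" and M: "Q.is_rep M"
  shows "\<exists>(Q :: ('o, 'm set, 'k, 'v) rep) p. Q.rep_proj Q \<and> Q.rep_hom Q M p \<and> Q.rep_surj Q M p"
proof -
  obtain U V :: "('o, 'm, 'k, 'v) rep" and J p q r where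
    U: "C.rep_proj U" "C.rep_hom U (pull M) p" "C.rep_surj U (pull M) p" "C.is_subrep U J"
        "C.rep_proj (C.subrep U J)"
    and JY: "\<forall>(Y :: ('o, 'm, 'k, 'v) rep) t. C.is_rep Y \<and> kills Y \<and> C.rep_hom (C.subrep U J) Y t \<longrightarrow>
      (\<forall>a\<in>Obj C. \<forall>x\<in>J a. t a x = \<zero>\<^bsub>fobj Y a\<^esub>)"
    and V: "C.is_rep V" "kills V" "C.rep_hom U V q" "C.rep_surj U V q"
    and qJ: "\<forall>a\<in>Obj C. \<forall>x\<in>carrier (fobj U a). q a x = \<zero>\<^bsub>fobj V a\<^esub> \<longleftrightarrow> x \<in> J a"
    and r: "C.rep_hom V (pull M) r" "\<forall>a\<in>Obj C. \<forall>x\<in>carrier (fobj U a). r a (q a x) = p a x"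
    by (rule quotient_cover[OF small M]) (rule that; assumption)
  note rU = C.proj_rep[OF U(1)]
  have rD: "Q.is_rep (descend V)" by (rule rep_descend[OF V(1,2)])
  have "Q.rep_proj (descend V)"
    unfolding Q.rep_proj_def
  proof (intro conjI rD allI impI; elim conjE)
    fix A B :: "('o, 'm set, 'k, 'v) rep" and g f
    assume A: "Q.is_rep A" and B: "Q.is_rep B" and g: "Q.rep_hom A B g" "Q.rep_surj A B g"
        and f: "Q.rep_hom (descend V) B f"
    have f': "C.rep_hom V (pull B) f" using f by (simp add: hom_from_descend[OF V(1,2)])
    have g': "C.rep_hom (pull A) (pull B) g" "C.rep_surj (pull A) (pull B) g" using g
        by (simp_all add: hom_pull surj_pull)
    obtain h where h: "C.rep_hom U (pull A) h" "\<And>a x. a \<in> Obj C \<Longrightarrow> x \<in> carrier (fobj U a) \<Longrightarrow>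
        g a (h a x) = f a (q a x)"
      using C.proj_lift[OF U(1) rep_pull[OF A] rep_pull[OF B] g' C.hom_comp[OF V(3) f']] by metis
    have hJ: "h a x = \<zero>\<^bsub>fobj (pull A) a\<^esub>" if "a \<in> Obj C" "x \<in> carrier (fobj U a)"
        "q a x = \<zero>\<^bsub>fobj V a\<^esub>" for a x
      using JY rep_pull[OF A] kills_pull[OF A] C.hom_restrict[OF h(1) U(4)] that qJ by blast
    obtain k where k: "C.rep_hom V (pull A) k" "\<And>a x. a \<in> Obj C \<Longrightarrow> x \<in> carrier (fobj U a) \<Longrightarrow>
        k a (q a x) = h a x"
      using C.hom_factor_surj[OF rU V(1) rep_pull[OF A] V(3,4) h(1) hJ] by metis
    have "g a (k a y) = f a y" if a: "a \<in> Obj C" and y: "y \<in> carrier (fobj V a)" for a y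
    proof -
      obtain x where "x \<in> carrier (fobj U a)" "q a x = y" using V(4) a y unfolding C.rep_surj_def
          by blast
      then show ?thesis using k(2)[OF a] h(2)[OF a] by metis
    qed
    then show "\<exists>h. Q.rep_hom (descend V) A h \<and>
        (\<forall>a\<in>Obj (quot_cat C I). \<forall>x\<in>carrier (fobj (descend V) a). g a (h a x) = f a x)"
      using k(1) by (intro exI[of _ k]) (simp add: hom_from_descend[OF V(1,2)])
  qed
  moreover have "Q.rep_hom (descend V) M r" using r(1) by (simp add: hom_from_descend[OF V(1,2)])
  moreover have "Q.rep_surj (descend V) M r"
    unfolding Q.rep_surj_def
  proof (intro ballI)
    fix a y assume a: "a \<in> Obj (quot_cat C I)" and y: "y \<in> carrier (fobj M a)"
    then have aC: "a \<in> Obj C" by simp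
    obtain x where "x \<in> carrier (fobj U a)" "p a x = y" using U(3) aC y unfolding C.rep_surj_def
        by auto
    then show "\<exists>x\<in>carrier (fobj (descend V) a). r a x = y"
      using r(2) aC C.hom_closed[OF V(3) aC] by (intro bexI[of _ "q a x"]) auto
  qed
  ultimately show ?thesis by blast
qed

text \<open>Being projective, \<open>P\<close> is a summand of \<open>V\<close>, by a section
  \<open>s\<close> of \<open>r\<close>. The endomorphism \<theta> of \<open>U\<close> lifts
  \<open>s p\<close> along \<open>q\<close>: then
  \<open>p \<theta> = r q \<theta> = r s p = p\<close>, and \<open>p x = 0\<close> forces
  \<open>q (\<theta> x) = 0\<close>, so that \<open>\<theta> x\<close> lies in
  \<open>J\<close>.\<close>

lemma good_pull:
  fixes P N :: "('o, 'm set, 'k, 'v) rep"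
  assumes small: "small_in TYPE('v) C" and P: "Q.rep_proj P" and N: "Q.is_rep N"
  shows "C.good (pull N) (pull P)"
proof -
  note rP = Q.proj_rep[OF P]
  obtain U V :: "('o, 'm, 'k, 'v) rep" and J p q r where
    U: "C.rep_proj U" "C.rep_hom U (pull P) p" "C.rep_surj U (pull P) p" "C.is_subrep U J"
        "C.rep_proj (C.subrep U J)"
    and JY: "\<forall>(Y :: ('o, 'm, 'k, 'v) rep) t. C.is_rep Y \<and> kills Y \<and> C.rep_hom (C.subrep U J) Y t \<longrightarrow>
      (\<forall>a\<in>Obj C. \<forall>x\<in>J a. t a x = \<zero>\<^bsub>fobj Y a\<^esub>)"
    and V: "C.is_rep V" "kills V" "C.rep_hom U V q" "C.rep_surj U V q"
    and qJ: "\<forall>a\<in>Obj C. \<forall>x\<in>carrier (fobj U a). q a x = \<zero>\<^bsub>fobj V a\<^esub> \<longleftrightarrow> x \<in> J a"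
    and r: "C.rep_hom V (pull P) r" "\<forall>a\<in>Obj C. \<forall>x\<in>carrier (fobj U a). r a (q a x) = p a x"
    by (rule quotient_cover[OF small rP]) (rule that; assumption)
  note rU = C.proj_rep[OF U(1)] and pP = rep_pull[OF rP]
  have rD: "Q.is_rep (descend V)" by (rule rep_descend[OF V(1,2)])
  have r': "Q.rep_hom (descend V) P r" using r(1) by (simp add: hom_from_descend[OF V(1,2)])
  have "Q.rep_surj (descend V) P r"
    unfolding Q.rep_surj_def
  proof (intro ballI)
    fix a y assume a: "a \<in> Obj (quot_cat C I)" and y: "y \<in> carrier (fobj P a)"
    then have aC: "a \<in> Obj C" by simp
    obtain x where "x \<in> carrier (fobj U a)" "p a x = y" using U(3) aC y unfolding C.rep_surj_def
        by auto
    then show "\<exists>x\<in>carrier (fobj (descend V) a). r a x = y"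
      using r(2) aC C.hom_closed[OF V(3) aC] by (intro bexI[of _ "q a x"]) auto
  qed
  from Q.proj_lift[OF P rD rP r' this Q.hom_id] obtain s where s: "Q.rep_hom P (descend V) s"
    "\<And>a x. a \<in> Obj (quot_cat C I) \<Longrightarrow> x \<in> carrier (fobj P a) \<Longrightarrow> r a (s a x) = x" by blast
  have s': "C.rep_hom (pull P) V s" using s(1) by (simp add: hom_to_descend[OF V(1,2)])
  obtain \<theta> where \<theta>: "C.rep_hom U U \<theta>" "\<And>a x. a \<in> Obj C \<Longrightarrow> x \<in> carrier (fobj U a) \<Longrightarrow>
      q a (\<theta> a x) = s a (p a x)"
    using C.proj_lift[OF U(1) rU V(1,3,4) C.hom_comp[OF U(2) s']] by metis
  have "C.good_pres (pull N) (pull P) U J p \<theta>"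
  proof (rule C.good_presI[OF pP U(1,4,5) _ U(2,3) _ \<theta>(1)])
    show "t a x = \<zero>\<^bsub>fobj (pull N) a\<^esub>" if "C.rep_hom (C.subrep U J) (pull N) t" "a \<in> Obj C"
        "x \<in> J a" for t a x
      using JY rep_pull[OF N] kills_pull[OF N] that by blast
    show "p a x = \<zero>\<^bsub>fobj (pull P) a\<^esub>" if "a \<in> Obj C" "x \<in> J a" for a x
      using JY pP kills_pull[OF rP] C.hom_restrict[OF U(2,4)] that by blast
    fix a x assume a: "a \<in> Obj C" and x: "x \<in> carrier (fobj U a)"
    note \<theta>c = C.hom_closed[OF \<theta>(1) a x]
    have px: "p a x \<in> carrier (fobj P a)" using C.hom_closed[OF U(2) a x] by simp
    show "p a (\<theta> a x) = p a x"
      using r(2) a \<theta>c \<theta>(2)[OF a x] s(2)[of a "p a x"] px by (metis quot_Obj)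
    show "\<theta> a x \<in> J a" if "p a x = \<zero>\<^bsub>fobj (pull P) a\<^esub>"
      using qJ a \<theta>c \<theta>(2)[OF a x] C.hom_zero[OF s' pP V(1) a] that by simp
  qed
  then show ?thesis unfolding C.good_def by blast
qed

lemma strongly_idempotent_representable:
  assumes small: "small_in TYPE('v) C"
  shows "strongly_idempotent TYPE('v) K C I"
proof -
  have enoughC: "\<exists>(Q :: ('o, 'm, 'k, 'v) rep) p. C.rep_proj Q \<and> C.rep_hom Q M p \<and> C.rep_surj Q M p"
    if "C.is_rep M" for M :: "('o, 'm, 'k, 'v) rep"
    using ideal_cover[OF small that] by metis
  have inf: "infinite (UNIV :: 'v set)" using small by (simp add: small_in_def)
  show ?thesis
    unfolding strongly_idempotent_def Let_def
    using ideal Ext_map_linear_iso[OF inf enoughC enough_projectives_quotient[OF small]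
        good_pull[OF small]]
    by simp
qed

end

section \<open>The ideal of a torsion free class\<close>

text \<open>An arrow from \<open>c\<close> to an object of \<open>F\<close> vanishes on the torsion
  part of \<open>c\<close> and so factors through the cokernel \<epsilon>. All members of the ideal
  with source \<open>c\<close> thus factor through the single object \<open>Z c\<close>: they form
  the image of a linear map, which is why a sum of arrows through different objects of
  \<open>F\<close> stays in the ideal.\<close>

lemma representable_torsion_ideal:
  assumes K: "cring K" and kcat: "kcategory K C" and tors: "torsion_pair C T F"
  obtains Z \<epsilon> where "representable_ideal K C (factor_ideal C F) Z \<epsilon>"
proof -
  interpret linear_kcat K C by (rule linear_kcat.intro[OF K kcat])
  have F: "F \<subseteq> Obj C" and T: "T \<subseteq> Obj C"
    and TF: "\<And>a b. a \<in> T \<Longrightarrow> b \<in> F \<Longrightarrow> Hom C a b = {\<zero>\<^bsub>HomK C a b\<^esub>}"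
    and seq: "\<And>c. c \<in> Obj C \<Longrightarrow> \<exists>y\<in>T. \<exists>z\<in>F. \<exists>f g. short_exact C y c z f g"
    using tors by (auto simp: torsion_pair_def)
  have "\<forall>c\<in>Obj C. \<exists>z g. z \<in> F \<and> g \<in> Hom C c z \<and> (\<exists>y\<in>T. \<exists>f. is_cokernel C y c z f g)"
    using seq unfolding short_exact_def is_cokernel_def by blast
  then obtain Z \<epsilon> where Z: "\<And>c. c \<in> Obj C \<Longrightarrow> Z c \<in> F" and \<epsilon>: "\<And>c. c \<in> Obj C \<Longrightarrow> \<epsilon> c \<in> Hom C c (Z c)"
    and cok: "\<And>c. c \<in> Obj C \<Longrightarrow> \<exists>y\<in>T. \<exists>f. is_cokernel C y c (Z c) f (\<epsilon> c)" by metis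
  have ZO: "\<And>c. c \<in> Obj C \<Longrightarrow> Z c \<in> Obj C" using Z F by blast
  \<comment> \<open>\<open>w\<close> and zero have the same composite with the cokernel map, so
    uniqueness of factorisations equates them.\<close>
  have cancel: "w = \<zero>\<^bsub>HomK C (Z c) d\<^esub>"
    if c: "c \<in> Obj C" and d: "d \<in> Obj C" and w: "w \<in> Hom C (Z c) d"
      and z: "Cmp C c (Z c) d w (\<epsilon> c) = \<zero>\<^bsub>HomK C c d\<^esub>" for c d w
  proof -
    obtain y f where y: "y \<in> T" "is_cokernel C y c (Z c) f (\<epsilon> c)" using cok[OF c] by blast
    have yO: "y \<in> Obj C" using y T by blast
    have f: "f \<in> Hom C y c" using y by (simp add: is_cokernel_def)
    have "Cmp C y c d \<zero>\<^bsub>HomK C c d\<^esub> f = \<zero>\<^bsub>HomK C y d\<^esub>" by (rule Cmp_zero_left[OF yO c d f])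
    then have "\<exists>!v. v \<in> Hom C (Z c) d \<and> Cmp C c (Z c) d v (\<epsilon> c) = \<zero>\<^bsub>HomK C c d\<^esub>"
      using y(2) d Hom_zero[OF c d] unfolding is_cokernel_def by blast
    then show ?thesis
      using w z Hom_zero[OF ZO[OF c] d] Cmp_zero_left[OF c ZO[OF c] d \<epsilon>[OF c]] by blast
  qed
  have I: "factor_ideal C F c d = (\<lambda>w. Cmp C c (Z c) d w (\<epsilon> c)) ` Hom C (Z c) d"
    if c: "c \<in> Obj C" and d: "d \<in> Obj C" for c d
  proof (intro equalityI subsetI)
    fix h assume "h \<in> factor_ideal C F c d"
    then obtain z f g where z: "z \<in> F" and f: "f \<in> Hom C c z" and g: "g \<in> Hom C z d"
        and h: "h = Cmp C c z d g f"
      by (auto simp: factor_ideal_def)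
    have zO: "z \<in> Obj C" using z F by blast
    obtain y i where y: "y \<in> T" "is_cokernel C y c (Z c) i (\<epsilon> c)" using cok[OF c] by blast
    have yO: "y \<in> Obj C" using y T by blast
    have i: "i \<in> Hom C y c" using y by (simp add: is_cokernel_def)
    have "Cmp C y c z f i = \<zero>\<^bsub>HomK C y z\<^esub>"
      using TF[OF y(1) z] kcD(6)[OF yO c zO i f] by blast
    then obtain v where v: "v \<in> Hom C (Z c) z" "Cmp C c (Z c) z v (\<epsilon> c) = f"
      using y(2) zO f unfolding is_cokernel_def by blast
    have "h = Cmp C c (Z c) d (Cmp C (Z c) z d g v) (\<epsilon> c)"
      using kcD(9)[OF c ZO[OF c] zO d \<epsilon>[OF c] v(1) g] v(2) h by simp
    then show "h \<in> (\<lambda>w. Cmp C c (Z c) d w (\<epsilon> c)) ` Hom C (Z c) d"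
      using kcD(6)[OF ZO[OF c] zO d v(1) g] by blast
  next
    fix h assume "h \<in> (\<lambda>w. Cmp C c (Z c) d w (\<epsilon> c)) ` Hom C (Z c) d"
    then show "h \<in> factor_ideal C F c d" using Z[OF c] \<epsilon>[OF c] by (auto simp: factor_ideal_def)
  qed
  have sub: "submodule (factor_ideal C F c d) K (HomK C c d)" if c: "c \<in> Obj C" and d: "d \<in> Obj C"
      for c d
  proof -
    interpret H: module K "HomK C c d" by (rule kcD(1)[OF c d])
    note lin = kcD(4)[OF c ZO[OF c] d \<epsilon>[OF c]]
    note car = kcD(2)[OF ZO[OF c] d]
    show ?thesis
    proof (rule submodule_smultI[OF H.module_axioms])
      show "factor_ideal C F c d \<subseteq> carrier (HomK C c d)"
        unfolding I[OF c d] using linear_map_closed[OF lin] car by auto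
      show "\<zero>\<^bsub>HomK C c d\<^esub> \<in> factor_ideal C F c d"
        unfolding I[OF c d] using Cmp_zero_left[OF c ZO[OF c] d \<epsilon>[OF c]] Hom_zero[OF ZO[OF c] d]
            by (metis image_eqI)
      show "x \<oplus>\<^bsub>HomK C c d\<^esub> y \<in> factor_ideal C F c d"
          if "x \<in> factor_ideal C F c d" "y \<in> factor_ideal C F c d" for x y
        using that linear_map_add[OF lin, symmetric] Hom_add_closed[OF ZO[OF c] d] car
        unfolding I[OF c d] by auto
      show "r \<odot>\<^bsub>HomK C c d\<^esub> x \<in> factor_ideal C F c d"
          if "r \<in> carrier K" "x \<in> factor_ideal C F c d" for r x
        using that linear_map_smult[OF lin, symmetric] Hom_smult_closed[OF ZO[OF c] d] car
        unfolding I[OF c d] by auto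
    qed
  qed
  have ideal: "two_sided_ideal K C (factor_ideal C F)"
    unfolding two_sided_ideal_def
  proof (intro conjI ballI impI sub)
    fix a b c f g assume abc: "a \<in> Obj C" "b \<in> Obj C" "c \<in> Obj C" and f: "f \<in> Hom C a b"
        and g: "g \<in> Hom C b c"
      and fg: "f \<in> factor_ideal C F a b \<or> g \<in> factor_ideal C F b c"
    from fg show "Cmp C a b c g f \<in> factor_ideal C F a c"
    proof
      assume "f \<in> factor_ideal C F a b"
      then obtain z u v where z: "z \<in> F" "u \<in> Hom C a z" "v \<in> Hom C z b" "f = Cmp C a z b v u"
        by (auto simp: factor_ideal_def)
      have zO: "z \<in> Obj C" using z F by blast
      have "Cmp C a b c g f = Cmp C a z c (Cmp C z b c g v) u"
        using kcD(9)[OF abc(1) zO abc(2,3) z(2,3) g] z(4) by simp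
      then show ?thesis using z kcD(6)[OF zO abc(2,3) z(3) g] unfolding factor_ideal_def by blast
    next
      assume "g \<in> factor_ideal C F b c"
      then obtain z u v where z: "z \<in> F" "u \<in> Hom C b z" "v \<in> Hom C z c" "g = Cmp C b z c v u"
        by (auto simp: factor_ideal_def)
      have zO: "z \<in> Obj C" using z F by blast
      have "Cmp C a b c g f = Cmp C a z c v (Cmp C a b z u f)"
        using kcD(9)[OF abc(1,2) zO abc(3) f z(2,3)] z(4) by simp
      then show ?thesis using z kcD(6)[OF abc(1,2) zO f z(2)] unfolding factor_ideal_def by blast
    qed
  qed
  have "representable_ideal K C (factor_ideal C F) Z \<epsilon>"
  proof (intro representable_ideal.intro representable_ideal_axioms.intro linear_quotient.intro K
      kcat ideal)
    fix c assume c: "c \<in> Obj C"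
    have "Idn C (Z c) = Cmp C (Z c) (Z c) (Z c) (Idn C (Z c)) (Idn C (Z c))"
      using kcD(7)[OF ZO[OF c] ZO[OF c] kcD(5)[OF ZO[OF c]]] by simp
    then show "Idn C (Z c) \<in> factor_ideal C F (Z c) (Z c)"
      using Z[OF c] kcD(5)[OF ZO[OF c]] unfolding factor_ideal_def by blast
  next
    fix c d f assume "c \<in> Obj C" "d \<in> Obj C" "f \<in> factor_ideal C F c d"
    then show "\<exists>w\<in>Hom C (Z c) d. f = Cmp C c (Z c) d w (\<epsilon> c)" using I by blast
  qed (use ZO \<epsilon> cancel in auto)
  then show ?thesis by (rule that)
qed

theorem proposition5p8:
  fixes K :: "'k ring"
    and C :: "('o, 'm, 'k) kcat"
    and F :: "'o set"
  assumes "field K"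
    and "kcategory K C"
    and "small_in TYPE('v) C"
    and "abelian C"
    and "complete TYPE('i) TYPE('j) C"
    and "cocomplete TYPE('i) TYPE('j) C"
    and "torsion_free_class C F"
  shows "homological_epimorphism TYPE('v) K C
           (quot_cat C (factor_ideal C F)) (quot_proj C (factor_ideal C F))"
proof -
  obtain T where "torsion_pair C T F"
    using assms(7) by (auto simp: torsion_free_class_def)
  then obtain Z \<epsilon> where "representable_ideal K C (factor_ideal C F) Z \<epsilon>"
    using representable_torsion_ideal[OF fieldE(1)[OF assms(1)] assms(2)] by blast
  then have "strongly_idempotent TYPE('v) K C (factor_ideal C F)"
    using representable_ideal.strongly_idempotent_representable assms(3) by blast
  then show ?thesis unfolding homological_epimorphism_def by blast
qed

end
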